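(* Let $n\ge 1$ and let $\mathcal X$ be a Lie-Bäcklund field in $J^\infty(\mathbb R^n,\mathbb R)$ that satisfies condition $F$. Then $\mathcal X$ is a lifting of a Lie-Bäcklund field in $J^1(\mathbb R^n,\mathbb R)$, and is therefore exponentiable.
   Context: Notation (here the target dimension is $m=1$). A multiindex is $\alpha=(\alpha_1,\dots,\alpha_n)\in\mathbb Z_{\ge0}^n$, with $|\alpha|=\sum_i\alpha_i$; a letter such as $i$ or $k$ in $\{1,\dots,n\}$ also denotes the unit multiindex with $1$ in that place, so $\alpha+i$ makes sense. $J^\infty(\mathbb R^n,\mathbb R)$ has coordinates $x_1,\dots,x_n$ and $y^\alpha$ for all multiindices $\alpha$; $J^1(\mathbb R^n,\mathbb R)$ has coordinates $x_i$ and $y^\alpha$ with $|\alpha|\le1$. Functions on (open parts of) $J^\infty$ are $C^\infty$ functions of finitely many coordinates, defined on the preimage of an open subset of the corresponding finite-dimensional space; vector fields on $J^\infty$ have such functions as coefficients, and maps have such functions as components (each component with its own finite set of variables and its own domain). Total derivatives: $\mathbb D^i=\frac{\partial}{\partial x_i}+\sum_{\alpha}y^{\alpha+i}\frac{\partial}{\partial y^\alpha}$. A Lie-Bäcklund field in $J^\infty(\mathbb R^n,\mathbb R)$ is a vector field $\mathcal X=\sum_i\xi_i\frac{\partial}{\partial x_i}+\sum_\alpha\eta^\alpha\frac{\partial}{\partial y^\alpha}$ with $\eta^{\alpha+k}=\mathbb D^k\eta^\alpha-\sum_i y^{\alpha+i}\,\mathbb D^k\xi_i$ for all $\alpha$ and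 all $k\in\{1,\dots,n\}$. Condition $F$: for each coordinate function $g$ ($g=x_i$ or $g=y^\alpha$) there is a finite set $F_g$ of coordinates such that for all $k$ the function $\mathcal X^k(g)$ ($\mathcal X$ applied $k$ times to $g$) does not depend on coordinates outside $F_g$. A Lie-Bäcklund field in $J^1(\mathbb R^n,\mathbb R)$: for $f:U\subset\mathbb R^n\to\mathbb R$ smooth put $\tau^1f(x)=(x,f(x),\partial_1f(x),\dots,\partial_nf(x))$ and $\Gamma^1f=\tau^1f(U)$. A $C^\infty$ vector field on an open set $W\subset J^1(\mathbb R^n,\mathbb R)$ with (local) flow $\Phi_t$ is Lie-Bäcklund if for each $f$ with $\Gamma^1f\subset W$ and each $x_0$ in the domain of $f$ there are $\delta>0$ and a neighborhood $V$ of $x_0$ such that for each $|t|<\delta$ there is a function $f_t$ such that, for all $x\in V$, $\Phi_t$ maps the germ of the set $\Gamma^1f$ at $\tau^1f(x)$ to the germ of the set $\Gamma^1f_t$ at $\Phi_t(\tau^1f(x))$. Lifting: the lifting to $J^\infty$ of a Lie-Bäcklund field on $J^1$ is the vector field on $J^\infty$ whose flow is obtained by prolonging the action $f\mapsto f_t$ to all derivatives; equivalently, the Lie-Bäcklund field on $J^\infty$ whose coefficients of $\partial/\partial x_i$ and of $\partial/\partial y^\alpha$, $|\alpha|\le1$, are those of the field on $J^1$ and whose remaining coefficients are determined by the recursion above. Exponentiable: a vector field $\mathcal X$ on $J^\infty$ is exponentiable if there is a local flow $\Phi_t$, i.e. a local map in (point, $t$) whose components are smooth, each depending on a finite set of coordinates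 that can be chosen independent of $t$, with $\Phi_0=\mathrm{id}$, $\Phi_t\circ\Phi_s=\Phi_{t+s}$, and with the derivative at $t=0$ of each component equal to the corresponding coefficient of $\mathcal X$. Identities between local maps are understood where defined.
   Formalization: For a field given only on an open part of the infinite jet space, "is a lifting" is proved near each point, and on the whole domain only if the fibres of the domain over J^1 are connected (as for all of J^∞); otherwise it can fail, e.g. ξ=0, η=sgn y^(2) on y^(2)≠0. *)

theory Defs
  imports "HOL-Analysis.Analysis" "HOL-Library.Groups_Big_Fun"
begin

section \<open>Smooth maps between finite-dimensional spaces\<close>

text \<open>Meant for open sets; there \<open>Ck_on k S f\<close> says that \<open>f\<close> is of class \<open>C\<^sup>k\<close> on \<open>S\<close>.\<close>

primrec Ck_on :: "nat \<Rightarrow> 'a::euclidean_space set \<Rightarrow> ('a \<Rightarrow> 'b::real_normed_vector) \<Rightarrow> bool" where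
  "Ck_on 0 S f \<longleftrightarrow> continuous_on S f"
| "Ck_on (Suc k) S f \<longleftrightarrow> (\<forall>x\<in>S. f differentiable (at x)) \<and>
     (\<forall>b\<in>Basis. Ck_on k S (\<lambda>x. frechet_derivative f (at x) b))"

definition smooth_on :: "'a::euclidean_space set \<Rightarrow> ('a \<Rightarrow> 'b::real_normed_vector) \<Rightarrow> bool" where
  "smooth_on S f \<longleftrightarrow> (\<forall>k. Ck_on k S f)"


section \<open>Functions of finitely many out of infinitely many coordinates\<close>

text \<open>
  Points are families \<open>'i \<Rightarrow> real\<close> of coordinates, with the product topology. An open set that is
  saturated with respect to a finite set \<open>A\<close> of coordinates is the preimage of an open subset of
  the finite-dimensional space with coordinates \<open>A\<close>.
\<close>

definition agree_on :: "'i set \<Rightarrow> ('i \<Rightarrow> real) \<Rightarrow> ('i \<Rightarrow> real) \<Rightarrow> bool" where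
  "agree_on A p q \<longleftrightarrow> (\<forall>c\<in>A. p c = q c)"

definition open_cylinder :: "'i set \<Rightarrow> ('i \<Rightarrow> real) set \<Rightarrow> bool" where
  "open_cylinder A \<Omega> \<longleftrightarrow> open \<Omega> \<and> (\<forall>p\<in>\<Omega>. \<forall>q. agree_on A p q \<longrightarrow> q \<in> \<Omega>)"

definition depends_only_on :: "'i set \<Rightarrow> ('i \<Rightarrow> real) set \<Rightarrow> (('i \<Rightarrow> real) \<Rightarrow> real) \<Rightarrow> bool" where
  "depends_only_on A \<Omega> f \<longleftrightarrow> (\<forall>p\<in>\<Omega>. \<forall>q\<in>\<Omega>. agree_on A p q \<longrightarrow> f p = f q)"

definition pderiv_at :: "'i \<Rightarrow> (('i \<Rightarrow> real) \<Rightarrow> real) \<Rightarrow> ('i \<Rightarrow> real) \<Rightarrow> real" where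
  "pderiv_at c f p = deriv (\<lambda>s. f (p(c := s))) (p c)"

definition iterated_pderiv :: "'i list \<Rightarrow> (('i \<Rightarrow> real) \<Rightarrow> real) \<Rightarrow> ('i \<Rightarrow> real) \<Rightarrow> real" where
  "iterated_pderiv cs f = foldr pderiv_at cs f"

text \<open>
  For a function of finitely many coordinates, \<open>C\<^sup>\<infinity>\<close> means that all iterated partial derivatives
  exist and are continuous.
\<close>

definition smooth_coords :: "('i \<Rightarrow> real) set \<Rightarrow> (('i \<Rightarrow> real) \<Rightarrow> real) \<Rightarrow> bool" where
  "smooth_coords \<Omega> f \<longleftrightarrow>
     (\<forall>cs. continuous_on \<Omega> (iterated_pderiv cs f) \<and>
       (\<forall>c. \<forall>p\<in>\<Omega>. (\<lambda>s. iterated_pderiv cs f (p(c := s))) field_differentiable (at (p c))))"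


section \<open>The infinite jet space of functions of \<open>CARD('n)\<close> variables\<close>

type_synonym 'n multiindex = "'n \<Rightarrow> nat"

text \<open>\<open>Indep i\<close> is the coordinate \<open>x\<^sub>i\<close> and \<open>Dep \<alpha>\<close> is the coordinate \<open>y\<^sup>\<alpha>\<close>.\<close>

datatype 'n coord = Indep 'n | Dep "'n multiindex"

type_synonym 'n jet = "'n coord \<Rightarrow> real"

definition bump :: "'n multiindex \<Rightarrow> 'n \<Rightarrow> 'n multiindex" where
  "bump \<alpha> i = \<alpha>(i := Suc (\<alpha> i))"

abbreviation zero_multiindex :: "'n multiindex" where
  "zero_multiindex \<equiv> (\<lambda>_. 0)"

definition total_deriv :: "'n \<Rightarrow> ('n jet \<Rightarrow> real) \<Rightarrow> 'n jet \<Rightarrow> real" where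
  "total_deriv i f p =
     pderiv_at (Indep i) f p + Sum_any (\<lambda>\<alpha>. p (Dep (bump \<alpha> i)) * pderiv_at (Dep \<alpha>) f p)"

text \<open>A vector field is given by its coefficients: \<open>X c\<close> is the coefficient of \<open>\<partial>/\<partial>c\<close>.\<close>

type_synonym 'n jet_field = "'n coord \<Rightarrow> 'n jet \<Rightarrow> real"

definition field_apply :: "'n jet_field \<Rightarrow> ('n jet \<Rightarrow> real) \<Rightarrow> 'n jet \<Rightarrow> real" where
  "field_apply X f p = Sum_any (\<lambda>c. X c p * pderiv_at c f p)"

definition jet_domain :: "'n jet set \<Rightarrow> bool" where
  "jet_domain \<Omega> \<longleftrightarrow> (\<exists>A. finite A \<and> open_cylinder A \<Omega>)"

definition jet_function :: "'n jet set \<Rightarrow> ('n jet \<Rightarrow> real) \<Rightarrow> bool" where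
  "jet_function \<Omega> f \<longleftrightarrow> (\<exists>A. finite A \<and> depends_only_on A \<Omega> f) \<and> smooth_coords \<Omega> f"

definition jet_vector_field :: "'n jet set \<Rightarrow> 'n jet_field \<Rightarrow> bool" where
  "jet_vector_field \<Omega> X \<longleftrightarrow> jet_domain \<Omega> \<and> (\<forall>c. jet_function \<Omega> (X c))"

text \<open>
  All coefficients are taken on one domain \<open>\<Omega>\<close>: by the recursion the coefficients
  of all \<open>\<partial>/\<partial>y\<^sup>\<alpha>\<close> live where those of \<open>\<partial>/\<partial>x\<^sub>i\<close> and \<open>\<partial>/\<partial>y\<close> do.
\<close>

definition Lie_Baecklund :: "'n::finite jet set \<Rightarrow> 'n jet_field \<Rightarrow> bool" where
  "Lie_Baecklund \<Omega> X \<longleftrightarrow> jet_vector_field \<Omega> X \<and>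
     (\<forall>\<alpha> k. \<forall>p\<in>\<Omega>. X (Dep (bump \<alpha> k)) p =
        total_deriv k (X (Dep \<alpha>)) p
        - (\<Sum>i\<in>UNIV. p (Dep (bump \<alpha> i)) * total_deriv k (X (Indep i)) p))"

definition condition_F :: "'n jet set \<Rightarrow> 'n jet_field \<Rightarrow> bool" where
  "condition_F \<Omega> X \<longleftrightarrow>
     (\<forall>g. \<exists>F. finite F \<and> (\<forall>k. depends_only_on F \<Omega> ((field_apply X ^^ k) (\<lambda>p. p g))))"


section \<open>Lie-Baecklund fields on the first jet space\<close>

text \<open>The components are \<open>(x, y, (y\<^sup>1, \<dots>, y\<^sup>n))\<close>.\<close>

type_synonym 'n jet1 = "(real ^ 'n) \<times> real \<times> (real ^ 'n)"

definition tau1 :: "(real ^ 'n::finite \<Rightarrow> real) \<Rightarrow> real ^ 'n \<Rightarrow> 'n jet1" where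
  "tau1 f x = (x, f x, \<chi> i. frechet_derivative f (at x) (axis i 1))"

definition graph1 :: "(real ^ 'n::finite) set \<Rightarrow> (real ^ 'n \<Rightarrow> real) \<Rightarrow> 'n jet1 set" where
  "graph1 U f = tau1 f ` U"

definition local_flow1 ::
  "'n::finite jet1 set \<Rightarrow> ('n jet1 \<Rightarrow> 'n jet1) \<Rightarrow> ('n jet1 \<times> real) set \<Rightarrow>
   (real \<Rightarrow> 'n jet1 \<Rightarrow> 'n jet1) \<Rightarrow> bool" where
  "local_flow1 W Z E \<Phi> \<longleftrightarrow>
     open E \<and> E \<subseteq> W \<times> UNIV \<and> W \<times> {0} \<subseteq> E \<and> (\<forall>w. is_interval {t. (w, t) \<in> E}) \<and>
     (\<forall>w\<in>W. \<Phi> 0 w = w) \<and>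
     (\<forall>w t. (w, t) \<in> E \<longrightarrow>
        \<Phi> t w \<in> W \<and> ((\<lambda>s. \<Phi> s w) has_vector_derivative Z (\<Phi> t w)) (at t))"

text \<open>
  The local homeomorphism \<open>\<phi>\<close>, with open domain \<open>D\<close>, maps the germ of the set \<open>A\<close> at \<open>a\<close> to the
  germ of the set \<open>B\<close> at \<open>\<phi> a\<close>.
\<close>

definition maps_germ ::
  "'a::topological_space set \<Rightarrow> ('a \<Rightarrow> 'a) \<Rightarrow> 'a set \<Rightarrow> 'a \<Rightarrow> 'a set \<Rightarrow> bool" where
  "maps_germ D \<phi> A a B \<longleftrightarrow>
     (\<exists>N M. open N \<and> a \<in> N \<and> N \<subseteq> D \<and> open M \<and> \<phi> a \<in> M \<and> \<phi> ` (A \<inter> N) \<inter> M = B \<inter> M)"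

text \<open>
  Two local flows of \<open>Z\<close> coincide on the intersection of their domains, and only small
  times matter here, so it is immaterial which one is used.
\<close>

definition Lie_Baecklund1 :: "'n::finite jet1 set \<Rightarrow> ('n jet1 \<Rightarrow> 'n jet1) \<Rightarrow> bool" where
  "Lie_Baecklund1 W Z \<longleftrightarrow> open W \<and> smooth_on W Z \<and>
     (\<exists>E \<Phi>. local_flow1 W Z E \<Phi> \<and>
       (\<forall>U f. open U \<and> smooth_on U f \<and> graph1 U f \<subseteq> W \<longrightarrow>
         (\<forall>x0\<in>U. \<exists>\<delta>>0. \<exists>V. open V \<and> x0 \<in> V \<and> V \<subseteq> U \<and>
           (\<forall>t. \<bar>t\<bar> < \<delta> \<longrightarrow>
             (\<exists>Ut ft. open Ut \<and> smooth_on Ut ft \<and>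
               (\<forall>x\<in>V. maps_germ {w. (w, t) \<in> E} (\<Phi> t) (graph1 U f) (tau1 f x) (graph1 Ut ft)))))))"


section \<open>Liftings\<close>

definition proj1 :: "'n::finite jet \<Rightarrow> 'n jet1" where
  "proj1 p = (\<chi> i. p (Indep i), p (Dep zero_multiindex), \<chi> i. p (Dep (bump zero_multiindex i)))"

text \<open>
  Since \<open>X\<close> satisfies the recursion on \<open>\<Omega>\<close>, its remaining coefficients are determined by those
  compared here with \<open>Z\<close>.
\<close>

definition lifting_of ::
  "'n::finite jet set \<Rightarrow> 'n jet_field \<Rightarrow> 'n jet1 set \<Rightarrow> ('n jet1 \<Rightarrow> 'n jet1) \<Rightarrow> bool" where
  "lifting_of \<Omega> X W Z \<longleftrightarrow>
     Lie_Baecklund1 W Z \<and> Lie_Baecklund \<Omega> X \<and> proj1 ` \<Omega> \<subseteq> W \<and>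
     (\<forall>p\<in>\<Omega>. proj1 (\<lambda>c. X c p) = Z (proj1 p))"

text \<open>
  Functions with vanishing derivatives along the fibres of \<open>\<Omega> \<rightarrow> J\<^sup>1\<close> descend to \<open>J\<^sup>1\<close> in general only
  locally on \<open>\<Omega>\<close>; they do so on all of \<open>\<Omega>\<close> (for instance if \<open>\<Omega>\<close> is the whole jet space) if these
  fibres are connected.
\<close>

definition connected_fibres1 :: "'n::finite jet set \<Rightarrow> bool" where
  "connected_fibres1 \<Omega> \<longleftrightarrow> (\<forall>w. connected {p \<in> \<Omega>. proj1 p = w})"


section \<open>Exponentiable fields\<close>

text \<open>Pairs (point, time) are families indexed by \<open>'n coord option\<close>, with \<open>None\<close> for the time.\<close>

definition with_time :: "'n jet \<Rightarrow> real \<Rightarrow> ('n coord option \<Rightarrow> real)" where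
  "with_time p t = (\<lambda>c. case c of None \<Rightarrow> t | Some d \<Rightarrow> p d)"

text \<open>
  The component \<open>\<Phi> c\<close> of the flow has its own domain \<open>E c\<close> and depends only on the time and on the
  finite set \<open>S c\<close> of coordinates. Hence the component \<open>c\<close> of \<open>\<Phi>\<^sub>t \<circ> \<Phi>\<^sub>s\<close> is defined at \<open>p\<close> as soon as the
  components of \<open>\<Phi>\<^sub>s\<close> in \<open>S c\<close> are; \<open>q\<close> below is any point with these components.
\<close>

definition local_flow ::
  "'n jet set \<Rightarrow> 'n jet_field \<Rightarrow> ('n coord \<Rightarrow> 'n coord set) \<Rightarrow>
   ('n coord \<Rightarrow> ('n coord option \<Rightarrow> real) set) \<Rightarrow>
   ('n coord \<Rightarrow> ('n coord option \<Rightarrow> real) \<Rightarrow> real) \<Rightarrow> bool" where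
  "local_flow \<Omega> X S E \<Phi> \<longleftrightarrow>
     (\<forall>c. finite (S c) \<and>
        open_cylinder (insert None (Some ` S c)) (E c) \<and>
        depends_only_on (insert None (Some ` S c)) (E c) (\<Phi> c) \<and>
        smooth_coords (E c) (\<Phi> c) \<and>
        (\<forall>p t. with_time p t \<in> E c \<longrightarrow> p \<in> \<Omega>) \<and>
        (\<forall>p. is_interval {t. with_time p t \<in> E c}) \<and>
        (\<forall>p\<in>\<Omega>. with_time p 0 \<in> E c \<and> \<Phi> c (with_time p 0) = p c) \<and>
        (\<forall>p q s t. (\<forall>d\<in>S c. with_time p s \<in> E d \<and> q d = \<Phi> d (with_time p s)) \<and>
           with_time q t \<in> E c \<and> with_time p (s + t) \<in> E c \<longrightarrow>
           \<Phi> c (with_time q t) = \<Phi> c (with_time p (s + t))) \<and>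
        (\<forall>p\<in>\<Omega>. ((\<lambda>t. \<Phi> c (with_time p t)) has_real_derivative X c p) (at 0)))"

definition exponentiable :: "'n jet set \<Rightarrow> 'n jet_field \<Rightarrow> bool" where
  "exponentiable \<Omega> X \<longleftrightarrow> (\<exists>S E \<Phi>. local_flow \<Omega> X S E \<Phi>)"

end

theory Submission
  imports Defs
begin

text \<open>
  The contact form \<open>\<theta> = dy - \<Sum>\<^sub>i y\<^sup>i dx\<^sub>i\<close> satisfies \<open>L\<^sub>X \<theta> = P \<theta>\<close> for a scalar total differential operator \<open>P\<close>.
  The forms \<open>L\<^sub>X\<^sup>k \<theta>\<close> are combinations of the differentials of the functions \<open>X\<^sup>j y\<close> and \<open>X\<^sup>j x\<^sub>i\<close>, so
  condition \<open>F\<close> bounds the orders of these forms for all \<open>k\<close> together. As leading symbols multiply,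
  \<open>P\<close> has order \<open>0\<close>, that is, \<open>L\<^sub>X \<theta>\<close> is a multiple of \<open>\<theta>\<close>. Hence the coefficients of \<open>X\<close> at \<open>x\<^sub>i\<close>, \<open>y\<close> and
  \<open>y\<^sup>i\<close> depend on \<open>J\<^sup>1\<close> only and form a contact field there, whose flow preserves the contact form
  up to a factor and therefore maps 1-graphs to 1-graphs.

  By the recursion, the coefficients of order at most \<open>r\<close> then depend, up to the variables of the domain,
  only on coordinates of order at most \<open>r\<close>. The flow is obtained from finite-dimensional ones, one for each \<open>r\<close>.
\<close>

subsection \<open>Cylinders and boxes\<close>

text \<open>The obstacle is that \<Omega> is an arbitrary cylinder. A coefficient whose derivatives
  in the higher coordinates vanish is only locally independent of them: points of \<Omega> that
  agree in all lower coordinates may lie in different pieces of \<Omega>. Independence is therefore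
  claimed only between points of a common box inside \<Omega>. This shapes both parts of the
  conclusion: the field descends to J^1 box by box, and over all of \<Omega> when the fibres are
  connected; the finite-dimensional flows keep further coordinates as frozen parameters, and times
  are cut off so that trajectories stay in small boxes, where the flows for different r agree.
  Orders are bounded for all k at once because the Lie derivative of the vertical part of d(X^k g)
  involves only the vertical parts of d(X^(k+1) g) and of the d(X x_i). So condition F is used for
  the coordinates y and x_i alone, and a leading multiindex m of positive order would put all
  multiples k m into one finite set.\<close>

lemma open_box:
  fixes p :: "'i \<Rightarrow> real"
  assumes "finite S"
  shows "open {x :: 'i \<Rightarrow> real. \<forall>i\<in>S. \<bar>x i - p i\<bar> < e}"
proof -
  have "open {f :: 'i \<Rightarrow> real. \<forall>i\<in>S. f (id i) \<in> {p i - e <..< p i + e}}"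
    by (rule product_topology_basis') (use assms in auto)
  moreover have "{f. \<forall>i\<in>S. f (id i) \<in> {p i - e <..< p i + e}} = {x. \<forall>i\<in>S. \<bar>x i - p i\<bar> < e}"
    by (auto simp: abs_less_iff algebra_simps)
  ultimately show ?thesis by simp
qed

text \<open>A basic neighbourhood of p in the product topology may also restrict finitely many
  coordinates outside S. Those restrictions are met by keeping the values of p there, and saturation
  then carries membership over to x.\<close>

lemma open_cylinder_imp_box:
  assumes "open_cylinder S \<Omega>" "p \<in> \<Omega>" "finite S"
  shows "\<exists>e>0. \<forall>x. (\<forall>i\<in>S. \<bar>x i - p i\<bar> < e) \<longrightarrow> x \<in> \<Omega>"
proof -
  have "open \<Omega>" using assms by (simp add: open_cylinder_def)
  then have "openin (product_topology (\<lambda>i. euclidean) UNIV) \<Omega>"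
    by (simp add: open_fun_def)
  from product_topology_open_contains_basis[OF this assms(2)]
  obtain X where X': "p \<in> (\<Pi>\<^sub>E i\<in>UNIV. X i)" "\<forall>i. openin euclidean (X i)"
      "finite {i. X i \<noteq> topspace euclidean}" "(\<Pi>\<^sub>E i\<in>UNIV. X i) \<subseteq> \<Omega>" by (elim exE conjE)
  have X: "p \<in> (\<Pi>\<^sub>E i\<in>UNIV. X i)" "\<And>i. open (X i)" "finite {i. X i \<noteq> UNIV}"
      "(\<Pi>\<^sub>E i\<in>UNIV. X i) \<subseteq> \<Omega>" using X' by (simp_all add: open_openin[symmetric])
  have "\<exists>e>0. ball (p i) e \<subseteq> X i" for i
    using X(1) X(2)[of i] by (simp add: PiE_iff open_contains_ball)
  then obtain e where e: "\<And>i. e i > 0" "\<And>i. ball (p i) (e i) \<subseteq> X i" by metis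
  define d where "d = Min (insert 1 (e ` S))"
  have d: "d > 0" "\<And>i. i \<in> S \<Longrightarrow> d \<le> e i"
    using assms(3) e(1) by (auto simp: d_def)
  show ?thesis
  proof (intro exI[of _ d] conjI[OF d(1)] allI impI)
    fix x assume x: "\<forall>i\<in>S. \<bar>x i - p i\<bar> < d"
    define y where "y i = (if i \<in> S then x i else p i)" for i
    have "y i \<in> X i" for i
    proof (cases "i \<in> S")
      case True
      then have "x i \<in> ball (p i) (e i)" using x d(2)[of i] by (force simp: dist_real_def)
      then have "x i \<in> X i" using e(2) by (rule subsetD[rotated])
      then show ?thesis using True by (simp add: y_def)
    qed (use X(1) in \<open>auto simp: y_def PiE_iff\<close>)
    then have "y \<in> \<Omega>" using X(4) by (auto simp: PiE_iff)
    moreover have "agree_on S y x" by (simp add: agree_on_def y_def)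
    ultimately show "x \<in> \<Omega>" using assms(1) by (auto simp: open_cylinder_def)
  qed
qed

lemma open_cylinderI_box:
  assumes "finite S"
    and "\<And>p. p \<in> \<Omega> \<Longrightarrow> \<exists>e>0. \<forall>x. (\<forall>i\<in>S. \<bar>x i - p i\<bar> < e) \<longrightarrow> x \<in> \<Omega>"
  shows "open_cylinder S \<Omega>"
  unfolding open_cylinder_def
proof (intro conjI ballI allI impI)
  show "open \<Omega>"
    unfolding open_subopen[of \<Omega>]
  proof
    fix p assume "p \<in> \<Omega>"
    then obtain e where "e > 0" "\<forall>x. (\<forall>i\<in>S. \<bar>x i - p i\<bar> < e) \<longrightarrow> x \<in> \<Omega>" using assms(2) by blast
    then show "\<exists>T. open T \<and> p \<in> T \<and> T \<subseteq> \<Omega>"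
      by (intro exI[of _ "{x. \<forall>i\<in>S. \<bar>x i - p i\<bar> < e}"]) (auto simp: open_box[OF assms(1)])
  qed
  fix p q assume "p \<in> \<Omega>" "agree_on S p q"
  then show "q \<in> \<Omega>" using assms(2)[of p] by (auto simp: agree_on_def)
qed

lemma open_cylinder_open: "open_cylinder S \<Omega> \<Longrightarrow> open \<Omega>"
  by (simp add: open_cylinder_def)

lemma open_cylinder_agree: "open_cylinder S \<Omega> \<Longrightarrow> p \<in> \<Omega> \<Longrightarrow> (\<And>i. i \<in> S \<Longrightarrow> p i = q i) \<Longrightarrow> q \<in> \<Omega>"
  by (auto simp: open_cylinder_def agree_on_def)

lemma open_cylinder_mono: "open_cylinder S \<Omega> \<Longrightarrow> S \<subseteq> T \<Longrightarrow> open_cylinder T \<Omega>"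
  unfolding open_cylinder_def agree_on_def by (meson subsetD)

lemma depends_only_onD:
  "depends_only_on S \<Omega> f \<Longrightarrow> p \<in> \<Omega> \<Longrightarrow> q \<in> \<Omega> \<Longrightarrow> (\<And>i. i \<in> S \<Longrightarrow> p i = q i) \<Longrightarrow> f p = f q"
  unfolding depends_only_on_def agree_on_def by meson

lemma depends_only_on_mono:
  "depends_only_on S \<Omega> f \<Longrightarrow> S \<subseteq> T \<Longrightarrow> U \<subseteq> \<Omega> \<Longrightarrow> depends_only_on T U f"
  unfolding depends_only_on_def agree_on_def by (simp add: subset_eq)

text \<open>Supplies the neighbourhoods on which finitely many continuous functions stay close to
  prescribed values; being cylinders over S, they contain boxes that restrict S only.\<close>

lemma open_cylinder_sublevel:
  assumes "open_cylinder S \<Omega>" "finite I"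
    and F: "\<And>k. k \<in> I \<Longrightarrow> continuous_on \<Omega> (F k) \<and> depends_only_on S \<Omega> (F k)"
  shows "open_cylinder S {x \<in> \<Omega>. \<forall>k\<in>I. \<bar>F k x - a k\<bar> < b}"
proof -
  have "open {x \<in> \<Omega>. \<bar>F k x - a k\<bar> < b}" if "k \<in> I" for k
  proof -
    have "continuous_on \<Omega> (\<lambda>x. \<bar>F k x - a k\<bar>)"
      using F[OF that] by (intro continuous_intros) auto
    then have "open ((\<lambda>x. \<bar>F k x - a k\<bar>) -` {..<b} \<inter> \<Omega>)"
      unfolding continuous_on_open_vimage[OF open_cylinder_open[OF assms(1)]]
      by (elim allE impE) simp_all
    moreover have "(\<lambda>x. \<bar>F k x - a k\<bar>) -` {..<b} \<inter> \<Omega> = {x \<in> \<Omega>. \<bar>F k x - a k\<bar> < b}" by auto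
    ultimately show ?thesis by simp
  qed
  moreover have "{x \<in> \<Omega>. \<forall>k\<in>I. \<bar>F k x - a k\<bar> < b} =
      \<Omega> \<inter> (\<Inter>k\<in>I. {x \<in> \<Omega>. \<bar>F k x - a k\<bar> < b})" by auto
  ultimately have "open {x \<in> \<Omega>. \<forall>k\<in>I. \<bar>F k x - a k\<bar> < b}"
    using assms(2) open_cylinder_open[OF assms(1)] by (auto intro!: open_Int open_INT)
  moreover have "q \<in> {x \<in> \<Omega>. \<forall>k\<in>I. \<bar>F k x - a k\<bar> < b}"
    if x: "x \<in> {x \<in> \<Omega>. \<forall>k\<in>I. \<bar>F k x - a k\<bar> < b}" and q: "agree_on S x q" for x q
  proof -
    have "q \<in> \<Omega>" using x q assms(1) by (auto simp: open_cylinder_def)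
    moreover have "F k x = F k q" if "k \<in> I" for k
      using F[OF that] x q \<open>q \<in> \<Omega>\<close> by (auto simp: depends_only_on_def)
    ultimately show ?thesis using x by auto
  qed
  ultimately show ?thesis unfolding open_cylinder_def by blast
qed

text \<open>With two points such a set contains the whole box that they span, so one can pass from
  one point to the other inside the set by changing one coordinate after the other.\<close>

definition box_convex :: "('i \<Rightarrow> real) set \<Rightarrow> bool" where
  "box_convex B \<longleftrightarrow> (\<forall>x\<in>B. \<forall>y\<in>B. \<forall>z. (\<forall>i. z i \<in> closed_segment (x i) (y i)) \<longrightarrow> z \<in> B)"

lemma box_convexD:
  "box_convex B \<Longrightarrow> x \<in> B \<Longrightarrow> y \<in> B \<Longrightarrow> (\<And>i. z i \<in> closed_segment (x i) (y i)) \<Longrightarrow> z \<in> B"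
  unfolding box_convex_def by (drule bspec, assumption, drule bspec, assumption, drule spec, erule mp, rule allI)

lemma segment_abs_less:
  fixes x y z p :: real
  assumes "z \<in> closed_segment x y" "\<bar>x - p\<bar> < e" "\<bar>y - p\<bar> < e"
  shows "\<bar>z - p\<bar> < e"
  using assms by (auto simp: closed_segment_eq_real_ivl split: if_splits)

lemma segment_abs_le:
  fixes x y z p :: real
  assumes "z \<in> closed_segment x y" "\<bar>x - p\<bar> \<le> e" "\<bar>y - p\<bar> \<le> e"
  shows "\<bar>z - p\<bar> \<le> e"
  using assms by (auto simp: closed_segment_eq_real_ivl split: if_splits)

lemma box_convex_box: "box_convex {x. \<forall>i\<in>S. \<bar>x i - p i\<bar> < e i}"
  unfolding box_convex_def by (blast intro: segment_abs_less)

lemma box_convex_cbox: "box_convex {x. \<forall>i\<in>S. \<bar>x i - p i\<bar> \<le> e i}"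
  unfolding box_convex_def by (blast intro: segment_abs_le)

lemma continuous_on_fun_upd [continuous_intros]:
  fixes g :: "'a::topological_space \<Rightarrow> 'i \<Rightarrow> real"
  assumes "continuous_on T g" "continuous_on T h"
  shows "continuous_on T (\<lambda>x. (g x)(c := h x))"
proof (rule continuous_on_coordinatewise_then_product)
  fix i
  show "continuous_on T (\<lambda>x. ((g x)(c := h x)) i)"
    using assms by (cases "i = c") (auto intro: continuous_on_product_then_coordinatewise)
qed

lemma eventually_fun_upd_in:
  fixes p :: "'i \<Rightarrow> real"
  assumes "open \<Omega>" "p(c := s) \<in> \<Omega>"
  shows "\<forall>\<^sub>F t in nhds s. p(c := t) \<in> \<Omega>"
proof -
  have "continuous_on UNIV (\<lambda>t. p(c := t))"
    by (intro continuous_intros)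
  then have "open ((\<lambda>t. p(c := t)) -` \<Omega>)"
    using assms(1) open_vimage by blast
  then show ?thesis
    unfolding eventually_nhds using assms(2) by (intro exI[of _ "(\<lambda>t. p(c := t)) -` \<Omega>"]) auto
qed


subsection \<open>Partial derivatives\<close>

definition pdiff :: "('i \<Rightarrow> real) set \<Rightarrow> (('i \<Rightarrow> real) \<Rightarrow> real) \<Rightarrow> bool" where
  "pdiff \<Omega> f \<longleftrightarrow> continuous_on \<Omega> f \<and>
     (\<forall>c. \<forall>p\<in>\<Omega>. (\<lambda>s. f (p(c := s))) field_differentiable (at (p c)))"

text \<open>Recursive form of \<open>smooth_coords\<close>: inductions on the order run with the
  function arbitrary, the step replacing a function by its partial derivatives. Already
  \<open>Ckc 0\<close> includes partial differentiability, so \<open>Ckc 1\<close> includes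
  continuity of the first derivatives.\<close>

primrec Ckc :: "nat \<Rightarrow> ('i \<Rightarrow> real) set \<Rightarrow> (('i \<Rightarrow> real) \<Rightarrow> real) \<Rightarrow> bool" where
  "Ckc 0 \<Omega> f \<longleftrightarrow> pdiff \<Omega> f"
| "Ckc (Suc k) \<Omega> f \<longleftrightarrow> pdiff \<Omega> f \<and> (\<forall>c. Ckc k \<Omega> (pderiv_at c f))"

lemma pdiff_DERIV:
  assumes "pdiff \<Omega> f" "p \<in> \<Omega>"
  shows "((\<lambda>s. f (p(c := s))) has_real_derivative pderiv_at c f p) (at (p c))"
  using assms unfolding pdiff_def pderiv_at_def by (simp add: field_differentiable_derivI)

lemma pdiff_DERIV_upd:
  assumes "pdiff \<Omega> f" "p(c := s) \<in> \<Omega>"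
  shows "((\<lambda>s. f (p(c := s))) has_real_derivative pderiv_at c f (p(c := s))) (at s)"
  using pdiff_DERIV[OF assms, of c] by simp

lemma pderiv_at_eqI:
  "((\<lambda>s. f (p(c := s))) has_real_derivative D) (at (p c)) \<Longrightarrow> pderiv_at c f p = D"
  unfolding pderiv_at_def by (rule DERIV_imp_deriv)

lemma pdiffI:
  assumes "continuous_on \<Omega> f"
    and "\<And>c p. p \<in> \<Omega> \<Longrightarrow> \<exists>D. ((\<lambda>s. f (p(c := s))) has_real_derivative D) (at (p c))"
  shows "pdiff \<Omega> f"
  using assms unfolding pdiff_def field_differentiable_def by blast

lemma DERIV_upd_cong:
  assumes "open \<Omega>" "p \<in> \<Omega>" "\<forall>x\<in>\<Omega>. f x = g x"
  shows "((\<lambda>s. f (p(c := s))) has_real_derivative D) (at (p c)) \<longleftrightarrow>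
         ((\<lambda>s. g (p(c := s))) has_real_derivative D) (at (p c))"
proof (rule DERIV_cong_ev)
  have "\<forall>\<^sub>F t in nhds (p c). p(c := t) \<in> \<Omega>"
    using assms(1,2) by (intro eventually_fun_upd_in) auto
  then show "\<forall>\<^sub>F t in nhds (p c). f (p(c := t)) = g (p(c := t))"
    by eventually_elim (use assms(3) in blast)
qed auto

lemma pderiv_at_cong:
  assumes "open \<Omega>" "p \<in> \<Omega>" "\<And>x. x \<in> \<Omega> \<Longrightarrow> f x = g x"
  shows "pderiv_at c f p = pderiv_at c g p"
proof -
  have "\<forall>x\<in>\<Omega>. f x = g x" using assms(3) by blast
  from DERIV_upd_cong[OF assms(1,2) this] show ?thesis
    unfolding pderiv_at_def deriv_def by simp
qed

lemma pdiff_cong: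
  assumes "open \<Omega>" "\<And>x. x \<in> \<Omega> \<Longrightarrow> f x = g x" "pdiff \<Omega> f"
  shows "pdiff \<Omega> g"
proof -
  have "continuous_on \<Omega> g" using assms by (metis continuous_on_cong pdiff_def)
  moreover have "((\<lambda>s. g (p(c := s))) has_real_derivative pderiv_at c f p) (at (p c))"
    if "p \<in> \<Omega>" for c p
  proof -
    have "\<forall>x\<in>\<Omega>. f x = g x" using assms(2) by blast
    from DERIV_upd_cong[OF assms(1) that this] show ?thesis
      using pdiff_DERIV[OF assms(3) that, of c] by simp
  qed
  ultimately show ?thesis by (rule pdiffI[OF _ exI])
qed

lemma Ckc_cong:
  assumes "open \<Omega>" "\<And>x. x \<in> \<Omega> \<Longrightarrow> f x = g x" "Ckc k \<Omega> f"
  shows "Ckc k \<Omega> g"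
  using assms(2,3)
proof (induction k arbitrary: f g)
  case 0 then show ?case using pdiff_cong[OF assms(1)] by (metis Ckc.simps(1))
next
  case (Suc k)
  have "Ckc k \<Omega> (pderiv_at c g)" for c
  proof (rule Suc.IH[of "pderiv_at c f"])
    show "pderiv_at c f p = pderiv_at c g p" if "p \<in> \<Omega>" for p
      by (rule pderiv_at_cong[OF assms(1) that Suc.prems(1)])
    show "Ckc k \<Omega> (pderiv_at c f)" using Suc.prems(2) by simp
  qed
  then show ?case using Suc.prems pdiff_cong[OF assms(1)] by (metis Ckc.simps(2))
qed

lemma Ckc_pdiff: "Ckc k \<Omega> f \<Longrightarrow> pdiff \<Omega> f"
  by (cases k) auto

lemma Ckc_Suc_imp: "Ckc (Suc k) \<Omega> f \<Longrightarrow> Ckc k \<Omega> f"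
  by (induction k arbitrary: f) auto

lemma smooth_coords_iff_Ckc: "smooth_coords \<Omega> f \<longleftrightarrow> (\<forall>k. Ckc k \<Omega> f)"
proof
  assume f: "smooth_coords \<Omega> f"
  have "Ckc k \<Omega> (iterated_pderiv cs f)" for k cs
  proof (induction k arbitrary: cs)
    case 0
    then show ?case using f by (auto simp: smooth_coords_def pdiff_def)
  next
    case (Suc k)
    have "pderiv_at c (iterated_pderiv cs f) = iterated_pderiv (c # cs) f" for c
      by (simp add: iterated_pderiv_def)
    then show ?case using f Suc by (simp add: smooth_coords_def pdiff_def)
  qed
  from this[of _ "[]"] show "\<forall>k. Ckc k \<Omega> f" by (simp add: iterated_pderiv_def)
next
  assume f: "\<forall>k. Ckc k \<Omega> f"
  have "Ckc k \<Omega> (iterated_pderiv cs f)" for k cs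
  proof (induction cs arbitrary: k)
    case Nil then show ?case using f by (simp add: iterated_pderiv_def)
  next
    case (Cons c cs)
    show ?case using Cons[of "Suc k"] by (simp add: iterated_pderiv_def)
  qed
  then have "pdiff \<Omega> (iterated_pderiv cs f)" for cs using Ckc_pdiff by blast
  then show "smooth_coords \<Omega> f" by (auto simp: smooth_coords_def pdiff_def)
qed

lemma smooth_coords_pdiff: "smooth_coords \<Omega> f \<Longrightarrow> pdiff \<Omega> f"
  using Ckc_pdiff by (auto simp: smooth_coords_iff_Ckc)

lemma smooth_coords_cont: "smooth_coords \<Omega> f \<Longrightarrow> continuous_on \<Omega> f"
  using smooth_coords_pdiff by (auto simp: pdiff_def)

lemma smooth_coords_DERIV:
  "smooth_coords \<Omega> f \<Longrightarrow> p \<in> \<Omega> \<Longrightarrow>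
    ((\<lambda>s. f (p(c := s))) has_real_derivative pderiv_at c f p) (at (p c))"
  by (rule pdiff_DERIV[OF smooth_coords_pdiff])

lemma smooth_coords_pderiv: "smooth_coords \<Omega> f \<Longrightarrow> smooth_coords \<Omega> (pderiv_at c f)"
  unfolding smooth_coords_iff_Ckc by (metis Ckc.simps(2))

lemma smooth_coords_cong:
  "open \<Omega> \<Longrightarrow> (\<And>x. x \<in> \<Omega> \<Longrightarrow> f x = g x) \<Longrightarrow> smooth_coords \<Omega> f \<Longrightarrow> smooth_coords \<Omega> g"
  unfolding smooth_coords_iff_Ckc by (metis Ckc_cong)

lemma pdiff_local:
  assumes "\<And>p. p \<in> \<Omega> \<Longrightarrow> \<exists>U. open U \<and> p \<in> U \<and> pdiff U f"
  shows "pdiff \<Omega> f"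
proof (rule pdiffI)
  have "\<exists>U. open U \<and> p \<in> U \<and> continuous_on U f" if "p \<in> \<Omega>" for p
    using assms[OF that] unfolding pdiff_def by blast
  then obtain U where U: "\<And>p. p \<in> \<Omega> \<Longrightarrow> open (U p) \<and> p \<in> U p \<and> continuous_on (U p) f" by metis
  then have "continuous_on (\<Union>p\<in>\<Omega>. U p) f" by (intro continuous_on_open_UN) auto
  then show "continuous_on \<Omega> f" by (rule continuous_on_subset) (use U in blast)
  show "\<exists>D. ((\<lambda>s. f (p(c := s))) has_real_derivative D) (at (p c))" if "p \<in> \<Omega>" for c p
    using assms[OF that] pdiff_DERIV[of _ f p c] by blast
qed

lemma Ckc_local:
  assumes "\<And>p. p \<in> \<Omega> \<Longrightarrow> \<exists>U. open U \<and> p \<in> U \<and> Ckc k U f"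
  shows "Ckc k \<Omega> f"
  using assms
proof (induction k arbitrary: f)
  case 0 then show ?case using pdiff_local by (metis Ckc.simps(1))
next
  case (Suc k)
  have "pdiff \<Omega> f" using Suc.prems by (intro pdiff_local) (metis Ckc.simps(2))
  moreover have "Ckc k \<Omega> (pderiv_at c f)" for c
    by (rule Suc.IH) (metis Suc.prems Ckc.simps(2))
  ultimately show ?case by simp
qed

lemma smooth_coords_local:
  assumes "\<And>p. p \<in> \<Omega> \<Longrightarrow> \<exists>U. open U \<and> p \<in> U \<and> smooth_coords U f"
  shows "smooth_coords \<Omega> f"
  using assms unfolding smooth_coords_iff_Ckc by (metis Ckc_local)

lemma smooth_coords_subset: "smooth_coords \<Omega> f \<Longrightarrow> U \<subseteq> \<Omega> \<Longrightarrow> smooth_coords U f"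
  unfolding smooth_coords_def by (meson continuous_on_subset subsetD)

lemma Ckc_const: "Ckc k \<Omega> (\<lambda>_. a)"
proof (induction k arbitrary: a)
  case 0 show ?case by (auto intro!: pdiffI derivative_eq_intros)
next
  case (Suc k)
  have "pderiv_at c (\<lambda>_. a) = (\<lambda>_. 0 :: real)" for c :: 'a
    by (rule ext, rule pderiv_at_eqI) (auto intro!: derivative_eq_intros)
  then show ?case using Suc by (auto intro!: pdiffI derivative_eq_intros)
qed

lemma pdiff_coord: "pdiff \<Omega> (\<lambda>p. p i)"
proof (rule pdiffI)
  show "continuous_on \<Omega> (\<lambda>p. p i)"
    by (rule continuous_on_subset[OF continuous_on_product_coordinates]) simp
  show "\<exists>D. ((\<lambda>s. (p(c := s)) i) has_real_derivative D) (at (p c))" for c p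
  proof (cases "c = i")
    case True
    then show ?thesis by (auto intro: exI[of _ 1])
  next
    case False
    then show ?thesis by (auto intro: exI[of _ 0])
  qed
qed

lemma pderiv_at_coord: "pderiv_at c (\<lambda>p. p i) = (\<lambda>_. if c = i then 1 else 0)"
  by (rule ext, rule pderiv_at_eqI) (cases "c = i"; auto intro: derivative_eq_intros)

lemma Ckc_coord: "Ckc k \<Omega> (\<lambda>p. p i)"
  by (cases k) (auto simp: pdiff_coord pderiv_at_coord Ckc_const)

lemma smooth_coords_const: "smooth_coords \<Omega> (\<lambda>_. a)"
  by (simp add: smooth_coords_iff_Ckc Ckc_const)

lemma smooth_coords_coord: "smooth_coords \<Omega> (\<lambda>p. p i)"
  by (simp add: smooth_coords_iff_Ckc Ckc_coord)

lemma pdiff_add: "pdiff \<Omega> f \<Longrightarrow> pdiff \<Omega> g \<Longrightarrow> pdiff \<Omega> (\<lambda>p. f p + g p)"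
  unfolding pdiff_def by (auto intro!: continuous_on_add field_differentiable_add)

lemma pderiv_at_add:
  "pdiff \<Omega> f \<Longrightarrow> pdiff \<Omega> g \<Longrightarrow> p \<in> \<Omega> \<Longrightarrow>
    pderiv_at c (\<lambda>p. f p + g p) p = pderiv_at c f p + pderiv_at c g p"
  by (rule pderiv_at_eqI) (intro DERIV_add pdiff_DERIV)

lemma pdiff_mult: "pdiff \<Omega> f \<Longrightarrow> pdiff \<Omega> g \<Longrightarrow> pdiff \<Omega> (\<lambda>p. f p * g p)"
  unfolding pdiff_def by (auto intro!: continuous_on_mult field_differentiable_mult)

lemma pderiv_at_mult:
  assumes "pdiff \<Omega> f" "pdiff \<Omega> g" "p \<in> \<Omega>"
  shows "pderiv_at c (\<lambda>p. f p * g p) p = pderiv_at c f p * g p + f p * pderiv_at c g p"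
proof (rule pderiv_at_eqI)
  show "((\<lambda>s. f (p(c := s)) * g (p(c := s))) has_real_derivative
      pderiv_at c f p * g p + f p * pderiv_at c g p) (at (p c))"
    using DERIV_mult[OF pdiff_DERIV[OF assms(1,3)] pdiff_DERIV[OF assms(2,3)], of c]
    by (simp add: algebra_simps)
qed

lemma Ckc_add:
  assumes "open \<Omega>" "Ckc k \<Omega> f" "Ckc k \<Omega> g"
  shows "Ckc k \<Omega> (\<lambda>p. f p + g p)"
  using assms(2,3)
proof (induction k arbitrary: f g)
  case 0 then show ?case using pdiff_add by auto
next
  case (Suc k)
  have "Ckc k \<Omega> (pderiv_at c (\<lambda>p. f p + g p))" for c
  proof (rule Ckc_cong[OF assms(1)])
    show "Ckc k \<Omega> (\<lambda>p. pderiv_at c f p + pderiv_at c g p)" using Suc by auto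
  qed (use Suc.prems pderiv_at_add in \<open>fastforce\<close>)
  then show ?case using Suc.prems pdiff_add by auto
qed

lemma Ckc_mult:
  assumes "open \<Omega>" "Ckc k \<Omega> f" "Ckc k \<Omega> g"
  shows "Ckc k \<Omega> (\<lambda>p. f p * g p)"
  using assms(2,3)
proof (induction k arbitrary: f g)
  case 0 then show ?case using pdiff_mult by auto
next
  case (Suc k)
  have "Ckc k \<Omega> (pderiv_at c (\<lambda>p. f p * g p))" for c
  proof (rule Ckc_cong[OF assms(1)])
    have "Ckc k \<Omega> f" "Ckc k \<Omega> g" using Suc.prems Ckc_Suc_imp by blast+
    then show "Ckc k \<Omega> (\<lambda>p. pderiv_at c f p * g p + f p * pderiv_at c g p)"
      using Suc by (intro Ckc_add assms(1)) auto
  qed (use Suc.prems pderiv_at_mult in \<open>fastforce\<close>)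
  then show ?case using Suc.prems pdiff_mult by auto
qed

lemma smooth_coords_add:
  "open \<Omega> \<Longrightarrow> smooth_coords \<Omega> f \<Longrightarrow> smooth_coords \<Omega> g \<Longrightarrow> smooth_coords \<Omega> (\<lambda>p. f p + g p)"
  by (simp add: smooth_coords_iff_Ckc Ckc_add)

lemma smooth_coords_mult:
  "open \<Omega> \<Longrightarrow> smooth_coords \<Omega> f \<Longrightarrow> smooth_coords \<Omega> g \<Longrightarrow> smooth_coords \<Omega> (\<lambda>p. f p * g p)"
  by (simp add: smooth_coords_iff_Ckc Ckc_mult)

lemma smooth_coords_diff:
  assumes "open \<Omega>" "smooth_coords \<Omega> f" "smooth_coords \<Omega> g"
  shows "smooth_coords \<Omega> (\<lambda>p. f p - g p)"
  using smooth_coords_add[OF assms(1,2) smooth_coords_mult[OF assms(1) smooth_coords_const[of _ "-1"] assms(3)]]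
  by simp

lemma smooth_coords_sum:
  assumes "open \<Omega>" "\<And>i. i \<in> I \<Longrightarrow> smooth_coords \<Omega> (f i)"
  shows "smooth_coords \<Omega> (\<lambda>p. \<Sum>i\<in>I. f i p)"
proof (cases "finite I")
  case True
  then show ?thesis using assms(2)
    by (induction I rule: finite_induct) (auto intro: smooth_coords_const smooth_coords_add[OF assms(1)])
qed (simp add: smooth_coords_const)

lemma pderiv_at_diff:
  assumes "pdiff \<Omega> f" "pdiff \<Omega> g" "p \<in> \<Omega>"
  shows "pderiv_at c (\<lambda>p. f p - g p) p = pderiv_at c f p - pderiv_at c g p"
  using assms by (intro pderiv_at_eqI DERIV_diff pdiff_DERIV)

lemma pderiv_at_sum:
  assumes "\<And>i. i \<in> I \<Longrightarrow> pdiff \<Omega> (f i)" "p \<in> \<Omega>"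
  shows "pderiv_at c (\<lambda>p. \<Sum>i\<in>I. f i p) p = (\<Sum>i\<in>I. pderiv_at c (f i) p)"
  using assms by (intro pderiv_at_eqI DERIV_sum pdiff_DERIV)

section \<open>Renaming and freezing coordinates\<close>

definition subst_coords :: "('j \<Rightarrow> 'i option) \<Rightarrow> ('j \<Rightarrow> real) \<Rightarrow> ('i \<Rightarrow> real) \<Rightarrow> 'j \<Rightarrow> real" where
  "subst_coords \<tau> a p j = (case \<tau> j of Some i \<Rightarrow> p i | None \<Rightarrow> a j)"

text \<open>Distinct j read distinct coordinates, so a variation of p i moves at most one coordinate
  of the substituted point, and partial derivatives correspond one to one.\<close>

lemma subst_coords_upd:
  assumes "\<And>j j' i. \<tau> j = Some i \<Longrightarrow> \<tau> j' = Some i \<Longrightarrow> j = j'" "\<tau> j = Some i"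
  shows "subst_coords \<tau> a (p(i := s)) = (subst_coords \<tau> a p)(j := s)"
  using assms by (fastforce simp: subst_coords_def fun_eq_iff split: option.splits)

lemma subst_coords_upd_other:
  assumes "\<And>j. \<tau> j \<noteq> Some i"
  shows "subst_coords \<tau> a (p(i := s)) = subst_coords \<tau> a p"
  using assms by (auto simp: subst_coords_def fun_eq_iff split: option.splits)

lemma continuous_on_subst_coords: "continuous_on T (subst_coords \<tau> a)"
proof (rule continuous_on_coordinatewise_then_product)
  fix j
  have "continuous_on T (\<lambda>p. p i)" for i
    by (rule continuous_on_subset[OF continuous_on_product_coordinates]) simp
  then show "continuous_on T (\<lambda>p. subst_coords \<tau> a p j)"
    by (cases "\<tau> j") (auto simp: subst_coords_def)
qed

lemma pderiv_subst_coords: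
  assumes inj: "\<And>j j' i. \<tau> j = Some i \<Longrightarrow> \<tau> j' = Some i \<Longrightarrow> j = j'" and j: "\<tau> j = Some i"
  shows "pderiv_at i (\<lambda>p. F (subst_coords \<tau> a p)) p = pderiv_at j F (subst_coords \<tau> a p)"
proof -
  have "subst_coords \<tau> a p j = p i" using j by (simp add: subst_coords_def)
  moreover have "(\<lambda>s. F (subst_coords \<tau> a (p(i := s)))) = (\<lambda>s. F ((subst_coords \<tau> a p)(j := s)))"
    using subst_coords_upd[of \<tau>, OF inj j] by simp
  ultimately show ?thesis unfolding pderiv_at_def by simp
qed

lemma pderiv_subst_coords_other:
  assumes "\<And>j. \<tau> j \<noteq> Some i"
  shows "pderiv_at i (\<lambda>p. F (subst_coords \<tau> a p)) p = 0"
  unfolding pderiv_at_def subst_coords_upd_other[OF assms] by simp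

lemma Ckc_subst_coords:
  assumes inj: "\<And>j j' i. \<tau> j = Some i \<Longrightarrow> \<tau> j' = Some i \<Longrightarrow> j = j'"
    and "Ckc k \<Omega> F" "open \<Omega>" "open U" "subst_coords \<tau> a ` U \<subseteq> \<Omega>"
  shows "Ckc k U (\<lambda>p. F (subst_coords \<tau> a p))"
  using assms(2)
proof (induction k arbitrary: F)
  case 0
  have "pdiff U (\<lambda>p. F (subst_coords \<tau> a p))"
  proof (rule pdiffI)
    show "continuous_on U (\<lambda>p. F (subst_coords \<tau> a p))"
      by (rule continuous_on_compose2[OF _ continuous_on_subst_coords assms(5)])
        (use 0 in \<open>auto simp: pdiff_def\<close>)
    fix i p assume p: "p \<in> U"
    show "\<exists>D. ((\<lambda>s. F (subst_coords \<tau> a (p(i := s)))) has_real_derivative D) (at (p i))"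
    proof (cases "\<exists>j. \<tau> j = Some i")
      case True
      then obtain j where j: "\<tau> j = Some i" by blast
      then have *: "subst_coords \<tau> a p j = p i" by (simp add: subst_coords_def)
      have "subst_coords \<tau> a p \<in> \<Omega>" using p assms(5) by auto
      then have "((\<lambda>s. F ((subst_coords \<tau> a p)(j := s))) has_real_derivative
          pderiv_at j F (subst_coords \<tau> a p)) (at (p i))"
        using pdiff_DERIV[of \<Omega> F _ j] 0 unfolding *[symmetric] by simp
      moreover have "(\<lambda>s. F (subst_coords \<tau> a (p(i := s)))) = (\<lambda>s. F ((subst_coords \<tau> a p)(j := s)))"
        using subst_coords_upd[of \<tau>, OF inj j] by simp
      ultimately show ?thesis by auto
    next
      case False
      then have "(\<lambda>s. F (subst_coords \<tau> a (p(i := s)))) = (\<lambda>s. F (subst_coords \<tau> a p))"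
        using subst_coords_upd_other[of \<tau> i a] by simp
      then show ?thesis using DERIV_const by metis
    qed
  qed
  then show ?case by simp
next
  case (Suc k)
  have "Ckc k U (pderiv_at i (\<lambda>p. F (subst_coords \<tau> a p)))" for i
  proof (cases "\<exists>j. \<tau> j = Some i")
    case True
    then obtain j where j: "\<tau> j = Some i" by blast
    show ?thesis
      by (rule Ckc_cong[OF assms(4) _ Suc.IH[of "pderiv_at j F"]])
        (use pderiv_subst_coords[of \<tau>, OF inj j] Suc.prems in auto)
  next
    case False
    show ?thesis
      by (rule Ckc_cong[OF assms(4) _ Ckc_const[of _ _ 0]])
        (use pderiv_subst_coords_other[of \<tau>] False in auto)
  qed
  moreover have "pdiff U (\<lambda>p. F (subst_coords \<tau> a p))"
    using Suc.prems Suc.IH[of F] Ckc_Suc_imp Ckc_pdiff by blast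
  ultimately show ?case by simp
qed

lemma smooth_coords_subst:
  assumes "\<And>j j' i. \<tau> j = Some i \<Longrightarrow> \<tau> j' = Some i \<Longrightarrow> j = j'"
    and "smooth_coords \<Omega> F" "open \<Omega>" "open U" "subst_coords \<tau> a ` U \<subseteq> \<Omega>"
  shows "smooth_coords U (\<lambda>p. F (subst_coords \<tau> a p))"
  unfolding smooth_coords_iff_Ckc
proof
  show "Ckc k U (\<lambda>p. F (subst_coords \<tau> a p))" for k
    by (rule Ckc_subst_coords[of \<tau>, OF assms(1) _ assms(3-5)])
      (use assms(2) in \<open>auto simp: smooth_coords_iff_Ckc\<close>)
qed

text \<open>For c in S, p and q can be varied together in c while they keep agreeing on S; for c
  outside S, saturation keeps the whole line in \<Omega>, where f is constant.\<close>

lemma depends_only_on_pderiv: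
  assumes "open_cylinder S \<Omega>" "depends_only_on S \<Omega> f"
  shows "depends_only_on S \<Omega> (pderiv_at c f)"
  unfolding depends_only_on_def
proof (intro ballI impI)
  fix p q assume pq: "p \<in> \<Omega>" "q \<in> \<Omega>" "agree_on S p q"
  show "pderiv_at c f p = pderiv_at c f q"
  proof (cases "c \<in> S")
    case True
    have "\<forall>\<^sub>F t in nhds (p c). p(c := t) \<in> \<Omega>"
      using pq open_cylinder_open[OF assms(1)] by (intro eventually_fun_upd_in) auto
    then have "\<forall>\<^sub>F t in nhds (p c). f (p(c := t)) = f (q(c := t))"
    proof eventually_elim
      case (elim t)
      have "q(c := t) \<in> \<Omega>" by (rule open_cylinder_agree[OF assms(1) elim]) (use pq in \<open>auto simp: agree_on_def\<close>)
      then show ?case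
        by (intro depends_only_onD[OF assms(2) elim]) (use pq in \<open>auto simp: agree_on_def\<close>)
    qed
    moreover have "p c = q c" using pq True by (auto simp: agree_on_def)
    ultimately show ?thesis unfolding pderiv_at_def by (intro deriv_cong_ev) auto
  next
    case False
    have "f (x(c := t)) = f x" if "x \<in> \<Omega>" for x t
      by (rule depends_only_onD[OF assms(2)], rule open_cylinder_agree[OF assms(1) that])
        (use that False in auto)
    then show ?thesis using pq unfolding pderiv_at_def by simp
  qed
qed

lemma pderiv_at_eq_0_outside:
  assumes "open \<Omega>" "depends_only_on S \<Omega> f" "c \<notin> S" "p \<in> \<Omega>"
  shows "pderiv_at c f p = 0"
proof (rule pderiv_at_eqI)
  have "\<forall>\<^sub>F t in nhds (p c). p(c := t) \<in> \<Omega>"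
    using assms by (intro eventually_fun_upd_in) auto
  then have "\<forall>\<^sub>F t in nhds (p c). f (p(c := t)) = f p"
    by eventually_elim (rule depends_only_onD[OF assms(2)], use assms in auto)
  then show "((\<lambda>s. f (p(c := s))) has_real_derivative 0) (at (p c))"
    using DERIV_cong_ev[of "p c" "p c" "\<lambda>s. f (p(c := s))" "\<lambda>_. f p" 0 0] by simp
qed


subsection \<open>Mean values, the chain rule and the symmetry of second derivatives\<close>

text \<open>The coordinates in S are changed one at a time, box convexity keeping the path in B.
  Measuring the derivatives against a fixed vector m covers several uses: m = 0 and e = 0 gives
  constancy, m = 0 a Lipschitz bound, and the gradient at a point as m gives differentiability with
  a remainder.\<close>

lemma mean_value_box:
  fixes f :: "('i \<Rightarrow> real) \<Rightarrow> real"
  assumes "finite S" "box_convex B"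
    and der: "\<And>x c. x \<in> B \<Longrightarrow> c \<in> S \<Longrightarrow> ((\<lambda>s. f (x(c := s))) has_real_derivative f' c x) (at (x c))"
    and bound: "\<And>x c. x \<in> B \<Longrightarrow> c \<in> S \<Longrightarrow> \<bar>f' c x - m c\<bar> \<le> e"
    and "p \<in> B" "q \<in> B" "\<And>c. c \<notin> S \<Longrightarrow> p c = q c"
  shows "\<bar>f q - f p - (\<Sum>c\<in>S. m c * (q c - p c))\<bar> \<le> e * (\<Sum>c\<in>S. \<bar>q c - p c\<bar>)"
  using assms(1) der bound assms(5,7)
proof (induction S arbitrary: p rule: finite_induct)
  case empty
  then have "p = q" by auto
  then show ?case by simp
next
  case (insert c S)
  define p' where "p' = p(c := q c)"
  have upd: "p(c := s) \<in> B" if "s \<in> closed_segment (p c) (q c)" for s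
    by (rule box_convexD[OF assms(2) \<open>p \<in> B\<close> assms(6)]) (use that in auto)
  then have p': "p' \<in> B" by (simp add: p'_def)
  have 1: "\<bar>f q - f p' - (\<Sum>c\<in>S. m c * (q c - p' c))\<bar> \<le> e * (\<Sum>c\<in>S. \<bar>q c - p' c\<bar>)"
  proof (rule insert.IH[OF _ _ p'])
    show "((\<lambda>s. f (x(d := s))) has_real_derivative f' d x) (at (x d))" if "x \<in> B" "d \<in> S" for x d
      by (rule insert.prems(1)) (use that in auto)
    show "\<bar>f' d x - m d\<bar> \<le> e" if "x \<in> B" "d \<in> S" for x d
      by (rule insert.prems(2)) (use that in auto)
    show "p' d = q d" if "d \<notin> S" for d
      using insert.prems(4) that by (auto simp: p'_def)
  qed
  have eq: "p' d = p d" if "d \<in> S" for d using that insert.hyps by (auto simp: p'_def)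
  \<comment> \<open>Subtracting the linear part turns the claim for one coordinate into a bound on a
    derivative.\<close>
  define h where "h s = f (p(c := s)) - m c * s" for s
  have "norm (h (q c) - h (p c)) \<le> e * norm (q c - p c)"
  proof (rule field_differentiable_bound[where S = "closed_segment (p c) (q c)"
        and f' = "\<lambda>s. f' c (p(c := s)) - m c"])
    fix s assume s: "s \<in> closed_segment (p c) (q c)"
    have "((\<lambda>s'. f ((p(c := s))(c := s'))) has_real_derivative f' c (p(c := s))) (at ((p(c := s)) c))"
      by (rule insert.prems(1)[OF upd[OF s]]) simp
    then have "((\<lambda>s. f (p(c := s))) has_real_derivative f' c (p(c := s))) (at s)"
      by (simp only: fun_upd_upd fun_upd_same)
    then show "(h has_field_derivative f' c (p(c := s)) - m c)
        (at s within closed_segment (p c) (q c))"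
      unfolding h_def
      using DERIV_diff[OF _ DERIV_cmult_Id] by (metis has_field_derivative_at_within)
    show "norm (f' c (p(c := s)) - m c) \<le> e"
      unfolding real_norm_def by (rule insert.prems(2)[OF upd[OF s]]) simp
  qed auto
  then have 2: "\<bar>f p' - f p - m c * (q c - p c)\<bar> \<le> e * \<bar>q c - p c\<bar>"
    by (simp add: h_def p'_def algebra_simps)
  have "f q - f p - (\<Sum>c\<in>insert c S. m c * (q c - p c)) =
      (f q - f p' - (\<Sum>c\<in>S. m c * (q c - p' c))) + (f p' - f p - m c * (q c - p c))"
    using insert.hyps eq by (simp add: algebra_simps)
  moreover have "e * (\<Sum>c\<in>insert c S. \<bar>q c - p c\<bar>) =
      e * (\<Sum>c\<in>S. \<bar>q c - p' c\<bar>) + e * \<bar>q c - p c\<bar>"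
    using insert.hyps eq by (simp add: algebra_simps)
  ultimately show ?case using 1 2 by linarith
qed

lemma constant_on_box:
  assumes "finite S" "box_convex B" "B \<subseteq> \<Omega>" "smooth_coords \<Omega> f"
    and "\<And>x c. x \<in> B \<Longrightarrow> c \<in> S \<Longrightarrow> pderiv_at c f x = 0"
    and "p \<in> B" "q \<in> B" "\<And>c. c \<notin> S \<Longrightarrow> p c = q c"
  shows "f p = f q"
proof -
  have "\<bar>f q - f p - (\<Sum>c\<in>S. 0 * (q c - p c))\<bar> \<le> 0 * (\<Sum>c\<in>S. \<bar>q c - p c\<bar>)"
  proof (rule mean_value_box[OF assms(1,2) _ _ assms(6-8), where f' = "\<lambda>c. pderiv_at c f"])
    show "((\<lambda>s. f (x(c := s))) has_real_derivative pderiv_at c f x) (at (x c))" if "x \<in> B" for x c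
      by (rule smooth_coords_DERIV[OF assms(4)]) (use that assms(3) in auto)
  qed (use assms(5) in auto)
  then show ?thesis by simp
qed

text \<open>By continuity the partial derivatives differ by less than e from those at p on a small
  box. The box restricts S only; q' returns to the values of p outside S without changing f.\<close>

lemma total_differential:
  assumes "open_cylinder S \<Omega>" "finite S" "depends_only_on S \<Omega> f" "Ckc 1 \<Omega> f" "p \<in> \<Omega>" "e > 0"
  shows "\<exists>d>0. \<forall>q. (\<forall>i\<in>S. \<bar>q i - p i\<bar> < d) \<longrightarrow>
    q \<in> \<Omega> \<and> \<bar>f q - f p - (\<Sum>c\<in>S. pderiv_at c f p * (q c - p c))\<bar> \<le> e * (\<Sum>c\<in>S. \<bar>q c - p c\<bar>)"
proof -
  have pd: "pdiff \<Omega> f" "\<And>c. pdiff \<Omega> (pderiv_at c f)" using assms(4) by auto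
  define U where "U = {x \<in> \<Omega>. \<forall>c\<in>S. \<bar>pderiv_at c f x - pderiv_at c f p\<bar> < e}"
  have "open_cylinder S U"
    unfolding U_def
    by (rule open_cylinder_sublevel[OF assms(1,2)])
      (use pd(2) depends_only_on_pderiv[OF assms(1,3)] in \<open>auto simp: pdiff_def\<close>)
  moreover have "p \<in> U" using assms by (auto simp: U_def)
  ultimately obtain d where d: "d > 0" "\<forall>x. (\<forall>i\<in>S. \<bar>x i - p i\<bar> < d) \<longrightarrow> x \<in> U"
    using open_cylinder_imp_box[OF _ _ assms(2)] by blast
  show ?thesis
  proof (intro exI[of _ d] conjI[OF d(1)] allI impI)
    fix q assume q: "\<forall>i\<in>S. \<bar>q i - p i\<bar> < d"
    define q' where "q' i = (if i \<in> S then q i else p i)" for i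
    have U: "q \<in> U" "q' \<in> U" using d(2) q by (auto simp: q'_def)
    have "\<bar>f q' - f p - (\<Sum>c\<in>S. pderiv_at c f p * (q' c - p c))\<bar> \<le> e * (\<Sum>c\<in>S. \<bar>q' c - p c\<bar>)"
    proof (rule mean_value_box[OF assms(2) box_convex_box[of S p "\<lambda>_. d"],
          where f' = "\<lambda>c. pderiv_at c f"])
      fix x c assume "x \<in> {x. \<forall>i\<in>S. \<bar>x i - p i\<bar> < d}" "c \<in> S"
      then have "x \<in> U" using d(2) by blast
      then show "((\<lambda>s. f (x(c := s))) has_real_derivative pderiv_at c f x) (at (x c))"
        "\<bar>pderiv_at c f x - pderiv_at c f p\<bar> \<le> e"
        using pdiff_DERIV[OF pd(1)] \<open>c \<in> S\<close> by (auto simp: U_def less_imp_le)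
    qed (use d q in \<open>auto simp: q'_def\<close>)
    moreover have "f q' = f q"
      by (rule depends_only_onD[OF assms(3)]) (use U in \<open>auto simp: U_def q'_def\<close>)
    moreover have "(\<Sum>c\<in>S. pderiv_at c f p * (q' c - p c)) = (\<Sum>c\<in>S. pderiv_at c f p * (q c - p c))"
      "(\<Sum>c\<in>S. \<bar>q' c - p c\<bar>) = (\<Sum>c\<in>S. \<bar>q c - p c\<bar>)" by (simp_all add: q'_def)
    ultimately show "q \<in> \<Omega> \<and> \<bar>f q - f p - (\<Sum>c\<in>S. pderiv_at c f p * (q c - p c))\<bar>
        \<le> e * (\<Sum>c\<in>S. \<bar>q c - p c\<bar>)" using U by (auto simp: U_def)
  qed
qed

text \<open>Chain rule for maps into a space of families, which carries no norm: only the finitely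
  many coordinates of g on which f depends are differentiated.\<close>

lemma has_derivative_coords:
  fixes g :: "'a::real_normed_vector \<Rightarrow> 'i \<Rightarrow> real"
  assumes "open_cylinder S \<Omega>" "finite S" "depends_only_on S \<Omega> f" "Ckc 1 \<Omega> f" "g x0 \<in> \<Omega>"
    and g': "\<And>c. c \<in> S \<Longrightarrow> ((\<lambda>x. g x c) has_derivative g' c) (at x0 within T)"
  shows "((\<lambda>x. f (g x)) has_derivative (\<lambda>h. \<Sum>c\<in>S. pderiv_at c f (g x0) * g' c h)) (at x0 within T)"
proof -
  define m where "m c = pderiv_at c f (g x0)" for c
  have bl: "bounded_linear (g' c)" if "c \<in> S" for c using g'[OF that] has_derivative_bounded_linear by blast
  have lin: "((\<lambda>x. \<Sum>c\<in>S. m c * g x c) has_derivative (\<lambda>h. \<Sum>c\<in>S. m c * g' c h)) (at x0 within T)"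
    by (intro has_derivative_sum has_derivative_mult_right g')
  have "\<exists>C. \<forall>\<^sub>F x in at x0 within T. \<bar>g x c - g x0 c\<bar> \<le> C * norm (x - x0)" if c: "c \<in> S" for c
  proof -
    obtain C where C: "\<And>h. norm (g' c h) \<le> norm h * C"
      using bl[OF c] unfolding bounded_linear_def bounded_linear_axioms_def by blast
    have "\<forall>\<^sub>F x in at x0 within T. norm (g x c - g x0 c - g' c (x - x0)) \<le> 1 * norm (x - x0)"
      using g'[OF that] unfolding has_derivative_within_alt2 by (metis zero_less_one)
    then have "\<forall>\<^sub>F x in at x0 within T. \<bar>g x c - g x0 c\<bar> \<le> (C + 1) * norm (x - x0)"
    proof eventually_elim
      case (elim x) then show ?case using C[of "x - x0"] by (simp add: algebra_simps)
    qed
    then show ?thesis by blast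
  qed
  then obtain C where C: "\<And>c. c \<in> S \<Longrightarrow> \<forall>\<^sub>F x in at x0 within T. \<bar>g x c - g x0 c\<bar> \<le> C c * norm (x - x0)"
    by metis
  \<comment> \<open>Bounds the total change of the coordinates of g by K times the distance from x0,
    and is positive so that one can divide by it. The remainder of f is given e / 2, that of g the
    other half.\<close>
  define K where "K = (\<Sum>c\<in>S. \<bar>C c\<bar>) + 1"
  have K: "K > 0" by (simp add: K_def add_nonneg_pos sum_nonneg)
  have "\<forall>\<^sub>F x in at x0 within T. norm (f (g x) - f (g x0) - (\<Sum>c\<in>S. m c * g' c (x - x0))) \<le> e * norm (x - x0)"
    if e: "e > 0" for e
  proof -
    have eK: "e / (2 * K) > 0" using e K by simp
    obtain d where d: "d > 0" "\<forall>q. (\<forall>i\<in>S. \<bar>q i - g x0 i\<bar> < d) \<longrightarrow> q \<in> \<Omega> \<and>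
      \<bar>f q - f (g x0) - (\<Sum>c\<in>S. m c * (q c - g x0 c))\<bar>
        \<le> e / (2 * K) * (\<Sum>c\<in>S. \<bar>q c - g x0 c\<bar>)"
      using total_differential[OF assms(1-5) eK] unfolding m_def by blast
    have "\<forall>\<^sub>F x in at x0 within T. \<forall>c\<in>S. \<bar>g x c - g x0 c\<bar> < d"
    proof (rule eventually_ball_finite[OF assms(2)], intro ballI)
      fix c assume "c \<in> S"
      then have "((\<lambda>x. g x c) \<longlongrightarrow> g x0 c) (at x0 within T)"
        using has_derivative_continuous[OF g'] continuous_within by blast
      then show "\<forall>\<^sub>F x in at x0 within T. \<bar>g x c - g x0 c\<bar> < d"
        using tendstoD[of "\<lambda>x. g x c" "g x0 c" "at x0 within T" d] d(1) by (simp add: dist_real_def)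
    qed
    moreover have "\<forall>\<^sub>F x in at x0 within T. \<forall>c\<in>S. \<bar>g x c - g x0 c\<bar> \<le> C c * norm (x - x0)"
      using C by (intro eventually_ball_finite[OF assms(2)]) auto
    moreover have "\<forall>\<^sub>F x in at x0 within T. norm ((\<Sum>c\<in>S. m c * g x c) - (\<Sum>c\<in>S. m c * g x0 c)
        - (\<Sum>c\<in>S. m c * g' c (x - x0))) \<le> e / 2 * norm (x - x0)"
      using conjunct2[OF lin[unfolded has_derivative_within_alt2], rule_format, OF half_gt_zero[OF e]] by simp
    ultimately show ?thesis
    proof eventually_elim
      case (elim x)
      have "(\<Sum>c\<in>S. \<bar>g x c - g x0 c\<bar>) \<le> (\<Sum>c\<in>S. \<bar>C c\<bar> * norm (x - x0))"
        using elim(2) by (intro sum_mono) (smt (verit) mult_right_mono norm_ge_zero)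
      also have "\<dots> \<le> K * norm (x - x0)" by (simp add: K_def flip: sum_distrib_right) (simp add: algebra_simps)
      finally have "e / (2 * K) * (\<Sum>c\<in>S. \<bar>g x c - g x0 c\<bar>) \<le> e / (2 * K) * (K * norm (x - x0))"
        using e K by (intro mult_left_mono) auto
      also have "\<dots> = e / 2 * norm (x - x0)" using K by (simp add: field_simps)
      finally have "\<bar>f (g x) - f (g x0) - (\<Sum>c\<in>S. m c * (g x c - g x0 c))\<bar> \<le> e / 2 * norm (x - x0)"
        using d(2)[THEN spec, THEN mp, OF elim(1)] by linarith
      moreover have "(\<Sum>c\<in>S. m c * (g x c - g x0 c)) = (\<Sum>c\<in>S. m c * g x c) - (\<Sum>c\<in>S. m c * g x0 c)"
        by (simp add: right_diff_distrib sum_subtractf)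
      moreover have "e * norm (x - x0) = e / 2 * norm (x - x0) + e / 2 * norm (x - x0)" by simp
      ultimately show ?case using elim(3) unfolding real_norm_def by linarith
    qed
  qed
  then show ?thesis
    using has_derivative_bounded_linear[OF lin] unfolding has_derivative_within_alt2 m_def by blast
qed

lemma has_real_derivative_coords:
  fixes g :: "real \<Rightarrow> 'i \<Rightarrow> real"
  assumes "open_cylinder S \<Omega>" "finite S" "depends_only_on S \<Omega> f" "smooth_coords \<Omega> f" "g t \<in> \<Omega>"
    and g': "\<And>c. c \<in> S \<Longrightarrow> ((\<lambda>x. g x c) has_real_derivative g' c) (at t within T)"
  shows "((\<lambda>x. f (g x)) has_real_derivative (\<Sum>c\<in>S. pderiv_at c f (g t) * g' c)) (at t within T)"
proof -
  have "((\<lambda>x. f (g x)) has_derivative (\<lambda>h. \<Sum>c\<in>S. pderiv_at c f (g t) * (g' c * h))) (at t within T)"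
    by (rule has_derivative_coords[OF assms(1-3), of g, OF _ assms(5)])
      (use assms(4) g' in \<open>auto simp: smooth_coords_iff_Ckc has_field_derivative_def simp del: Ckc.simps\<close>)
  moreover have "(\<lambda>h. \<Sum>c\<in>S. pderiv_at c f (g t) * (g' c * h)) = (*) (\<Sum>c\<in>S. pderiv_at c f (g t) * g' c)"
    by (simp add: fun_eq_iff sum_distrib_right mult.assoc)
  ultimately show ?thesis by (simp add: has_field_derivative_def)
qed

text \<open>Two applications of the mean value theorem: in c to the difference of f between the two
  values of d, then in d to the c-derivative.\<close>

lemma mixed_difference:
  assumes "pdiff \<Omega> f" "pdiff \<Omega> (pderiv_at c f)" "c \<noteq> d" "h > 0"
    and \<Omega>: "\<And>s t. p c \<le> s \<Longrightarrow> s \<le> p c + h \<Longrightarrow> p d \<le> t \<Longrightarrow> t \<le> p d + h \<Longrightarrow> p(c := s, d := t) \<in> \<Omega>"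
  obtains s t where "p c \<le> s" "s \<le> p c + h" "p d \<le> t" "t \<le> p d + h"
    "f (p(c := p c + h, d := p d + h)) - f (p(c := p c + h, d := p d))
      - (f (p(c := p c, d := p d + h)) - f (p(c := p c, d := p d)))
     = h * (h * pderiv_at d (pderiv_at c f) (p(c := s, d := t)))"
proof -
  define G where "G s = f (p(c := s, d := p d + h)) - f (p(c := s, d := p d))" for s
  have G: "(G has_real_derivative
     pderiv_at c f (p(c := s, d := p d + h)) - pderiv_at c f (p(c := s, d := p d))) (at s)"
    if "p c \<le> s" "s \<le> p c + h" for s
  proof -
    have "((\<lambda>s. f ((p(d := t))(c := s))) has_real_derivative pderiv_at c f ((p(d := t))(c := s))) (at s)"
      if "p d \<le> t" "t \<le> p d + h" for t
      by (rule pdiff_DERIV_upd[OF assms(1)])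
        (use \<Omega>[of s t] that \<open>p c \<le> s\<close> \<open>s \<le> p c + h\<close> assms(3) in \<open>simp add: fun_upd_twist\<close>)
    from DERIV_diff[OF this[of "p d + h"] this[of "p d"]] show ?thesis
      unfolding G_def fun_upd_twist[OF assms(3)[symmetric]] using assms(4) by simp
  qed
  then obtain s where s: "p c < s" "s < p c + h"
     "G (p c + h) - G (p c) = (p c + h - p c) *
       (pderiv_at c f (p(c := s, d := p d + h)) - pderiv_at c f (p(c := s, d := p d)))"
    using MVT2[of "p c" "p c + h" G, OF _ G] assms(4) by auto
  have "((\<lambda>t. pderiv_at c f (p(c := s, d := t))) has_real_derivative
      pderiv_at d (pderiv_at c f) (p(c := s, d := t))) (at t)" if "p d \<le> t" "t \<le> p d + h" for t
    by (rule pdiff_DERIV_upd[OF assms(2)]) (use \<Omega> s that in simp)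
  then obtain t where t: "p d < t" "t < p d + h"
     "pderiv_at c f (p(c := s, d := p d + h)) - pderiv_at c f (p(c := s, d := p d)) =
       (p d + h - p d) * pderiv_at d (pderiv_at c f) (p(c := s, d := t))"
    using MVT2[of "p d" "p d + h" "\<lambda>t. pderiv_at c f (p(c := s, d := t))"
        "\<lambda>t. pderiv_at d (pderiv_at c f) (p(c := s, d := t))"] assms(4) by auto
  show ?thesis
    by (rule that[of s t]) (use s t in \<open>auto simp: G_def\<close>)
qed

text \<open>The second difference over a small square is symmetric in the two directions, so it
  forces the two mixed derivatives to take equal values at some pair of points close to p; by
  continuity they cannot differ at p.\<close>

lemma pderiv_commute:
  fixes f :: "('i \<Rightarrow> real) \<Rightarrow> real"
  assumes "open \<Omega>" "smooth_coords \<Omega> f" "p \<in> \<Omega>"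
  shows "pderiv_at c (pderiv_at d f) p = pderiv_at d (pderiv_at c f) p"
proof (cases "c = d")
  case False
  let ?A = "pderiv_at c (pderiv_at d f)" and ?B = "pderiv_at d (pderiv_at c f)"
  have pd: "pdiff \<Omega> f" "pdiff \<Omega> (pderiv_at c f)" "pdiff \<Omega> (pderiv_at d f)" "pdiff \<Omega> ?A" "pdiff \<Omega> ?B"
    using assms(2) by (auto intro!: smooth_coords_pdiff smooth_coords_pderiv)
  define q where "q z = p(c := fst z, d := snd z)" for z :: "real \<times> real"
  have qc: "continuous_on UNIV q" unfolding q_def by (intro continuous_intros)
  have q0: "q (p c, p d) = p" using False by (auto simp: q_def)
  have op: "open (q -` \<Omega>)" using qc assms(1) open_vimage by blast
  have near: "\<forall>\<^sub>F z in nhds (p c, p d). q z \<in> \<Omega>"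
    unfolding eventually_nhds using op q0 assms(3) by (intro exI[of _ "q -` \<Omega>"]) auto
  have "((\<lambda>z. g (q z)) \<longlongrightarrow> g p) (nhds (p c, p d))" if "pdiff \<Omega> g" for g
  proof -
    have "continuous_on (q -` \<Omega>) (\<lambda>z. g (q z))"
    proof (rule continuous_on_compose2[of \<Omega> g])
      show "continuous_on \<Omega> g" using that by (simp add: pdiff_def)
      show "continuous_on (q -` \<Omega>) q" by (rule continuous_on_subset[OF qc]) simp
    qed auto
    then have "isCont (\<lambda>z. g (q z)) (p c, p d)"
      using op q0 assms(3) by (simp add: continuous_on_eq_continuous_at)
    then show ?thesis using q0 by (metis continuous_at tendsto_at_iff_tendsto_nhds)
  qed
  from this[OF pd(4)] this[OF pd(5)]
  have lim: "((\<lambda>z. ?A (q z)) \<longlongrightarrow> ?A p) (nhds (p c, p d))" "((\<lambda>z. ?B (q z)) \<longlongrightarrow> ?B p) (nhds (p c, p d))"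
    by auto
  show ?thesis
  proof (rule ccontr)
    assume neq: "?A p \<noteq> ?B p"
    define e where "e = \<bar>?A p - ?B p\<bar> / 2"
    have e: "e > 0" using neq by (simp add: e_def)
    have "\<forall>\<^sub>F z in nhds (p c, p d). q z \<in> \<Omega> \<and> dist (?A (q z)) (?A p) < e \<and> dist (?B (q z)) (?B p) < e"
      by (intro eventually_conj near tendstoD lim e)
    then obtain r where r: "r > 0" "\<And>z. dist z (p c, p d) < r \<Longrightarrow>
        q z \<in> \<Omega> \<and> dist (?A (q z)) (?A p) < e \<and> dist (?B (q z)) (?B p) < e"
      unfolding eventually_nhds_metric by blast
    \<comment> \<open>Two sides of length r / 3 add up to less than r, which keeps the square in the
      chosen ball.\<close>
    define h where "h = r / 3"
    have h: "h > 0" using r by (simp add: h_def)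
    have small: "dist (s, t) (p c, p d) < r" if "p c \<le> s" "s \<le> p c + h" "p d \<le> t" "t \<le> p d + h" for s t
    proof -
      have "dist (s, t) (p c, p d) \<le> dist s (p c) + dist t (p d)"
        unfolding dist_prod_def by (simp add: sqrt_sum_squares_le_sum)
      also have "\<dots> \<le> h + h" using that by (auto simp: dist_real_def)
      finally show ?thesis using h by (simp add: h_def)
    qed
    have O1: "p(c := s, d := t) \<in> \<Omega>" if "p c \<le> s" "s \<le> p c + h" "p d \<le> t" "t \<le> p d + h" for s t
      using r(2)[OF small[OF that]] by (simp add: q_def)
    obtain s t where 1: "p c \<le> s" "s \<le> p c + h" "p d \<le> t" "t \<le> p d + h"
      "f (p(c := p c + h, d := p d + h)) - f (p(c := p c + h, d := p d))
        - (f (p(c := p c, d := p d + h)) - f (p(c := p c, d := p d)))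
       = h * (h * ?B (p(c := s, d := t)))"
      using mixed_difference[OF pd(1,2) False h O1] by blast
    have O2: "p(d := t, c := s) \<in> \<Omega>" if "p d \<le> t" "t \<le> p d + h" "p c \<le> s" "s \<le> p c + h" for s t
      using O1[OF that(3,4,1,2)] False by (simp add: fun_upd_twist)
    obtain t' s' where 2: "p d \<le> t'" "t' \<le> p d + h" "p c \<le> s'" "s' \<le> p c + h"
      "f (p(d := p d + h, c := p c + h)) - f (p(d := p d + h, c := p c))
        - (f (p(d := p d, c := p c + h)) - f (p(d := p d, c := p c)))
       = h * (h * ?A (p(d := t', c := s')))"
      using mixed_difference[OF pd(1,3) False[symmetric] h O2] by blast
    have "h * (h * ?B (p(c := s, d := t))) = h * (h * ?A (p(c := s', d := t')))"
      using 1(5) 2(5) unfolding fun_upd_twist[OF False[symmetric]] by linarith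
    then have "?B (q (s, t)) = ?A (q (s', t'))" using h by (simp add: q_def)
    moreover have "dist (?B (q (s, t))) (?B p) < e" "dist (?A (q (s', t'))) (?A p) < e"
      using r(2)[OF small] 1 2 by auto
    ultimately have "\<bar>?A p - ?B p\<bar> < e + e" by (simp add: dist_real_def)
    then show False by (simp add: e_def)
  qed
qed simp


subsection \<open>Solution curves on the unit interval\<close>

lemma deriv_nonneg_imp_le:
  fixes F :: "real \<Rightarrow> real"
  assumes "\<And>t. t \<in> {0..1} \<Longrightarrow> (F has_real_derivative F' t) (at t within {0..1})"
    and "\<And>t. t \<in> {0..1} \<Longrightarrow> F' t \<ge> 0" and t: "t \<in> {0..1}"
  shows "F 0 \<le> F t"
proof (rule DERIV_nonneg_imp_increasing_open[where f = F])
  show "0 \<le> t" using t by simp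
  fix x assume x: "0 < x" "x < t"
  have "at x within {0..1} = at x"
    by (rule at_within_interior) (use x t in auto)
  then show "\<exists>y. (F has_real_derivative y) (at x) \<and> 0 \<le> y"
    using assms(1,2)[of x] x t by auto
next
  have "continuous_on {0..1} F" using DERIV_continuous_on assms(1) by blast
  then show "continuous_on {0..t} F" by (rule continuous_on_subset) (use t in auto)
qed

text \<open>The bound on h' is the derivative of B exp(l t), so neither B exp(l t) - h nor B exp(l
  t) + h decreases. In \<open>picard\<close> this does the work of a norm weighted by exp(l
  t).\<close>

lemma growth_bound:
  fixes h :: "real \<Rightarrow> real"
  assumes "\<And>t. t \<in> {0..1} \<Longrightarrow> (h has_real_derivative h' t) (at t within {0..1})"
    and "\<And>t. t \<in> {0..1} \<Longrightarrow> \<bar>h' t\<bar> \<le> B * l * exp (l * t)"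
    and "h 0 = 0" "B \<ge> 0" "t \<in> {0..1}"
  shows "\<bar>h t\<bar> \<le> B * exp (l * t)"
proof -
  have "B * exp (l * 0) - h 0 \<le> B * exp (l * t) - h t"
  proof (rule deriv_nonneg_imp_le[OF _ _ assms(5), where F' = "\<lambda>t. B * l * exp (l * t) - h' t"])
    fix s :: real assume s: "s \<in> {0..1}"
    show "((\<lambda>t. B * exp (l * t) - h t) has_real_derivative B * l * exp (l * s) - h' s) (at s within {0..1})"
      using assms(1)[OF s] by (auto intro!: derivative_eq_intros)
    show "0 \<le> B * l * exp (l * s) - h' s" using assms(2)[OF s] by linarith
  qed
  moreover have "B * exp (l * 0) + h 0 \<le> B * exp (l * t) + h t"
  proof (rule deriv_nonneg_imp_le[OF _ _ assms(5), where F' = "\<lambda>t. B * l * exp (l * t) + h' t"])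
    fix s :: real assume s: "s \<in> {0..1}"
    show "((\<lambda>t. B * exp (l * t) + h t) has_real_derivative B * l * exp (l * s) + h' s) (at s within {0..1})"
      using assms(1)[OF s] by (auto intro!: derivative_eq_intros)
    show "0 \<le> B * l * exp (l * s) + h' s" using assms(2)[OF s] by linarith
  qed
  ultimately show ?thesis using assms(3,4) by (simp add: abs_le_iff)
qed

lemma gronwall:
  fixes N :: "real \<Rightarrow> real"
  assumes "\<And>t. t \<in> {0..1} \<Longrightarrow> (N has_real_derivative N' t) (at t within {0..1})"
    and "\<And>t. t \<in> {0..1} \<Longrightarrow> N' t \<le> K * N t + C"
    and "K \<ge> 0" "C \<ge> 0" and t: "t \<in> {0..1}"
  shows "N t \<le> (N 0 + C) * exp (K * t)"
proof -
  have "N 0 + C * 0 - N 0 * exp (- (K * 0)) \<le> N 0 + C * t - N t * exp (- (K * t))"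
  proof (rule deriv_nonneg_imp_le[OF _ _ t,
        where F = "\<lambda>t. N 0 + C * t - N t * exp (- (K * t))" and F' = "\<lambda>t. C - (N' t - K * N t) * exp (- (K * t))"])
    fix s :: real assume s: "s \<in> {0..1}"
    show "((\<lambda>t. N 0 + C * t - N t * exp (- (K * t))) has_real_derivative
        C - (N' s - K * N s) * exp (- (K * s))) (at s within {0..1})"
      using assms(1)[OF s] by (auto intro!: derivative_eq_intros simp: algebra_simps)
    have "(N' s - K * N s) * exp (- (K * s)) \<le> C * exp (- (K * s))"
      using assms(2)[OF s] by (intro mult_right_mono) auto
    also have "\<dots> \<le> C * 1" using assms(3,4) s by (intro mult_left_mono) auto
    finally show "0 \<le> C - (N' s - K * N s) * exp (- (K * s))" by simp
  qed
  then have "N t * exp (- (K * t)) \<le> N 0 + C * t" by simp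
  also have "\<dots> \<le> N 0 + C * 1" using t assms(4) by (intro add_left_mono mult_left_mono) auto
  finally show ?thesis by (simp add: exp_minus field_simps)
qed

text \<open>Sums of squares are differentiable, unlike sums of absolute values, and can be fed into
  \<open>gronwall\<close>. The summand 1 in the exponent comes from 2 a R \<le> a^2 + R^2, the other
  one from Cauchy-Schwarz.\<close>

lemma sum_squares_gronwall:
  fixes w :: "real \<Rightarrow> 'i \<Rightarrow> real" and M R :: real
  assumes "finite S"
    and der: "\<And>t i. t \<in> {0..1} \<Longrightarrow> i \<in> S \<Longrightarrow> ((\<lambda>t. w t i) has_real_derivative w' t i) (at t within {0..1})"
    and bound: "\<And>t i. t \<in> {0..1} \<Longrightarrow> i \<in> S \<Longrightarrow> \<bar>w' t i\<bar> \<le> R + M * (\<Sum>j\<in>S. \<bar>w t j\<bar>)"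
    and "R \<ge> 0" "M \<ge> 0" and t: "t \<in> {0..1}"
  shows "(\<Sum>i\<in>S. (w t i)\<^sup>2) \<le>
    ((\<Sum>i\<in>S. (w 0 i)\<^sup>2) + card S * R\<^sup>2) * exp (1 + 2 * M * card S)"
proof -
  let ?N = "\<lambda>t. \<Sum>i\<in>S. (w t i)\<^sup>2" and ?K = "1 + 2 * M * real (card S)"
  have K: "?K \<ge> 0" using assms(5) by simp
  have "?N t \<le> (?N 0 + card S * R\<^sup>2) * exp (?K * t)"
  proof (rule gronwall[OF _ _ K _ t, where N' = "\<lambda>t. \<Sum>i\<in>S. 2 * w t i * w' t i"])
    fix s :: real assume s: "s \<in> {0..1}"
    show "(?N has_real_derivative (\<Sum>i\<in>S. 2 * w s i * w' s i)) (at s within {0..1})"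
      by (intro DERIV_sum) (auto intro!: derivative_eq_intros der[OF s])
    let ?s = "\<Sum>j\<in>S. \<bar>w s j\<bar>"
    have "2 * w s i * w' s i \<le> ((w s i)\<^sup>2 + R\<^sup>2) + 2 * M * ?s * \<bar>w s i\<bar>" if i: "i \<in> S" for i
    proof -
      have "2 * w s i * w' s i \<le> 2 * (\<bar>w s i\<bar> * \<bar>w' s i\<bar>)"
        by (metis abs_ge_self abs_mult mult.assoc mult_left_mono zero_le_numeral)
      also have "\<dots> \<le> 2 * (\<bar>w s i\<bar> * (R + M * ?s))"
        using bound[OF s i] by (intro mult_left_mono) auto
      also have "\<dots> = 2 * \<bar>w s i\<bar> * R + 2 * M * ?s * \<bar>w s i\<bar>" by (simp add: algebra_simps)
      also have "2 * \<bar>w s i\<bar> * R \<le> (w s i)\<^sup>2 + R\<^sup>2"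
        using sum_squares_bound[of "\<bar>w s i\<bar>" R] by simp
      finally show ?thesis by simp
    qed
    then have "(\<Sum>i\<in>S. 2 * w s i * w' s i) \<le> (\<Sum>i\<in>S. ((w s i)\<^sup>2 + R\<^sup>2) + 2 * M * ?s * \<bar>w s i\<bar>)"
      by (rule sum_mono)
    also have "\<dots> = ?N s + card S * R\<^sup>2 + 2 * M * ?s\<^sup>2"
      by (simp add: sum.distrib power2_eq_square flip: sum_distrib_left)
    also have "2 * M * ?s\<^sup>2 \<le> 2 * M * (?N s * card S)"
      using sum_squared_le_sum_of_squares[of "\<lambda>j. \<bar>w s j\<bar>" S] assms(5)
      by (intro mult_left_mono) auto
    finally show "(\<Sum>i\<in>S. 2 * w s i * w' s i) \<le> ?K * ?N s + card S * R\<^sup>2"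
      by (simp add: algebra_simps)
  qed simp
  also have "\<dots> \<le> (?N 0 + card S * R\<^sup>2) * exp ?K"
    using t K mult_left_mono[of t 1 ?K] by (intro mult_left_mono add_nonneg_nonneg sum_nonneg) auto
  finally show ?thesis .
qed

text \<open>Compactness for constants that can be chosen locally and may always be enlarged: they
  are indexed by a natural number, and the maximum over a finite subcover serves the whole
  interval.\<close>

lemma compact_uniform_nat:
  fixes P :: "nat \<Rightarrow> real \<Rightarrow> bool"
  assumes mono: "\<And>n m t. n \<le> m \<Longrightarrow> P n t \<Longrightarrow> P m t"
    and loc: "\<And>t. t \<in> {0..1} \<Longrightarrow> \<exists>T n. open T \<and> t \<in> T \<and> (\<forall>s\<in>T \<inter> {0..1}. P n s)"
  shows "\<exists>n. \<forall>s\<in>{0..1}. P n s"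
proof -
  obtain T n where Tn: "\<And>t. t \<in> {0..1} \<Longrightarrow> open (T t) \<and> t \<in> T t \<and> (\<forall>s\<in>T t \<inter> {0..1}. P (n t) s)"
    using loc by metis
  have cov: "{0..1} \<subseteq> (\<Union>t\<in>{0..1}. T t)" using Tn by blast
  obtain C where C: "C \<subseteq> {0..1}" "finite C" "{0..1} \<subseteq> (\<Union>t\<in>C. T t)"
    by (rule compactE_image[of "{0..1::real}" "{0..1}" T]) (use Tn cov in auto)
  have "P (Max (n ` C)) s" if s: "s \<in> {0..1}" for s
  proof -
    obtain t where t: "t \<in> C" "s \<in> T t" using C(3) s by blast
    then have "P (n t) s" using Tn C(1) s by blast
    then show ?thesis using t C(2) by (auto intro: mono[rotated])
  qed
  then show ?thesis by blast
qed

text \<open>As the Lipschitz bound is global, the iterates can be compared on the whole interval,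
  and they converge there whatever the size of L.\<close>

lemma picard:
  fixes g :: "real \<Rightarrow> ('i \<Rightarrow> real) \<Rightarrow> 'i \<Rightarrow> real" and L :: real
  assumes fin: "finite S"
    and cont: "\<And>x i. i \<in> S \<Longrightarrow> \<forall>j\<in>S. continuous_on {0..1} (\<lambda>t. x t j) \<Longrightarrow>
        continuous_on {0..1} (\<lambda>t. g t (x t) i)"
    and lip: "\<And>t x y i. t \<in> {0..1} \<Longrightarrow> i \<in> S \<Longrightarrow> \<bar>g t x i - g t y i\<bar> \<le> L * (\<Sum>j\<in>S. \<bar>x j - y j\<bar>)"
  shows "\<exists>u. u 0 = p \<and> (\<forall>t i. i \<notin> S \<longrightarrow> u t i = p i) \<and>
    (\<forall>t\<in>{0..1}. \<forall>i\<in>S. ((\<lambda>t. u t i) has_real_derivative g t (u t) i) (at t within {0..1}))"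
proof -
  define K where "K = real (card S)"
  \<comment> \<open>Positive whatever the sign of L, since L' occurs in a denominator below.\<close>
  define L' where "L' = \<bar>L\<bar> + 1"
  \<comment> \<open>With this weight one integration gains the factor L' K / l \<le> 1 / 2, so
    consecutive iterates differ by at most C (1/2)^n exp(l t).\<close>
  define l where "l = 2 * (K + 1) * L'"
  have pos: "K \<ge> 0" "L' > 0" "l > 0" by (auto simp: K_def L'_def l_def)
  have lip': "\<bar>g t x i - g t y i\<bar> \<le> L' * (\<Sum>j\<in>S. \<bar>x j - y j\<bar>)" if "t \<in> {0..1}" "i \<in> S" for t x y i
    using lip[OF that, of x y] mult_right_mono[of L L' "\<Sum>j\<in>S. \<bar>x j - y j\<bar>"]
    by (auto simp: L'_def sum_nonneg intro!: order_trans[OF _ mult_right_mono[of L "\<bar>L\<bar> + 1"]])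
  define step where "step v t i = (if i \<in> S then p i + integral {0..t} (\<lambda>s. g s (v s) i) else p i)"
    for v :: "real \<Rightarrow> 'i \<Rightarrow> real" and t i
  define U where "U n = (step ^^ n) (\<lambda>t. p)" for n
  have U0: "U 0 = (\<lambda>t. p)" and US: "U (Suc n) = step (U n)" for n by (simp_all add: U_def)
  have step_der: "((\<lambda>t. step v t i) has_real_derivative g t (v t) i) (at t within {0..1})"
    if "\<forall>j\<in>S. continuous_on {0..1} (\<lambda>t. v t j)" "t \<in> {0..1}" "i \<in> S" for v t i
    using integral_has_real_derivative[OF cont[OF that(3,1)] that(2)] that(3)
    by (auto simp: step_def intro!: derivative_eq_intros)
  have Ucont: "\<forall>j\<in>S. continuous_on {0..1} (\<lambda>t. U n t j)" for n
  proof (induction n)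
    case 0 then show ?case by (simp add: U0)
  next
    case (Suc n)
    show ?case unfolding US by (rule ballI, rule DERIV_continuous_on, rule step_der[OF Suc])
  qed
  have Uder: "((\<lambda>t. U (Suc n) t i) has_real_derivative g t (U n t) i) (at t within {0..1})"
    if "t \<in> {0..1}" "i \<in> S" for n t i
    unfolding US by (rule step_der[OF Ucont that])
  have Uinit: "U n 0 i = p i" for n i by (cases n) (auto simp: U0 US step_def)
  have "\<exists>M\<ge>0. \<forall>t\<in>{0..1}. \<bar>g t p i\<bar> \<le> M" if "i \<in> S" for i
  proof -
    have "compact ((\<lambda>t. g t p i) ` {0..1})"
      using cont[OF that, of "\<lambda>_. p"] by (intro compact_continuous_image) auto
    then obtain M where "\<forall>x\<in>(\<lambda>t. g t p i) ` {0..1}. norm x \<le> M"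
      using compact_imp_bounded bounded_iff by metis
    then show ?thesis by (intro exI[of _ "\<bar>M\<bar>"]) force
  qed
  then obtain M where M: "\<And>i. i \<in> S \<Longrightarrow> M i \<ge> 0" "\<And>i t. i \<in> S \<Longrightarrow> t \<in> {0..1} \<Longrightarrow> \<bar>g t p i\<bar> \<le> M i"
    by metis
  define C where "C = (\<Sum>i\<in>S. M i) / l"
  have C: "C \<ge> 0" using pos M by (auto simp: C_def intro!: divide_nonneg_pos sum_nonneg)
  have diff: "\<bar>U (Suc n) t i - U n t i\<bar> \<le> C * (1/2) ^ n * exp (l * t)" if "t \<in> {0..1}" "i \<in> S" for n t i
    using that
  proof (induction n arbitrary: t i)
    case 0
    have "\<bar>U (Suc 0) t i - U 0 t i\<bar> \<le> C * exp (l * t)"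
    proof (rule growth_bound[OF _ _ _ C 0(1), where h' = "\<lambda>t. g t p i"])
      fix s :: real assume s: "s \<in> {0..1}"
      show "((\<lambda>t. U (Suc 0) t i - U 0 t i) has_real_derivative g s p i) (at s within {0..1})"
        using Uder[OF s 0(2), of 0] by (auto simp: U0 intro!: derivative_eq_intros)
      have "\<bar>g s p i\<bar> \<le> (\<Sum>i\<in>S. M i)"
        using M(2)[OF 0(2) s] member_le_sum[of i S M] M(1) fin 0(2) by fastforce
      also have "\<dots> = C * l * 1" using pos by (simp add: C_def)
      also have "\<dots> \<le> C * l * exp (l * s)" using C pos s by (intro mult_left_mono) auto
      finally show "\<bar>g s p i\<bar> \<le> C * l * exp (l * s)" .
    qed (simp add: Uinit)
    then show ?case by simp
  next
    case (Suc n)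
    have B: "C * (1/2) ^ Suc n \<ge> 0" using C by simp
    show ?case
    proof (rule growth_bound[OF _ _ _ B Suc.prems(1),
          where h' = "\<lambda>t. g t (U (Suc n) t) i - g t (U n t) i"])
      fix s :: real assume s: "s \<in> {0..1}"
      show "((\<lambda>t. U (Suc (Suc n)) t i - U (Suc n) t i) has_real_derivative
          g s (U (Suc n) s) i - g s (U n s) i) (at s within {0..1})"
        by (intro DERIV_diff Uder s Suc.prems)
      have "\<bar>g s (U (Suc n) s) i - g s (U n s) i\<bar> \<le> L' * (\<Sum>j\<in>S. \<bar>U (Suc n) s j - U n s j\<bar>)"
        by (rule lip'[OF s Suc.prems(2)])
      also have "\<dots> \<le> L' * (\<Sum>j\<in>S. C * (1/2) ^ n * exp (l * s))"
        using pos by (intro mult_left_mono sum_mono Suc.IH s) auto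
      also have "\<dots> = (L' * K) * (C * (1/2) ^ n * exp (l * s))" by (simp add: K_def)
      also have "\<dots> \<le> (l / 2) * (C * (1/2) ^ n * exp (l * s))"
        using pos C by (intro mult_right_mono) (auto simp: l_def algebra_simps)
      finally show "\<bar>g s (U (Suc n) s) i - g s (U n s) i\<bar> \<le> C * (1/2) ^ Suc n * l * exp (l * s)"
        by (simp add: algebra_simps)
    qed (simp add: Uinit)
  qed
  define V where "V t i = p i + suminf (\<lambda>n. U (Suc n) t i - U n t i)" for t i
  have ul: "uniform_limit {0..1} (\<lambda>n t. U n t i) (\<lambda>t. V t i) sequentially" if i: "i \<in> S" for i
  proof -
    have "uniform_limit {0..1} (\<lambda>n t. \<Sum>k<n. U (Suc k) t i - U k t i)
        (\<lambda>t. suminf (\<lambda>n. U (Suc n) t i - U n t i)) sequentially"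
    proof (rule Weierstrass_m_test_ev[where M = "\<lambda>n. C * exp l * (1/2) ^ n"])
      have "norm (U (Suc n) t i - U n t i) \<le> C * exp l * (1/2) ^ n" if "t \<in> {0..1}" for n t
      proof -
        have "C * (1/2) ^ n * exp (l * t) \<le> C * (1/2) ^ n * exp l"
          using C pos that by (intro mult_left_mono) auto
        then show ?thesis using diff[OF that i, of n] by (simp add: algebra_simps)
      qed
      then show "\<forall>\<^sub>F n in sequentially. \<forall>t\<in>{0..1}. norm (U (Suc n) t i - U n t i) \<le> C * exp l * (1/2) ^ n"
        by (auto intro: always_eventually)
      show "summable (\<lambda>n. C * exp l * (1/2::real) ^ n)"
        by (intro summable_mult summable_geometric) auto
    qed
    moreover have "(\<Sum>k<n. U (Suc k) t i - U k t i) = U n t i - p i" for n t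
      using sum_lessThan_telescope[of "\<lambda>k. U k t i" n] by (simp add: U0)
    ultimately have "uniform_limit {0..1} (\<lambda>n t. p i + (U n t i - p i)) (\<lambda>t. V t i) sequentially"
      unfolding V_def by (intro uniform_limit_add uniform_limit_const) simp
    then show ?thesis by simp
  qed
  have Vcont: "\<forall>j\<in>S. continuous_on {0..1} (\<lambda>t. V t j)"
  proof
    fix j assume j: "j \<in> S"
    show "continuous_on {0..1} (\<lambda>t. V t j)"
      by (rule uniform_limit_theorem[OF _ ul[OF j]]) (use Ucont j in auto)
  qed
  have ulg: "uniform_limit {0..1} (\<lambda>n t. g t (U n t) i) (\<lambda>t. g t (V t) i) sequentially" if i: "i \<in> S" for i
  proof (rule uniform_limitI)
    fix e :: real assume e: "e > 0"
    define d where "d = e / (L' * (K + 1))"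
    have d: "d > 0" using e pos by (auto simp: d_def)
    have "\<forall>\<^sub>F n in sequentially. \<forall>j\<in>S. \<forall>t\<in>{0..1}. dist (U n t j) (V t j) < d"
      by (intro eventually_ball_finite[OF fin] ballI uniform_limitD[OF ul d])
    then show "\<forall>\<^sub>F n in sequentially. \<forall>t\<in>{0..1}. dist (g t (U n t) i) (g t (V t) i) < e"
    proof eventually_elim
      case (elim n)
      show ?case
      proof
        fix t :: real assume t: "t \<in> {0..1}"
        have "\<bar>g t (U n t) i - g t (V t) i\<bar> \<le> L' * (\<Sum>j\<in>S. \<bar>U n t j - V t j\<bar>)" by (rule lip'[OF t i])
        also have "\<dots> \<le> L' * (\<Sum>j\<in>S. d)"
          using elim t pos by (intro mult_left_mono sum_mono) (auto simp: dist_real_def less_imp_le)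
        also have "\<dots> = L' * K * d" by (simp add: K_def)
        also have "\<dots> < L' * (K + 1) * d" using pos d by simp
        also have "\<dots> = e" using pos by (simp add: d_def)
        finally show "dist (g t (U n t) i) (g t (V t) i) < e" by (simp add: dist_real_def)
      qed
    qed
  qed
  have VS: "V t i = step V t i" if t: "t \<in> {0..1}" and i: "i \<in> S" for t i
  proof -
    have "uniform_limit {0..t} (\<lambda>n s. g s (U n s) i) (\<lambda>s. g s (V s) i) sequentially"
      by (rule uniform_limit_on_subset[OF ulg[OF i]]) (use t in auto)
    moreover have "continuous_on {0..t} (\<lambda>s. g s (U n s) i)" for n
      by (rule continuous_on_subset[OF cont[OF i Ucont]]) (use t in auto)
    ultimately obtain I J where IJ: "\<And>n. ((\<lambda>s. g s (U n s) i) has_integral I n) {0..t}"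
      "((\<lambda>s. g s (V s) i) has_integral J) {0..t}" "I \<longlonglongrightarrow> J"
      by (rule uniform_limit_integral) auto
    have "(\<lambda>n. p i + I n) \<longlonglongrightarrow> p i + J" by (intro tendsto_intros IJ(3))
    moreover have "U (Suc n) t i = p i + I n" for n
      using integral_unique[OF IJ(1)] i by (simp add: US step_def)
    ultimately have "(\<lambda>n. U (Suc n) t i) \<longlonglongrightarrow> step V t i"
      using integral_unique[OF IJ(2)] i by (simp add: step_def)
    moreover have "(\<lambda>n. U (Suc n) t i) \<longlonglongrightarrow> V t i"
      using tendsto_uniform_limitI[OF ul[OF i] t] LIMSEQ_Suc by blast
    ultimately show ?thesis using LIMSEQ_unique by blast
  qed
  show ?thesis
  \<comment> \<open>By the fundamental theorem of calculus \<open>step V\<close> is differentiable,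
    with \<open>V\<close> inside the right-hand side; \<open>VS\<close> then replaces
    \<open>V\<close> by \<open>step V\<close> there.\<close>
  proof (intro exI[of _ "step V"] conjI allI impI ballI)
    show "step V 0 = p" by (auto simp: step_def)
    show "step V t i = p i" if "i \<notin> S" for t i using that by (simp add: step_def)
    fix t :: real and i assume t: "t \<in> {0..1}" and i: "i \<in> S"
    have "\<bar>g t (V t) i - g t (step V t) i\<bar> \<le> L' * (\<Sum>j\<in>S. \<bar>V t j - step V t j\<bar>)" by (rule lip'[OF t i])
    also have "(\<Sum>j\<in>S. \<bar>V t j - step V t j\<bar>) = 0" using VS t by (intro sum.neutral) auto
    finally have "g t (V t) i = g t (step V t) i" by simp
    then show "((\<lambda>t. step V t i) has_real_derivative g t (step V t) i) (at t within {0..1})"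
      using step_der[OF Vcont t i] by simp
  qed
qed


subsection \<open>The time-one map of a vector field\<close>

text \<open>All trajectories run over the unit interval. Other times are reached by multiplying the
  field with the time, so that a flow becomes a time-one map.\<close>

definition sol :: "'i set \<Rightarrow> ('i \<Rightarrow> real) set \<Rightarrow> ('i \<Rightarrow> ('i \<Rightarrow> real) \<Rightarrow> real) \<Rightarrow>
    ('i \<Rightarrow> real) \<Rightarrow> (real \<Rightarrow> 'i \<Rightarrow> real) \<Rightarrow> bool" where
  "sol S \<Omega> f p u \<longleftrightarrow> u 0 = p \<and> (\<forall>t\<in>{0..1}. u t \<in> \<Omega> \<and> (\<forall>i. i \<notin> S \<longrightarrow> u t i = p i) \<and>
     (\<forall>i\<in>S. ((\<lambda>t. u t i) has_real_derivative f i (u t)) (at t within {0..1})))"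

definition coord_field :: "'i set \<Rightarrow> ('i \<Rightarrow> real) set \<Rightarrow> ('i \<Rightarrow> ('i \<Rightarrow> real) \<Rightarrow> real) \<Rightarrow> bool" where
  "coord_field S \<Omega> f \<longleftrightarrow> finite S \<and> open_cylinder S \<Omega> \<and>
     (\<forall>i\<in>S. depends_only_on S \<Omega> (f i) \<and> smooth_coords \<Omega> (f i))"

lemma coord_fieldD:
  assumes "coord_field S \<Omega> f"
  shows "finite S" "open_cylinder S \<Omega>" "open \<Omega>"
    "i \<in> S \<Longrightarrow> depends_only_on S \<Omega> (f i)" "i \<in> S \<Longrightarrow> smooth_coords \<Omega> (f i)"
  using assms by (auto simp: coord_field_def open_cylinder_def)

definition sol_dom :: "'i set \<Rightarrow> ('i \<Rightarrow> real) set \<Rightarrow> ('i \<Rightarrow> ('i \<Rightarrow> real) \<Rightarrow> real) \<Rightarrow> ('i \<Rightarrow> real) set" where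
  "sol_dom S \<Omega> f = {p. \<exists>u. sol S \<Omega> f p u}"

text \<open>A solution is determined on the unit interval only, so one has to be chosen; by
  \<open>time_one_eq\<close> the choice does not affect the value.\<close>

definition time_one :: "'i set \<Rightarrow> ('i \<Rightarrow> real) set \<Rightarrow> ('i \<Rightarrow> ('i \<Rightarrow> real) \<Rightarrow> real) \<Rightarrow>
    ('i \<Rightarrow> real) \<Rightarrow> 'i \<Rightarrow> real" where
  "time_one S \<Omega> f p = (SOME u. sol S \<Omega> f p u) 1"

lemma solD:
  assumes "sol S \<Omega> f p u"
  shows "u 0 = p" "t \<in> {0..1} \<Longrightarrow> u t \<in> \<Omega>" "t \<in> {0..1} \<Longrightarrow> i \<notin> S \<Longrightarrow> u t i = p i"
    "t \<in> {0..1} \<Longrightarrow> i \<in> S \<Longrightarrow> ((\<lambda>t. u t i) has_real_derivative f i (u t)) (at t within {0..1})"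
  using assms by (auto simp: sol_def)

lemma sol_cont_coord: "sol S \<Omega> f p u \<Longrightarrow> continuous_on {0..1} (\<lambda>t. u t i)"
proof (cases "i \<in> S")
  case True
  assume "sol S \<Omega> f p u"
  then show ?thesis by (rule DERIV_continuous_on[OF solD(4)[OF _ _ True]])
next
  case False
  assume "sol S \<Omega> f p u"
  then have "continuous_on {0..1} (\<lambda>t. u t i) = continuous_on {0..1} (\<lambda>t::real. p i)"
    using False by (intro continuous_on_cong) (auto dest: solD(3))
  then show ?thesis by simp
qed

lemma sol_cont: "sol S \<Omega> f p u \<Longrightarrow> continuous_on {0..1} u"
  by (intro continuous_on_coordinatewise_then_product sol_cont_coord)

lemma local_lipschitz_coords:
  assumes "finite S" "open_cylinder S \<Omega>" "finite H"
    and H: "\<And>h. h \<in> H \<Longrightarrow> depends_only_on S \<Omega> h \<and> smooth_coords \<Omega> h" and "p \<in> \<Omega>"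
  shows "\<exists>r>0. \<exists>M\<ge>0. (\<forall>x. (\<forall>i\<in>S. \<bar>x i - p i\<bar> < r) \<longrightarrow> x \<in> \<Omega>) \<and>
    (\<forall>h\<in>H. \<forall>x y. (\<forall>i\<in>S. \<bar>x i - p i\<bar> < r) \<longrightarrow> (\<forall>i\<in>S. \<bar>y i - p i\<bar> < r) \<longrightarrow>
      \<bar>h x - h y\<bar> \<le> M * (\<Sum>i\<in>S. \<bar>x i - y i\<bar>))"
proof -
  \<comment> \<open>The summand 1 makes M a strict bound at p, hence a bound on a
    neighbourhood.\<close>
  define M where "M = 1 + (\<Sum>h\<in>H. \<Sum>c\<in>S. \<bar>pderiv_at c h p\<bar>)"
  have M1: "M \<ge> 1" by (simp add: M_def sum_nonneg)
  define U where "U = {x \<in> \<Omega>. \<forall>k\<in>H \<times> S. \<bar>pderiv_at (snd k) (fst k) x - 0\<bar> < M}"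
  have "open_cylinder S U"
    unfolding U_def
  proof (rule open_cylinder_sublevel[OF assms(2)])
    show "finite (H \<times> S)" using assms by simp
    show "continuous_on \<Omega> (pderiv_at (snd k) (fst k)) \<and> depends_only_on S \<Omega> (pderiv_at (snd k) (fst k))"
      if "k \<in> H \<times> S" for k
      using H[of "fst k"] that
      by (auto intro!: smooth_coords_cont[OF smooth_coords_pderiv] depends_only_on_pderiv[OF assms(2)])
  qed
  moreover have "p \<in> U"
  proof -
    have "\<bar>pderiv_at c h p\<bar> < M" if "h \<in> H" "c \<in> S" for h c
    proof -
      have "\<bar>pderiv_at c h p\<bar> \<le> (\<Sum>c\<in>S. \<bar>pderiv_at c h p\<bar>)"
        by (rule member_le_sum) (use that assms(1) in auto)
      also have "\<dots> \<le> (\<Sum>h\<in>H. \<Sum>c\<in>S. \<bar>pderiv_at c h p\<bar>)"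
        by (rule member_le_sum[of h H "\<lambda>h. \<Sum>c\<in>S. \<bar>pderiv_at c h p\<bar>"])
          (use that assms(3) in \<open>auto intro: sum_nonneg\<close>)
      finally show ?thesis by (simp add: M_def)
    qed
    then show ?thesis using assms(5) by (auto simp: U_def)
  qed
  ultimately obtain r where r: "r > 0" "\<forall>x. (\<forall>i\<in>S. \<bar>x i - p i\<bar> < r) \<longrightarrow> x \<in> U"
    using open_cylinder_imp_box[OF _ _ assms(1)] by blast
  have "\<bar>h x - h y\<bar> \<le> M * (\<Sum>i\<in>S. \<bar>x i - y i\<bar>)"
    if h: "h \<in> H" and xy: "\<forall>i\<in>S. \<bar>x i - p i\<bar> < r" "\<forall>i\<in>S. \<bar>y i - p i\<bar> < r" for h x y
  proof -
    define x' where "x' i = (if i \<in> S then x i else y i)" for i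
    have x': "\<forall>i\<in>S. \<bar>x' i - p i\<bar> < r" using xy by (simp add: x'_def)
    have "\<bar>h x' - h y - (\<Sum>c\<in>S. 0 * (x' c - y c))\<bar> \<le> M * (\<Sum>c\<in>S. \<bar>x' c - y c\<bar>)"
    proof (rule mean_value_box[OF assms(1) box_convex_box[of S p "\<lambda>_. r"], where f' = "\<lambda>c. pderiv_at c h"])
      fix z c assume z: "z \<in> {x. \<forall>i\<in>S. \<bar>x i - p i\<bar> < r}" and c: "c \<in> S"
      have zU: "z \<in> U" using r(2) z by blast
      then show "((\<lambda>s. h (z(c := s))) has_real_derivative pderiv_at c h z) (at (z c))"
        using H[OF h] by (intro smooth_coords_DERIV[of \<Omega>]) (auto simp: U_def)
      show "\<bar>pderiv_at c h z - 0\<bar> \<le> M" using zU h c by (auto simp: U_def less_imp_le)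
    qed (use xy x' in \<open>auto simp: x'_def\<close>)
    moreover have "h x' = h x"
    proof (rule depends_only_onD[of S \<Omega> h])
      show "depends_only_on S \<Omega> h" using H[OF h] by simp
      show "x' \<in> \<Omega>" "x \<in> \<Omega>" using r(2) xy x' by (auto simp: U_def)
    qed (simp add: x'_def)
    moreover have "(\<Sum>c\<in>S. \<bar>x' c - y c\<bar>) = (\<Sum>c\<in>S. \<bar>x c - y c\<bar>)" by (simp add: x'_def)
    ultimately show ?thesis by simp
  qed
  moreover have "x \<in> \<Omega>" if "\<forall>i\<in>S. \<bar>x i - p i\<bar> < r" for x using r(2) that by (auto simp: U_def)
  ultimately show ?thesis using r(1) M1 by (intro exI[of _ r] conjI exI[of _ M]) auto
qed

text \<open>A uniform version of \<open>local_lipschitz_coords\<close> along a curve. Radius and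
  constant are tied to a single number n, as 1 / (n + 1) and n, to fit
  \<open>compact_uniform_nat\<close>.\<close>

lemma tube:
  assumes "finite S" "open_cylinder S \<Omega>" "finite H"
    and H: "\<And>h. h \<in> H \<Longrightarrow> depends_only_on S \<Omega> h \<and> smooth_coords \<Omega> h"
    and u: "\<And>i. continuous_on {0..1} (\<lambda>t. u t i)" "\<And>t. t \<in> {0..1} \<Longrightarrow> u t \<in> \<Omega>"
  shows "\<exists>e>0. \<exists>L\<ge>0. \<forall>t\<in>{0..1::real}. (\<forall>x. (\<forall>i\<in>S. \<bar>x i - u t i\<bar> \<le> e) \<longrightarrow> x \<in> \<Omega>) \<and>
    (\<forall>h\<in>H. \<forall>x y. (\<forall>i\<in>S. \<bar>x i - u t i\<bar> \<le> e) \<longrightarrow> (\<forall>i\<in>S. \<bar>y i - u t i\<bar> \<le> e) \<longrightarrow>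
      \<bar>h x - h y\<bar> \<le> L * (\<Sum>i\<in>S. \<bar>x i - y i\<bar>))"
proof -
  define P where "P n t \<longleftrightarrow> (\<forall>x. (\<forall>i\<in>S. \<bar>x i - u t i\<bar> \<le> 1 / real (Suc n)) \<longrightarrow> x \<in> \<Omega>) \<and>
    (\<forall>h\<in>H. \<forall>x y. (\<forall>i\<in>S. \<bar>x i - u t i\<bar> \<le> 1 / real (Suc n)) \<longrightarrow>
      (\<forall>i\<in>S. \<bar>y i - u t i\<bar> \<le> 1 / real (Suc n)) \<longrightarrow>
      \<bar>h x - h y\<bar> \<le> real n * (\<Sum>i\<in>S. \<bar>x i - y i\<bar>))" for n t
  have "\<exists>n. \<forall>t\<in>{0..1}. P n t"
  proof (rule compact_uniform_nat)
    fix n m :: nat and t :: real assume nm: "n \<le> m" and P: "P n t"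
    have le: "1 / real (Suc m) \<le> 1 / real (Suc n)" using nm by (simp add: frac_le)
    have *: "\<forall>i\<in>S. \<bar>x i - u t i\<bar> \<le> 1 / real (Suc n)" if "\<forall>i\<in>S. \<bar>x i - u t i\<bar> \<le> 1 / real (Suc m)" for x
      using that le by force
    have **: "real n * (\<Sum>i\<in>S. \<bar>x i - y i\<bar>) \<le> real m * (\<Sum>i\<in>S. \<bar>x i - y i\<bar>)" for x y :: "'a \<Rightarrow> real"
      using nm by (intro mult_right_mono sum_nonneg) auto
    show "P m t"
      unfolding P_def
    proof (intro conjI allI impI ballI)
      show "x \<in> \<Omega>" if "\<forall>i\<in>S. \<bar>x i - u t i\<bar> \<le> 1 / real (Suc m)" for x
        using P *[OF that] unfolding P_def by blast
      show "\<bar>h x - h y\<bar> \<le> real m * (\<Sum>i\<in>S. \<bar>x i - y i\<bar>)" if "h \<in> H"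
        "\<forall>i\<in>S. \<bar>x i - u t i\<bar> \<le> 1 / real (Suc m)" "\<forall>i\<in>S. \<bar>y i - u t i\<bar> \<le> 1 / real (Suc m)" for h x y
        using P that(1) *[OF that(2)] *[OF that(3)] order_trans[OF _ **] unfolding P_def by blast
    qed
  next
    fix t :: real assume t: "t \<in> {0..1}"
    obtain r M where rM: "r > 0" "M \<ge> 0" "\<forall>x. (\<forall>i\<in>S. \<bar>x i - u t i\<bar> < r) \<longrightarrow> x \<in> \<Omega>"
      "\<forall>h\<in>H. \<forall>x y. (\<forall>i\<in>S. \<bar>x i - u t i\<bar> < r) \<longrightarrow> (\<forall>i\<in>S. \<bar>y i - u t i\<bar> < r) \<longrightarrow>
        \<bar>h x - h y\<bar> \<le> M * (\<Sum>i\<in>S. \<bar>x i - y i\<bar>)"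
      using local_lipschitz_coords[OF assms(1-3) H u(2)[OF t]] by blast
    \<comment> \<open>Half of r is left for the motion of the curve near t, the other half for the
      distance from the curve.\<close>
    obtain n1 where n1: "1 / real (Suc n1) < r / 2"
      using rM(1) nat_approx_posE[of "r / 2"] by auto
    obtain n2 where n2: "M \<le> real n2" using real_arch_simple by blast
    define n where "n = max n1 n2"
    have n: "1 / real (Suc n) < r / 2" "M \<le> real n"
    proof -
      have "1 / real (Suc n) \<le> 1 / real (Suc n1)" by (simp add: n_def frac_le)
      then show "1 / real (Suc n) < r / 2" using n1 by linarith
    qed (use n2 in \<open>simp add: n_def\<close>)
    have "\<exists>T. open T \<and> t \<in> T \<and> (\<forall>s\<in>T \<inter> {0..1}. \<bar>u s i - u t i\<bar> < r / 2)" for i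
    proof -
      have "((\<lambda>s. u s i) \<longlongrightarrow> u t i) (at t within {0..1})"
        using u(1)[of i] t by (auto simp: continuous_on_def)
      then have "\<forall>\<^sub>F s in at t within {0..1}. dist (u s i) (u t i) < r / 2"
        using rM(1) by (intro tendstoD) auto
      then obtain T where "open T" "t \<in> T" "\<forall>s\<in>T. s \<noteq> t \<longrightarrow> s \<in> {0..1} \<longrightarrow> dist (u s i) (u t i) < r / 2"
        unfolding eventually_at_topological by blast
      then show ?thesis using rM(1) by (intro exI[of _ T]) (auto simp: dist_real_def)
    qed
    then obtain T where T: "\<And>i. open (T i)" "\<And>i. t \<in> T i"
      "\<And>i s. s \<in> T i \<Longrightarrow> s \<in> {0..1} \<Longrightarrow> \<bar>u s i - u t i\<bar> < r / 2" by (metis IntI)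
    have "P n s" if s: "s \<in> (\<Inter>i\<in>S. T i) \<inter> {0..1}" for s
    proof -
      have near: "\<forall>i\<in>S. \<bar>x i - u t i\<bar> < r" if "\<forall>i\<in>S. \<bar>x i - u s i\<bar> \<le> 1 / real (Suc n)" for x
      proof
        fix i assume i: "i \<in> S"
        then have "\<bar>u s i - u t i\<bar> < r / 2" using T(3)[of s i] s by auto
        moreover have "\<bar>x i - u s i\<bar> \<le> 1 / real (Suc n)" using that i by blast
        ultimately show "\<bar>x i - u t i\<bar> < r" using n(1) by linarith
      qed
      have **: "M * (\<Sum>i\<in>S. \<bar>x i - y i\<bar>) \<le> real n * (\<Sum>i\<in>S. \<bar>x i - y i\<bar>)" for x y :: "'a \<Rightarrow> real"
        using n(2) by (intro mult_right_mono sum_nonneg) auto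
      show ?thesis
        unfolding P_def
      proof (intro conjI allI impI ballI)
        show "x \<in> \<Omega>" if "\<forall>i\<in>S. \<bar>x i - u s i\<bar> \<le> 1 / real (Suc n)" for x
          using rM(3) near[OF that] by blast
        show "\<bar>h x - h y\<bar> \<le> real n * (\<Sum>i\<in>S. \<bar>x i - y i\<bar>)" if "h \<in> H"
          "\<forall>i\<in>S. \<bar>x i - u s i\<bar> \<le> 1 / real (Suc n)" "\<forall>i\<in>S. \<bar>y i - u s i\<bar> \<le> 1 / real (Suc n)" for h x y
          using rM(4) that(1) near[OF that(2)] near[OF that(3)] order_trans[OF _ **] by blast
      qed
    qed
    moreover have "open (\<Inter>i\<in>S. T i)" "t \<in> (\<Inter>i\<in>S. T i)" using T assms(1) by auto
    ultimately show "\<exists>T n. open T \<and> t \<in> T \<and> (\<forall>s\<in>T \<inter> {0..1}. P n s)" by blast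
  qed
  then obtain n where "\<forall>t\<in>{0..1}. P n t" by blast
  then show ?thesis
    unfolding P_def by (intro exI[of _ "1 / real (Suc n)"] conjI exI[of _ "real n"]) auto
qed

text \<open>Retraction of the line onto the interval of radius e about a. It does not increase
  distances, so composing with it turns a Lipschitz bound near a curve into a global one.\<close>

definition clamp_to :: "real \<Rightarrow> real \<Rightarrow> real \<Rightarrow> real" where
  "clamp_to e a x = max (a - e) (min (a + e) x)"

lemma clamp_to_near: "e \<ge> 0 \<Longrightarrow> \<bar>clamp_to e a x - a\<bar> \<le> e"
  by (auto simp: clamp_to_def)

lemma clamp_to_lipschitz: "\<bar>clamp_to e a x - clamp_to e a y\<bar> \<le> \<bar>x - y\<bar>"
  by (auto simp: clamp_to_def max_def min_def)

lemma clamp_to_id: "\<bar>x - a\<bar> \<le> e \<Longrightarrow> clamp_to e a x = x"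
  by (auto simp: clamp_to_def max_def min_def)

text \<open>Clamped to a tube about u, the field is globally Lipschitz, and \<open>picard\<close>
  yields a solution v on the whole interval. By Gronwall v stays in the tube if q is close to p, and
  inside the tube the clamped field is the original one.\<close>

lemma sol_stability:
  assumes "coord_field S \<Omega> f" "sol S \<Omega> f p u"
  shows "\<exists>d>0. \<exists>C\<ge>0. \<forall>q. (\<forall>i\<in>S. \<bar>q i - p i\<bar> < d) \<longrightarrow>
    (\<exists>v. sol S \<Omega> f q v \<and> (\<forall>t\<in>{0..1}. (\<Sum>i\<in>S. (v t i - u t i)\<^sup>2) \<le> C * (\<Sum>i\<in>S. (q i - p i)\<^sup>2)))"
proof -
  note F = coord_fieldD[OF assms(1)]
  have H: "depends_only_on S \<Omega> h \<and> smooth_coords \<Omega> h" if "h \<in> f ` S" for h using F(4,5) that by auto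
  obtain e L where e: "e > 0" and L: "L \<ge> 0"
    and T: "\<forall>t\<in>{0..1::real}. (\<forall>x. (\<forall>i\<in>S. \<bar>x i - u t i\<bar> \<le> e) \<longrightarrow> x \<in> \<Omega>) \<and>
    (\<forall>h\<in>f ` S. \<forall>x y. (\<forall>i\<in>S. \<bar>x i - u t i\<bar> \<le> e) \<longrightarrow> (\<forall>i\<in>S. \<bar>y i - u t i\<bar> \<le> e) \<longrightarrow>
      \<bar>h x - h y\<bar> \<le> L * (\<Sum>i\<in>S. \<bar>x i - y i\<bar>))"
    using tube[OF F(1,2) finite_imageI[OF F(1)] H sol_cont_coord[OF assms(2)] solD(2)[OF assms(2)]]
    by blast
  define K where "K = real (card S)"
  define cl where "cl t x j = (if j \<in> S then clamp_to e (u t j) (x j) else u t j)" for t x j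
  define g where "g t x i = f i (cl t x)" for t x i
  have cl_near: "\<forall>i\<in>S. \<bar>cl t x i - u t i\<bar> \<le> e" for t x
    using e by (simp add: cl_def clamp_to_near)
  have cl_in: "cl t x \<in> \<Omega>" if "t \<in> {0..1}" for t x
    using T that cl_near by blast
  have cl_cont: "continuous_on {0..1} (\<lambda>t. cl t (x t))"
    if "\<forall>j\<in>S. continuous_on {0..1} (\<lambda>t. x t j)" for x
  proof (rule continuous_on_coordinatewise_then_product)
    fix j show "continuous_on {0..1} (\<lambda>t. cl t (x t) j)"
      using that sol_cont_coord[OF assms(2), of j]
      by (cases "j \<in> S") (auto simp: cl_def clamp_to_def intro!: continuous_intros)
  qed
  have g_cont: "continuous_on {0..1} (\<lambda>t. g t (x t) i)"
    if i: "i \<in> S" and x: "\<forall>j\<in>S. continuous_on {0..1} (\<lambda>t. x t j)" for x i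
    unfolding g_def
    by (rule continuous_on_compose2[OF smooth_coords_cont[OF F(5)[OF i]] cl_cont[OF x]]) (use cl_in in auto)
  have g_lip: "\<bar>g t x i - g t y i\<bar> \<le> L * (\<Sum>j\<in>S. \<bar>x j - y j\<bar>)" if t: "t \<in> {0..1}" and i: "i \<in> S" for t x y i
  proof -
    have "\<bar>g t x i - g t y i\<bar> \<le> L * (\<Sum>j\<in>S. \<bar>cl t x j - cl t y j\<bar>)"
      unfolding g_def using T t i cl_near by blast
    also have "\<dots> \<le> L * (\<Sum>j\<in>S. \<bar>x j - y j\<bar>)"
      using L clamp_to_lipschitz by (intro mult_left_mono sum_mono) (auto simp: cl_def)
    finally show ?thesis .
  qed
  have cl_id: "g t x i = f i x" if t: "t \<in> {0..1}" and i: "i \<in> S" and x: "\<forall>i\<in>S. \<bar>x i - u t i\<bar> \<le> e" for t i x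
    unfolding g_def
  proof (rule depends_only_onD[OF F(4)[OF i] cl_in[OF t]])
    show "x \<in> \<Omega>" using T t x by blast
    show "cl t x j = x j" if "j \<in> S" for j using x that by (simp add: cl_def clamp_to_id)
  qed
  define C where "C = exp (1 + 2 * L * K)"
  have C: "C > 0" by (simp add: C_def)
  \<comment> \<open>Chosen such that C (K + 1) d^2 = e^2, which makes the Gronwall bound at most
    e^2.\<close>
  define d where "d = e / sqrt (C * (K + 1))"
  have K: "K \<ge> 0" by (simp add: K_def)
  have d: "d > 0" using e C K by (simp add: d_def)
  have d2: "C * (K + 1) * d\<^sup>2 = e\<^sup>2"
  proof -
    have "(sqrt (C * (K + 1)))\<^sup>2 = C * (K + 1)" using C K by simp
    then show ?thesis using C K by (simp add: d_def power_divide)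
  qed
  have "\<exists>v. sol S \<Omega> f q v \<and> (\<forall>t\<in>{0..1}. (\<Sum>i\<in>S. (v t i - u t i)\<^sup>2) \<le> C * (\<Sum>i\<in>S. (q i - p i)\<^sup>2))"
    if q: "\<forall>i\<in>S. \<bar>q i - p i\<bar> < d" for q
  proof -
    have "\<exists>v. v 0 = q \<and> (\<forall>t i. i \<notin> S \<longrightarrow> v t i = q i) \<and>
      (\<forall>t\<in>{0..1}. \<forall>i\<in>S. ((\<lambda>t. v t i) has_real_derivative g t (v t) i) (at t within {0..1}))"
      by (rule picard[OF F(1)]) (fact g_cont, fact g_lip)
    then obtain v where v: "v 0 = q" "\<forall>t i. i \<notin> S \<longrightarrow> v t i = q i"
      "\<forall>t\<in>{0..1}. \<forall>i\<in>S. ((\<lambda>t. v t i) has_real_derivative g t (v t) i) (at t within {0..1})"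
      by blast
    have est: "(\<Sum>i\<in>S. (v t i - u t i)\<^sup>2) \<le> C * (\<Sum>i\<in>S. (q i - p i)\<^sup>2)" if t: "t \<in> {0..1}" for t
    proof -
      have "(\<Sum>i\<in>S. (v t i - u t i)\<^sup>2) \<le>
        ((\<Sum>i\<in>S. (v 0 i - u 0 i)\<^sup>2) + real (card S) * (0::real)\<^sup>2) * exp (1 + 2 * L * card S)"
      proof (rule sum_squares_gronwall[OF F(1) _ _ _ L t, where w' = "\<lambda>t i. g t (v t) i - f i (u t)"])
        fix s :: real and i assume s: "s \<in> {0..1}" and i: "i \<in> S"
        show "((\<lambda>t. v t i - u t i) has_real_derivative g s (v s) i - f i (u s)) (at s within {0..1})"
          by (intro DERIV_diff solD(4)[OF assms(2) s i]) (use v(3) s i in blast)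
        have "f i (u s) = g s (u s) i" using cl_id[OF s i] e by simp
        then show "\<bar>g s (v s) i - f i (u s)\<bar> \<le> 0 + L * (\<Sum>j\<in>S. \<bar>v s j - u s j\<bar>)"
          using g_lip[OF s i, of "v s" "u s"] by simp
      qed simp
      then show ?thesis by (simp add: v(1) solD(1)[OF assms(2)] C_def K_def mult.commute)
    qed
    have "(\<Sum>i\<in>S. (q i - p i)\<^sup>2) \<le> (\<Sum>i\<in>S. d\<^sup>2)"
      using q d by (intro sum_mono) (metis abs_ge_zero less_imp_le power2_abs power_mono)
    also have "\<dots> \<le> (K + 1) * d\<^sup>2" by (simp add: K_def algebra_simps)
    finally have "C * (\<Sum>i\<in>S. (q i - p i)\<^sup>2) \<le> C * ((K + 1) * d\<^sup>2)"
      by (rule mult_left_mono) (use C in simp)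
    then have "C * (\<Sum>i\<in>S. (q i - p i)\<^sup>2) \<le> e\<^sup>2" using d2 by (simp add: mult.assoc)
    have near: "\<forall>i\<in>S. \<bar>v t i - u t i\<bar> \<le> e" if t: "t \<in> {0..1}" for t
    proof
      fix i assume i: "i \<in> S"
      have "(v t i - u t i)\<^sup>2 \<le> (\<Sum>i\<in>S. (v t i - u t i)\<^sup>2)"
        by (rule member_le_sum[OF i, of "\<lambda>i. (v t i - u t i)\<^sup>2"]) (use F(1) in auto)
      also have "\<dots> \<le> e\<^sup>2" using est[OF t] \<open>C * _ \<le> e\<^sup>2\<close> by linarith
      finally show "\<bar>v t i - u t i\<bar> \<le> e" using e abs_le_square_iff[of "v t i - u t i" e] by simp
    qed
    have "sol S \<Omega> f q v"
      unfolding sol_def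
    proof (intro conjI ballI allI impI)
      fix t :: real assume t: "t \<in> {0..1}"
      show "v t \<in> \<Omega>" using T t near[OF t] by blast
      show "((\<lambda>t. v t i) has_real_derivative f i (v t)) (at t within {0..1})" if i: "i \<in> S" for i
        using v(3)[rule_format, OF t i] cl_id[OF t i near[OF t]] by simp
    qed (use v in auto)
    then show ?thesis using est by blast
  qed
  then show ?thesis using d C by (intro exI[of _ d] conjI exI[of _ C]) auto
qed

text \<open>The solutions are not known to share a tube with a Lipschitz bound. Along the pair of
  curves, however, the difference of the fields is still at most a multiple of the distance: where
  the curves meet, by the local Lipschitz bound; elsewhere, because the distance is bounded away
  from 0. Compactness gives one multiple for all times, and Gronwall applies.\<close>

lemma sol_unique:
  assumes "coord_field S \<Omega> f" "sol S \<Omega> f p u" "sol S \<Omega> f q v" "\<And>i. i \<in> S \<Longrightarrow> p i = q i"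
    and t: "t \<in> {0..1}" and i: "i \<in> S"
  shows "u t i = v t i"
proof -
  note F = coord_fieldD[OF assms(1)]
  let ?w = "\<lambda>s. \<Sum>i\<in>S. \<bar>u s i - v s i\<bar>" and ?h = "\<lambda>s. \<Sum>i\<in>S. \<bar>f i (u s) - f i (v s)\<bar>"
  have fcont: "continuous_on {0..1} (\<lambda>s. f i (u s))" if "i \<in> S" "sol S \<Omega> f p u" for i p u
    by (rule continuous_on_compose2[OF smooth_coords_cont[OF F(5)[OF that(1)]] sol_cont[OF that(2)]])
      (use solD(2)[OF that(2)] in auto)
  have wc: "continuous_on {0..1} ?w"
    using sol_cont_coord[OF assms(2)] sol_cont_coord[OF assms(3)] by (intro continuous_intros) auto
  have hc: "continuous_on {0..1} ?h"
    using fcont[OF _ assms(2)] fcont[OF _ assms(3)] by (intro continuous_intros) auto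
  have w0: "?w s \<ge> 0" for s by (intro sum_nonneg) auto
  have h0: "?h s \<ge> 0" for s by (intro sum_nonneg) auto
  have "\<exists>n. \<forall>s\<in>{0..1}. ?h s \<le> real n * ?w s"
  proof (rule compact_uniform_nat)
    show "?h s \<le> real m * ?w s" if "n \<le> m" "?h s \<le> real n * ?w s" for n m s
      using that mult_right_mono[of "real n" "real m" "?w s"] w0[of s] by simp
    fix t0 :: real assume t0: "t0 \<in> {0..1}"
    have near: "\<exists>T. open T \<and> t0 \<in> T \<and> (\<forall>s\<in>T \<inter> {0..1}. \<bar>k s - k t0\<bar> < e)"
      if "continuous_on {0..1} k" "e > 0" for k :: "real \<Rightarrow> real" and e
    proof -
      have "(k \<longlongrightarrow> k t0) (at t0 within {0..1})"
        using that(1) t0 by (auto simp: continuous_on_def)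
      then have "\<forall>\<^sub>F s in at t0 within {0..1}. dist (k s) (k t0) < e"
        using that(2) by (intro tendstoD) auto
      then obtain T where "open T" "t0 \<in> T" "\<forall>s\<in>T. s \<noteq> t0 \<longrightarrow> s \<in> {0..1} \<longrightarrow> dist (k s) (k t0) < e"
        unfolding eventually_at_topological by blast
      then show ?thesis using that(2) by (intro exI[of _ T]) (auto simp: dist_real_def)
    qed
    show "\<exists>T n. open T \<and> t0 \<in> T \<and> (\<forall>s\<in>T \<inter> {0..1}. ?h s \<le> real n * ?w s)"
    proof (cases "?w t0 = 0")
      case True
      have "\<forall>i\<in>S. \<bar>u t0 i - v t0 i\<bar> = 0"
        using True sum_nonneg_eq_0_iff[OF F(1), of "\<lambda>i. \<bar>u t0 i - v t0 i\<bar>"] by simp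
      then have eq: "u t0 i = v t0 i" if "i \<in> S" for i using that by auto
      have H: "depends_only_on S \<Omega> h \<and> smooth_coords \<Omega> h" if "h \<in> f ` S" for h using F(4,5) that by auto
      obtain r M where rM: "r > 0" "M \<ge> 0"
        "\<forall>h\<in>f ` S. \<forall>x y. (\<forall>i\<in>S. \<bar>x i - u t0 i\<bar> < r) \<longrightarrow> (\<forall>i\<in>S. \<bar>y i - u t0 i\<bar> < r) \<longrightarrow>
        \<bar>h x - h y\<bar> \<le> M * (\<Sum>i\<in>S. \<bar>x i - y i\<bar>)"
        using local_lipschitz_coords[OF F(1,2) finite_imageI[OF F(1)] H solD(2)[OF assms(2) t0]] by blast
      obtain T1 where T1: "\<And>i. open (T1 i) \<and> t0 \<in> T1 i \<and> (\<forall>s\<in>T1 i \<inter> {0..1}. \<bar>u s i - u t0 i\<bar> < r)"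
        using near[OF sol_cont_coord[OF assms(2)] rM(1)] by metis
      obtain T2 where T2: "\<And>i. open (T2 i) \<and> t0 \<in> T2 i \<and> (\<forall>s\<in>T2 i \<inter> {0..1}. \<bar>v s i - v t0 i\<bar> < r)"
        using near[OF sol_cont_coord[OF assms(3)] rM(1)] by metis
      obtain n where n: "real (card S) * M \<le> real n" using real_arch_simple by blast
      show ?thesis
      proof (intro exI[of _ "\<Inter>i\<in>S. T1 i \<inter> T2 i"] exI[of _ n] conjI ballI)
        show "open (\<Inter>i\<in>S. T1 i \<inter> T2 i)" using T1 T2 F(1) by (intro open_INT) auto
        show "t0 \<in> (\<Inter>i\<in>S. T1 i \<inter> T2 i)" using T1 T2 by auto
        fix s assume s: "s \<in> (\<Inter>i\<in>S. T1 i \<inter> T2 i) \<inter> {0..1}"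
        have 1: "\<forall>i\<in>S. \<bar>u s i - u t0 i\<bar> < r" using s T1 by blast
        have 2: "\<forall>i\<in>S. \<bar>v s i - u t0 i\<bar> < r"
        proof
          fix i assume i: "i \<in> S"
          then have "\<bar>v s i - v t0 i\<bar> < r" using s T2 by blast
          then show "\<bar>v s i - u t0 i\<bar> < r" using eq[OF i] by simp
        qed
        have "?h s \<le> (\<Sum>i\<in>S. M * ?w s)"
          using rM(3) 1 2 by (intro sum_mono) blast
        also have "\<dots> = (real (card S) * M) * ?w s" by simp
        also have "\<dots> \<le> real n * ?w s" using n w0 by (intro mult_right_mono) auto
        finally show "?h s \<le> real n * ?w s" .
      qed
    next
      case False
      then have pos: "?w t0 > 0" using w0[of t0] by linarith
      obtain T1 where T1: "open T1" "t0 \<in> T1" "\<forall>s\<in>T1 \<inter> {0..1}. \<bar>?w s - ?w t0\<bar> < ?w t0 / 2"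
        using near[OF wc, of "?w t0 / 2"] pos by auto
      obtain T2 where T2: "open T2" "t0 \<in> T2" "\<forall>s\<in>T2 \<inter> {0..1}. \<bar>?h s - ?h t0\<bar> < 1"
        using near[OF hc, of 1] by auto
      obtain n where n: "(?h t0 + 1) / (?w t0 / 2) \<le> real n" using real_arch_simple by blast
      show ?thesis
      proof (intro exI[of _ "T1 \<inter> T2"] exI[of _ n] conjI ballI)
        fix s assume s: "s \<in> T1 \<inter> T2 \<inter> {0..1}"
        have 1: "\<bar>?h s - ?h t0\<bar> < 1" using s T2(3) by blast
        have 2: "\<bar>?w s - ?w t0\<bar> < ?w t0 / 2" using s T1(3) by blast
        have "?h s \<le> ?h t0 + 1" using 1 by linarith
        also have "\<dots> \<le> real n * (?w t0 / 2)" using n pos by (simp add: field_simps)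
        also have "\<dots> \<le> real n * ?w s" using 2 by (intro mult_left_mono) linarith+
        finally show "?h s \<le> real n * ?w s" .
      qed (use T1 T2 in auto)
    qed
  qed
  then obtain n where n: "\<forall>s\<in>{0..1}. ?h s \<le> real n * ?w s" by blast
  have "(\<Sum>i\<in>S. (u t i - v t i)\<^sup>2) \<le>
    ((\<Sum>i\<in>S. (u 0 i - v 0 i)\<^sup>2) + real (card S) * (0::real)\<^sup>2) * exp (1 + 2 * real n * card S)"
  proof (rule sum_squares_gronwall[OF F(1) _ _ _ _ t, where w' = "\<lambda>t i. f i (u t) - f i (v t)"])
    fix s :: real and i assume s: "s \<in> {0..1}" and i: "i \<in> S"
    show "((\<lambda>t. u t i - v t i) has_real_derivative f i (u s) - f i (v s)) (at s within {0..1})"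
      by (intro DERIV_diff solD(4)[OF assms(2) s i] solD(4)[OF assms(3) s i])
    have "\<bar>f i (u s) - f i (v s)\<bar> \<le> ?h s"
      by (rule member_le_sum[OF i, of "\<lambda>i. \<bar>f i (u s) - f i (v s)\<bar>"]) (use F(1) in auto)
    then show "\<bar>f i (u s) - f i (v s)\<bar> \<le> 0 + real n * ?w s" using n s by fastforce
  qed auto
  also have "(\<Sum>i\<in>S. (u 0 i - v 0 i)\<^sup>2) = 0"
    using assms(4) by (simp add: solD(1)[OF assms(2)] solD(1)[OF assms(3)])
  finally have le: "(\<Sum>i\<in>S. (u t i - v t i)\<^sup>2) \<le> 0" by simp
  have "(u t i - v t i)\<^sup>2 \<le> (\<Sum>i\<in>S. (u t i - v t i)\<^sup>2)"
    by (rule member_le_sum[OF i, of "\<lambda>i. (u t i - v t i)\<^sup>2"]) (use F(1) in auto)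
  with le have "(u t i - v t i)\<^sup>2 \<le> 0" by linarith
  then show ?thesis by simp
qed

section \<open>The time-one map: domain and continuity\<close>

lemma time_one_eq:
  assumes "coord_field S \<Omega> f" "sol S \<Omega> f p u"
  shows "time_one S \<Omega> f p i = u 1 i"
proof -
  have s: "sol S \<Omega> f p (SOME u. sol S \<Omega> f p u)" by (rule someI[of "sol S \<Omega> f p", OF assms(2)])
  show ?thesis
  proof (cases "i \<in> S")
    case True
    then show ?thesis unfolding time_one_def by (intro sol_unique[OF assms(1) s assms(2)]) auto
  next
    case False
    then show ?thesis unfolding time_one_def using solD(3)[OF s] solD(3)[OF assms(2)] by simp
  qed
qed

lemma open_cylinder_sol_dom:
  assumes "coord_field S \<Omega> f"
  shows "open_cylinder S (sol_dom S \<Omega> f)"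
proof (rule open_cylinderI_box)
  show "finite S" using coord_fieldD[OF assms] by blast
  fix p assume "p \<in> sol_dom S \<Omega> f"
  then obtain u where "sol S \<Omega> f p u" by (auto simp: sol_dom_def)
  from sol_stability[OF assms this]
  show "\<exists>e>0. \<forall>x. (\<forall>i\<in>S. \<bar>x i - p i\<bar> < e) \<longrightarrow> x \<in> sol_dom S \<Omega> f"
    unfolding sol_dom_def mem_Collect_eq by (elim exE conjE) (intro exI conjI, assumption, blast)
qed

lemma depends_only_on_time_one:
  assumes "coord_field S \<Omega> f" "i \<in> S"
  shows "depends_only_on S (sol_dom S \<Omega> f) (\<lambda>p. time_one S \<Omega> f p i)"
  unfolding depends_only_on_def sol_dom_def
proof (intro ballI impI)
  fix p q assume pq: "p \<in> {p. \<exists>u. sol S \<Omega> f p u}" "q \<in> {p. \<exists>u. sol S \<Omega> f p u}" "agree_on S p q"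
  then obtain u v where uv: "sol S \<Omega> f p u" "sol S \<Omega> f q v" by blast
  have "u 1 i = v 1 i" by (rule sol_unique[OF assms(1) uv _ _ assms(2)]) (use pq in \<open>auto simp: agree_on_def\<close>)
  then show "time_one S \<Omega> f p i = time_one S \<Omega> f q i"
    using time_one_eq[OF assms(1)] uv by metis
qed

lemma continuous_on_time_one:
  assumes F: "coord_field S \<Omega> f" and i: "i \<in> S"
  shows "continuous_on (sol_dom S \<Omega> f) (\<lambda>p. time_one S \<Omega> f p i)"
  unfolding continuous_on_def
proof (intro ballI tendstoI)
  fix p and e :: real assume p: "p \<in> sol_dom S \<Omega> f" and e: "e > 0"
  then obtain u where u: "sol S \<Omega> f p u" by (auto simp: sol_dom_def)
  obtain d C where dC: "d > 0" "C \<ge> 0" "\<forall>q. (\<forall>i\<in>S. \<bar>q i - p i\<bar> < d) \<longrightarrow>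
    (\<exists>v. sol S \<Omega> f q v \<and> (\<forall>t\<in>{0..1}. (\<Sum>i\<in>S. (v t i - u t i)\<^sup>2) \<le> C * (\<Sum>i\<in>S. (q i - p i)\<^sup>2)))"
    using sol_stability[OF F u] by blast
  have fin: "finite S" using coord_fieldD[OF F] by blast
  \<comment> \<open>Makes (C + 1)(card S + 1) r^2 at most e^2; the added ones keep the denominator
    positive and the final estimate strict.\<close>
  define r where "r = min d (e / sqrt ((C + 1) * (card S + 1)))"
  have r: "r > 0" using dC e by (auto simp: r_def)
  have r2: "(C + 1) * (card S + 1) * r\<^sup>2 \<le> e\<^sup>2"
  proof -
    have pos: "(C + 1) * (card S + 1) > 0" using dC by simp
    have "r\<^sup>2 \<le> (e / sqrt ((C + 1) * (card S + 1)))\<^sup>2" using r by (intro power_mono) (auto simp: r_def)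
    also have "\<dots> = e\<^sup>2 / ((C + 1) * (card S + 1))" using pos by (simp add: power_divide)
    finally show ?thesis using pos by (simp add: pos_le_divide_eq mult.commute)
  qed
  have "dist (time_one S \<Omega> f q i) (time_one S \<Omega> f p i) < e" if q: "\<forall>i\<in>S. \<bar>q i - p i\<bar> < r" for q
  proof -
    have "\<forall>i\<in>S. \<bar>q i - p i\<bar> < d" using q by (auto simp: r_def)
    then obtain v where v: "sol S \<Omega> f q v"
      "\<forall>t\<in>{0..1}. (\<Sum>i\<in>S. (v t i - u t i)\<^sup>2) \<le> C * (\<Sum>i\<in>S. (q i - p i)\<^sup>2)" using dC by blast
    have "(v 1 i - u 1 i)\<^sup>2 \<le> (\<Sum>i\<in>S. (v 1 i - u 1 i)\<^sup>2)"
      by (rule member_le_sum[OF i, of "\<lambda>i. (v 1 i - u 1 i)\<^sup>2"]) (use fin in auto)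
    also have "\<dots> \<le> C * (\<Sum>i\<in>S. (q i - p i)\<^sup>2)" using v(2) by simp
    also have "\<dots> \<le> C * (\<Sum>i\<in>S. r\<^sup>2)"
      using q dC by (intro mult_left_mono sum_mono) (metis abs_ge_zero less_imp_le power2_abs power_mono)+
    also have "\<dots> = C * card S * r\<^sup>2" by simp
    also have "\<dots> < (C + 1) * (card S + 1) * r\<^sup>2"
    proof -
      have "C * card S < (C + 1) * (card S + 1)" using dC by (simp add: algebra_simps add_nonneg_pos)
      then show ?thesis using r by (intro mult_strict_right_mono) auto
    qed
    also note r2
    finally have "\<bar>v 1 i - u 1 i\<bar> < e" using e power2_less_imp_less[of "\<bar>v 1 i - u 1 i\<bar>" e] by simp
    then show ?thesis using time_one_eq[OF F u] time_one_eq[OF F v(1)] by (simp add: dist_real_def)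
  qed
  then show "\<forall>\<^sub>F q in at p within sol_dom S \<Omega> f. dist (time_one S \<Omega> f q i) (time_one S \<Omega> f p i) < e"
    unfolding eventually_at_topological using r open_box[OF fin, of p r]
    by (intro exI[of _ "{x. \<forall>i\<in>S. \<bar>x i - p i\<bar> < r}"]) auto
qed


subsection \<open>Smooth dependence on the initial point\<close>

text \<open>
  The tangent lift of a field: the coordinate \<open>\<sigma> i\<close> is the \<open>i\<close>-th component of the tangent vector.
  The partial derivatives of the time-one map are components of the time-one map of the tangent
  lift, so that continuity of time-one maps of all fields gives their smoothness.
\<close>

definition tangent_lift :: "('i \<Rightarrow> 'i) \<Rightarrow> 'i set \<Rightarrow> ('i \<Rightarrow> ('i \<Rightarrow> real) \<Rightarrow> real) \<Rightarrow> 'i \<Rightarrow> ('i \<Rightarrow> real) \<Rightarrow> real" where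
  "tangent_lift \<sigma> S f k x = (if k \<in> S then f k x
     else \<Sum>j\<in>S. pderiv_at j (f (inv_into S \<sigma> k)) x * x (\<sigma> j))"

lemma coord_field_tangent_lift:
  assumes F: "coord_field S \<Omega> f" and \<sigma>: "inj_on \<sigma> S" "\<sigma> ` S \<inter> S = {}"
  shows "coord_field (S \<union> \<sigma> ` S) \<Omega> (tangent_lift \<sigma> S f)"
  unfolding coord_field_def
proof (intro conjI ballI)
  note D = coord_fieldD[OF F]
  show "finite (S \<union> \<sigma> ` S)" using D by simp
  show "open_cylinder (S \<union> \<sigma> ` S) \<Omega>" by (rule open_cylinder_mono[OF D(2)]) simp
  fix k assume k: "k \<in> S \<union> \<sigma> ` S"
  show "depends_only_on (S \<union> \<sigma> ` S) \<Omega> (tangent_lift \<sigma> S f k)"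
  proof (cases "k \<in> S")
    case True
    then have "tangent_lift \<sigma> S f k = f k" by (simp add: tangent_lift_def fun_eq_iff)
    then show ?thesis using D(4)[OF True] depends_only_on_mono by (metis Un_upper1 order_refl)
  next
    case False
    then obtain i where i: "i \<in> S" "k = \<sigma> i" using k by auto
    show ?thesis
      unfolding depends_only_on_def
    proof (intro ballI impI)
      fix p q assume pq: "p \<in> \<Omega>" "q \<in> \<Omega>" "agree_on (S \<union> \<sigma> ` S) p q"
      have "pderiv_at j (f i) p = pderiv_at j (f i) q" for j
        by (rule depends_only_onD[OF depends_only_on_pderiv[OF D(2) D(4)[OF i(1)]] pq(1,2)])
          (use pq(3) in \<open>auto simp: agree_on_def\<close>)
      moreover have "p (\<sigma> j) = q (\<sigma> j)" if "j \<in> S" for j using pq(3) that by (auto simp: agree_on_def)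
      ultimately show "tangent_lift \<sigma> S f k p = tangent_lift \<sigma> S f k q"
        using False i \<sigma>(1) by (simp add: tangent_lift_def)
    qed
  qed
  show "smooth_coords \<Omega> (tangent_lift \<sigma> S f k)"
  proof (cases "k \<in> S")
    case True
    then have "tangent_lift \<sigma> S f k = f k" by (simp add: tangent_lift_def fun_eq_iff)
    then show ?thesis using D(5)[OF True] by simp
  next
    case False
    then obtain i where i: "i \<in> S" "k = \<sigma> i" using k by auto
    have "tangent_lift \<sigma> S f k = (\<lambda>x. \<Sum>j\<in>S. pderiv_at j (f i) x * x (\<sigma> j))"
      using False i \<sigma>(1) by (simp add: tangent_lift_def fun_eq_iff)
    moreover have "smooth_coords \<Omega> (\<lambda>x. \<Sum>j\<in>S. pderiv_at j (f i) x * x (\<sigma> j))"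
      by (intro smooth_coords_sum smooth_coords_mult smooth_coords_pderiv D(3) D(5) i smooth_coords_coord)
    ultimately show ?thesis by simp
  qed
qed

text \<open>The variational equation along u is linear with coefficients continuous on the unit
  interval, hence globally Lipschitz. A tangent vector is therefore transported for as long as u
  exists.\<close>

lemma sol_tangent_lift:
  assumes F: "coord_field S \<Omega> f" and \<sigma>: "inj_on \<sigma> S" "\<sigma> ` S \<inter> S = {}"
    and u: "sol S \<Omega> f p u" and q: "\<And>i. i \<in> S \<Longrightarrow> q i = p i"
  shows "\<exists>U. sol (S \<union> \<sigma> ` S) \<Omega> (tangent_lift \<sigma> S f) q U"
proof -
  note D = coord_fieldD[OF F]
  define A where "A t i j = pderiv_at j (f i) (u t)" for t i j
  have Ac: "continuous_on {0..1} (\<lambda>t. A t i j)" if i: "i \<in> S" for i j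
    unfolding A_def
    by (rule continuous_on_compose2[OF smooth_coords_cont[OF smooth_coords_pderiv[OF D(5)[OF i]]] sol_cont[OF u]])
      (use solD(2)[OF u] in auto)
  have "\<exists>M\<ge>0. \<forall>t\<in>{0..1}. \<bar>A t i j\<bar> \<le> M" if "i \<in> S" for i j
  proof -
    have "compact ((\<lambda>t. A t i j) ` {0..1})"
      using Ac[OF that] by (intro compact_continuous_image) auto
    then obtain M where "\<forall>x\<in>(\<lambda>t. A t i j) ` {0..1}. norm x \<le> M"
      using compact_imp_bounded bounded_iff by metis
    then show ?thesis by (intro exI[of _ "\<bar>M\<bar>"]) force
  qed
  then obtain B where B: "\<And>i j. i \<in> S \<Longrightarrow> B i j \<ge> 0" "\<And>i j t. i \<in> S \<Longrightarrow> t \<in> {0..1} \<Longrightarrow> \<bar>A t i j\<bar> \<le> B i j"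
    by metis
  define M where "M = (\<Sum>i\<in>S. \<Sum>j\<in>S. B i j)"
  have AM: "\<bar>A t i j\<bar> \<le> M" if "i \<in> S" "j \<in> S" "t \<in> {0..1}" for i j t
  proof -
    have "\<bar>A t i j\<bar> \<le> B i j" using B that by blast
    also have "\<dots> \<le> (\<Sum>j\<in>S. B i j)" by (rule member_le_sum) (use that B D(1) in auto)
    also have "\<dots> \<le> M" unfolding M_def
      by (rule member_le_sum[of i S "\<lambda>i. \<Sum>j\<in>S. B i j"]) (use that B D(1) in \<open>auto intro: sum_nonneg\<close>)
    finally show ?thesis .
  qed
  define g where "g t x i = (\<Sum>j\<in>S. A t i j * x j)" for t i and x :: "'a \<Rightarrow> real"
  have "\<exists>v. v 0 = (\<lambda>i. q (\<sigma> i)) \<and> (\<forall>t i. i \<notin> S \<longrightarrow> v t i = q (\<sigma> i)) \<and>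
    (\<forall>t\<in>{0..1}. \<forall>i\<in>S. ((\<lambda>t. v t i) has_real_derivative g t (v t) i) (at t within {0..1}))"
  proof (rule picard[OF D(1)])
    show "continuous_on {0..1} (\<lambda>t. g t (x t) i)" if "i \<in> S" "\<forall>j\<in>S. continuous_on {0..1} (\<lambda>t. x t j)" for x i
      unfolding g_def using that Ac by (intro continuous_intros) auto
    fix t :: real and x y :: "'a \<Rightarrow> real" and i assume t: "t \<in> {0..1}" and i: "i \<in> S"
    have "g t x i - g t y i = (\<Sum>j\<in>S. A t i j * (x j - y j))"
      by (simp add: g_def right_diff_distrib sum_subtractf)
    then have "\<bar>g t x i - g t y i\<bar> \<le> (\<Sum>j\<in>S. \<bar>A t i j * (x j - y j)\<bar>)"
      by (simp only:) (rule sum_abs)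
    also have "\<dots> \<le> (\<Sum>j\<in>S. M * \<bar>x j - y j\<bar>)"
      unfolding abs_mult using AM[OF i _ t] by (intro sum_mono mult_right_mono) auto
    also have "\<dots> = M * (\<Sum>j\<in>S. \<bar>x j - y j\<bar>)" by (simp add: sum_distrib_left)
    finally show "\<bar>g t x i - g t y i\<bar> \<le> M * (\<Sum>j\<in>S. \<bar>x j - y j\<bar>)" .
  qed
  then obtain v where v: "v 0 = (\<lambda>i. q (\<sigma> i))"
    "\<forall>t\<in>{0..1}. \<forall>i\<in>S. ((\<lambda>t. v t i) has_real_derivative g t (v t) i) (at t within {0..1})"
    by blast
  define U where "U t k = (if k \<in> S then u t k else if k \<in> \<sigma> ` S then v t (inv_into S \<sigma> k) else q k)" for t k
  have US: "U t i = u t i" if "i \<in> S" for t i using that by (simp add: U_def)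
  have U\<sigma>: "U t (\<sigma> i) = v t i" if "i \<in> S" for t i
  proof -
    have "\<sigma> i \<notin> S" using \<sigma>(2) that by blast
    then show ?thesis using that \<sigma>(1) by (simp add: U_def)
  qed
  have Uin: "U t \<in> \<Omega>" if "t \<in> {0..1}" for t
    by (rule open_cylinder_agree[OF D(2) solD(2)[OF u that]]) (simp add: US)
  have "sol (S \<union> \<sigma> ` S) \<Omega> (tangent_lift \<sigma> S f) q U"
    unfolding sol_def
  proof (intro conjI ballI allI impI)
    show "U 0 = q"
      using q solD(1)[OF u] v(1) by (auto simp: U_def fun_eq_iff f_inv_into_f)
    fix t :: real assume t: "t \<in> {0..1}"
    show "U t \<in> \<Omega>" by (rule Uin[OF t])
    show "U t k = q k" if "k \<notin> S \<union> \<sigma> ` S" for k using that by (simp add: U_def)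
    fix k assume k: "k \<in> S \<union> \<sigma> ` S"
    show "((\<lambda>t. U t k) has_real_derivative tangent_lift \<sigma> S f k (U t)) (at t within {0..1})"
    proof (cases "k \<in> S")
      case True
      have "f k (U t) = f k (u t)"
        by (rule depends_only_onD[OF D(4)[OF True] Uin[OF t] solD(2)[OF u t]]) (simp add: US)
      then show ?thesis using solD(4)[OF u t True] True by (simp add: US tangent_lift_def)
    next
      case False
      then obtain i where i: "i \<in> S" "k = \<sigma> i" using k by auto
      have "pderiv_at j (f i) (U t) = A t i j" for j
        unfolding A_def
        by (rule depends_only_onD[OF depends_only_on_pderiv[OF D(2) D(4)[OF i(1)]] Uin[OF t] solD(2)[OF u t]])
          (simp add: US)
      then have "tangent_lift \<sigma> S f k (U t) = g t (v t) i"
        using False i \<sigma>(1) by (simp add: tangent_lift_def g_def U\<sigma>)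
      then show ?thesis using v(2) t i by (simp add: U\<sigma>)
    qed
  qed
  then show ?thesis by blast
qed

text \<open>The point q carries the tangent vector in direction c. The error w = z - u - h v between
  the solution z from the shifted point and its linearization starts at 0 and satisfies a linear
  equation up to a term of size h^2, so Gronwall bounds it by Q h^2 and the difference quotient
  converges.\<close>

lemma time_one_deriv:
  assumes F: "coord_field S \<Omega> f" and \<sigma>: "inj_on \<sigma> S" "\<sigma> ` S \<inter> S = {}"
    and p: "p \<in> sol_dom S \<Omega> f" and c: "c \<in> S" and i: "i \<in> S"
    and q: "q = (\<lambda>k. if k \<in> \<sigma> ` S then (if k = \<sigma> c then 1 else 0) else p k)"
  shows "((\<lambda>s. time_one S \<Omega> f (p(c := s)) i) has_real_derivative
    time_one (S \<union> \<sigma> ` S) \<Omega> (tangent_lift \<sigma> S f) q (\<sigma> i)) (at (p c))"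
proof -
  note D = coord_fieldD[OF F]
  let ?T = "tangent_lift \<sigma> S f" and ?S = "S \<union> \<sigma> ` S"
  have \<sigma>S: "\<sigma> j \<notin> S" if "j \<in> S" for j using \<sigma>(2) that by blast
  have qS: "q j = p j" if "j \<in> S" for j using that \<sigma>(2) by (auto simp: q)
  have q\<sigma>: "q (\<sigma> j) = (if j = c then 1 else 0)" if "j \<in> S" for j
    using that c inj_onD[OF \<sigma>(1), of j c] by (auto simp: q)
  obtain u0 where u0: "sol S \<Omega> f p u0" using p by (auto simp: sol_dom_def)
  obtain U where U: "sol ?S \<Omega> ?T q U" using sol_tangent_lift[OF F \<sigma> u0 qS] by blast
  define u where "u = u0"
  define v where "v t j = U t (\<sigma> j)" for t j
  have u: "sol S \<Omega> f p u" using u0 by (simp add: u_def)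
  have T: "coord_field ?S \<Omega> ?T" by (rule coord_field_tangent_lift[OF F \<sigma>])
  \<comment> \<open>The part of the lifted solution over S is again a solution of the original
    field, hence equal to u by uniqueness.\<close>
  have Uu: "U t j = u t j" if t: "t \<in> {0..1}" and j: "j \<in> S" for t j
  proof -
    define U' where "U' t k = (if k \<in> S then U t k else p k)" for t k
    have US': "U' t k = U t k" if "k \<in> S" for t k using that by (simp add: U'_def)
    have U'in: "U' t \<in> \<Omega>" if "t \<in> {0..1}" for t
      by (rule open_cylinder_agree[OF D(2) solD(2)[OF U that]]) (simp add: U'_def)
    have "sol S \<Omega> f p U'"
      unfolding sol_def
    proof (intro conjI ballI allI impI)
      show "U' 0 = p" using solD(1)[OF U] qS by (auto simp: U'_def)
      fix t :: real assume t: "t \<in> {0..1}"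
      show "U' t \<in> \<Omega>" by (rule U'in[OF t])
      show "((\<lambda>t. U' t k) has_real_derivative f k (U' t)) (at t within {0..1})" if k: "k \<in> S" for k
      proof -
        have "f k (U' t) = f k (U t)"
          by (rule depends_only_onD[OF D(4)[OF k] U'in[OF t] solD(2)[OF U t]]) (simp add: US')
        then show ?thesis using solD(4)[OF U t, of k] k by (simp add: US' tangent_lift_def)
      qed
    qed (simp add: U'_def)
    from sol_unique[OF F this u _ t j] show ?thesis by (simp add: US'[OF j])
  qed
  define A where "A t k j = pderiv_at j (f k) (u t)" for t k j
  have vder: "((\<lambda>t. v t k) has_real_derivative (\<Sum>j\<in>S. A t k j * v t j)) (at t within {0..1})"
    if t: "t \<in> {0..1}" and k: "k \<in> S" for t k
  proof -
    have "pderiv_at j (f k) (U t) = A t k j" for j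
      unfolding A_def
      by (rule depends_only_onD[OF depends_only_on_pderiv[OF D(2) D(4)[OF k]] solD(2)[OF U t] solD(2)[OF u t]])
        (simp add: Uu[OF t])
    then have "?T (\<sigma> k) (U t) = (\<Sum>j\<in>S. A t k j * v t j)"
      using \<sigma>S[OF k] k \<sigma>(1) by (simp add: tangent_lift_def v_def)
    then show ?thesis using solD(4)[OF U t, of "\<sigma> k"] k by (simp add: v_def)
  qed
  define H where "H = (\<lambda>(k, j). pderiv_at j (f k)) ` (S \<times> S)"
  have H: "depends_only_on S \<Omega> h \<and> smooth_coords \<Omega> h" if "h \<in> H" for h
    using that by (auto simp: H_def intro!: depends_only_on_pderiv[OF D(2)] smooth_coords_pderiv D(4,5))
  have fH: "finite H" using D(1) by (simp add: H_def)
  obtain e L where e: "e > 0" and L: "L \<ge> 0"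
    and TU: "\<forall>t\<in>{0..1::real}. (\<forall>x. (\<forall>i\<in>S. \<bar>x i - u t i\<bar> \<le> e) \<longrightarrow> x \<in> \<Omega>) \<and>
    (\<forall>h\<in>H. \<forall>x y. (\<forall>i\<in>S. \<bar>x i - u t i\<bar> \<le> e) \<longrightarrow> (\<forall>i\<in>S. \<bar>y i - u t i\<bar> \<le> e) \<longrightarrow>
      \<bar>h x - h y\<bar> \<le> L * (\<Sum>i\<in>S. \<bar>x i - y i\<bar>))"
    using tube[OF D(1,2) fH H sol_cont_coord[OF u] solD(2)[OF u]] by blast
  have "\<exists>M\<ge>0. \<forall>t\<in>{0..1}. \<bar>A t k j\<bar> \<le> M" if "k \<in> S" for k j
  proof -
    have "continuous_on {0..1} (\<lambda>t. A t k j)"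
      unfolding A_def
      by (rule continuous_on_compose2[OF smooth_coords_cont[OF smooth_coords_pderiv[OF D(5)[OF that]]] sol_cont[OF u]])
        (use solD(2)[OF u] in auto)
    then have "compact ((\<lambda>t. A t k j) ` {0..1})" by (intro compact_continuous_image) auto
    then obtain M where "\<forall>x\<in>(\<lambda>t. A t k j) ` {0..1}. norm x \<le> M"
      using compact_imp_bounded bounded_iff by metis
    then show ?thesis by (intro exI[of _ "\<bar>M\<bar>"]) force
  qed
  then obtain B where B: "\<And>k j. k \<in> S \<Longrightarrow> B k j \<ge> 0" "\<And>k j t. k \<in> S \<Longrightarrow> t \<in> {0..1} \<Longrightarrow> \<bar>A t k j\<bar> \<le> B k j"
    by metis
  define M where "M = (\<Sum>k\<in>S. \<Sum>j\<in>S. B k j)"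
  have M0: "M \<ge> 0" unfolding M_def using B by (intro sum_nonneg) auto
  have AM: "\<bar>A t k j\<bar> \<le> M" if "k \<in> S" "j \<in> S" "t \<in> {0..1}" for k j t
  proof -
    have "\<bar>A t k j\<bar> \<le> B k j" using B that by blast
    also have "\<dots> \<le> (\<Sum>j\<in>S. B k j)" by (rule member_le_sum) (use that B D(1) in auto)
    also have "\<dots> \<le> M" unfolding M_def
      by (rule member_le_sum[of k S "\<lambda>k. \<Sum>j\<in>S. B k j"]) (use that B D(1) in \<open>auto intro: sum_nonneg\<close>)
    finally show ?thesis .
  qed
  obtain d C where dC: "d > 0" "C \<ge> 0" "\<forall>q. (\<forall>i\<in>S. \<bar>q i - p i\<bar> < d) \<longrightarrow>
    (\<exists>v. sol S \<Omega> f q v \<and> (\<forall>t\<in>{0..1}. (\<Sum>i\<in>S. (v t i - u t i)\<^sup>2) \<le> C * (\<Sum>i\<in>S. (q i - p i)\<^sup>2)))"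
    using sol_stability[OF F u] by blast
  define K where "K = real (card S)"
  \<comment> \<open>The Gronwall bound for w at time 1, with initial value 0 and inhomogeneity L K C
    h^2, is (Q h^2)^2.\<close>
  define Q where "Q = sqrt (K * (L * K * C)\<^sup>2 * exp (1 + 2 * M * K))"
  have K: "K \<ge> 0" by (simp add: K_def)
  have Q: "Q \<ge> 0" by (simp add: Q_def K)
  \<comment> \<open>The bound d provides the solution z; the bound e / (C + 1) keeps it in the tube,
    since it gives C h^2 \<le> e^2.\<close>
  define r where "r = min d (e / (C + 1))"
  have r: "r > 0" using dC e by (simp add: r_def)
  have key: "\<bar>time_one S \<Omega> f (p(c := p c + h)) i - time_one S \<Omega> f p i - h * v 1 i\<bar> \<le> Q * h\<^sup>2"
    if h: "\<bar>h\<bar> < r" "\<bar>h\<bar> \<le> 1" for h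
  proof -
    define ph where "ph = p(c := p c + h)"
    have sumh: "(\<Sum>i\<in>S. (ph i - p i)\<^sup>2) = h\<^sup>2"
    proof -
      have "(\<Sum>i\<in>S. (ph i - p i)\<^sup>2) = (\<Sum>i\<in>S. if i = c then h\<^sup>2 else 0)"
        by (intro sum.cong) (auto simp: ph_def)
      then show ?thesis using c D(1) by simp
    qed
    have "\<forall>i\<in>S. \<bar>ph i - p i\<bar> < d" using h dC(1) by (auto simp: ph_def r_def)
    then obtain z where z: "sol S \<Omega> f ph z"
      "\<And>t. t \<in> {0..1} \<Longrightarrow> (\<Sum>i\<in>S. (z t i - u t i)\<^sup>2) \<le> C * h\<^sup>2"
      using dC(3)[THEN spec, of ph] unfolding sumh by blast
    have Ch: "C * h\<^sup>2 \<le> e\<^sup>2"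
    proof -
      have "\<bar>h\<bar> \<le> e / (C + 1)" using h by (simp add: r_def)
      then have "h\<^sup>2 \<le> (e / (C + 1))\<^sup>2" by (metis abs_ge_zero power2_abs power_mono)
      then have "C * h\<^sup>2 \<le> (C + 1)\<^sup>2 * (e / (C + 1))\<^sup>2"
        using dC(2) by (intro mult_mono) (auto simp: power2_eq_square algebra_simps)
      also have "\<dots> = e\<^sup>2" using dC(2) by (simp add: power_divide)
      finally show ?thesis .
    qed
    have near: "\<bar>z t k - u t k\<bar> \<le> e" if t: "t \<in> {0..1}" and k: "k \<in> S" for t k
    proof -
      have "(z t k - u t k)\<^sup>2 \<le> (\<Sum>i\<in>S. (z t i - u t i)\<^sup>2)"
        by (rule member_le_sum[OF k, of "\<lambda>i. (z t i - u t i)\<^sup>2"]) (use D(1) in auto)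
      also have "\<dots> \<le> e\<^sup>2" using z(2)[OF t] Ch by linarith
      finally show ?thesis using e abs_le_square_iff[of "z t k - u t k" e] by simp
    qed
    define w where "w t k = z t k - u t k - h * v t k" for t k
    define w' where "w' t k = f k (z t) - f k (u t) - h * (\<Sum>j\<in>S. A t k j * v t j)" for t k
    have wder: "((\<lambda>t. w t k) has_real_derivative w' t k) (at t within {0..1})"
      if t: "t \<in> {0..1}" and k: "k \<in> S" for t k
      unfolding w_def w'_def
      by (intro DERIV_diff DERIV_cmult vder[OF t k] solD(4)[OF z(1) t k] solD(4)[OF u t k])
    have wbound: "\<bar>w' t k\<bar> \<le> L * K * C * h\<^sup>2 + M * (\<Sum>j\<in>S. \<bar>w t j\<bar>)"
      if t: "t \<in> {0..1}" and k: "k \<in> S" for t k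
    proof -
      let ?s = "\<Sum>j\<in>S. \<bar>z t j - u t j\<bar>"
      \<comment> \<open>The remainder of f is quadratic: on the box about u t that reaches to z t,
        its derivatives change by at most L times the distance.\<close>
      have "\<bar>f k (z t) - f k (u t) - (\<Sum>j\<in>S. A t k j * (z t j - u t j))\<bar> \<le> (L * ?s) * ?s"
      proof (rule mean_value_box[OF D(1) box_convex_cbox[of S "u t" "\<lambda>j. \<bar>z t j - u t j\<bar>"],
            where f' = "\<lambda>j. pderiv_at j (f k)"])
        fix x j assume x: "x \<in> {x. \<forall>j\<in>S. \<bar>x j - u t j\<bar> \<le> \<bar>z t j - u t j\<bar>}" and j: "j \<in> S"
        have xe: "\<forall>i\<in>S. \<bar>x i - u t i\<bar> \<le> e" using x near[OF t] by fastforce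
        then have "x \<in> \<Omega>" using TU t by blast
        then show "((\<lambda>s. f k (x(j := s))) has_real_derivative pderiv_at j (f k) x) (at (x j))"
          by (rule smooth_coords_DERIV[OF D(5)[OF k]])
        have "pderiv_at j (f k) \<in> H" using j k by (auto simp: H_def)
        moreover have "\<forall>i\<in>S. \<bar>u t i - u t i\<bar> \<le> e" using e by simp
        ultimately have "\<bar>pderiv_at j (f k) x - pderiv_at j (f k) (u t)\<bar> \<le> L * (\<Sum>i\<in>S. \<bar>x i - u t i\<bar>)"
          using TU t xe by blast
        also have "\<dots> \<le> L * ?s" using x L by (intro mult_left_mono sum_mono) auto
        finally show "\<bar>pderiv_at j (f k) x - A t k j\<bar> \<le> L * ?s" by (simp add: A_def)
      next
        show "u t j = z t j" if "j \<notin> S" for j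
          using that c solD(3)[OF u t that] solD(3)[OF z(1) t that] by (auto simp: ph_def)
      qed auto
      also have "(L * ?s) * ?s = L * ?s\<^sup>2" by (simp add: power2_eq_square)
      also have "\<dots> \<le> L * (C * h\<^sup>2 * K)"
      proof (intro mult_left_mono L)
        have "?s\<^sup>2 \<le> (\<Sum>j\<in>S. (z t j - u t j)\<^sup>2) * K"
          using sum_squared_le_sum_of_squares[of "\<lambda>j. \<bar>z t j - u t j\<bar>" S] by (simp add: K_def)
        also have "\<dots> \<le> C * h\<^sup>2 * K" using z(2)[OF t] K by (intro mult_right_mono)
        finally show "?s\<^sup>2 \<le> C * h\<^sup>2 * K" .
      qed
      finally have 1: "\<bar>f k (z t) - f k (u t) - (\<Sum>j\<in>S. A t k j * (z t j - u t j))\<bar> \<le> L * K * C * h\<^sup>2"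
        by (simp add: mult.commute mult.left_commute)
      have 2: "w' t k = (f k (z t) - f k (u t) - (\<Sum>j\<in>S. A t k j * (z t j - u t j))) + (\<Sum>j\<in>S. A t k j * w t j)"
        unfolding w'_def w_def
        by (simp add: right_diff_distrib sum_subtractf sum_distrib_left mult.left_commute)
      have "\<bar>\<Sum>j\<in>S. A t k j * w t j\<bar> \<le> (\<Sum>j\<in>S. \<bar>A t k j * w t j\<bar>)" by (rule sum_abs)
      also have "\<dots> \<le> (\<Sum>j\<in>S. M * \<bar>w t j\<bar>)"
        unfolding abs_mult using AM[OF k _ t] by (intro sum_mono mult_right_mono) auto
      also have "\<dots> = M * (\<Sum>j\<in>S. \<bar>w t j\<bar>)" by (simp add: sum_distrib_left)
      finally show ?thesis using 1 2 by linarith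
    qed
    have "(\<Sum>k\<in>S. (w 1 k)\<^sup>2) \<le>
      ((\<Sum>k\<in>S. (w 0 k)\<^sup>2) + card S * (L * K * C * h\<^sup>2)\<^sup>2) * exp (1 + 2 * M * card S)"
      by (rule sum_squares_gronwall[OF D(1) wder wbound _ M0]) (use L K dC(2) in auto)
    moreover have "w 0 k = 0" if "k \<in> S" for k
      using that q\<sigma>[OF that] by (auto simp: w_def v_def solD(1)[OF z(1)] solD(1)[OF u] solD(1)[OF U] ph_def)
    ultimately have "(\<Sum>k\<in>S. (w 1 k)\<^sup>2) \<le> K * (L * K * C * h\<^sup>2)\<^sup>2 * exp (1 + 2 * M * K)"
      by (simp add: K_def)
    also have "\<dots> = (Q * h\<^sup>2)\<^sup>2"
    proof -
      have "Q\<^sup>2 = K * (L * K * C)\<^sup>2 * exp (1 + 2 * M * K)" by (simp add: Q_def K)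
      then show ?thesis by (simp add: power_mult_distrib)
    qed
    finally have "(\<Sum>k\<in>S. (w 1 k)\<^sup>2) \<le> (Q * h\<^sup>2)\<^sup>2" .
    moreover have "(w 1 i)\<^sup>2 \<le> (\<Sum>k\<in>S. (w 1 k)\<^sup>2)"
      by (rule member_le_sum[OF i, of "\<lambda>k. (w 1 k)\<^sup>2"]) (use D(1) in auto)
    ultimately have "(w 1 i)\<^sup>2 \<le> (Q * h\<^sup>2)\<^sup>2" by linarith
    then have "\<bar>w 1 i\<bar> \<le> Q * h\<^sup>2" using Q abs_le_square_iff[of "w 1 i" "Q * h\<^sup>2"] by simp
    then show ?thesis
      using time_one_eq[OF F z(1)] time_one_eq[OF F u] by (simp add: w_def ph_def)
  qed
  let ?\<phi> = "\<lambda>s. time_one S \<Omega> f (p(c := s)) i"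
  have "((\<lambda>s. ?\<phi> s) has_real_derivative v 1 i) (at (p c))"
    unfolding DERIV_def
  proof (rule LIM_zero_cancel)
    show "((\<lambda>h. (?\<phi> (p c + h) - ?\<phi> (p c)) / h - v 1 i) \<longlongrightarrow> 0) (at 0)"
    proof (rule Lim_null_comparison[where g = "\<lambda>h. Q * \<bar>h\<bar>"])
      have "\<forall>\<^sub>F h in at (0::real). \<bar>h\<bar> < min r 1"
        using r eventually_at[of "\<lambda>h. \<bar>h\<bar> < min r 1" "0::real" UNIV] by (auto intro!: exI[of _ "min r 1"])
      moreover have "\<forall>\<^sub>F h in at (0::real). h \<noteq> 0" by (simp add: eventually_at_filter)
      ultimately show "\<forall>\<^sub>F h in at 0. norm ((?\<phi> (p c + h) - ?\<phi> (p c)) / h - v 1 i) \<le> Q * \<bar>h\<bar>"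
      proof eventually_elim
        case (elim h)
        have "(?\<phi> (p c + h) - ?\<phi> (p c)) / h - v 1 i = (?\<phi> (p c + h) - ?\<phi> (p c) - h * v 1 i) / h"
          using elim(2) by (simp add: field_simps)
        also have "\<bar>\<dots>\<bar> \<le> Q * h\<^sup>2 / \<bar>h\<bar>"
          using key[of h] elim unfolding abs_divide by (intro divide_right_mono) auto
        also have "\<dots> = Q * \<bar>h\<bar>" using elim(2) by (simp add: power2_eq_square abs_if)
        finally show ?case by simp
      qed
      show "((\<lambda>h. Q * \<bar>h\<bar>) \<longlongrightarrow> 0) (at 0)" by (auto intro!: tendsto_eq_intros)
    qed
  qed
  moreover have "time_one ?S \<Omega> ?T q (\<sigma> i) = v 1 i"
    using time_one_eq[OF T U] by (simp add: v_def)
  ultimately show ?thesis by simp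
qed

text \<open>Tangent coordinates are found in the same index type because it is infinite, so the
  induction on the order of differentiability can pass from S to its lift.\<close>

lemma ex_tangent_indices:
  fixes S :: "'i set"
  assumes "infinite (UNIV :: 'i set)" "finite S"
  obtains \<sigma> :: "'i \<Rightarrow> 'i" where "inj_on \<sigma> S" "\<sigma> ` S \<inter> S = {}"
proof -
  have "infinite (UNIV - S)" using assms by simp
  then obtain B where B: "finite B" "card B = card S" "B \<subseteq> UNIV - S"
    using infinite_arbitrarily_large by metis
  then obtain \<sigma> where "bij_betw \<sigma> S B" using finite_same_card_bij[OF assms(2) B(1)] by auto
  then show ?thesis using B(3) by (intro that[of \<sigma>]) (auto simp: bij_betw_def)
qed

lemma Ckc_time_one:
  fixes S :: "'i set"
  assumes inf: "infinite (UNIV :: 'i set)" and "coord_field S \<Omega> f" "i \<in> S"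
  shows "Ckc k (sol_dom S \<Omega> f) (\<lambda>p. time_one S \<Omega> f p i)"
  using assms(2,3)
proof (induction k arbitrary: S f i)
  case 0
  note D = coord_fieldD[OF 0(1)]
  obtain \<sigma> :: "'i \<Rightarrow> 'i" where \<sigma>: "inj_on \<sigma> S" "\<sigma> ` S \<inter> S = {}"
    using ex_tangent_indices[OF inf D(1)] by blast
  have "pdiff (sol_dom S \<Omega> f) (\<lambda>p. time_one S \<Omega> f p i)"
  proof (rule pdiffI[OF continuous_on_time_one[OF 0]])
    fix c p assume p: "p \<in> sol_dom S \<Omega> f"
    show "\<exists>D. ((\<lambda>s. time_one S \<Omega> f (p(c := s)) i) has_real_derivative D) (at (p c))"
    proof (cases "c \<in> S")
      case True
      then show ?thesis using time_one_deriv[OF 0(1) \<sigma> p True 0(2) refl] by blast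
    next
      case False
      have "time_one S \<Omega> f (p(c := s)) i = time_one S \<Omega> f p i" for s
        by (rule depends_only_onD[OF depends_only_on_time_one[OF 0] open_cylinder_agree[OF open_cylinder_sol_dom[OF 0(1)] p] p])
          (use False in auto)
      then show ?thesis by (auto intro: exI[of _ 0])
    qed
  qed
  then show ?case by simp
next
  case (Suc k)
  note D = coord_fieldD[OF Suc.prems(1)]
  obtain \<sigma> :: "'i \<Rightarrow> 'i" where \<sigma>: "inj_on \<sigma> S" "\<sigma> ` S \<inter> S = {}"
    using ex_tangent_indices[OF inf D(1)] by blast
  let ?T = "tangent_lift \<sigma> S f" and ?S = "S \<union> \<sigma> ` S"
  note T = coord_field_tangent_lift[OF Suc.prems(1) \<sigma>]
  have op: "open (sol_dom S \<Omega> f)" "open (sol_dom ?S \<Omega> ?T)"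
    using open_cylinder_sol_dom[OF Suc.prems(1)] open_cylinder_sol_dom[OF T] open_cylinder_open by auto
  \<comment> \<open>Original coordinates are kept and tangent coordinates become constants, so that
    the lifted time-one map, taken at the tangent vector in direction c, is a function of the
    original point.\<close>
  define \<tau> where "\<tau> k = (if k \<in> \<sigma> ` S then None else Some k)" for k
  have "Ckc k (sol_dom S \<Omega> f) (pderiv_at c (\<lambda>p. time_one S \<Omega> f p i))" for c
  proof (cases "c \<in> S")
    case True
    define a where "a k = (if k = \<sigma> c then 1 else 0 :: real)" for k
    have sub: "subst_coords \<tau> a p = (\<lambda>k. if k \<in> \<sigma> ` S then (if k = \<sigma> c then 1 else 0) else p k)" for p
      by (auto simp: subst_coords_def \<tau>_def a_def fun_eq_iff)
    show ?thesis
    proof (rule Ckc_cong[OF op(1)])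
      show "Ckc k (sol_dom S \<Omega> f) (\<lambda>p. time_one ?S \<Omega> ?T (subst_coords \<tau> a p) (\<sigma> i))"
      proof (rule Ckc_subst_coords[where \<Omega> = "sol_dom ?S \<Omega> ?T" and F = "\<lambda>q. time_one ?S \<Omega> ?T q (\<sigma> i)"])
        show "Ckc k (sol_dom ?S \<Omega> ?T) (\<lambda>q. time_one ?S \<Omega> ?T q (\<sigma> i))"
          by (rule Suc.IH[OF T]) (use Suc.prems(2) in simp)
        show "subst_coords \<tau> a ` sol_dom S \<Omega> f \<subseteq> sol_dom ?S \<Omega> ?T"
        proof (rule image_subsetI)
          fix p assume "p \<in> sol_dom S \<Omega> f"
          then obtain u where "sol S \<Omega> f p u" by (auto simp: sol_dom_def)
          then have "\<exists>U. sol ?S \<Omega> ?T (subst_coords \<tau> a p) U"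
            by (rule sol_tangent_lift[OF Suc.prems(1) \<sigma>]) (use \<sigma>(2) in \<open>auto simp: sub\<close>)
          then show "subst_coords \<tau> a p \<in> sol_dom ?S \<Omega> ?T" by (simp add: sol_dom_def)
        qed
      qed (use op in \<open>auto simp: \<tau>_def split: if_splits\<close>)
      fix p assume p: "p \<in> sol_dom S \<Omega> f"
      show "time_one ?S \<Omega> ?T (subst_coords \<tau> a p) (\<sigma> i) = pderiv_at c (\<lambda>p. time_one S \<Omega> f p i) p"
        using pderiv_at_eqI[OF time_one_deriv[OF Suc.prems(1) \<sigma> p True Suc.prems(2) sub]] by simp
    qed
  next
    case False
    show ?thesis
      by (rule Ckc_cong[OF op(1) _ Ckc_const[of _ _ 0]])
        (simp add: pderiv_at_eq_0_outside[OF op(1) depends_only_on_time_one[OF Suc.prems] False])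
  qed
  moreover have "pdiff (sol_dom S \<Omega> f) (\<lambda>p. time_one S \<Omega> f p i)"
    using Ckc_pdiff Suc.IH[OF Suc.prems] by blast
  ultimately show ?case by simp
qed

lemma smooth_coords_time_one:
  fixes S :: "'i set"
  assumes "infinite (UNIV :: 'i set)" "coord_field S \<Omega> f" "i \<in> S"
  shows "smooth_coords (sol_dom S \<Omega> f) (\<lambda>p. time_one S \<Omega> f p i)"
  using Ckc_time_one[OF assms] by (simp add: smooth_coords_iff_Ckc)


subsection \<open>Local flows\<close>

text \<open>The time is an additional coordinate, by which the field is multiplied.\<close>

definition timed_field :: "('i \<Rightarrow> ('i \<Rightarrow> real) \<Rightarrow> real) \<Rightarrow> 'i option \<Rightarrow> ('i option \<Rightarrow> real) \<Rightarrow> real" where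
  "timed_field f k P = (case k of None \<Rightarrow> 0 | Some c \<Rightarrow> P None * f c (\<lambda>d. P (Some d)))"

definition timed_coords :: "'i set \<Rightarrow> 'i option set" where
  "timed_coords S = insert None (Some ` S)"

definition timed_domain :: "('i \<Rightarrow> real) set \<Rightarrow> ('i option \<Rightarrow> real) set" where
  "timed_domain \<Omega> = {P. (\<lambda>d. P (Some d)) \<in> \<Omega>}"

definition at_time :: "('i \<Rightarrow> real) \<Rightarrow> real \<Rightarrow> 'i option \<Rightarrow> real" where
  "at_time p t = (\<lambda>c. case c of None \<Rightarrow> t | Some d \<Rightarrow> p d)"

definition flow_dom :: "'i set \<Rightarrow> ('i \<Rightarrow> real) set \<Rightarrow> ('i \<Rightarrow> ('i \<Rightarrow> real) \<Rightarrow> real) \<Rightarrow> ('i option \<Rightarrow> real) set" where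
  "flow_dom S \<Omega> f = sol_dom (timed_coords S) (timed_domain \<Omega>) (timed_field f)"

definition flow :: "'i set \<Rightarrow> ('i \<Rightarrow> real) set \<Rightarrow> ('i \<Rightarrow> ('i \<Rightarrow> real) \<Rightarrow> real) \<Rightarrow> 'i \<Rightarrow> ('i option \<Rightarrow> real) \<Rightarrow> real" where
  "flow S \<Omega> f c P = time_one (timed_coords S) (timed_domain \<Omega>) (timed_field f) P (Some c)"

lemma at_time_simps [simp]: "at_time p t None = t" "at_time p t (Some d) = p d"
  by (simp_all add: at_time_def)

lemma at_time_upd [simp]: "(at_time p t)(None := s) = at_time p s"
  by (auto simp: at_time_def fun_eq_iff split: option.splits)

lemma at_time_surj: "at_time (\<lambda>d. P (Some d)) (P None) = P"
  by (auto simp: at_time_def fun_eq_iff split: option.splits)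

lemma drop_time_subst: "subst_coords (\<lambda>j. Some (Some j)) a = (\<lambda>P d. P (Some d))"
  by (auto simp: subst_coords_def fun_eq_iff)

lemma open_cylinder_timed:
  assumes "open_cylinder S \<Omega>"
  shows "open_cylinder (timed_coords S) (timed_domain \<Omega>)"
  unfolding open_cylinder_def
proof (intro conjI ballI allI impI)
  have "continuous_on UNIV (\<lambda>P :: 'a option \<Rightarrow> real. \<lambda>d. P (Some d))"
    using continuous_on_subst_coords[of UNIV "\<lambda>j. Some (Some j)"] by (simp add: drop_time_subst)
  then have "open ((\<lambda>P. \<lambda>d. P (Some d)) -` \<Omega>)" using open_cylinder_open[OF assms] open_vimage by blast
  moreover have "(\<lambda>P. \<lambda>d. P (Some d)) -` \<Omega> = timed_domain \<Omega>" by (auto simp: timed_domain_def)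
  ultimately show "open (timed_domain \<Omega>)" by simp
  fix P Q :: "'a option \<Rightarrow> real" assume P: "P \<in> timed_domain \<Omega>" and PQ: "agree_on (timed_coords S) P Q"
  have "(\<lambda>d. Q (Some d)) \<in> \<Omega>"
    by (rule open_cylinder_agree[OF assms, of "\<lambda>d. P (Some d)"])
      (use P PQ in \<open>auto simp: timed_domain_def timed_coords_def agree_on_def\<close>)
  then show "Q \<in> timed_domain \<Omega>" by (simp add: timed_domain_def)
qed

lemma coord_field_timed:
  assumes "coord_field S \<Omega> f"
  shows "coord_field (timed_coords S) (timed_domain \<Omega>) (timed_field f)"
  unfolding coord_field_def
proof (intro conjI ballI)
  note D = coord_fieldD[OF assms]
  show "finite (timed_coords S)" using D(1) by (simp add: timed_coords_def)
  show oc: "open_cylinder (timed_coords S) (timed_domain \<Omega>)" by (rule open_cylinder_timed[OF D(2)])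
  fix k assume k: "k \<in> timed_coords S"
  show "depends_only_on (timed_coords S) (timed_domain \<Omega>) (timed_field f k)"
    unfolding depends_only_on_def
  proof (intro ballI impI)
    fix P Q assume PQ: "P \<in> timed_domain \<Omega>" "Q \<in> timed_domain \<Omega>" "agree_on (timed_coords S) P Q"
    have "f c (\<lambda>d. P (Some d)) = f c (\<lambda>d. Q (Some d))" if "c \<in> S" for c
      by (rule depends_only_onD[OF D(4)[OF that]])
        (use PQ in \<open>auto simp: timed_domain_def timed_coords_def agree_on_def\<close>)
    then show "timed_field f k P = timed_field f k Q"
      using k PQ(3) by (auto simp: timed_field_def timed_coords_def agree_on_def)
  qed
  show "smooth_coords (timed_domain \<Omega>) (timed_field f k)"
  proof (cases k)
    case None
    then have "timed_field f k = (\<lambda>_. 0)" by (auto simp: timed_field_def)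
    then show ?thesis by (simp add: smooth_coords_const)
  next
    case (Some c)
    then have c: "c \<in> S" using k by (auto simp: timed_coords_def)
    have "smooth_coords (timed_domain \<Omega>) (\<lambda>P. f c (subst_coords (\<lambda>j. Some (Some j)) (\<lambda>_. 0) P))"
      by (rule smooth_coords_subst[OF _ D(5)[OF c] D(3) open_cylinder_open[OF oc]])
        (auto simp: drop_time_subst timed_domain_def)
    then have "smooth_coords (timed_domain \<Omega>) (\<lambda>P. P None * f c (\<lambda>d. P (Some d)))"
      unfolding drop_time_subst
      by (rule smooth_coords_mult[OF open_cylinder_open[OF oc] smooth_coords_coord])
    moreover have "timed_field f k = (\<lambda>P. P None * f c (\<lambda>d. P (Some d)))"
      using Some by (auto simp: timed_field_def)
    ultimately show ?thesis by simp
  qed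
qed

lemma sol_imp_flow:
  assumes F: "coord_field S \<Omega> f" and x: "sol S \<Omega> (\<lambda>i x. t * f i x) p x"
  shows "at_time p t \<in> flow_dom S \<Omega> f" "flow S \<Omega> f c (at_time p t) = x 1 c"
proof -
  have s: "sol (timed_coords S) (timed_domain \<Omega>) (timed_field f) (at_time p t) (\<lambda>\<theta>. at_time (x \<theta>) t)"
    unfolding sol_def
  proof (intro conjI ballI allI impI)
    show "at_time (x 0) t = at_time p t" using solD(1)[OF x] by simp
    fix \<theta> :: real assume \<theta>: "\<theta> \<in> {0..1}"
    show "at_time (x \<theta>) t \<in> timed_domain \<Omega>" using solD(2)[OF x \<theta>] by (simp add: timed_domain_def)
    show "at_time (x \<theta>) t k = at_time p t k" if "k \<notin> timed_coords S" for k
      using that solD(3)[OF x \<theta>] by (cases k) (auto simp: timed_coords_def)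
    fix k assume "k \<in> timed_coords S"
    then show "((\<lambda>\<theta>. at_time (x \<theta>) t k) has_real_derivative timed_field f k (at_time (x \<theta>) t))
        (at \<theta> within {0..1})"
      using solD(4)[OF x \<theta>] by (auto simp: timed_coords_def timed_field_def)
  qed
  then show "at_time p t \<in> flow_dom S \<Omega> f" by (auto simp: flow_dom_def sol_dom_def)
  show "flow S \<Omega> f c (at_time p t) = x 1 c"
    unfolding flow_def time_one_eq[OF coord_field_timed[OF F] s] by simp
qed

lemma flow_imp_sol:
  assumes F: "coord_field S \<Omega> f" and "at_time p t \<in> flow_dom S \<Omega> f"
  shows "\<exists>x. sol S \<Omega> (\<lambda>i x. t * f i x) p x"
proof -
  obtain U where U: "sol (timed_coords S) (timed_domain \<Omega>) (timed_field f) (at_time p t) U"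
    using assms(2) by (auto simp: flow_dom_def sol_dom_def)
  have None: "U \<theta> None = t" if \<theta>: "\<theta> \<in> {0..1}" for \<theta>
  proof -
    have d: "((\<lambda>\<theta>. U \<theta> None) has_real_derivative 0) (at \<theta> within {0..1})" if "\<theta> \<in> {0..1}" for \<theta>
      using solD(4)[OF U that, of None] by (simp add: timed_coords_def timed_field_def)
    \<comment> \<open>The time coordinate has derivative 0; its constancy is read off from two
      monotonicity statements.\<close>
    have "U 0 None \<le> U \<theta> None" by (rule deriv_nonneg_imp_le[OF d _ \<theta>]) auto
    moreover have "- U 0 None \<le> - U \<theta> None"
      by (rule deriv_nonneg_imp_le[OF _ _ \<theta>, where F = "\<lambda>\<theta>. - U \<theta> None" and F' = "\<lambda>_. -0"])
        (use d DERIV_minus in fastforce)+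
    ultimately show ?thesis using solD(1)[OF U] by simp
  qed
  have "sol S \<Omega> (\<lambda>i x. t * f i x) p (\<lambda>\<theta> d. U \<theta> (Some d))"
    unfolding sol_def
  proof (intro conjI ballI allI impI)
    show "(\<lambda>d. U 0 (Some d)) = p" using solD(1)[OF U] by simp
    fix \<theta> :: real assume \<theta>: "\<theta> \<in> {0..1}"
    show "(\<lambda>d. U \<theta> (Some d)) \<in> \<Omega>" using solD(2)[OF U \<theta>] by (simp add: timed_domain_def)
    show "U \<theta> (Some i) = p i" if "i \<notin> S" for i
      using solD(3)[OF U \<theta>, of "Some i"] that by (auto simp: timed_coords_def)
    show "((\<lambda>\<theta>. U \<theta> (Some i)) has_real_derivative t * f i (\<lambda>d. U \<theta> (Some d))) (at \<theta> within {0..1})"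
      if "i \<in> S" for i
      using solD(4)[OF U \<theta>, of "Some i"] that None[OF \<theta>] by (simp add: timed_coords_def timed_field_def)
  qed
  then show ?thesis by blast
qed

lemma flow_cases:
  assumes "coord_field S \<Omega> f" "at_time p t \<in> flow_dom S \<Omega> f"
  obtains x where "sol S \<Omega> (\<lambda>i x. t * f i x) p x" "\<And>c. flow S \<Omega> f c (at_time p t) = x 1 c"
  using flow_imp_sol[OF assms] sol_imp_flow(2)[OF assms(1)] by metis

lemma open_cylinder_flow_dom:
  "coord_field S \<Omega> f \<Longrightarrow> open_cylinder (timed_coords S) (flow_dom S \<Omega> f)"
  unfolding flow_dom_def by (rule open_cylinder_sol_dom[OF coord_field_timed])

lemma depends_only_on_flow:
  "coord_field S \<Omega> f \<Longrightarrow> c \<in> S \<Longrightarrow> depends_only_on (timed_coords S) (flow_dom S \<Omega> f) (flow S \<Omega> f c)"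
  unfolding flow_dom_def flow_def
  by (rule depends_only_on_time_one[OF coord_field_timed]) (auto simp: timed_coords_def)

lemma smooth_coords_flow:
  fixes S :: "'i set"
  assumes "infinite (UNIV :: 'i set)" "coord_field S \<Omega> f" "c \<in> S"
  shows "smooth_coords (flow_dom S \<Omega> f) (flow S \<Omega> f c)"
  unfolding flow_dom_def flow_def
proof (rule smooth_coords_time_one[OF _ coord_field_timed[OF assms(2)]])
  show "infinite (UNIV :: 'i option set)" using assms(1) by (simp add: finite_option_UNIV)
qed (use assms(3) in \<open>auto simp: timed_coords_def\<close>)

lemma flow_0:
  assumes F: "coord_field S \<Omega> f" and "p \<in> \<Omega>"
  shows "at_time p 0 \<in> flow_dom S \<Omega> f" "flow S \<Omega> f c (at_time p 0) = p c"
proof -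
  have "sol S \<Omega> (\<lambda>i x. 0 * f i x) p (\<lambda>_. p)" using assms(2) by (auto simp: sol_def)
  from sol_imp_flow[OF F this] show "at_time p 0 \<in> flow_dom S \<Omega> f" "flow S \<Omega> f c (at_time p 0) = p c" .
qed

lemma flow_in:
  assumes "coord_field S \<Omega> f" "at_time p t \<in> flow_dom S \<Omega> f"
  shows "p \<in> \<Omega>" "(\<lambda>c. flow S \<Omega> f c (at_time p t)) \<in> \<Omega>" "c \<notin> S \<Longrightarrow> flow S \<Omega> f c (at_time p t) = p c"
proof -
  obtain x where x: "sol S \<Omega> (\<lambda>i x. t * f i x) p x" "\<And>c. flow S \<Omega> f c (at_time p t) = x 1 c"
    using flow_cases[OF assms] by blast
  show "p \<in> \<Omega>" using solD(1)[OF x(1)] solD(2)[OF x(1), of 0] by simp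
  show "(\<lambda>c. flow S \<Omega> f c (at_time p t)) \<in> \<Omega>" using solD(2)[OF x(1), of 1] x(2) by simp
  show "c \<notin> S \<Longrightarrow> flow S \<Omega> f c (at_time p t) = p c" using solD(3)[OF x(1), of 1] x(2) by simp
qed

text \<open>A trajectory of t f run at speed l is a trajectory of (l t) f, so a single solution
  shows the flow at all times between 0 and t.\<close>

lemma flow_scale_time:
  assumes F: "coord_field S \<Omega> f" and x: "sol S \<Omega> (\<lambda>i x. t * f i x) p x" and l: "l \<in> {0..1}"
  shows "at_time p (l * t) \<in> flow_dom S \<Omega> f" "flow S \<Omega> f c (at_time p (l * t)) = x l c"
proof -
  have "sol S \<Omega> (\<lambda>i x. (l * t) * f i x) p (\<lambda>\<theta>. x (l * \<theta>))"
    unfolding sol_def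
  proof (intro conjI ballI allI impI)
    show "x (l * 0) = p" using solD(1)[OF x] by simp
    fix \<theta> :: real assume \<theta>: "\<theta> \<in> {0..1}"
    then have l\<theta>: "l * \<theta> \<in> {0..1}" using l by (auto intro: mult_le_one)
    show "x (l * \<theta>) \<in> \<Omega>" by (rule solD(2)[OF x l\<theta>])
    show "x (l * \<theta>) i = p i" if "i \<notin> S" for i by (rule solD(3)[OF x l\<theta> that])
    fix i assume i: "i \<in> S"
    have "((\<lambda>s. x s i) has_real_derivative t * f i (x (l * \<theta>))) (at (l * \<theta>) within (\<lambda>\<theta>. l * \<theta>) ` {0..1})"
      by (rule has_field_derivative_subset[OF solD(4)[OF x l\<theta> i]]) (use l in \<open>auto intro: mult_le_one\<close>)
    moreover have "((\<lambda>\<theta>. l * \<theta>) has_real_derivative l) (at \<theta> within {0..1})"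
      by (auto intro!: derivative_eq_intros)
    ultimately have "((\<lambda>s. x s i) \<circ> (\<lambda>\<theta>. l * \<theta>) has_real_derivative (t * f i (x (l * \<theta>))) * l) (at \<theta> within {0..1})"
      by (rule DERIV_image_chain)
    then show "((\<lambda>\<theta>. x (l * \<theta>) i) has_real_derivative l * t * f i (x (l * \<theta>))) (at \<theta> within {0..1})"
      by (simp add: o_def mult_ac)
  qed
  from sol_imp_flow[OF F this]
  show "at_time p (l * t) \<in> flow_dom S \<Omega> f" "flow S \<Omega> f c (at_time p (l * t)) = x l c" by auto
qed

lemma star_is_interval:
  fixes T :: "real set"
  assumes "\<And>t l. t \<in> T \<Longrightarrow> l \<in> {0..1} \<Longrightarrow> l * t \<in> T"
  shows "is_interval T"
  unfolding is_interval_1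
proof (intro ballI allI impI)
  fix a b x assume a: "a \<in> T" and b: "b \<in> T" and x: "a \<le> x \<and> x \<le> b"
  show "x \<in> T"
  proof (cases "x \<ge> 0")
    case True
    then have "x = (if b = 0 then 0 else x / b) * b" using x by auto
    moreover have "(if b = 0 then 0 else x / b) \<in> {0..1}" using x True by (auto simp: divide_le_eq_1)
    ultimately show ?thesis using assms[OF b] by metis
  next
    case False
    then have "x = (x / a) * a" using x by auto
    moreover have "x / a \<in> {0..1}" using x False by (auto simp: divide_le_eq_1 zero_le_divide_iff)
    ultimately show ?thesis using assms[OF a] by metis
  qed
qed

text \<open>Differentiability in time comes from the smoothness of the time-one map in the time
  coordinate. Only the value of the derivative has to be found, by comparison with one trajectory on
  the unit interval.\<close>

lemma flow_DERIV:
  fixes S :: "'i set"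
  assumes inf: "infinite (UNIV :: 'i set)" and F: "coord_field S \<Omega> f" and pt: "at_time p t \<in> flow_dom S \<Omega> f"
    and c: "c \<in> S"
  shows "((\<lambda>s. flow S \<Omega> f c (at_time p s)) has_real_derivative
    f c (\<lambda>d. flow S \<Omega> f d (at_time p t))) (at t)"
proof -
  define D where "D = pderiv_at None (flow S \<Omega> f c) (at_time p t)"
  have D: "((\<lambda>s. flow S \<Omega> f c (at_time p s)) has_real_derivative D) (at t)"
    using smooth_coords_DERIV[OF smooth_coords_flow[OF inf F c] pt, of None] by (simp add: D_def)
  \<comment> \<open>The time t is written as l t' with t' nonzero, because the comparison yields the
    derivative only after division by t'. For t = 0 a small positive t' is available, as the domain
    is open.\<close>
  have "\<exists>t' l. at_time p t' \<in> flow_dom S \<Omega> f \<and> l \<in> {0..1} \<and> t = l * t' \<and> t' \<noteq> 0"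
  proof (cases "t = 0")
    case True
    have "\<forall>\<^sub>F s in nhds t. at_time p s \<in> flow_dom S \<Omega> f"
      using eventually_fun_upd_in[OF open_cylinder_open[OF open_cylinder_flow_dom[OF F]], of "at_time p t" None t] pt
      by simp
    then obtain e where e: "e > 0" "\<And>s. dist s t < e \<Longrightarrow> at_time p s \<in> flow_dom S \<Omega> f"
      unfolding eventually_nhds_metric by blast
    then have "at_time p (e / 2) \<in> flow_dom S \<Omega> f" using True by (simp add: dist_real_def)
    then show ?thesis using True e(1) by (intro exI[of _ "e / 2"] exI[of _ 0]) auto
  next
    case False
    then show ?thesis using pt by (intro exI[of _ t] exI[of _ 1]) auto
  qed
  then obtain t' l where t': "at_time p t' \<in> flow_dom S \<Omega> f" and l: "l \<in> {0..1}" and tl: "t = l * t'" "t' \<noteq> 0"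
    by blast
  obtain x where x: "sol S \<Omega> (\<lambda>i x. t' * f i x) p x" using flow_imp_sol[OF F t'] by blast
  have fx: "flow S \<Omega> f d (at_time p (k * t')) = x k d" if "k \<in> {0..1}" for k d
    by (rule flow_scale_time(2)[OF F x that])
  have "((\<lambda>s. flow S \<Omega> f c (at_time p s)) \<circ> (\<lambda>k. k * t') has_real_derivative D * t') (at l within {0..1})"
  proof (rule DERIV_image_chain)
    show "((\<lambda>s. flow S \<Omega> f c (at_time p s)) has_real_derivative D) (at (l * t') within (\<lambda>k. k * t') ` {0..1})"
      using D unfolding tl(1) by (rule has_field_derivative_at_within)
    show "((\<lambda>k. k * t') has_real_derivative t') (at l within {0..1})"
      by (auto intro!: derivative_eq_intros)
  qed
  moreover have "((\<lambda>s. flow S \<Omega> f c (at_time p s)) \<circ> (\<lambda>k. k * t') has_real_derivative t' * f c (x l))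
      (at l within {0..1})"
    by (rule has_field_derivative_transform_within[OF solD(4)[OF x l c] zero_less_one l]) (simp add: fx)
  ultimately have "D * t' = t' * f c (x l)"
    using l vector_derivative_unique_within[of l "{0..1}" _ "D * t'" "t' * f c (x l)"]
    by (auto simp: has_real_derivative_iff_has_vector_derivative trivial_limit_within islimpt_Icc)
  then have "D = f c (x l)" using tl(2) by simp
  also have "x l = (\<lambda>d. flow S \<Omega> f d (at_time p t))" using fx[OF l] tl(1) by simp
  finally show ?thesis using D by simp
qed


subsection \<open>Flows of fields that are filtered by a rank\<close>

lemma with_time_eq: "with_time = at_time"
  by (simp add: with_time_def at_time_def fun_eq_iff)

lemma infinite_coord: "infinite (UNIV :: 'n coord set)"
proof -
  have "inj (\<lambda>k::nat. Dep (\<lambda>_ :: 'n. k))" by (auto simp: inj_def fun_eq_iff)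
  then show ?thesis by (metis finite_subset infinite_UNIV_nat finite_imageD subset_UNIV)
qed

lemma continuous_on_scale_time:
  "continuous_on UNIV (\<lambda>z :: ('i option \<Rightarrow> real) \<times> real. (fst z)(None := snd z * fst z None))"
  by (intro continuous_on_fun_upd continuous_intros continuous_on_product_then_coordinatewise[OF continuous_on_fst])

text \<open>Each coefficient depends on the finite set G c, but inside a box only on the coordinates
  of rank at most that of c. The second property is confined to boxes, since a locally constant
  dependence on higher coordinates cannot be excluded on all of \<Omega>.\<close>

locale ranked_field =
  fixes A :: "'i set" and \<Omega> :: "('i \<Rightarrow> real) set" and X :: "'i \<Rightarrow> ('i \<Rightarrow> real) \<Rightarrow> real"
    and G :: "'i \<Rightarrow> 'i set" and rk :: "'i \<Rightarrow> nat"
  assumes inf: "infinite (UNIV :: 'i set)"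
    and fin_A: "finite A" and dom: "open_cylinder A \<Omega>"
    and X: "\<And>c. finite (G c)" "\<And>c. depends_only_on (G c) \<Omega> (X c)" "\<And>c. smooth_coords \<Omega> (X c)"
    and rk: "\<And>r. finite {c. rk c \<le> r}"
    and X_rk: "\<And>B c p q. box_convex B \<Longrightarrow> B \<subseteq> \<Omega> \<Longrightarrow> p \<in> B \<Longrightarrow> q \<in> B \<Longrightarrow>
      \<forall>d. rk d \<le> rk c \<longrightarrow> p d = q d \<Longrightarrow> X c p = X c q"
begin

text \<open>Besides the moving coordinates, the finite-dimensional system must contain those that
  delimit \<Omega> and, as parameters, all those on which the moving coefficients may
  depend.\<close>

definition S :: "nat \<Rightarrow> 'i set" where
  "S r = A \<union> {c. rk c \<le> r} \<union> (\<Union>d\<in>{c. rk c \<le> r}. G d)"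

text \<open>The coordinates of rank greater than \<open>r\<close> are frozen.\<close>

definition Y :: "nat \<Rightarrow> 'i \<Rightarrow> ('i \<Rightarrow> real) \<Rightarrow> real" where
  "Y r d p = (if rk d \<le> r then X d p else 0)"

abbreviation fl :: "nat \<Rightarrow> 'i \<Rightarrow> ('i option \<Rightarrow> real) \<Rightarrow> real" where
  "fl r \<equiv> flow (S r) \<Omega> (Y r)"

definition abox :: "('i \<Rightarrow> real) \<Rightarrow> real \<Rightarrow> ('i \<Rightarrow> real) set" where
  "abox p0 e = {x. \<forall>a\<in>A. \<bar>x a - p0 a\<bar> < e}"

text \<open>Only times up to which the trajectory stays in a small box are admitted.\<close>

definition near :: "nat \<Rightarrow> ('i \<Rightarrow> real) \<Rightarrow> real \<Rightarrow> ('i option \<Rightarrow> real) set" where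
  "near r p0 e = {P \<in> flow_dom (S r) \<Omega> (Y r). \<forall>a\<in>A. \<bar>fl r a P - p0 a\<bar> < e}"

definition E :: "nat \<Rightarrow> ('i option \<Rightarrow> real) set" where
  "E r = {P. \<exists>p0 e. e > 0 \<and> abox p0 (4 * e) \<subseteq> \<Omega> \<and> (\<forall>l\<in>{0..1}. P(None := l * P None) \<in> near r p0 e)}"

lemma finite_S: "finite (S r)"
  using fin_A X(1) rk by (simp add: S_def)

lemma in_S: "a \<in> A \<Longrightarrow> a \<in> S r" "rk c \<le> r \<Longrightarrow> c \<in> S r"
  by (auto simp: S_def)

lemma cyl_S: "open_cylinder (S r) \<Omega>"
  by (rule open_cylinder_mono[OF dom]) (auto simp: S_def)

lemma Y_field: "coord_field (S r) \<Omega> (Y r)"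
proof -
  have "depends_only_on (S r) \<Omega> (Y r d) \<and> smooth_coords \<Omega> (Y r d)" for d
  proof (cases "rk d \<le> r")
    case True
    then have "Y r d = X d" by (simp add: Y_def fun_eq_iff)
    moreover have "depends_only_on (S r) \<Omega> (X d)"
      by (rule depends_only_on_mono[OF X(2)]) (use True in \<open>auto simp: S_def\<close>)
    ultimately show ?thesis using X(3) by simp
  next
    case False
    then have "Y r d = (\<lambda>_. 0)" by (simp add: Y_def fun_eq_iff)
    then show ?thesis by (simp add: smooth_coords_const depends_only_on_def)
  qed
  then show ?thesis using finite_S cyl_S by (simp add: coord_field_def)
qed

lemma box_convex_abox: "box_convex (abox p0 e)"
  unfolding abox_def by (rule box_convex_box)

lemma open_cylinder_near: "open_cylinder (timed_coords (S r)) (near r p0 e)"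
  unfolding near_def
  by (rule open_cylinder_sublevel[OF open_cylinder_flow_dom[OF Y_field] fin_A])
    (auto intro!: smooth_coords_cont[OF smooth_coords_flow[OF inf Y_field]] depends_only_on_flow[OF Y_field] in_S(1))

text \<open>The condition ranges over the compact set of factors l, so the tube lemma makes it open
  in P.\<close>

lemma open_cylinder_E: "open_cylinder (timed_coords (S r)) (E r)"
  unfolding open_cylinder_def
proof (intro conjI ballI allI impI)
  show "open (E r)"
    unfolding open_subopen[of "E r"]
  proof
    fix P assume "P \<in> E r"
    then obtain p0 e where pe: "e > 0" "abox p0 (4 * e) \<subseteq> \<Omega>"
      "\<forall>l\<in>{0..1}. P(None := l * P None) \<in> near r p0 e" by (auto simp: E_def)
    let ?h = "\<lambda>z :: ('i option \<Rightarrow> real) \<times> real. (fst z)(None := snd z * fst z None)"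
    have op: "open (?h -` near r p0 e)"
      by (rule open_vimage[OF open_cylinder_open[OF open_cylinder_near] continuous_on_scale_time])
    have sub: "{P} \<times> {0..1} \<subseteq> ?h -` near r p0 e" using pe(3) by auto
    obtain U where U: "P \<in> U" "open U" "U \<times> {0..1} \<subseteq> ?h -` near r p0 e"
      using Elementary_Topology.tube_lemma[OF compact_Icc op sub] by blast
    have "Q(None := l * Q None) \<in> near r p0 e" if "Q \<in> U" "l \<in> {0..1}" for Q l
      using subsetD[OF U(3), of "(Q, l)"] that by simp
    then have "U \<subseteq> E r" using pe(1,2) unfolding E_def by blast
    then show "\<exists>T. open T \<and> P \<in> T \<and> T \<subseteq> E r" using U by blast
  qed
  fix P Q assume "P \<in> E r" and PQ: "agree_on (timed_coords (S r)) P Q"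
  then obtain p0 e where pe: "e > 0" "abox p0 (4 * e) \<subseteq> \<Omega>"
    "\<forall>l\<in>{0..1}. P(None := l * P None) \<in> near r p0 e" by (auto simp: E_def)
  have "\<forall>l\<in>{0..1}. Q(None := l * Q None) \<in> near r p0 e"
  proof
    fix l :: real assume l: "l \<in> {0..1}"
    show "Q(None := l * Q None) \<in> near r p0 e"
      by (rule open_cylinder_agree[OF open_cylinder_near pe(3)[rule_format, OF l]])
        (use PQ in \<open>auto simp: agree_on_def timed_coords_def\<close>)
  qed
  then show "Q \<in> E r" unfolding E_def using pe(1,2) by blast
qed

lemma E_flow_dom: "E r \<subseteq> flow_dom (S r) \<Omega> (Y r)"
proof
  fix P assume "P \<in> E r"
  then obtain p0 e where "P(None := 1 * P None) \<in> near r p0 e" unfolding E_def by fastforce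
  then show "P \<in> flow_dom (S r) \<Omega> (Y r)" by (simp add: near_def)
qed

lemma E_0:
  assumes "p \<in> \<Omega>"
  shows "at_time p 0 \<in> E r"
proof -
  obtain e where e: "e > 0" "\<forall>x. (\<forall>a\<in>A. \<bar>x a - p a\<bar> < e) \<longrightarrow> x \<in> \<Omega>"
    using open_cylinder_imp_box[OF dom assms fin_A] by blast
  have "abox p (4 * (e / 4)) \<subseteq> \<Omega>" using e(2) by (auto simp: abox_def)
  moreover have "at_time p 0 \<in> near r p (e / 4)"
    using flow_0[OF Y_field assms] e(1) by (simp add: near_def)
  ultimately show ?thesis using e(1) unfolding E_def by (auto intro!: exI[of _ p] exI[of _ "e / 4"])
qed

lemma E_interval: "is_interval {t. at_time p t \<in> E r}"
proof (rule star_is_interval)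
  fix t l :: real assume t: "t \<in> {t. at_time p t \<in> E r}" and l: "l \<in> {0..1}"
  then obtain p0 e where pe: "e > 0" "abox p0 (4 * e) \<subseteq> \<Omega>"
    "\<forall>k\<in>{0..1}. at_time p (k * t) \<in> near r p0 e" by (auto simp: E_def)
  have "\<forall>k\<in>{0..1}. at_time p (k * (l * t)) \<in> near r p0 e"
  proof
    fix k :: real assume "k \<in> {0..1}"
    then show "at_time p (k * (l * t)) \<in> near r p0 e"
      using pe(3)[rule_format, of "k * l"] l by (auto simp: mult.assoc intro: mult_le_one)
  qed
  then have "at_time p (l * t) \<in> E r" unfolding E_def using pe(1,2) by (auto intro!: exI[of _ p0] exI[of _ e])
  then show "l * t \<in> {t. at_time p t \<in> E r}" by simp
qed

text \<open>Within a box the coefficients of rank at most r' ignore higher coordinates, so these may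
  be replaced by constants; what remains of a trajectory of rank r is one of rank r'.\<close>

lemma override_sol:
  assumes "r' \<le> r" and x: "sol (S r) \<Omega> (\<lambda>i x. t * Y r i x) p x"
    and B: "\<And>\<theta>. \<theta> \<in> {0..1} \<Longrightarrow> x \<theta> \<in> abox p0 e" "q \<in> abox p0 e" "abox p0 e \<subseteq> \<Omega>"
    and q: "\<And>d. rk d \<le> r' \<Longrightarrow> q d = p d"
  shows "sol (S r') \<Omega> (\<lambda>i x. t * Y r' i x) q (\<lambda>\<theta> i. if rk i \<le> r' then x \<theta> i else q i)"
proof -
  define y where "y \<theta> i = (if rk i \<le> r' then x \<theta> i else q i)" for \<theta> i
  have yB: "y \<theta> \<in> abox p0 e" if "\<theta> \<in> {0..1}" for \<theta>
    using B(1)[OF that] B(2) by (auto simp: y_def abox_def)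
  have "sol (S r') \<Omega> (\<lambda>i x. t * Y r' i x) q y"
    unfolding sol_def
  proof (intro conjI ballI allI impI)
    show "y 0 = q" using q solD(1)[OF x] by (auto simp: y_def fun_eq_iff)
    fix \<theta> :: real assume \<theta>: "\<theta> \<in> {0..1}"
    show "y \<theta> \<in> \<Omega>" using yB[OF \<theta>] B(3) by blast
    show "y \<theta> i = q i" if "i \<notin> S r'" for i using that in_S(2)[of i r'] by (auto simp: y_def)
    fix i assume "i \<in> S r'"
    show "((\<lambda>\<theta>. y \<theta> i) has_real_derivative t * Y r' i (y \<theta>)) (at \<theta> within {0..1})"
    proof (cases "rk i \<le> r'")
      case True
      have "X i (x \<theta>) = X i (y \<theta>)"
        by (rule X_rk[OF box_convex_abox B(3) B(1)[OF \<theta>] yB[OF \<theta>]]) (use True in \<open>auto simp: y_def\<close>)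
      then show ?thesis
        using solD(4)[OF x \<theta>, of i] True assms(1) in_S(2)[of i r] by (simp add: y_def Y_def)
    qed (simp add: y_def Y_def)
  qed
  then show ?thesis by (simp add: y_def [abs_def])
qed

text \<open>The components of q come from flows of different ranks, each with its own box. All these
  boxes contain p, so the one of largest radius, enlarged threefold, contains everything that
  occurs. Inside it the flows of different ranks agree, and the trajectory from p can be followed
  from time s to s + t.\<close>

lemma flow_compose:
  assumes q: "\<And>d. d \<in> S (rk c) \<Longrightarrow> at_time p s \<in> E (rk d) \<and> q d = fl (rk d) d (at_time p s)"
    and qt: "at_time q t \<in> E (rk c)" and pst: "at_time p (s + t) \<in> E (rk c)"
  shows "fl (rk c) c (at_time q t) = fl (rk c) c (at_time p (s + t))"
proof -
  define r where "r = rk c"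
  have c: "c \<in> S r" by (simp add: r_def in_S)
  have near_ex: "\<exists>p0 e. e > 0 \<and> abox p0 (4 * e) \<subseteq> \<Omega> \<and> (\<forall>l\<in>{0..1}. at_time p (l * s) \<in> near (rk d) p0 e)"
    if "d \<in> S r" for d using q[of d] that by (auto simp: E_def r_def)
  then obtain P0 e where Pe: "\<And>d. d \<in> S r \<Longrightarrow> e d > 0 \<and> abox (P0 d) (4 * e d) \<subseteq> \<Omega> \<and>
      (\<forall>l\<in>{0..1}. at_time p (l * s) \<in> near (rk d) (P0 d) (e d))" by metis
  obtain p1 e1 where p1: "e1 > 0" "abox p1 (4 * e1) \<subseteq> \<Omega>"
    "\<forall>l\<in>{0..1}. at_time p (l * (s + t)) \<in> near r p1 e1" using pst by (auto simp: E_def r_def)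
  \<comment> \<open>The boxes, as pairs of radius and centre, of all components of q and of the flow
    at time s + t.\<close>
  define J where "J = insert (e1, p1) ((\<lambda>d. (e d, P0 d)) ` S r)"
  have finJ: "finite J" "J \<noteq> {}" using finite_S by (auto simp: J_def)
  obtain m pm where m: "(m, pm) \<in> J" "\<And>e p. (e, p) \<in> J \<Longrightarrow> e \<le> m"
  proof -
    have "Max (fst ` J) \<in> fst ` J" using finJ by (intro Max_in) auto
    then obtain pm where "(Max (fst ` J), pm) \<in> J" by force
    moreover have "e \<le> Max (fst ` J)" if "(e, p) \<in> J" for e p using finJ that by (force intro: Max_ge)
    ultimately show ?thesis using that by blast
  qed
  have p\<Omega>: "p \<in> \<Omega>" using flow_in(1)[OF Y_field subsetD[OF E_flow_dom]] pst by blast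
  \<comment> \<open>At time 0 every trajectory is at p, so p lies in each box.\<close>
  have Jp: "\<bar>p a - p' a\<bar> < e'" if J: "(e', p') \<in> J" "a \<in> A" for e' p' a
  proof -
    have "at_time p 0 \<in> near r' p' e' \<Longrightarrow> ?thesis" for r'
      using flow_0(2)[OF Y_field p\<Omega>] that(2) by (auto simp: near_def)
    moreover have "\<exists>r'. at_time p 0 \<in> near r' p' e'"
    proof -
      consider "e' = e1" "p' = p1" | d where "d \<in> S r" "e' = e d" "p' = P0 d"
        using J(1) by (auto simp: J_def)
      then show ?thesis
      proof cases
        case 1 then show ?thesis using p1(3)[rule_format, of 0] by auto
      next
        case 2
        have "at_time p (0 * s) \<in> near (rk d) (P0 d) (e d)"
          using Pe[OF 2(1)] by (metis atLeastAtMost_iff order_refl zero_le_one)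
        then show ?thesis using 2 by auto
      qed
    qed
    ultimately show ?thesis by blast
  qed
  have mbox: "m > 0" "abox pm (4 * m) \<subseteq> \<Omega>" using m(1) Pe p1 by (auto simp: J_def)
  \<comment> \<open>From x to the centre of its box, from there to p, and from p to pm: three
    distances below m.\<close>
  have inb: "x \<in> abox pm (3 * m)" if "(e', p') \<in> J" "\<And>a. a \<in> A \<Longrightarrow> \<bar>x a - p' a\<bar> < e'" for x e' p'
    unfolding abox_def
  proof (intro CollectI ballI)
    fix a assume a: "a \<in> A"
    show "\<bar>x a - pm a\<bar> < 3 * m"
      using that(2)[OF a] Jp[OF that(1) a] Jp[OF m(1) a] m(2)[OF that(1)] by linarith
  qed
  have box34: "abox pm (3 * m) \<subseteq> \<Omega>"
  proof
    fix x assume x: "x \<in> abox pm (3 * m)"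
    have "x \<in> abox pm (4 * m)" unfolding abox_def
    proof (intro CollectI ballI)
      fix a assume "a \<in> A"
      then have "\<bar>x a - pm a\<bar> < 3 * m" using x by (simp add: abox_def)
      then show "\<bar>x a - pm a\<bar> < 4 * m" using mbox(1) by linarith
    qed
    then show "x \<in> \<Omega>" using mbox(2) by blast
  qed
  have ps: "at_time p s \<in> E r" using q[of c] c by (simp add: r_def)
  obtain xs where xs: "sol (S r) \<Omega> (\<lambda>i x. s * Y r i x) p xs"
    using flow_imp_sol[OF Y_field subsetD[OF E_flow_dom ps]] by blast
  obtain xst where xst: "sol (S r) \<Omega> (\<lambda>i x. (s + t) * Y r i x) p xst"
    using flow_imp_sol[OF Y_field subsetD[OF E_flow_dom pst]] by (auto simp: r_def)
  have xsB: "xs l \<in> abox pm (3 * m)" if l: "l \<in> {0..1}" for l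
  proof (rule inb)
    show "(e c, P0 c) \<in> J" using c by (auto simp: J_def)
    fix a assume a: "a \<in> A"
    have "at_time p (l * s) \<in> near (rk c) (P0 c) (e c)" using Pe[OF c] l by blast
    then show "\<bar>xs l a - P0 c a\<bar> < e c"
      using a flow_scale_time(2)[OF Y_field xs l] by (auto simp: near_def r_def)
  qed
  have xstB: "xst l \<in> abox pm (3 * m)" if l: "l \<in> {0..1}" for l
  proof (rule inb)
    show "(e1, p1) \<in> J" by (simp add: J_def)
    fix a assume a: "a \<in> A"
    have "at_time p (l * (s + t)) \<in> near r p1 e1" using p1(3) l by blast
    then show "\<bar>xst l a - p1 a\<bar> < e1"
      using a flow_scale_time(2)[OF Y_field xst l] by (auto simp: near_def)
  qed
  have pB: "p \<in> abox pm (3 * m)" using xsB[of 0] solD(1)[OF xs] by simp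
  have qB: "q \<in> abox pm (3 * m)"
    unfolding abox_def
  proof (intro CollectI ballI)
    fix a assume a: "a \<in> A"
    then have aS: "a \<in> S r" by (rule in_S)
    have "at_time p (1 * s) \<in> near (rk a) (P0 a) (e a)" using Pe[OF aS] by (metis atLeastAtMost_iff order_refl zero_le_one)
    then have "\<bar>q a - P0 a a\<bar> < e a" using q[of a] aS a by (simp add: near_def r_def)
    moreover have "(e a, P0 a) \<in> J" using aS by (auto simp: J_def)
    ultimately show "\<bar>q a - pm a\<bar> < 3 * m"
      using Jp[of "e a" "P0 a" a] Jp[OF m(1) a] m(2)[of "e a" "P0 a"] a by fastforce
  qed
  \<comment> \<open>The component d of q belongs to the flow of rank \<open>rk d\<close>; in the
    common box it coincides with that of the flow of rank r.\<close>
  have q_eq: "q d = xs 1 d" if d: "rk d \<le> r" for d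
  proof -
    have "sol (S (rk d)) \<Omega> (\<lambda>i x. s * Y (rk d) i x) p (\<lambda>\<theta> i. if rk i \<le> rk d then xs \<theta> i else p i)"
      by (rule override_sol[OF d xs xsB pB box34]) auto
    from sol_imp_flow(2)[OF Y_field this, of d] show ?thesis using q[of d] in_S(2)[OF d] by (simp add: r_def)
  qed
  define Z where "Z \<sigma> i = fl r i (at_time p \<sigma>)" for \<sigma> i
  \<comment> \<open>A time between s and s + t lies between 0 and one of the two, hence it is
    reached along one of the trajectories xs and xst.\<close>
  have between: "\<exists>l\<in>{0..1}. s + \<theta> * t = l * s \<or> s + \<theta> * t = l * (s + t)" if \<theta>: "\<theta> \<in> {0..1}" for \<theta>
  proof -
    let ?\<sigma> = "s + \<theta> * t"
    have \<sigma>: "min s (s + t) \<le> ?\<sigma>" "?\<sigma> \<le> max s (s + t)"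
    proof -
      have "\<theta> * t \<le> max 0 t" "min 0 t \<le> \<theta> * t"
        using \<theta> mult_right_mono[of \<theta> 1 t] mult_right_mono_neg[of \<theta> 1 t]
        by (cases "t \<ge> 0"; auto simp: max_def min_def mult_nonneg_nonpos mult_nonneg_nonneg)+
      then show "min s (s + t) \<le> ?\<sigma>" "?\<sigma> \<le> max s (s + t)" by (auto simp: max_def min_def split: if_splits)
    qed
    have *: "\<exists>l\<in>{0..1}. ?\<sigma> = l * b" if "0 \<le> ?\<sigma> \<and> ?\<sigma> \<le> b \<or> b \<le> ?\<sigma> \<and> ?\<sigma> \<le> 0" for b
    proof (cases "b = 0")
      case True
      then show ?thesis using that by (intro bexI[of _ 0]) auto
    next
      case False
      then show ?thesis using that
        by (intro bexI[of _ "?\<sigma> / b"]) (auto simp: divide_le_eq zero_le_divide_iff)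
    qed
    show ?thesis
    proof (cases "?\<sigma> \<ge> 0")
      case True
      then show ?thesis using \<sigma>(2) *[of s] *[of "s + t"] by (auto simp: max_def split: if_splits)
    next
      case False
      then show ?thesis using \<sigma>(1) *[of s] *[of "s + t"] by (auto simp: min_def split: if_splits)
    qed
  qed
  have Zdom: "at_time p (s + \<theta> * t) \<in> flow_dom (S r) \<Omega> (Y r)" "Z (s + \<theta> * t) \<in> abox pm (3 * m)"
    if \<theta>: "\<theta> \<in> {0..1}" for \<theta>
  proof -
    obtain l where l: "l \<in> {0..1}" "s + \<theta> * t = l * s \<or> s + \<theta> * t = l * (s + t)" using between[OF \<theta>] by blast
    have "at_time p (l * s) \<in> flow_dom (S r) \<Omega> (Y r) \<and> Z (l * s) \<in> abox pm (3 * m)"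
      using flow_scale_time[OF Y_field xs l(1)] xsB[OF l(1)] by (simp add: Z_def [abs_def])
    moreover have "at_time p (l * (s + t)) \<in> flow_dom (S r) \<Omega> (Y r) \<and> Z (l * (s + t)) \<in> abox pm (3 * m)"
      using flow_scale_time[OF Y_field xst l(1)] xstB[OF l(1)] by (simp add: Z_def [abs_def])
    ultimately show "at_time p (s + \<theta> * t) \<in> flow_dom (S r) \<Omega> (Y r)" "Z (s + \<theta> * t) \<in> abox pm (3 * m)"
      using l(2) by auto
  qed
  have "sol (S r) \<Omega> (\<lambda>i x. t * Y r i x) (Z s) (\<lambda>\<theta>. Z (s + \<theta> * t))"
    unfolding sol_def
  proof (intro conjI ballI allI impI)
    fix \<theta> :: real assume \<theta>: "\<theta> \<in> {0..1}"
    show "Z (s + \<theta> * t) \<in> \<Omega>" using Zdom(2)[OF \<theta>] box34 by blast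
    show "Z (s + \<theta> * t) i = Z s i" if "i \<notin> S r" for i
      using flow_in(3)[OF Y_field Zdom(1)[OF \<theta>] that] flow_in(3)[OF Y_field _ that, of p s]
        Zdom(1)[of 0] by (simp add: Z_def)
    fix i assume i: "i \<in> S r"
    have "((\<lambda>\<sigma>. Z \<sigma> i) has_real_derivative Y r i (Z (s + \<theta> * t))) (at (s + \<theta> * t))"
      using flow_DERIV[OF inf Y_field Zdom(1)[OF \<theta>] i] by (simp add: Z_def [abs_def])
    moreover have "((\<lambda>\<theta>. s + \<theta> * t) has_real_derivative t) (at \<theta> within {0..1})"
      by (auto intro!: derivative_eq_intros)
    ultimately have "((\<lambda>\<sigma>. Z \<sigma> i) \<circ> (\<lambda>\<theta>. s + \<theta> * t) has_real_derivative Y r i (Z (s + \<theta> * t)) * t) (at \<theta> within {0..1})"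
      by (rule DERIV_chain)
    then show "((\<lambda>\<theta>. Z (s + \<theta> * t) i) has_real_derivative t * Y r i (Z (s + \<theta> * t))) (at \<theta> within {0..1})"
      by (simp add: o_def mult.commute)
  qed simp
  \<comment> \<open>Above rank r the points q and Z s may differ; \<open>override_sol\<close> with
    equal ranks exchanges these coordinates.\<close>
  then have "sol (S r) \<Omega> (\<lambda>i x. t * Y r i x) q (\<lambda>\<theta> i. if rk i \<le> r then Z (s + \<theta> * t) i else q i)"
  proof (rule override_sol[OF order_refl _ _ qB box34])
    show "q d = Z s d" if "rk d \<le> r" for d
      using q_eq[OF that] flow_scale_time(2)[OF Y_field xs, of 1 d] by (simp add: Z_def)
  qed (use Zdom in auto)
  from sol_imp_flow(2)[OF Y_field this, of c] show ?thesis by (simp add: Z_def r_def)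
qed

end

lemma (in ranked_field) flow_components:
  shows "finite (S (rk c))"
    and "open_cylinder (timed_coords (S (rk c))) (E (rk c))"
    and "depends_only_on (timed_coords (S (rk c))) (E (rk c)) (fl (rk c) c)"
    and "smooth_coords (E (rk c)) (fl (rk c) c)"
    and "at_time p t \<in> E (rk c) \<Longrightarrow> p \<in> \<Omega>"
    and "p \<in> \<Omega> \<Longrightarrow> fl (rk c) c (at_time p 0) = p c"
    and "p \<in> \<Omega> \<Longrightarrow> ((\<lambda>t. fl (rk c) c (at_time p t)) has_real_derivative X c p) (at 0)"
proof -
  have c: "c \<in> S (rk c)" by (rule in_S) simp
  show "finite (S (rk c))" by (rule finite_S)
  show "open_cylinder (timed_coords (S (rk c))) (E (rk c))" by (rule open_cylinder_E)
  show "depends_only_on (timed_coords (S (rk c))) (E (rk c)) (fl (rk c) c)"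
    by (rule depends_only_on_mono[OF depends_only_on_flow[OF Y_field c] order_refl E_flow_dom])
  show "smooth_coords (E (rk c)) (fl (rk c) c)"
    by (rule smooth_coords_subset[OF smooth_coords_flow[OF inf Y_field c] E_flow_dom])
  show "at_time p t \<in> E (rk c) \<Longrightarrow> p \<in> \<Omega>" using flow_in(1)[OF Y_field] E_flow_dom by blast
  assume p: "p \<in> \<Omega>"
  show "fl (rk c) c (at_time p 0) = p c" by (rule flow_0(2)[OF Y_field p])
  show "((\<lambda>t. fl (rk c) c (at_time p t)) has_real_derivative X c p) (at 0)"
    using flow_DERIV[OF inf Y_field flow_0(1)[OF Y_field p] c] flow_0(2)[OF Y_field p] by (simp add: Y_def)
qed

lemma exponentiable_ranked:
  fixes \<Omega> :: "'n jet set"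
  assumes "ranked_field A \<Omega> X G rk"
  shows "exponentiable \<Omega> X"
proof -
  interpret ranked_field A \<Omega> X G rk by (rule assms)
  have "local_flow \<Omega> X (\<lambda>c. S (rk c)) (\<lambda>c. E (rk c)) (\<lambda>c. fl (rk c) c)"
    unfolding local_flow_def with_time_eq timed_coords_def[symmetric]
    using flow_components E_interval E_0 by (auto intro: flow_compose)
  then show ?thesis unfolding exponentiable_def by blast
qed


subsection \<open>Multiindices\<close>

definition msize :: "'n::finite multiindex \<Rightarrow> nat" where
  "msize \<gamma> = (\<Sum>i\<in>UNIV. \<gamma> i)"

definition mlower :: "'n multiindex \<Rightarrow> 'n \<Rightarrow> 'n multiindex" where
  "mlower \<gamma> k = \<gamma>(k := \<gamma> k - 1)"

lemma msize_zero [simp]: "msize (\<lambda>_. 0) = 0"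
  by (simp add: msize_def)

lemma msize_bump [simp]: "msize (bump \<gamma> k) = Suc (msize \<gamma>)"
proof -
  have "(\<Sum>i\<in>UNIV. bump \<gamma> k i) = (\<Sum>i\<in>UNIV. \<gamma> i + (if i = k then 1 else 0))"
    by (intro sum.cong) (auto simp: bump_def)
  then show ?thesis by (simp add: msize_def sum.distrib)
qed

lemma bump_mlower: "\<gamma> k > 0 \<Longrightarrow> bump (mlower \<gamma> k) k = \<gamma>"
  by (auto simp: bump_def mlower_def)

lemma mlower_bump [simp]: "mlower (bump \<gamma> k) k = \<gamma>"
  by (auto simp: bump_def mlower_def)

lemma bump_pos [simp]: "bump \<gamma> k k > 0"
  by (simp add: bump_def)

lemma msize_mlower: "\<gamma> k > 0 \<Longrightarrow> Suc (msize (mlower \<gamma> k)) = msize \<gamma>"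
  using msize_bump[of "mlower \<gamma> k" k] bump_mlower[of \<gamma> k] by simp

lemma bump_commute: "bump (bump \<gamma> i) k = bump (bump \<gamma> k) i"
  by (auto simp: bump_def fun_eq_iff)

lemma bump_left_inject: "bump \<gamma> i = bump \<gamma> j \<longleftrightarrow> i = j"
  by (metis bump_def fun_upd_apply n_not_Suc_n)

lemma bump_neq_zero [simp]: "bump \<gamma> i \<noteq> (\<lambda>_. 0)" "(\<lambda>_. 0) \<noteq> bump \<gamma> i"
  by (metis bump_def fun_upd_same nat.distinct(1))+

lemma msize_eq_0: "msize \<gamma> = 0 \<longleftrightarrow> \<gamma> = (\<lambda>_. 0)"
  by (auto simp: msize_def fun_eq_iff)

lemma multiindex_induct [case_names zero bump]:
  fixes \<beta> :: "'n::finite multiindex"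
  assumes "P (\<lambda>_. 0)" "\<And>\<beta> k. P \<beta> \<Longrightarrow> P (bump \<beta> k)"
  shows "P \<beta>"
proof (induction "msize \<beta>" arbitrary: \<beta>)
  case 0
  then have "\<beta> = (\<lambda>_. 0)" by (simp add: msize_eq_0[symmetric])
  then show ?case using assms(1) by simp
next
  case (Suc m)
  then have "\<beta> \<noteq> (\<lambda>_. 0)" by auto
  then obtain k where k: "\<beta> k > 0" by (auto simp: fun_eq_iff)
  have "m = msize (mlower \<beta> k)" using Suc(2) msize_mlower[of \<beta> k, OF k] by simp
  from assms(2)[OF Suc(1)[OF this], of k] show ?case by (simp add: bump_mlower[of \<beta> k, OF k])
qed

lemma finite_msize_le: "finite {\<gamma> :: 'n::finite multiindex. msize \<gamma> \<le> r}"
proof (rule finite_subset)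
  have "\<gamma> i \<le> msize \<gamma>" for \<gamma> :: "'n multiindex" and i
    unfolding msize_def by (rule member_le_sum) auto
  then show "{\<gamma> :: 'n multiindex. msize \<gamma> \<le> r} \<subseteq> Pi\<^sub>E UNIV (\<lambda>_. {..r})"
    by (auto simp: PiE_iff intro: order_trans)
  show "finite (Pi\<^sub>E (UNIV :: 'n set) (\<lambda>_. {..r}))" by (intro finite_PiE) auto
qed


subsection \<open>Functions of finitely many jet coordinates\<close>

lemma Sum_any_eq_sum:
  assumes "finite F" "\<And>c. c \<notin> F \<Longrightarrow> g c = (0 :: real)"
  shows "Sum_any g = sum g F"
  by (rule Sum_any.expand_superset) (use assms in auto)

locale jet_dom =
  fixes A :: "'n::finite coord set" and \<Omega> :: "'n jet set"
  assumes fin_A: "finite A" and cyl: "open_cylinder A \<Omega>"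
begin

abbreviation "JF \<equiv> jet_function \<Omega>"

lemma open_dom: "open \<Omega>"
  using cyl by (rule open_cylinder_open)

lemma JF_smooth: "JF f \<Longrightarrow> smooth_coords \<Omega> f"
  by (simp add: jet_function_def)

lemma JF_pdiff: "JF f \<Longrightarrow> pdiff \<Omega> f"
  by (simp add: JF_smooth smooth_coords_pdiff)

lemma JF_deps:
  assumes "JF f"
  obtains F where "finite F" "A \<subseteq> F" "depends_only_on F \<Omega> f"
proof -
  obtain F where F: "finite F" "depends_only_on F \<Omega> f" using assms by (auto simp: jet_function_def)
  show ?thesis
  proof (rule that[of "F \<union> A"])
    show "depends_only_on (F \<union> A) \<Omega> f" by (rule depends_only_on_mono[OF F(2)]) auto
  qed (use F fin_A in auto)
qed

lemma JF_I: "finite F \<Longrightarrow> depends_only_on F \<Omega> f \<Longrightarrow> smooth_coords \<Omega> f \<Longrightarrow> JF f"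
  by (auto simp: jet_function_def)

lemma cyl_mono: "A \<subseteq> F \<Longrightarrow> open_cylinder F \<Omega>"
  by (rule open_cylinder_mono[OF cyl])

lemma pderiv_0: "depends_only_on F \<Omega> f \<Longrightarrow> c \<notin> F \<Longrightarrow> p \<in> \<Omega> \<Longrightarrow> pderiv_at c f p = 0"
  by (rule pderiv_at_eq_0_outside[OF open_dom])

lemma JF_cong: "JF f \<Longrightarrow> (\<And>p. p \<in> \<Omega> \<Longrightarrow> f p = g p) \<Longrightarrow> JF g"
  using smooth_coords_cong[OF open_dom, of f g] unfolding jet_function_def depends_only_on_def by simp

lemma JF_const: "JF (\<lambda>_. a)"
  by (rule JF_I[of "{}"]) (auto simp: depends_only_on_def smooth_coords_const)

lemma JF_coord: "JF (\<lambda>p. p c)"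
  by (rule JF_I[of "{c}"]) (auto simp: depends_only_on_def agree_on_def smooth_coords_coord)

lemma JF_binop:
  assumes "JF f" "JF g" "smooth_coords \<Omega> (\<lambda>p. h (f p) (g p))"
  shows "JF (\<lambda>p. h (f p) (g p))"
proof -
  obtain F1 F2 where F: "finite F1" "depends_only_on F1 \<Omega> f" "finite F2" "depends_only_on F2 \<Omega> g"
    using assms(1,2) by (auto simp: jet_function_def)
  have "depends_only_on (F1 \<union> F2) \<Omega> (\<lambda>p. h (f p) (g p))"
    unfolding depends_only_on_def
  proof (intro ballI impI)
    fix p q assume pq: "p \<in> \<Omega>" "q \<in> \<Omega>" "agree_on (F1 \<union> F2) p q"
    have "f p = f q"
      by (rule depends_only_onD[OF F(2) pq(1,2)]) (use pq(3) in \<open>auto simp: agree_on_def\<close>)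
    moreover have "g p = g q"
      by (rule depends_only_onD[OF F(4) pq(1,2)]) (use pq(3) in \<open>auto simp: agree_on_def\<close>)
    ultimately
    show "h (f p) (g p) = h (f q) (g q)" by simp
  qed
  then show ?thesis using F(1,3) assms(3) by (intro JF_I[of "F1 \<union> F2"]) auto
qed

lemma JF_add: "JF f \<Longrightarrow> JF g \<Longrightarrow> JF (\<lambda>p. f p + g p)"
  by (rule JF_binop[where h = "(+)"]) (simp_all add: smooth_coords_add[OF open_dom] JF_smooth)

lemma JF_diff: "JF f \<Longrightarrow> JF g \<Longrightarrow> JF (\<lambda>p. f p - g p)"
  by (rule JF_binop[where h = "(-)"]) (simp_all add: smooth_coords_diff[OF open_dom] JF_smooth)

lemma JF_mult: "JF f \<Longrightarrow> JF g \<Longrightarrow> JF (\<lambda>p. f p * g p)"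
  by (rule JF_binop[where h = "(*)"]) (simp_all add: smooth_coords_mult[OF open_dom] JF_smooth)

lemma JF_sum: "(\<And>i. i \<in> I \<Longrightarrow> JF (f i)) \<Longrightarrow> JF (\<lambda>p. \<Sum>i\<in>I. f i p)"
proof (induction I rule: infinite_finite_induct)
  case (insert i I)
  then show ?case using JF_add[of "f i" "\<lambda>p. \<Sum>i\<in>I. f i p"] by simp
qed (simp_all add: JF_const)

lemma JF_pderiv:
  assumes "JF f"
  shows "JF (pderiv_at c f)"
proof -
  obtain F where F: "finite F" "A \<subseteq> F" "depends_only_on F \<Omega> f" by (rule JF_deps[OF assms])
  show ?thesis
    by (rule JF_I[OF F(1) depends_only_on_pderiv[OF cyl_mono[OF F(2)] F(3)] smooth_coords_pderiv[OF JF_smooth[OF assms]]])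
qed

lemma pderiv_cong: "(\<And>p. p \<in> \<Omega> \<Longrightarrow> f p = g p) \<Longrightarrow> p \<in> \<Omega> \<Longrightarrow> pderiv_at c f p = pderiv_at c g p"
  by (rule pderiv_at_cong[OF open_dom])

lemma pderiv_swap: "JF f \<Longrightarrow> p \<in> \<Omega> \<Longrightarrow> pderiv_at c (pderiv_at d f) p = pderiv_at d (pderiv_at c f) p"
  by (intro pderiv_commute[OF open_dom] JF_smooth)

lemma total_deriv_cong:
  "(\<And>p. p \<in> \<Omega> \<Longrightarrow> f p = g p) \<Longrightarrow> p \<in> \<Omega> \<Longrightarrow> total_deriv k f p = total_deriv k g p"
  unfolding total_deriv_def using pderiv_cong[of f g p] by simp

lemma field_apply_cong:
  "(\<And>p. p \<in> \<Omega> \<Longrightarrow> f p = g p) \<Longrightarrow> p \<in> \<Omega> \<Longrightarrow> field_apply Y f p = field_apply Y g p"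
  unfolding field_apply_def using pderiv_cong[of f g p] by simp

lemma field_apply_sum:
  assumes "finite F" "depends_only_on F \<Omega> f" "p \<in> \<Omega>"
  shows "field_apply Y f p = (\<Sum>c\<in>F. Y c p * pderiv_at c f p)"
  unfolding field_apply_def by (rule Sum_any_eq_sum[OF assms(1)]) (simp add: pderiv_0[OF assms(2) _ assms(3)])

lemma total_deriv_sum:
  assumes "finite B" "\<And>\<alpha>. \<alpha> \<notin> B \<Longrightarrow> pderiv_at (Dep \<alpha>) f p = 0"
  shows "total_deriv k f p = pderiv_at (Indep k) f p + (\<Sum>\<alpha>\<in>B. p (Dep (bump \<alpha> k)) * pderiv_at (Dep \<alpha>) f p)"
  unfolding total_deriv_def by (subst Sum_any_eq_sum[OF assms(1)]) (use assms(2) in auto)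

lemma JF_deps_multi:
  assumes "JF f"
  shows "\<exists>B. finite B \<and> (\<forall>\<alpha> p. \<alpha> \<notin> B \<longrightarrow> p \<in> \<Omega> \<longrightarrow> pderiv_at (Dep \<alpha>) f p = 0)"
proof -
  obtain F where F: "finite F" "A \<subseteq> F" "depends_only_on F \<Omega> f" by (rule JF_deps[OF assms])
  show ?thesis
  proof (intro exI[of _ "Dep -` F"] conjI allI impI)
    show "finite (Dep -` F)" by (rule finite_vimageI[OF F(1)]) (simp add: inj_def)
    show "pderiv_at (Dep \<alpha>) f p = 0" if "\<alpha> \<notin> Dep -` F" "p \<in> \<Omega>" for \<alpha> p
      by (rule pderiv_0[OF F(3)]) (use that in auto)
  qed
qed

lemma JF_field_apply:
  assumes "\<And>c. JF (Y c)" "JF f"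
  shows "JF (field_apply Y f)"
proof -
  obtain F where F: "finite F" "A \<subseteq> F" "depends_only_on F \<Omega> f" by (rule JF_deps[OF assms(2)])
  have "JF (\<lambda>p. \<Sum>c\<in>F. Y c p * pderiv_at c f p)" by (intro JF_sum JF_mult JF_pderiv assms)
  then show ?thesis by (rule JF_cong) (simp add: field_apply_sum[OF F(1,3)])
qed

lemma JF_total_deriv:
  assumes "JF f"
  shows "JF (total_deriv k f)"
proof -
  obtain B where B: "finite B" "\<And>\<alpha> p. \<alpha> \<notin> B \<Longrightarrow> p \<in> \<Omega> \<Longrightarrow> pderiv_at (Dep \<alpha>) f p = 0"
    using JF_deps_multi[OF assms] by blast
  have "JF (\<lambda>p. pderiv_at (Indep k) f p + (\<Sum>\<alpha>\<in>B. p (Dep (bump \<alpha> k)) * pderiv_at (Dep \<alpha>) f p))"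
    by (intro JF_add JF_sum JF_mult JF_pderiv JF_coord assms)
  then show ?thesis by (rule JF_cong) (use total_deriv_sum[OF B(1)] B(2) in auto)
qed

text \<open>The numbers a and b may be chosen for the given p, so a = g p and b = f p yield the
  product rule, and constants yield linearity.\<close>

lemma total_deriv_linear:
  assumes "\<And>c. c \<in> range Dep \<union> {Indep k} \<Longrightarrow>
      pderiv_at c h p = a * pderiv_at c f p + b * pderiv_at c g p"
    and "JF f" "JF g" "p \<in> \<Omega>"
  shows "total_deriv k h p = a * total_deriv k f p + b * total_deriv k g p"
proof -
  obtain B1 where B1: "finite B1" "\<And>\<alpha> p. \<alpha> \<notin> B1 \<Longrightarrow> p \<in> \<Omega> \<Longrightarrow> pderiv_at (Dep \<alpha>) f p = 0"
    using JF_deps_multi[OF assms(2)] by blast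
  obtain B2 where B2: "finite B2" "\<And>\<alpha> p. \<alpha> \<notin> B2 \<Longrightarrow> p \<in> \<Omega> \<Longrightarrow> pderiv_at (Dep \<alpha>) g p = 0"
    using JF_deps_multi[OF assms(3)] by blast
  let ?B = "B1 \<union> B2"
  have fin: "finite ?B" using B1 B2 by simp
  have f: "total_deriv k f p = pderiv_at (Indep k) f p + (\<Sum>\<alpha>\<in>?B. p (Dep (bump \<alpha> k)) * pderiv_at (Dep \<alpha>) f p)"
    by (rule total_deriv_sum[OF fin]) (use B1 assms(4) in auto)
  have g: "total_deriv k g p = pderiv_at (Indep k) g p + (\<Sum>\<alpha>\<in>?B. p (Dep (bump \<alpha> k)) * pderiv_at (Dep \<alpha>) g p)"
    by (rule total_deriv_sum[OF fin]) (use B2 assms(4) in auto)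
  have "total_deriv k h p = pderiv_at (Indep k) h p + (\<Sum>\<alpha>\<in>?B. p (Dep (bump \<alpha> k)) * pderiv_at (Dep \<alpha>) h p)"
    by (rule total_deriv_sum[OF fin]) (use B1 B2 assms(1,4) in auto)
  also have "\<dots> = a * total_deriv k f p + b * total_deriv k g p"
    unfolding f g using assms(1)
    by (simp add: sum_distrib_left sum.distrib distrib_left mult.left_commute)
  finally show ?thesis .
qed

lemma total_deriv_diff:
  "JF f \<Longrightarrow> JF g \<Longrightarrow> p \<in> \<Omega> \<Longrightarrow>
    total_deriv k (\<lambda>p. f p - g p) p = total_deriv k f p - total_deriv k g p"
  using total_deriv_linear[of k "\<lambda>p. f p - g p" p 1 f "-1" g]
  by (simp add: pderiv_at_diff[OF JF_pdiff JF_pdiff])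

lemma total_deriv_mult:
  assumes "JF f" "JF g" "p \<in> \<Omega>"
  shows "total_deriv k (\<lambda>p. f p * g p) p = total_deriv k f p * g p + f p * total_deriv k g p"
proof -
  have "total_deriv k (\<lambda>p. f p * g p) p = g p * total_deriv k f p + f p * total_deriv k g p"
    by (rule total_deriv_linear[OF _ assms]) (simp add: pderiv_at_mult[OF JF_pdiff JF_pdiff] assms)
  then show ?thesis by simp
qed

lemma total_deriv_const: "total_deriv k (\<lambda>_. a) p = 0"
proof -
  have "pderiv_at c (\<lambda>_. a) p = 0" for c by (rule pderiv_at_eqI) simp
  then show ?thesis by (simp add: total_deriv_def)
qed

lemma total_deriv_sum_fun:
  assumes "\<And>i. i \<in> I \<Longrightarrow> JF (f i)" "p \<in> \<Omega>"
  shows "total_deriv k (\<lambda>p. \<Sum>i\<in>I. f i p) p = (\<Sum>i\<in>I. total_deriv k (f i) p)"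
  using assms(1)
proof (induction I rule: infinite_finite_induct)
  case (insert i I)
  have "total_deriv k (\<lambda>p. f i p + (\<Sum>i\<in>I. f i p)) p =
      1 * total_deriv k (f i) p + 1 * total_deriv k (\<lambda>p. \<Sum>i\<in>I. f i p) p"
    by (rule total_deriv_linear[OF _ _ _ assms(2)])
      (use insert.prems in \<open>auto intro!: JF_sum simp: pderiv_at_add[OF JF_pdiff JF_pdiff[OF JF_sum] assms(2)]\<close>)
  then show ?case using insert by simp
qed (simp_all add: total_deriv_const)

lemma total_deriv_coord_Dep: "total_deriv k (\<lambda>p. p (Dep \<delta>)) p = p (Dep (bump \<delta> k))"
proof -
  have "total_deriv k (\<lambda>p. p (Dep \<delta>)) p = pderiv_at (Indep k) (\<lambda>p. p (Dep \<delta>)) p +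
      (\<Sum>\<alpha>\<in>{\<delta>}. p (Dep (bump \<alpha> k)) * pderiv_at (Dep \<alpha>) (\<lambda>p. p (Dep \<delta>)) p)"
    by (rule total_deriv_sum) (auto simp: pderiv_at_coord)
  then show ?thesis by (simp add: pderiv_at_coord)
qed

text \<open>Commutator of a partial derivative with the field: the mixed second derivatives agree,
  and the derivatives of the coefficients remain.\<close>

lemma pderiv_field_apply:
  assumes "\<And>c. JF (Y c)" "JF f" and F: "finite F" "A \<subseteq> F" "depends_only_on F \<Omega> f" and "p \<in> \<Omega>"
  shows "pderiv_at \<gamma> (field_apply Y f) p =
    field_apply Y (pderiv_at \<gamma> f) p + (\<Sum>c\<in>F. pderiv_at \<gamma> (Y c) p * pderiv_at c f p)"
proof -
  have "pderiv_at \<gamma> (field_apply Y f) p = pderiv_at \<gamma> (\<lambda>p. \<Sum>c\<in>F. Y c p * pderiv_at c f p) p"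
    by (rule pderiv_cong[OF field_apply_sum[OF F(1,3)] assms(6)])
  also have "\<dots> = (\<Sum>c\<in>F. pderiv_at \<gamma> (\<lambda>p. Y c p * pderiv_at c f p) p)"
    by (intro pderiv_at_sum[OF _ assms(6)] JF_pdiff JF_mult JF_pderiv assms)
  also have "\<dots> = (\<Sum>c\<in>F. pderiv_at \<gamma> (Y c) p * pderiv_at c f p + Y c p * pderiv_at \<gamma> (pderiv_at c f) p)"
    by (intro sum.cong refl pderiv_at_mult[OF JF_pdiff JF_pdiff assms(6)] JF_pderiv assms)
  also have "\<dots> = (\<Sum>c\<in>F. Y c p * pderiv_at c (pderiv_at \<gamma> f) p) + (\<Sum>c\<in>F. pderiv_at \<gamma> (Y c) p * pderiv_at c f p)"
    using pderiv_swap[OF assms(2,6)] by (simp add: sum.distrib)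
  also have "(\<Sum>c\<in>F. Y c p * pderiv_at c (pderiv_at \<gamma> f) p) = field_apply Y (pderiv_at \<gamma> f) p"
    by (rule field_apply_sum[symmetric, OF F(1) depends_only_on_pderiv[OF cyl_mono[OF F(2)] F(3)] assms(6)])
  finally show ?thesis .
qed

text \<open>The commutator of \<partial>/\<partial>y^\<gamma> with D^k comes from differentiating
  the coefficients y^(\<alpha>+k), so only \<alpha> = \<gamma> - k contributes.\<close>

lemma pderiv_total_deriv:
  assumes "JF f" "p \<in> \<Omega>"
  shows "pderiv_at (Dep \<gamma>) (total_deriv k f) p = total_deriv k (pderiv_at (Dep \<gamma>) f) p +
    (if \<gamma> k > 0 then pderiv_at (Dep (mlower \<gamma> k)) f p else 0)"
proof -
  obtain B where B: "finite B" "\<And>\<alpha> p. \<alpha> \<notin> B \<Longrightarrow> p \<in> \<Omega> \<Longrightarrow> pderiv_at (Dep \<alpha>) f p = 0"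
    using JF_deps_multi[OF assms(1)] by blast
  let ?c = "Dep \<gamma>"
  have B': "pderiv_at (Dep \<alpha>) (pderiv_at ?c f) p = 0" if "\<alpha> \<notin> B" for \<alpha>
  proof -
    have "pderiv_at ?c (pderiv_at (Dep \<alpha>) f) p = pderiv_at ?c (\<lambda>_. 0) p"
      by (rule pderiv_cong[OF _ assms(2)]) (use B(2)[OF that] in auto)
    also have "\<dots> = 0" by (rule pderiv_at_eqI) simp
    finally show ?thesis using pderiv_swap[OF assms] by simp
  qed
  have "pderiv_at ?c (total_deriv k f) p =
      pderiv_at ?c (\<lambda>p. pderiv_at (Indep k) f p + (\<Sum>\<alpha>\<in>B. p (Dep (bump \<alpha> k)) * pderiv_at (Dep \<alpha>) f p)) p"
    by (rule pderiv_cong[OF total_deriv_sum[OF B(1)] assms(2)]) (use B(2) in auto)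
  also have "\<dots> = pderiv_at ?c (pderiv_at (Indep k) f) p +
      pderiv_at ?c (\<lambda>p. \<Sum>\<alpha>\<in>B. p (Dep (bump \<alpha> k)) * pderiv_at (Dep \<alpha>) f p) p"
    by (intro pderiv_at_add[OF _ _ assms(2)] JF_pdiff JF_sum JF_mult JF_pderiv JF_coord assms(1))
  also have "pderiv_at ?c (\<lambda>p. \<Sum>\<alpha>\<in>B. p (Dep (bump \<alpha> k)) * pderiv_at (Dep \<alpha>) f p) p =
      (\<Sum>\<alpha>\<in>B. pderiv_at ?c (\<lambda>p. p (Dep (bump \<alpha> k)) * pderiv_at (Dep \<alpha>) f p) p)"
    by (intro pderiv_at_sum[OF _ assms(2)] JF_pdiff JF_mult JF_pderiv JF_coord assms(1))
  also have "\<dots> = (\<Sum>\<alpha>\<in>B. pderiv_at ?c (\<lambda>p. p (Dep (bump \<alpha> k))) p * pderiv_at (Dep \<alpha>) f p +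
      p (Dep (bump \<alpha> k)) * pderiv_at ?c (pderiv_at (Dep \<alpha>) f) p)"
    by (intro sum.cong refl pderiv_at_mult[OF JF_pdiff JF_pdiff assms(2)] JF_pderiv JF_coord assms(1))
  also have "\<dots> = (\<Sum>\<alpha>\<in>B. (if \<gamma> = bump \<alpha> k then pderiv_at (Dep \<alpha>) f p else 0)) +
      (\<Sum>\<alpha>\<in>B. p (Dep (bump \<alpha> k)) * pderiv_at (Dep \<alpha>) (pderiv_at ?c f) p)"
    unfolding sum.distrib[symmetric] using pderiv_swap[OF assms]
    by (intro sum.cong) (auto simp: pderiv_at_coord)
  also have "(\<Sum>\<alpha>\<in>B. (if \<gamma> = bump \<alpha> k then pderiv_at (Dep \<alpha>) f p else 0)) =
      (if \<gamma> k > 0 then pderiv_at (Dep (mlower \<gamma> k)) f p else 0)"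
  proof (cases "\<gamma> k > 0")
    case True
    have eq: "\<gamma> = bump \<alpha> k \<longleftrightarrow> \<alpha> = mlower \<gamma> k" for \<alpha> using bump_mlower[of \<gamma> k, OF True] by auto
    show ?thesis unfolding eq using True B(1) B(2)[OF _ assms(2), of "mlower \<gamma> k"] by auto
  next
    case False
    then have "\<gamma> \<noteq> bump \<alpha> k" for \<alpha> using bump_pos[of \<alpha> k] by metis
    then show ?thesis using False by simp
  qed
  finally show ?thesis
    using total_deriv_sum[OF B(1), of "pderiv_at ?c f" p k] B' pderiv_swap[OF assms] by simp
qed

end


subsection \<open>The action of a Lie-Baecklund field on contact forms\<close>

locale lb_field = jet_dom A \<Omega> for A :: "'n::finite coord set" and \<Omega> :: "'n jet set" +
  fixes X :: "'n jet_field"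
  assumes LB: "Lie_Baecklund \<Omega> X"
begin

abbreviation "\<xi> i \<equiv> X (Indep i)"
abbreviation "\<eta> \<beta> \<equiv> X (Dep \<beta>)"

lemma JF_X: "JF (X c)"
  using LB by (simp add: Lie_Baecklund_def jet_vector_field_def)

lemma recursion: "p \<in> \<Omega> \<Longrightarrow> \<eta> (bump \<alpha> k) p =
    total_deriv k (\<eta> \<alpha>) p - (\<Sum>i\<in>UNIV. p (Dep (bump \<alpha> i)) * total_deriv k (\<xi> i) p)"
  using LB by (simp add: Lie_Baecklund_def)

text \<open>
  With the contact forms \<open>\<theta>\<^sup>\<beta> = dy\<^sup>\<beta> - \<Sum>\<^sub>i y\<^sup>\<beta>\<^sup>+\<^sup>i dx\<^sub>i\<close>, the Lie derivative of \<open>\<theta>\<^sup>\<beta>\<close> along the field is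
  \<open>\<Sum>\<^sub>\<gamma> M \<beta> \<gamma> \<theta>\<^sup>\<gamma>\<close>.
\<close>

definition M :: "'n multiindex \<Rightarrow> 'n multiindex \<Rightarrow> 'n jet \<Rightarrow> real" where
  "M \<beta> \<gamma> p = pderiv_at (Dep \<gamma>) (\<eta> \<beta>) p - (\<Sum>i\<in>UNIV. p (Dep (bump \<beta> i)) * pderiv_at (Dep \<gamma>) (\<xi> i) p)"

text \<open>One has \<theta>^(\<beta>+k) = L_(D^k) \<theta>^\<beta>, and the commutator of D^k with
  X is the sum of the (D^k \<xi> i) D^i. Hence L_X \<theta>^(\<beta>+k) is L_(D^k) L_X
  \<theta>^\<beta> minus the sum of the (D^k \<xi> i) \<theta>^(\<beta>+i). The proof carries this
  out in coefficients.\<close>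

lemma M_bump:
  assumes p: "p \<in> \<Omega>"
  shows "M (bump \<beta> k) \<gamma> p = total_deriv k (M \<beta> \<gamma>) p + (if \<gamma> k > 0 then M \<beta> (mlower \<gamma> k) p else 0)
    - (\<Sum>i\<in>UNIV. if \<gamma> = bump \<beta> i then total_deriv k (\<xi> i) p else 0)"
proof -
  let ?c = "Dep \<gamma>"
  let ?lo = "\<lambda>f. if \<gamma> k > 0 then pderiv_at (Dep (mlower \<gamma> k)) f p else 0"
  have "pderiv_at ?c (\<eta> (bump \<beta> k)) p = pderiv_at ?c
      (\<lambda>p. total_deriv k (\<eta> \<beta>) p - (\<Sum>i\<in>UNIV. p (Dep (bump \<beta> i)) * total_deriv k (\<xi> i) p)) p"
    by (rule pderiv_cong[OF recursion p])
  also have "\<dots> = pderiv_at ?c (total_deriv k (\<eta> \<beta>)) p -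
      pderiv_at ?c (\<lambda>p. \<Sum>i\<in>UNIV. p (Dep (bump \<beta> i)) * total_deriv k (\<xi> i) p) p"
    by (intro pderiv_at_diff[OF _ _ p] JF_pdiff JF_sum JF_mult JF_total_deriv JF_coord JF_X)
  also have "pderiv_at ?c (\<lambda>p. \<Sum>i\<in>UNIV. p (Dep (bump \<beta> i)) * total_deriv k (\<xi> i) p) p =
      (\<Sum>i\<in>UNIV. pderiv_at ?c (\<lambda>p. p (Dep (bump \<beta> i)) * total_deriv k (\<xi> i) p) p)"
    by (intro pderiv_at_sum[OF _ p] JF_pdiff JF_mult JF_total_deriv JF_coord JF_X)
  also have "\<dots> = (\<Sum>i\<in>UNIV. pderiv_at ?c (\<lambda>p. p (Dep (bump \<beta> i))) p * total_deriv k (\<xi> i) p +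
      p (Dep (bump \<beta> i)) * pderiv_at ?c (total_deriv k (\<xi> i)) p)"
    by (intro sum.cong refl pderiv_at_mult[OF JF_pdiff JF_pdiff p] JF_total_deriv JF_coord JF_X)
  also have "\<dots> = (\<Sum>i\<in>UNIV. if \<gamma> = bump \<beta> i then total_deriv k (\<xi> i) p else 0) +
      (\<Sum>i\<in>UNIV. p (Dep (bump \<beta> i)) * (total_deriv k (pderiv_at ?c (\<xi> i)) p + ?lo (\<xi> i)))"
    unfolding sum.distrib[symmetric] pderiv_total_deriv[OF JF_X p]
    by (intro sum.cong) (auto simp: pderiv_at_coord)
  also have "pderiv_at ?c (total_deriv k (\<eta> \<beta>)) p = total_deriv k (pderiv_at ?c (\<eta> \<beta>)) p + ?lo (\<eta> \<beta>)"
    by (rule pderiv_total_deriv[OF JF_X p])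
  finally have 1: "pderiv_at ?c (\<eta> (bump \<beta> k)) p = total_deriv k (pderiv_at ?c (\<eta> \<beta>)) p + ?lo (\<eta> \<beta>) -
     ((\<Sum>i\<in>UNIV. if \<gamma> = bump \<beta> i then total_deriv k (\<xi> i) p else 0) +
      (\<Sum>i\<in>UNIV. p (Dep (bump \<beta> i)) * (total_deriv k (pderiv_at ?c (\<xi> i)) p + ?lo (\<xi> i))))" .
  have "total_deriv k (M \<beta> \<gamma>) p = total_deriv k (pderiv_at ?c (\<eta> \<beta>)) p -
      total_deriv k (\<lambda>p. \<Sum>i\<in>UNIV. p (Dep (bump \<beta> i)) * pderiv_at ?c (\<xi> i) p) p"
    unfolding M_def by (intro total_deriv_diff[OF _ _ p] JF_sum JF_mult JF_pderiv JF_coord JF_X)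
  also have "total_deriv k (\<lambda>p. \<Sum>i\<in>UNIV. p (Dep (bump \<beta> i)) * pderiv_at ?c (\<xi> i) p) p =
      (\<Sum>i\<in>UNIV. total_deriv k (\<lambda>p. p (Dep (bump \<beta> i)) * pderiv_at ?c (\<xi> i) p) p)"
    by (intro total_deriv_sum_fun[OF _ p] JF_mult JF_pderiv JF_coord JF_X)
  also have "\<dots> = (\<Sum>i\<in>UNIV. p (Dep (bump (bump \<beta> k) i)) * pderiv_at ?c (\<xi> i) p +
      p (Dep (bump \<beta> i)) * total_deriv k (pderiv_at ?c (\<xi> i)) p)"
    by (intro sum.cong refl)
      (simp add: total_deriv_mult[OF JF_coord JF_pderiv[OF JF_X] p] total_deriv_coord_Dep bump_commute)
  finally have 2: "total_deriv k (M \<beta> \<gamma>) p = total_deriv k (pderiv_at ?c (\<eta> \<beta>)) p -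
      (\<Sum>i\<in>UNIV. p (Dep (bump (bump \<beta> k) i)) * pderiv_at ?c (\<xi> i) p +
      p (Dep (bump \<beta> i)) * total_deriv k (pderiv_at ?c (\<xi> i)) p)" .
  have 3: "(if \<gamma> k > 0 then M \<beta> (mlower \<gamma> k) p else 0) =
      ?lo (\<eta> \<beta>) - (\<Sum>i\<in>UNIV. p (Dep (bump \<beta> i)) * ?lo (\<xi> i))"
    by (simp add: M_def)
  show ?thesis
    unfolding 2 3 unfolding M_def 1 by (simp add: sum.distrib distrib_left)
qed

text \<open>By \<open>M_bump\<close>, passing from \<beta> to \<beta> + k raises the order by at
  most one.\<close>

lemma M_above:
  assumes "\<forall>\<gamma> p. msize \<gamma> > r \<longrightarrow> p \<in> \<Omega> \<longrightarrow> M (\<lambda>_. 0) \<gamma> p = 0"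
  shows "msize \<gamma> > msize \<beta> + r \<Longrightarrow> p \<in> \<Omega> \<Longrightarrow> M \<beta> \<gamma> p = 0"
proof (induction \<beta> arbitrary: \<gamma> p rule: multiindex_induct)
  case zero then show ?case using assms by simp
next
  case (bump \<beta> k)
  have "total_deriv k (M \<beta> \<gamma>) p = total_deriv k (\<lambda>_. 0) p"
    by (rule total_deriv_cong[OF _ bump.prems(2)]) (use bump in auto)
  moreover have "M \<beta> (mlower \<gamma> k) p = 0" if "\<gamma> k > 0"
    using bump.IH[of "mlower \<gamma> k" p] bump.prems msize_mlower[of \<gamma> k] that by simp
  moreover have "\<gamma> \<noteq> bump \<beta> i" for i using bump.prems by auto
  ultimately show ?case by (simp add: M_bump[OF bump.prems(2)] total_deriv_const)
qed

text \<open>In the top order only the shift from \<gamma> to \<gamma> - k in \<open>M_bump\<close>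
  survives, so the leading symbol for \<beta> is the one for 0 times the monomial with exponent
  \<beta>. The condition r \<ge> 1 keeps the terms with D^k \<xi> i, of order |\<beta>| + 1, below
  the top.\<close>

lemma M_top:
  assumes "r \<ge> 1" and above: "\<forall>\<gamma> p. msize \<gamma> > r \<longrightarrow> p \<in> \<Omega> \<longrightarrow> M (\<lambda>_. 0) \<gamma> p = 0"
  shows "msize \<gamma> = msize \<beta> + r \<Longrightarrow> p \<in> \<Omega> \<Longrightarrow>
    M \<beta> \<gamma> p = (if \<forall>i. \<beta> i \<le> \<gamma> i then M (\<lambda>_. 0) (\<lambda>i. \<gamma> i - \<beta> i) p else 0)"
proof (induction \<beta> arbitrary: \<gamma> p rule: multiindex_induct)
  case zero then show ?case by simp
next
  case (bump \<beta> k)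
  have "total_deriv k (M \<beta> \<gamma>) p = total_deriv k (\<lambda>_. 0) p"
    by (rule total_deriv_cong[OF _ bump.prems(2)]) (use M_above[OF above, where \<beta> = \<beta> and \<gamma> = \<gamma>] bump.prems in auto)
  moreover have "\<gamma> \<noteq> bump \<beta> i" for i using bump.prems assms(1) by auto
  ultimately have *: "M (bump \<beta> k) \<gamma> p = (if \<gamma> k > 0 then M \<beta> (mlower \<gamma> k) p else 0)"
    by (simp add: M_bump[OF bump.prems(2)] total_deriv_const)
  show ?case
  proof (cases "\<gamma> k > 0")
    case True
    have "msize (mlower \<gamma> k) = msize \<beta> + r" using bump.prems(1) msize_mlower[of \<gamma> k] True by simp
    from bump.IH[OF this bump.prems(2)]
    have "M (bump \<beta> k) \<gamma> p =
        (if \<forall>i. \<beta> i \<le> mlower \<gamma> k i then M (\<lambda>_. 0) (\<lambda>i. mlower \<gamma> k i - \<beta> i) p else 0)"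
      using * True by simp
    moreover have "(\<forall>i. \<beta> i \<le> mlower \<gamma> k i) \<longleftrightarrow> (\<forall>i. bump \<beta> k i \<le> \<gamma> i)"
    proof -
      have "\<beta> i \<le> mlower \<gamma> k i \<longleftrightarrow> bump \<beta> k i \<le> \<gamma> i" for i
        using True by (auto simp: bump_def mlower_def)
      then show ?thesis by simp
    qed
    moreover have "(\<lambda>i. mlower \<gamma> k i - \<beta> i) = (\<lambda>i. \<gamma> i - bump \<beta> k i)"
      by (auto simp: bump_def mlower_def)
    ultimately show ?thesis by simp
  next
    case False
    then have n: "\<not> (\<forall>i. bump \<beta> k i \<le> \<gamma> i)" by (auto simp: bump_def intro!: exI[of _ k])
    have "M (bump \<beta> k) \<gamma> p = 0" using * False by simp
    then show ?thesis by (simp only: if_not_P[OF n])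
  qed
qed

end

section \<open>The field as a derivation on functions\<close>

context lb_field
begin

lemma field_apply_coord: "field_apply X (\<lambda>p. p c) p = X c p"
proof -
  have "field_apply X (\<lambda>p. p c) p = (\<Sum>d\<in>{c}. X d p * pderiv_at d (\<lambda>p. p c) p)"
    unfolding field_apply_def by (rule Sum_any_eq_sum) (auto simp: pderiv_at_coord)
  then show ?thesis by (simp add: pderiv_at_coord)
qed

lemma JF_iterate: "JF f \<Longrightarrow> JF ((field_apply X ^^ k) f)"
  by (induction k) (simp_all add: JF_field_apply[OF JF_X])

lemma field_apply_add:
  assumes "JF f" "JF g" "p \<in> \<Omega>"
  shows "field_apply X (\<lambda>p. f p + g p) p = field_apply X f p + field_apply X g p"
proof -
  obtain F1 where F1: "finite F1" "A \<subseteq> F1" "depends_only_on F1 \<Omega> f" by (rule JF_deps[OF assms(1)])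
  obtain F2 where F2: "finite F2" "A \<subseteq> F2" "depends_only_on F2 \<Omega> g" by (rule JF_deps[OF assms(2)])
  let ?F = "F1 \<union> F2"
  have F: "finite ?F" "depends_only_on ?F \<Omega> f" "depends_only_on ?F \<Omega> g"
    using F1 F2 by (auto intro: depends_only_on_mono[OF F1(3)] depends_only_on_mono[OF F2(3)])
  have "depends_only_on ?F \<Omega> (\<lambda>p. f p + g p)"
    using F(2,3) unfolding depends_only_on_def by fastforce
  then show ?thesis
    using field_apply_sum[OF F(1) F(2) assms(3)] field_apply_sum[OF F(1) F(3) assms(3)]
      field_apply_sum[OF F(1) _ assms(3), of "\<lambda>p. f p + g p" X]
    by (simp add: pderiv_at_add[OF JF_pdiff JF_pdiff assms(3)] assms distrib_left sum.distrib)
qed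

lemma field_apply_mult:
  assumes "JF f" "JF g" "p \<in> \<Omega>"
  shows "field_apply X (\<lambda>p. f p * g p) p = field_apply X f p * g p + f p * field_apply X g p"
proof -
  obtain F1 where F1: "finite F1" "A \<subseteq> F1" "depends_only_on F1 \<Omega> f" by (rule JF_deps[OF assms(1)])
  obtain F2 where F2: "finite F2" "A \<subseteq> F2" "depends_only_on F2 \<Omega> g" by (rule JF_deps[OF assms(2)])
  let ?F = "F1 \<union> F2"
  have F: "finite ?F" "depends_only_on ?F \<Omega> f" "depends_only_on ?F \<Omega> g"
    using F1 F2 by (auto intro: depends_only_on_mono[OF F1(3)] depends_only_on_mono[OF F2(3)])
  have "depends_only_on ?F \<Omega> (\<lambda>p. f p * g p)"
    using F(2,3) unfolding depends_only_on_def by fastforce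
  then have "field_apply X (\<lambda>p. f p * g p) p = (\<Sum>c\<in>?F. X c p * pderiv_at c (\<lambda>p. f p * g p) p)"
    by (rule field_apply_sum[OF F(1) _ assms(3)])
  also have "\<dots> = (\<Sum>c\<in>?F. X c p * pderiv_at c f p * g p + f p * (X c p * pderiv_at c g p))"
    by (intro sum.cong refl) (simp add: pderiv_at_mult[OF JF_pdiff JF_pdiff assms(3)] assms algebra_simps)
  also have "\<dots> = field_apply X f p * g p + f p * field_apply X g p"
    by (simp add: field_apply_sum[OF F(1) F(2) assms(3)] field_apply_sum[OF F(1) F(3) assms(3)]
        sum.distrib sum_distrib_left sum_distrib_right)
  finally show ?thesis .
qed

end

text \<open>
  A vertical form is a family of coefficients \<open>w \<gamma>\<close> of \<open>\<theta>\<^sup>\<gamma>\<close>. Condition \<open>F\<close> provides a finite set \<open>F\<close> of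
  coordinates for the independent variables and \<open>y\<close> together; then the Lie derivatives of \<open>\<theta>\<close> of all
  orders are combinations of \<open>\<theta>\<^sup>\<gamma>\<close> with \<open>y\<^sup>\<gamma> \<in> F\<close>.
\<close>

locale lb_field_F = lb_field A \<Omega> X for A :: "'n::finite coord set" and \<Omega> and X :: "'n jet_field" +
  fixes F :: "'n coord set"
  assumes fin_F: "finite F" and A_F: "A \<subseteq> F"
    and dep_F: "\<And>g k. g \<in> insert (Dep (\<lambda>_. 0)) (range Indep) \<Longrightarrow>
      depends_only_on F \<Omega> ((field_apply X ^^ k) (\<lambda>p. p g))"
begin

definition B :: "'n multiindex set" where
  "B = Dep -` F"

lemma finite_B: "finite B"
  unfolding B_def by (rule finite_vimageI[OF fin_F]) (simp add: inj_def)

text \<open>Leibniz rule for the Lie derivative of the sum of the w \<gamma> \<theta>^\<gamma>; the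
  sum over B is complete for forms supported in B.\<close>

definition lie :: "('n multiindex \<Rightarrow> 'n jet \<Rightarrow> real) \<Rightarrow> 'n multiindex \<Rightarrow> 'n jet \<Rightarrow> real" where
  "lie w \<gamma> p = field_apply X (w \<gamma>) p + (\<Sum>\<beta>\<in>B. w \<beta> p * M \<beta> \<gamma> p)"

text \<open>The module over the functions on \<Omega> that is spanned by the vertical parts of d(X^k
  y) and d(X^k x_i). Coefficients are total functions but known on \<Omega> only, so
  \<open>eq_on\<close> forgets their values elsewhere.\<close>

inductive vspan :: "('n multiindex \<Rightarrow> 'n jet \<Rightarrow> real) \<Rightarrow> bool" where
  gen: "JF f \<Longrightarrow> g \<in> insert (Dep (\<lambda>_. 0)) (range Indep) \<Longrightarrow>
    vspan (\<lambda>\<gamma> p. f p * pderiv_at (Dep \<gamma>) ((field_apply X ^^ k) (\<lambda>p. p g)) p)"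
| plus: "vspan w \<Longrightarrow> vspan w' \<Longrightarrow> vspan (\<lambda>\<gamma> p. w \<gamma> p + w' \<gamma> p)"
| eq_on: "vspan w \<Longrightarrow> (\<And>\<gamma> p. p \<in> \<Omega> \<Longrightarrow> w \<gamma> p = w' \<gamma> p) \<Longrightarrow> vspan w'"

lemma vspan_JF: "vspan w \<Longrightarrow> JF (w \<gamma>)"
proof (induction rule: vspan.induct)
  case (gen f g k)
  then show ?case by (intro JF_mult JF_pderiv JF_iterate JF_coord)
next
  case (plus w w') then show ?case by (intro JF_add)
next
  case (eq_on w w') then show ?case using JF_cong[of "w \<gamma>" "w' \<gamma>"] by auto
qed

lemma vspan_B: "vspan w \<Longrightarrow> \<gamma> \<notin> B \<Longrightarrow> p \<in> \<Omega> \<Longrightarrow> w \<gamma> p = 0"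
proof (induction rule: vspan.induct)
  case (gen f g k)
  have "pderiv_at (Dep \<gamma>) ((field_apply X ^^ k) (\<lambda>p. p g)) p = 0"
    by (rule pderiv_0[OF dep_F[OF gen(2)]]) (use gen in \<open>auto simp: B_def\<close>)
  then show ?case by simp
qed auto

lemma vspan_zero: "vspan (\<lambda>_ _. 0)"
  using vspan.gen[OF JF_const[of 0], of "Dep (\<lambda>_. 0)"] by simp

lemma vspan_sum: "(\<And>i. i \<in> I \<Longrightarrow> vspan (w i)) \<Longrightarrow> vspan (\<lambda>\<gamma> p. \<Sum>i\<in>I. w i \<gamma> p)"
proof (induction I rule: infinite_finite_induct)
  case (insert i I)
  then show ?case using vspan.plus[of "w i" "\<lambda>\<gamma> p. \<Sum>i\<in>I. w i \<gamma> p"] by simp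
qed (simp_all add: vspan_zero)

text \<open>The form dh splits into the sum of the D^i h dx_i and a vertical part. Since L_X dh =
  d(X h), the vertical part contributed by L_X (D^i h dx_i), which is that of D^i h d(\<xi> i), has
  to be subtracted.\<close>

lemma lie_vertical_differential:
  assumes h: "JF h" "depends_only_on F \<Omega> h" and p: "p \<in> \<Omega>"
  shows "field_apply X (pderiv_at (Dep \<gamma>) h) p + (\<Sum>\<beta>\<in>B. pderiv_at (Dep \<beta>) h p * M \<beta> \<gamma> p) =
    pderiv_at (Dep \<gamma>) (field_apply X h) p - (\<Sum>i\<in>UNIV. total_deriv i h p * pderiv_at (Dep \<gamma>) (\<xi> i) p)"
proof -
  let ?c = "Dep \<gamma>"
  have Dep_B: "Dep ` B = F \<inter> range Dep" by (auto simp: B_def)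
  have F_split: "(\<Sum>c\<in>F. pderiv_at ?c (X c) p * pderiv_at c h p) =
      (\<Sum>\<beta>\<in>B. pderiv_at ?c (\<eta> \<beta>) p * pderiv_at (Dep \<beta>) h p) +
      (\<Sum>i\<in>UNIV. pderiv_at ?c (\<xi> i) p * pderiv_at (Indep i) h p)"
  proof -
    have "(\<Sum>c\<in>F. pderiv_at ?c (X c) p * pderiv_at c h p) =
        (\<Sum>c\<in>Dep ` B \<union> range Indep. pderiv_at ?c (X c) p * pderiv_at c h p)"
    proof (rule sum.mono_neutral_left)
      show "F \<subseteq> Dep ` B \<union> range Indep"
      proof
        fix c assume "c \<in> F" then show "c \<in> Dep ` B \<union> range Indep" by (cases c) (auto simp: B_def)
      qed
      show "\<forall>c\<in>Dep ` B \<union> range Indep - F. pderiv_at ?c (X c) p * pderiv_at c h p = 0"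
        using pderiv_0[OF h(2) _ p] by auto
    qed (use finite_B in auto)
    also have "\<dots> = (\<Sum>c\<in>Dep ` B. pderiv_at ?c (X c) p * pderiv_at c h p) +
        (\<Sum>c\<in>range Indep. pderiv_at ?c (X c) p * pderiv_at c h p)"
      using finite_B by (intro sum.union_disjoint) auto
    also have "(\<Sum>c\<in>Dep ` B. pderiv_at ?c (X c) p * pderiv_at c h p) =
        (\<Sum>\<beta>\<in>B. pderiv_at ?c (\<eta> \<beta>) p * pderiv_at (Dep \<beta>) h p)"
      by (subst sum.reindex) (auto simp: inj_on_def)
    also have "(\<Sum>c\<in>range Indep. pderiv_at ?c (X c) p * pderiv_at c h p) =
        (\<Sum>i\<in>UNIV. pderiv_at ?c (\<xi> i) p * pderiv_at (Indep i) h p)"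
      by (subst sum.reindex) (auto simp: inj_on_def)
    finally show ?thesis .
  qed
  have td: "total_deriv i h p = pderiv_at (Indep i) h p + (\<Sum>\<beta>\<in>B. p (Dep (bump \<beta> i)) * pderiv_at (Dep \<beta>) h p)" for i
    by (rule total_deriv_sum[OF finite_B]) (use pderiv_0[OF h(2) _ p] in \<open>auto simp: B_def\<close>)
  have "(\<Sum>\<beta>\<in>B. pderiv_at (Dep \<beta>) h p * M \<beta> \<gamma> p) =
      (\<Sum>\<beta>\<in>B. pderiv_at ?c (\<eta> \<beta>) p * pderiv_at (Dep \<beta>) h p) -
      (\<Sum>\<beta>\<in>B. \<Sum>i\<in>UNIV. p (Dep (bump \<beta> i)) * pderiv_at (Dep \<beta>) h p * pderiv_at ?c (\<xi> i) p)"
    by (simp add: M_def right_diff_distrib sum_subtractf sum_distrib_left mult_ac)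
  also have "(\<Sum>\<beta>\<in>B. \<Sum>i\<in>UNIV. p (Dep (bump \<beta> i)) * pderiv_at (Dep \<beta>) h p * pderiv_at ?c (\<xi> i) p) =
      (\<Sum>i\<in>UNIV. (\<Sum>\<beta>\<in>B. p (Dep (bump \<beta> i)) * pderiv_at (Dep \<beta>) h p) * pderiv_at ?c (\<xi> i) p)"
    by (subst sum.swap) (simp add: sum_distrib_right)
  finally show ?thesis
    unfolding pderiv_field_apply[OF JF_X h(1) fin_F A_F h(2) p] F_split td
    by (simp add: algebra_simps sum.distrib)
qed

text \<open>Applied to f times the vertical part of d(X^k g), the Lie derivative also produces the
  vertical parts of d(X^(k+1) g) and of the d(\<xi> i). As \<xi> i = X x_i, the latter are
  generators too; this is why the x_i are included.\<close>

lemma vspan_lie: "vspan w \<Longrightarrow> vspan (lie w)"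
proof (induction rule: vspan.induct)
  case (gen f g k)
  define h where "h = (field_apply X ^^ k) (\<lambda>p. p g)"
  have h: "JF h" "depends_only_on F \<Omega> h"
    unfolding h_def using dep_F[OF gen(2)] by (auto intro: JF_iterate JF_coord)
  let ?w = "\<lambda>\<gamma> p. (field_apply X f p * pderiv_at (Dep \<gamma>) ((field_apply X ^^ k) (\<lambda>p. p g)) p +
      f p * pderiv_at (Dep \<gamma>) ((field_apply X ^^ Suc k) (\<lambda>p. p g)) p) +
      (\<Sum>i\<in>UNIV. (0 - f p * total_deriv i h p) * pderiv_at (Dep \<gamma>) ((field_apply X ^^ Suc 0) (\<lambda>p. p (Indep i))) p)"
  have "vspan ?w"
    by (intro vspan.plus vspan_sum vspan.gen JF_diff JF_mult JF_const JF_total_deriv JF_field_apply[OF JF_X] gen h) auto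
  moreover have "?w \<gamma> p = lie (\<lambda>\<gamma> p. f p * pderiv_at (Dep \<gamma>) ((field_apply X ^^ k) (\<lambda>p. p g)) p) \<gamma> p"
    if p: "p \<in> \<Omega>" for \<gamma> p
  proof -
    have "lie (\<lambda>\<gamma> p. f p * pderiv_at (Dep \<gamma>) h p) \<gamma> p =
      field_apply X f p * pderiv_at (Dep \<gamma>) h p + f p * (field_apply X (pderiv_at (Dep \<gamma>) h) p +
        (\<Sum>\<beta>\<in>B. pderiv_at (Dep \<beta>) h p * M \<beta> \<gamma> p))"
      by (simp add: lie_def field_apply_mult[OF gen(1) JF_pderiv[OF h(1)] p] distrib_left sum_distrib_left mult.assoc)
    also note lie_vertical_differential[OF h p]
    finally have 1: "lie (\<lambda>\<gamma> p. f p * pderiv_at (Dep \<gamma>) h p) \<gamma> p =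
      field_apply X f p * pderiv_at (Dep \<gamma>) h p + f p * (pderiv_at (Dep \<gamma>) (field_apply X h) p -
        (\<Sum>i\<in>UNIV. total_deriv i h p * pderiv_at (Dep \<gamma>) (\<xi> i) p))" .
    have 2: "pderiv_at (Dep \<gamma>) (field_apply X (\<lambda>p. p (Indep i))) p = pderiv_at (Dep \<gamma>) (\<xi> i) p" for i
      by (simp add: field_apply_coord[abs_def])
    show ?thesis
      using 1 unfolding h_def[symmetric] funpow.simps(2) o_def funpow_0
      by (simp add: h_def[symmetric] 2 right_diff_distrib sum_distrib_left sum_negf mult_ac)
  qed
  ultimately show ?case by (rule vspan.eq_on)
next
  case (plus w w')
  from vspan.plus[OF plus(3,4)] show ?case
  proof (rule vspan.eq_on)
    fix \<gamma> p assume p: "p \<in> \<Omega>"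
    show "lie w \<gamma> p + lie w' \<gamma> p = lie (\<lambda>\<gamma> p. w \<gamma> p + w' \<gamma> p) \<gamma> p"
      by (simp add: lie_def field_apply_add[OF vspan_JF[OF plus(1)] vspan_JF[OF plus(2)] p] distrib_right sum.distrib)
  qed
next
  case (eq_on w w')
  from eq_on(3) show ?case
  proof (rule vspan.eq_on)
    fix \<gamma> p assume p: "p \<in> \<Omega>"
    show "lie w \<gamma> p = lie w' \<gamma> p"
      unfolding lie_def using field_apply_cong[of "w \<gamma>" "w' \<gamma>" p X] eq_on(2) p by simp
  qed
qed

text \<open>The coefficients of the k-th Lie derivative of \<theta>.\<close>

definition W :: "nat \<Rightarrow> 'n multiindex \<Rightarrow> 'n jet \<Rightarrow> real" where
  "W k = (lie ^^ k) (\<lambda>\<gamma> p. if \<gamma> = (\<lambda>_. 0) then 1 else 0)"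

lemma W_0: "W 0 \<gamma> p = (if \<gamma> = (\<lambda>_. 0) then 1 else 0)"
  by (simp add: W_def)

lemma W_Suc: "W (Suc k) \<gamma> p = field_apply X (W k \<gamma>) p + (\<Sum>\<beta>\<in>B. W k \<beta> p * M \<beta> \<gamma> p)"
  by (simp add: W_def lie_def)

lemma vspan_W: "vspan (W k)"
proof (induction k)
  case 0
  \<comment> \<open>The form \<theta> is the vertical part of dy.\<close>
  have "vspan (\<lambda>\<gamma> p. 1 * pderiv_at (Dep \<gamma>) ((field_apply X ^^ 0) (\<lambda>p. p (Dep (\<lambda>_. 0)))) p)"
    by (intro vspan.gen JF_const) simp
  then show ?case by (rule vspan.eq_on) (auto simp: W_0 pderiv_at_coord)
next
  case (Suc k)
  then show ?case using vspan_lie[OF Suc] by (simp add: W_def)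
qed

lemma W_B: "\<gamma> \<notin> B \<Longrightarrow> p \<in> \<Omega> \<Longrightarrow> W k \<gamma> p = 0"
  by (rule vspan_B[OF vspan_W])

lemma field_apply_zero: "(\<And>p. p \<in> \<Omega> \<Longrightarrow> f p = 0) \<Longrightarrow> p \<in> \<Omega> \<Longrightarrow> field_apply X f p = 0"
proof -
  assume "\<And>p. p \<in> \<Omega> \<Longrightarrow> f p = 0" "p \<in> \<Omega>"
  then have "field_apply X f p = field_apply X (\<lambda>_. 0) p" by (intro field_apply_cong) auto
  moreover have "pderiv_at c (\<lambda>_. 0) p = 0" for c by (rule pderiv_at_eqI) simp
  ultimately show ?thesis by (simp add: field_apply_def)
qed

text \<open>
  If \<open>\<theta>\<close> had a Lie derivative \<open>M 0\<close> of order \<open>r \<ge> 1\<close>, then the \<open>k\<close>-th one would have the order \<open>k r\<close>,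
  since the leading symbol is multiplicative. To see this without polynomials, the leading
  multiindex \<open>m\<close> is chosen of maximal Euclidean norm, so that \<open>k m\<close> is in a unique way
  a sum of \<open>k\<close> multiindices of the leading symbol.
\<close>

lemma M_zero_order:
  assumes "msize \<gamma> \<ge> 1" "p \<in> \<Omega>"
  shows "M (\<lambda>_. 0) \<gamma> p = 0"
proof (rule ccontr)
  assume neq: "M (\<lambda>_. 0) \<gamma> p \<noteq> 0"
  \<comment> \<open>Exponents of positive order that occur in L_X \<theta> somewhere on \<Omega>;
    thus r and m below do not depend on the point.\<close>
  define N where "N = {\<gamma>. msize \<gamma> \<ge> 1 \<and> (\<exists>p\<in>\<Omega>. M (\<lambda>_. 0) \<gamma> p \<noteq> 0)}"
  have finN: "finite N"
  proof -
    have "\<exists>B. finite B \<and> (\<forall>\<alpha> p. \<alpha> \<notin> B \<longrightarrow> p \<in> \<Omega> \<longrightarrow> pderiv_at (Dep \<alpha>) (X c) p = 0)" for c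
      by (rule JF_deps_multi[OF JF_X])
    then obtain Q where Q: "\<And>c. finite (Q c)"
      "\<And>c \<alpha> p. \<alpha> \<notin> Q c \<Longrightarrow> p \<in> \<Omega> \<Longrightarrow> pderiv_at (Dep \<alpha>) (X c) p = 0" by metis
    have "N \<subseteq> Q (Dep (\<lambda>_. 0)) \<union> (\<Union>i. Q (Indep i))"
    proof
      fix \<gamma> assume "\<gamma> \<in> N"
      then obtain p where p: "p \<in> \<Omega>" "M (\<lambda>_. 0) \<gamma> p \<noteq> 0" by (auto simp: N_def)
      show "\<gamma> \<in> Q (Dep (\<lambda>_. 0)) \<union> (\<Union>i. Q (Indep i))"
      proof (rule ccontr)
        assume "\<gamma> \<notin> Q (Dep (\<lambda>_. 0)) \<union> (\<Union>i. Q (Indep i))"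
        then have "M (\<lambda>_. 0) \<gamma> p = 0" using Q(2)[OF _ p(1)] by (simp add: M_def)
        then show False using p(2) by simp
      qed
    qed
    then show ?thesis by (rule finite_subset) (use Q(1) in auto)
  qed
  have N0: "\<gamma> \<in> N" using neq assms by (auto simp: N_def)
  define r where "r = Max (msize ` N)"
  have r: "r \<in> msize ` N" unfolding r_def using finN N0 by (intro Max_in) auto
  then have r1: "r \<ge> 1" by (auto simp: N_def)
  have above: "\<forall>\<gamma> p. msize \<gamma> > r \<longrightarrow> p \<in> \<Omega> \<longrightarrow> M (\<lambda>_. 0) \<gamma> p = 0"
  proof (intro allI impI, rule ccontr)
    fix \<gamma> p assume *: "msize \<gamma> > r" "p \<in> \<Omega>" "M (\<lambda>_. 0) \<gamma> p \<noteq> 0"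
    then have "\<gamma> \<in> N" using r1 by (auto simp: N_def)
    then have "msize \<gamma> \<le> r" unfolding r_def using finN by (intro Max_ge) auto
    then show False using *(1) by simp
  qed
  define T where "T = {\<gamma> \<in> N. msize \<gamma> = r}"
  have T: "finite T" "T \<noteq> {}" using finN r by (auto simp: T_def)
  have T_I: "\<beta> \<in> T" if "msize \<beta> = r" "p \<in> \<Omega>" "M (\<lambda>_. 0) \<beta> p \<noteq> 0" for \<beta> p
    using that r1 by (auto simp: T_def N_def)
  define sq where "sq \<beta> = (\<Sum>i\<in>UNIV. (int (\<beta> i))\<^sup>2)" for \<beta> :: "'n multiindex"
  obtain m where m: "m \<in> T" "\<And>\<beta>. \<beta> \<in> T \<Longrightarrow> sq \<beta> \<le> sq m"
  proof -
    have "Max (sq ` T) \<in> sq ` T" using T by (intro Max_in) auto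
    then obtain m where "m \<in> T" "sq m = Max (sq ` T)" by auto
    then show ?thesis using T(1) by (intro that[of m]) auto
  qed
  \<comment> \<open>The scalar product with m. Expanding |\<beta> - m|^2 shows that on T it is
    largest at m and only there.\<close>
  define l where "l \<beta> = (\<Sum>i\<in>UNIV. int (\<beta> i) * int (m i))" for \<beta> :: "'n multiindex"
  have l_T: "l \<beta> \<le> l m \<and> (l \<beta> = l m \<longrightarrow> \<beta> = m)" if "\<beta> \<in> T" for \<beta>
  proof -
    have e: "(\<Sum>i\<in>UNIV. (int (\<beta> i) - int (m i))\<^sup>2) = sq \<beta> + sq m - 2 * l \<beta>"
      by (simp add: sq_def l_def power2_diff sum.distrib sum_subtractf sum_distrib_left mult.assoc)
    have lm: "l m = sq m" by (simp add: l_def sq_def power2_eq_square)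
    have ge: "(\<Sum>i\<in>UNIV. (int (\<beta> i) - int (m i))\<^sup>2) \<ge> 0" by (intro sum_nonneg) auto
    have "\<beta> = m" if "l \<beta> = l m"
    proof -
      have "(\<Sum>i\<in>UNIV. (int (\<beta> i) - int (m i))\<^sup>2) = 0" using that e lm ge m(2)[OF \<open>\<beta> \<in> T\<close>] by linarith
      then show ?thesis by (simp add: sum_nonneg_eq_0_iff fun_eq_iff)
    qed
    moreover have "l \<beta> \<le> l m" using e lm ge m(2)[OF that] by linarith
    ultimately show ?thesis by blast
  qed
  have msz_add: "msize \<gamma> = msize \<beta> + msize (\<lambda>i. \<gamma> i - \<beta> i)" "l \<gamma> = l \<beta> + l (\<lambda>i. \<gamma> i - \<beta> i)"
    if "\<forall>i. \<beta> i \<le> \<gamma> i" for \<beta> \<gamma>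
  proof -
    show "msize \<gamma> = msize \<beta> + msize (\<lambda>i. \<gamma> i - \<beta> i)"
      unfolding msize_def sum.distrib[symmetric] using that by (intro sum.cong) auto
    show "l \<gamma> = l \<beta> + l (\<lambda>i. \<gamma> i - \<beta> i)"
      unfolding l_def sum.distrib[symmetric] using that
      by (intro sum.cong) (auto simp: of_nat_diff algebra_simps)
  qed
  have main: "(\<forall>\<gamma> p. p \<in> \<Omega> \<longrightarrow> msize \<gamma> > k * r \<longrightarrow> W k \<gamma> p = 0) \<and>
    (\<forall>\<gamma> p. p \<in> \<Omega> \<longrightarrow> msize \<gamma> = k * r \<longrightarrow> W k \<gamma> p \<noteq> 0 \<longrightarrow>
      l \<gamma> \<le> int k * l m \<and> (l \<gamma> = int k * l m \<longrightarrow> \<gamma> = (\<lambda>i. k * m i))) \<and>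
    (\<forall>p. p \<in> \<Omega> \<longrightarrow> W k (\<lambda>i. k * m i) p = (M (\<lambda>_. 0) m p) ^ k)" for k
  proof (induction k)
    case 0
    then show ?case by (auto simp: W_0 l_def msize_eq_0)
  next
    case (Suc k)
    \<comment> \<open>Differentiating along X does not raise the order: W k \<gamma> is 0 on all of
      \<Omega> if |\<gamma>| > k r, and (k + 1) r > k r.\<close>
    have XW: "field_apply X (W k \<gamma>) p = 0" if "p \<in> \<Omega>" "msize \<gamma> \<ge> Suc k * r" for \<gamma> p
      by (rule field_apply_zero[OF _ that(1)]) (use Suc.IH that(2) r1 in auto)
    have term_hi: "W k \<beta> p * M \<beta> \<gamma> p = 0" if "p \<in> \<Omega>" "msize \<gamma> > Suc k * r" for \<beta> \<gamma> p
    proof (cases "msize \<beta> > k * r")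
      case True then show ?thesis using Suc.IH that(1) by simp
    next
      case False
      then show ?thesis using M_above[OF above, where \<beta> = \<beta> and \<gamma> = \<gamma>] that by simp
    qed
    \<comment> \<open>In the top order both factors must be of top order, and \<gamma> - \<beta> is
      then an exponent of the leading symbol.\<close>
    have term_eq: "msize \<beta> = k * r \<and> (\<forall>i. \<beta> i \<le> \<gamma> i) \<and> l \<beta> \<le> int k * l m \<and>
        (l \<beta> = int k * l m \<longrightarrow> \<beta> = (\<lambda>i. k * m i)) \<and> l (\<lambda>i. \<gamma> i - \<beta> i) \<le> l m \<and>
        (l (\<lambda>i. \<gamma> i - \<beta> i) = l m \<longrightarrow> (\<lambda>i. \<gamma> i - \<beta> i) = m)"
      if p: "p \<in> \<Omega>" and sz: "msize \<gamma> = Suc k * r" and nz: "W k \<beta> p * M \<beta> \<gamma> p \<noteq> 0" for \<beta> \<gamma> p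
    proof -
      have Wn: "W k \<beta> p \<noteq> 0" and Mn: "M \<beta> \<gamma> p \<noteq> 0" using nz by auto
      have "msize \<beta> \<le> k * r" using Suc.IH Wn p by (meson not_le)
      moreover have "msize \<gamma> \<le> msize \<beta> + r"
        using M_above[OF above, where \<beta> = \<beta> and \<gamma> = \<gamma>] Mn p by (meson not_le)
      ultimately have b: "msize \<beta> = k * r" "msize \<gamma> = msize \<beta> + r" using sz by auto
      note Mt = M_top[OF r1 above b(2) p]
      have le: "\<forall>i. \<beta> i \<le> \<gamma> i" using Mt Mn by (metis (no_types))
      have "M (\<lambda>_. 0) (\<lambda>i. \<gamma> i - \<beta> i) p \<noteq> 0" using Mt Mn le by simp
      moreover have "msize (\<lambda>i. \<gamma> i - \<beta> i) = r" using msz_add(1)[OF le] b by simp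
      ultimately have "(\<lambda>i. \<gamma> i - \<beta> i) \<in> T" using T_I p by blast
      then show ?thesis using l_T le b(1) Suc.IH Wn p by blast
    qed
    have l_Suc: "int (Suc k) * l m = int k * l m + l m" by (simp add: algebra_simps)
    \<comment> \<open>If l \<gamma> is as large as possible, both summands of l \<gamma> = l \<beta>
      + l (\<gamma> - \<beta>) are extremal, which determines \<beta> and \<gamma>.\<close>
    have unique: "\<beta> = (\<lambda>i. k * m i) \<and> \<gamma> = (\<lambda>i. Suc k * m i)"
      if p: "p \<in> \<Omega>" and sz: "msize \<gamma> = Suc k * r" and nz: "W k \<beta> p * M \<beta> \<gamma> p \<noteq> 0"
        and ge: "l \<gamma> \<ge> int (Suc k) * l m" for \<beta> \<gamma> p
    proof -
      note t = term_eq[OF p sz nz]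
      have "l \<gamma> = l \<beta> + l (\<lambda>i. \<gamma> i - \<beta> i)" by (rule msz_add(2)) (use t in blast)
      then have "l \<beta> = int k * l m" "l (\<lambda>i. \<gamma> i - \<beta> i) = l m" using t ge l_Suc by linarith+
      then have *: "\<beta> = (\<lambda>i. k * m i)" "(\<lambda>i. \<gamma> i - \<beta> i) = m" using t by blast+
      have "\<gamma> i = Suc k * m i" for i
      proof -
        have "\<gamma> i = \<beta> i + (\<gamma> i - \<beta> i)" using t by simp
        also have "\<gamma> i - \<beta> i = m i" using fun_cong[OF *(2), of i] by simp
        finally show ?thesis using *(1) by simp
      qed
      then show ?thesis using *(1) by auto
    qed
    have A: "\<forall>\<gamma> p. p \<in> \<Omega> \<longrightarrow> msize \<gamma> > Suc k * r \<longrightarrow> W (Suc k) \<gamma> p = 0"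
    proof (intro allI impI)
      fix \<gamma> :: "'n multiindex" and p assume "p \<in> \<Omega>" "msize \<gamma> > Suc k * r"
      then have "field_apply X (W k \<gamma>) p = 0" "(\<Sum>\<beta>\<in>B. W k \<beta> p * M \<beta> \<gamma> p) = 0"
        using XW[of p \<gamma>] by (simp_all add: sum.neutral[OF ballI[OF term_hi]] del: mult_eq_0_iff)
      then show "W (Suc k) \<gamma> p = 0" by (simp add: W_Suc)
    qed
    have Bk: "\<forall>\<gamma> p. p \<in> \<Omega> \<longrightarrow> msize \<gamma> = Suc k * r \<longrightarrow> W (Suc k) \<gamma> p \<noteq> 0 \<longrightarrow>
      l \<gamma> \<le> int (Suc k) * l m \<and> (l \<gamma> = int (Suc k) * l m \<longrightarrow> \<gamma> = (\<lambda>i. Suc k * m i))"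
    proof (intro allI impI)
      fix \<gamma> p assume p: "p \<in> \<Omega>" and sz: "msize \<gamma> = Suc k * r" and nz: "W (Suc k) \<gamma> p \<noteq> 0"
      have "(\<Sum>\<beta>\<in>B. W k \<beta> p * M \<beta> \<gamma> p) \<noteq> 0" using nz XW[OF p] sz unfolding W_Suc by simp
      then obtain \<beta> where b: "W k \<beta> p * M \<beta> \<gamma> p \<noteq> 0" by (meson sum.not_neutral_contains_not_neutral)
      note t = term_eq[OF p sz b]
      have "l \<gamma> = l \<beta> + l (\<lambda>i. \<gamma> i - \<beta> i)" by (rule msz_add(2)) (use t in blast)
      then have "l \<gamma> \<le> int (Suc k) * l m" using t l_Suc by linarith
      then show "l \<gamma> \<le> int (Suc k) * l m \<and> (l \<gamma> = int (Suc k) * l m \<longrightarrow> \<gamma> = (\<lambda>i. Suc k * m i))"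
        using unique[OF p sz b] by auto
    qed
    have C: "\<forall>p. p \<in> \<Omega> \<longrightarrow> W (Suc k) (\<lambda>i. Suc k * m i) p = (M (\<lambda>_. 0) m p) ^ Suc k"
    proof (intro allI impI)
      fix p assume p: "p \<in> \<Omega>"
      let ?\<gamma> = "\<lambda>i. Suc k * m i" and ?\<beta> = "\<lambda>i. k * m i"
      have szm: "msize m = r" using m(1) by (simp add: T_def)
      have sz: "msize ?\<gamma> = Suc k * r" "msize ?\<beta> = k * r"
        unfolding szm[symmetric] msize_def by (simp_all add: sum_distrib_left)
      have lg: "l ?\<gamma> = int (Suc k) * l m" unfolding l_def sum_distrib_left of_nat_mult mult.assoc ..
      have z: "W k \<beta> p * M \<beta> ?\<gamma> p = 0" if "\<beta> \<noteq> ?\<beta>" for \<beta>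
        using unique[OF p sz(1), of \<beta>] lg that by auto
      have "(\<Sum>\<beta>\<in>B. W k \<beta> p * M \<beta> ?\<gamma> p) = (\<Sum>\<beta>\<in>B. if \<beta> = ?\<beta> then W k ?\<beta> p * M ?\<beta> ?\<gamma> p else 0)"
        using z by (intro sum.cong) auto
      also have "\<dots> = W k ?\<beta> p * M ?\<beta> ?\<gamma> p"
        using finite_B W_B[OF _ p, of ?\<beta> k] by (simp only: sum.delta) auto
      also have "M ?\<beta> ?\<gamma> p = M (\<lambda>_. 0) m p"
      proof -
        have "msize ?\<gamma> = msize ?\<beta> + r" using sz by simp
        from M_top[OF r1 above this p] show ?thesis by simp
      qed
      finally show "W (Suc k) ?\<gamma> p = (M (\<lambda>_. 0) m p) ^ Suc k"
        unfolding W_Suc using XW[OF p, of ?\<gamma>] sz(1) Suc.IH p by simp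
    qed
    show ?case using A Bk C by blast
  qed
  obtain q where q: "q \<in> \<Omega>" "M (\<lambda>_. 0) m q \<noteq> 0" using m(1) by (auto simp: T_def N_def)
  \<comment> \<open>The coefficient at k m is the k-th power of a nonzero number, so all multiples
    of m lie in the finite set B.\<close>
  have "(\<lambda>i. k * m i) \<in> B" for k
  proof (rule ccontr)
    assume "(\<lambda>i. k * m i) \<notin> B"
    then have "(M (\<lambda>_. 0) m q) ^ k = 0" using W_B[OF _ q(1)] main[of k] q(1) by metis
    then show False using q(2) by simp
  qed
  moreover have "inj (\<lambda>k i. k * m i)"
  proof -
    have "m \<noteq> (\<lambda>_. 0)" using m(1) r1 by (auto simp: T_def)
    then obtain i where "m i \<noteq> 0" by (auto simp: fun_eq_iff)
    then show ?thesis by (intro injI) (auto dest: fun_cong[of _ _ i])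
  qed
  ultimately have "finite (UNIV :: nat set)"
    using finite_B by (metis finite_imageD finite_subset image_subsetI)
  then show False by simp
qed

end

text \<open>The maximum with 1 puts all coordinates of J^1 into one class, as the coefficients of
  x_i and y may depend on the first derivatives.\<close>

definition coord_rank :: "'n::finite coord \<Rightarrow> nat" where
  "coord_rank c = (case c of Indep i \<Rightarrow> 1 | Dep \<alpha> \<Rightarrow> max 1 (msize \<alpha>))"

lemma coord_rank_simps [simp]: "coord_rank (Indep i) = 1" "coord_rank (Dep \<alpha>) = max 1 (msize \<alpha>)"
  by (simp_all add: coord_rank_def)

lemma finite_coord_rank_le: "finite {c :: 'n::finite coord. coord_rank c \<le> r}"
proof (rule finite_subset)
  show "{c :: 'n coord. coord_rank c \<le> r} \<subseteq> range Indep \<union> Dep ` {\<gamma>. msize \<gamma> \<le> r}"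
  proof
    fix c :: "'n coord" assume "c \<in> {c. coord_rank c \<le> r}"
    then show "c \<in> range Indep \<union> Dep ` {\<gamma>. msize \<gamma> \<le> r}" by (cases c) auto
  qed
  show "finite (range Indep \<union> Dep ` {\<gamma> :: 'n multiindex. msize \<gamma> \<le> r})"
    by (intro finite_UnI finite_imageI finite_msize_le) simp
qed

section \<open>Coefficients vary only with coordinates of no higher rank\<close>

lemma pderiv_at_const: "pderiv_at c (\<lambda>_. a) p = 0"
  by (rule pderiv_at_eqI) simp

context lb_field_F
begin

text \<open>The characteristic \<open>\<eta> - \<Sum>\<^sub>i y\<^sup>i \<xi>\<^sub>i\<close>, whose derivative with respect to \<open>y\<^sup>i\<close> is \<open>- \<xi>\<^sub>i\<close>.\<close>

definition char_fun :: "'n jet \<Rightarrow> real" where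
  "char_fun p = \<eta> (\<lambda>_. 0) p - (\<Sum>i\<in>UNIV. p (Dep (bump (\<lambda>_. 0) i)) * \<xi> i p)"

lemma JF_char_fun: "JF char_fun"
  unfolding char_fun_def [abs_def] by (intro JF_diff JF_sum JF_mult JF_coord JF_X)

text \<open>This is M 0 \<gamma> = 0: after the product rule only the terms in which y^i is
  differentiated are left.\<close>

lemma pderiv_char_fun:
  assumes "msize \<gamma> \<ge> 1" "p \<in> \<Omega>"
  shows "pderiv_at (Dep \<gamma>) char_fun p = - (\<Sum>i\<in>UNIV. if \<gamma> = bump (\<lambda>_. 0) i then \<xi> i p else 0)"
proof -
  let ?c = "Dep \<gamma>"
  have "pderiv_at ?c char_fun p = pderiv_at ?c (\<eta> (\<lambda>_. 0)) p -
      pderiv_at ?c (\<lambda>p. \<Sum>i\<in>UNIV. p (Dep (bump (\<lambda>_. 0) i)) * \<xi> i p) p"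
    unfolding char_fun_def [abs_def]
    by (intro pderiv_at_diff[OF _ _ assms(2)] JF_pdiff JF_sum JF_mult JF_coord JF_X)
  also have "pderiv_at ?c (\<lambda>p. \<Sum>i\<in>UNIV. p (Dep (bump (\<lambda>_. 0) i)) * \<xi> i p) p =
      (\<Sum>i\<in>UNIV. pderiv_at ?c (\<lambda>p. p (Dep (bump (\<lambda>_. 0) i)) * \<xi> i p) p)"
    by (intro pderiv_at_sum[OF _ assms(2)] JF_pdiff JF_mult JF_coord JF_X)
  also have "\<dots> = (\<Sum>i\<in>UNIV. (if \<gamma> = bump (\<lambda>_. 0) i then \<xi> i p else 0) +
      p (Dep (bump (\<lambda>_. 0) i)) * pderiv_at ?c (\<xi> i) p)"
    by (intro sum.cong refl)
      (simp add: pderiv_at_mult[OF JF_pdiff[OF JF_coord] JF_pdiff[OF JF_X] assms(2)] pderiv_at_coord)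
  finally show ?thesis
    using M_zero_order[OF assms] by (simp add: M_def sum.distrib)
qed

text \<open>As \<xi> i is minus the derivative of the characteristic by y^i, and the derivative of
  the characteristic by y^\<gamma> vanishes, the symmetry of second derivatives gives the
  claim.\<close>

lemma pderiv_\<xi>:
  assumes "msize \<gamma> \<ge> 2" "p \<in> \<Omega>"
  shows "pderiv_at (Dep \<gamma>) (\<xi> i) p = 0"
proof -
  let ?i = "Dep (bump (\<lambda>_. 0) i)" and ?c = "Dep \<gamma>"
  have inj: "bump (\<lambda>_. 0) i = bump (\<lambda>_. 0) j \<longleftrightarrow> j = i" for j :: 'n
    by (auto simp: bump_def fun_eq_iff split: if_splits)
  have \<xi>: "\<xi> i q = 0 - pderiv_at ?i char_fun q" if "q \<in> \<Omega>" for q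
    using pderiv_char_fun[of "bump (\<lambda>_. 0) i" q] that by (simp add: inj)
  have c0: "pderiv_at ?c char_fun q = 0" if "q \<in> \<Omega>" for q
  proof -
    have "\<gamma> \<noteq> bump (\<lambda>_. 0) j" for j using assms(1) by auto
    then show ?thesis using pderiv_char_fun[of \<gamma> q] assms(1) that by simp
  qed
  have "pderiv_at ?c (\<xi> i) p = pderiv_at ?c (\<lambda>q. 0 - pderiv_at ?i char_fun q) p"
    by (rule pderiv_cong[OF \<xi> assms(2)])
  also have "\<dots> = pderiv_at ?c (\<lambda>_. 0) p - pderiv_at ?c (pderiv_at ?i char_fun) p"
    by (intro pderiv_at_diff[OF _ _ assms(2)] JF_pdiff JF_const JF_pderiv JF_char_fun)
  also have "pderiv_at ?c (pderiv_at ?i char_fun) p = pderiv_at ?i (pderiv_at ?c char_fun) p"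
    by (rule pderiv_swap[OF JF_char_fun assms(2)])
  also have "\<dots> = pderiv_at ?i (\<lambda>_. 0) p" by (rule pderiv_cong[OF c0 assms(2)])
  finally show ?thesis by (simp add: pderiv_at_const)
qed

text \<open>For c = y^\<beta> the vanishing of M \<beta> \<gamma> expresses the derivative of \<eta>
  \<beta> by those of the \<xi> i, which are 0 by \<open>pderiv_\<xi>\<close>.\<close>

lemma pderiv_above_rank:
  assumes "coord_rank d > coord_rank c" "p \<in> \<Omega>"
  shows "pderiv_at d (X c) p = 0"
proof -
  obtain \<gamma> where d: "d = Dep \<gamma>"
  proof (cases d)
    case (Indep i)
    then show ?thesis using assms(1) by (cases c) auto
  qed blast
  show ?thesis
  proof (cases c)
    case (Indep i)
    then show ?thesis using pderiv_\<xi>[OF _ assms(2)] assms(1) d by auto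
  next
    case (Dep \<beta>)
    have sz: "msize \<gamma> > msize \<beta>" "msize \<gamma> \<ge> 2" using assms(1) d Dep by auto
    have "M \<beta> \<gamma> p = 0"
      by (rule M_above[where r = 0]) (use M_zero_order sz assms(2) in auto)
    then show ?thesis using pderiv_\<xi>[OF sz(2) assms(2)] Dep d by (simp add: M_def)
  qed
qed

lemma X_same_rank:
  assumes "box_convex D" "D \<subseteq> \<Omega>" "p \<in> D" "q \<in> D" "\<forall>d. coord_rank d \<le> coord_rank c \<longrightarrow> p d = q d"
  shows "X c p = X c q"
proof -
  obtain Q where Q: "finite Q" "A \<subseteq> Q" "depends_only_on Q \<Omega> (X c)" by (rule JF_deps[OF JF_X])
  \<comment> \<open>Only coordinates in the finite set Q are changed on the way from p to q', so
    that \<open>constant_on_box\<close> applies.\<close>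
  define q' where "q' d = (if d \<in> Q then q d else p d)" for d
  have q': "q' \<in> D" by (rule box_convexD[OF assms(1,3,4)]) (simp add: q'_def)
  have "X c p = X c q'"
  proof (rule constant_on_box[OF _ assms(1,2) JF_smooth[OF JF_X] _ assms(3) q'])
    let ?S = "{d \<in> Q. coord_rank d > coord_rank c}"
    show "finite ?S" using Q(1) by simp
    show "pderiv_at d (X c) x = 0" if "x \<in> D" "d \<in> ?S" for x d
      using pderiv_above_rank[of c d x] that assms(2) by auto
    show "p d = q' d" if "d \<notin> ?S" for d using that assms(5) by (auto simp: q'_def)
  qed
  also have "X c q' = X c q"
    by (rule depends_only_onD[OF Q(3)]) (use q' assms in \<open>auto simp: q'_def\<close>)
  finally show ?thesis .
qed

lemma exponentiable_X: "exponentiable \<Omega> X"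
proof -
  have "\<exists>Q. finite Q \<and> depends_only_on Q \<Omega> (X c)" for c
    using JF_X[of c] by (simp add: jet_function_def)
  then obtain Q where Q: "\<And>c. finite (Q c)" "\<And>c. depends_only_on (Q c) \<Omega> (X c)" by metis
  have "ranked_field A \<Omega> X Q coord_rank"
    by unfold_locales
      (use infinite_coord fin_A cyl Q JF_smooth[OF JF_X] finite_coord_rank_le X_same_rank in blast)+
  then show ?thesis by (rule exponentiable_ranked)
qed

text \<open>The component of L_X \<theta> along dy^j, which vanishes because \<theta> has
  none.\<close>

lemma contact_y:
  assumes "p \<in> \<Omega>"
  shows "pderiv_at (Dep (bump (\<lambda>_. 0) j)) (\<eta> (\<lambda>_. 0)) p =
    (\<Sum>i\<in>UNIV. p (Dep (bump (\<lambda>_. 0) i)) * pderiv_at (Dep (bump (\<lambda>_. 0) j)) (\<xi> i) p)"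
  using M_zero_order[of "bump (\<lambda>_. 0) j" p] assms by (simp add: M_def)

text \<open>The dx_j-component of L_X \<theta> = \<lambda> \<theta> with \<lambda> = M 0 0: in the
  recursion for y^j the terms with y^(\<alpha>+j) combine to multiples of M 0 \<alpha>, of which
  only \<alpha> = 0 is left.\<close>

lemma contact_x:
  assumes p: "p \<in> \<Omega>"
  shows "\<eta> (bump (\<lambda>_. 0) j) p = pderiv_at (Indep j) (\<eta> (\<lambda>_. 0)) p
    - (\<Sum>i\<in>UNIV. p (Dep (bump (\<lambda>_. 0) i)) * pderiv_at (Indep j) (\<xi> i) p)
    + p (Dep (bump (\<lambda>_. 0) j)) * M (\<lambda>_. 0) (\<lambda>_. 0) p"
proof -
  let ?z = "\<lambda>_ :: 'n. 0 :: nat" and ?y = "\<lambda>i. p (Dep (bump (\<lambda>_. 0) i))"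
  have "\<exists>B. finite B \<and> (\<forall>\<alpha> p. \<alpha> \<notin> B \<longrightarrow> p \<in> \<Omega> \<longrightarrow> pderiv_at (Dep \<alpha>) (X c) p = 0)" for c
    by (rule JF_deps_multi[OF JF_X])
  then obtain Q where Q: "\<And>c. finite (Q c)"
    "\<And>c \<alpha> p. \<alpha> \<notin> Q c \<Longrightarrow> p \<in> \<Omega> \<Longrightarrow> pderiv_at (Dep \<alpha>) (X c) p = 0" by metis
  let ?B = "insert ?z (Q (Dep ?z) \<union> (\<Union>i. Q (Indep i)))"
  have fin: "finite ?B" using Q(1) by simp
  have t\<eta>: "total_deriv j (\<eta> ?z) p = pderiv_at (Indep j) (\<eta> ?z) p +
      (\<Sum>\<alpha>\<in>?B. p (Dep (bump \<alpha> j)) * pderiv_at (Dep \<alpha>) (\<eta> ?z) p)"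
    by (rule total_deriv_sum[OF fin]) (use Q(2)[OF _ p] in auto)
  have t\<xi>: "total_deriv j (\<xi> i) p = pderiv_at (Indep j) (\<xi> i) p +
      (\<Sum>\<alpha>\<in>?B. p (Dep (bump \<alpha> j)) * pderiv_at (Dep \<alpha>) (\<xi> i) p)" for i
    by (rule total_deriv_sum[OF fin]) (use Q(2)[OF _ p] in auto)
  have "\<eta> (bump ?z j) p = (pderiv_at (Indep j) (\<eta> ?z) p - (\<Sum>i\<in>UNIV. ?y i * pderiv_at (Indep j) (\<xi> i) p)) +
      ((\<Sum>\<alpha>\<in>?B. p (Dep (bump \<alpha> j)) * pderiv_at (Dep \<alpha>) (\<eta> ?z) p) -
       (\<Sum>i\<in>UNIV. ?y i * (\<Sum>\<alpha>\<in>?B. p (Dep (bump \<alpha> j)) * pderiv_at (Dep \<alpha>) (\<xi> i) p)))"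
    unfolding recursion[OF p] t\<eta> t\<xi> by (simp add: distrib_left sum.distrib)
  also have "(\<Sum>i\<in>UNIV. ?y i * (\<Sum>\<alpha>\<in>?B. p (Dep (bump \<alpha> j)) * pderiv_at (Dep \<alpha>) (\<xi> i) p)) =
      (\<Sum>\<alpha>\<in>?B. p (Dep (bump \<alpha> j)) * (\<Sum>i\<in>UNIV. ?y i * pderiv_at (Dep \<alpha>) (\<xi> i) p))"
    unfolding sum_distrib_left by (subst sum.swap) (simp only: mult.left_commute)
  also have "(\<Sum>\<alpha>\<in>?B. p (Dep (bump \<alpha> j)) * pderiv_at (Dep \<alpha>) (\<eta> ?z) p) -
      (\<Sum>\<alpha>\<in>?B. p (Dep (bump \<alpha> j)) * (\<Sum>i\<in>UNIV. ?y i * pderiv_at (Dep \<alpha>) (\<xi> i) p)) =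
      (\<Sum>\<alpha>\<in>?B. p (Dep (bump \<alpha> j)) * M ?z \<alpha> p)"
    unfolding sum_subtractf[symmetric] by (simp only: M_def right_diff_distrib)
  also have "\<dots> = (\<Sum>\<alpha>\<in>?B. if \<alpha> = ?z then p (Dep (bump ?z j)) * M ?z ?z p else 0)"
  proof (rule sum.cong[OF refl])
    fix \<alpha> :: "'n multiindex"
    show "p (Dep (bump \<alpha> j)) * M ?z \<alpha> p = (if \<alpha> = ?z then p (Dep (bump ?z j)) * M ?z ?z p else 0)"
      using M_zero_order[of \<alpha> p] p msize_eq_0[of \<alpha>] by (cases "\<alpha> = ?z") auto
  qed
  also have "\<dots> = p (Dep (bump ?z j)) * M ?z ?z p" by (subst sum.delta[OF fin]) simp
  finally show ?thesis .
qed

end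

lemma lb_field_F_exists:
  assumes "Lie_Baecklund \<Omega> X" "condition_F \<Omega> X"
  shows "\<exists>A F. lb_field_F A \<Omega> X F"
proof -
  obtain A where A: "finite A" "open_cylinder A \<Omega>"
    using assms(1) by (auto simp: Lie_Baecklund_def jet_vector_field_def jet_domain_def)
  obtain F where F: "\<And>g. finite (F g)" "\<And>g k. depends_only_on (F g) \<Omega> ((field_apply X ^^ k) (\<lambda>p. p g))"
    using assms(2) unfolding condition_F_def by metis
  let ?G = "insert (Dep (\<lambda>_. 0)) (range Indep)"
  have "lb_field_F A \<Omega> X (A \<union> (\<Union>g\<in>?G. F g))"
  proof unfold_locales
    show "depends_only_on (A \<union> (\<Union>g\<in>?G. F g)) \<Omega> ((field_apply X ^^ k) (\<lambda>p. p g))" if "g \<in> ?G" for g k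
      by (rule depends_only_on_mono[OF F(2)[of g k] _ order_refl]) (use that in blast)
  qed (use A F(1) assms(1) in auto)
  then show ?thesis by blast
qed


subsection \<open>Smooth maps on Euclidean spaces\<close>

lemma Ck_on_SucI:
  assumes "\<And>x. x \<in> S \<Longrightarrow> (f has_derivative f' x) (at x)"
    and "open S" "\<And>b. b \<in> Basis \<Longrightarrow> Ck_on k S (\<lambda>x. frechet_derivative f (at x) b)"
  shows "Ck_on (Suc k) S f"
  using assms unfolding Ck_on.simps differentiable_def by blast

lemma frechet_derivative_cong_open:
  assumes "open S" "x \<in> S" "\<And>y. y \<in> S \<Longrightarrow> f y = g y"
  shows "f differentiable (at x) \<longleftrightarrow> g differentiable (at x)"
    "frechet_derivative f (at x) = frechet_derivative g (at x)"
proof -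
  have "(f has_derivative D) (at x) \<longleftrightarrow> (g has_derivative D) (at x)" for D
    using has_derivative_transform_within_open[of f D x UNIV S g]
      has_derivative_transform_within_open[of g D x UNIV S f] assms by auto
  then show "f differentiable (at x) \<longleftrightarrow> g differentiable (at x)"
    "frechet_derivative f (at x) = frechet_derivative g (at x)"
    unfolding differentiable_def frechet_derivative_def by simp_all
qed

lemma Ck_on_cong:
  assumes "open S" "\<And>x. x \<in> S \<Longrightarrow> f x = g x" "Ck_on k S f"
  shows "Ck_on k S g"
  using assms(2,3)
proof (induction k arbitrary: f g)
  case 0 then show ?case using continuous_on_cong[of S S f g] by simp
next
  case (Suc k)
  have "g differentiable (at x)" if "x \<in> S" for x
    using frechet_derivative_cong_open(1)[OF assms(1) that, of f g] Suc.prems that by auto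
  moreover have "Ck_on k S (\<lambda>x. frechet_derivative g (at x) b)" if "b \<in> Basis" for b
    by (rule Suc.IH[of "\<lambda>x. frechet_derivative f (at x) b"])
      (use frechet_derivative_cong_open(2)[OF assms(1), of _ f g] Suc.prems that in auto)
  ultimately show ?case by simp
qed

lemma Ck_on_SucI':
  assumes "open S" "\<And>x. x \<in> S \<Longrightarrow> (f has_derivative f' x) (at x)"
    and "\<And>b. b \<in> Basis \<Longrightarrow> Ck_on k S (\<lambda>x. f' x b)"
  shows "Ck_on (Suc k) S f"
proof (rule Ck_on_SucI[OF assms(2,1)])
  fix b :: 'a assume "b \<in> Basis"
  show "Ck_on k S (\<lambda>x. frechet_derivative f (at x) b)"
    by (rule Ck_on_cong[OF assms(1) _ assms(3)[OF \<open>b \<in> Basis\<close>]])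
      (use frechet_derivative_at[OF assms(2)] in metis)
qed

lemma Ck_on_SucD:
  assumes "Ck_on (Suc k) S f" "x \<in> S"
  shows "(f has_derivative frechet_derivative f (at x)) (at x)"
  using assms frechet_derivative_works by auto

lemma Ck_on_continuous: "Ck_on k S f \<Longrightarrow> continuous_on S f"
proof (cases k)
  case (Suc n)
  assume "Ck_on k S f"
  then have "continuous (at x within S) f" if "x \<in> S" for x
    using that Suc differentiable_imp_continuous_within continuous_at_imp_continuous_at_within by force
  then show ?thesis by (simp add: continuous_on_eq_continuous_within)
qed simp

lemma Ck_on_Suc_imp: "Ck_on (Suc k) S f \<Longrightarrow> Ck_on k S f"
proof (induction k arbitrary: f)
  case 0 then show ?case using Ck_on_continuous by (metis Ck_on.simps(1))
qed auto

lemma Ck_on_subset: "Ck_on k S f \<Longrightarrow> T \<subseteq> S \<Longrightarrow> Ck_on k T f"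
  by (induction k arbitrary: f) (auto intro: continuous_on_subset)

lemma Ck_on_const: "open S \<Longrightarrow> Ck_on k S (\<lambda>_. a)"
proof (induction k arbitrary: a)
  case (Suc k)
  show ?case by (rule Ck_on_SucI'[OF Suc.prems, where f' = "\<lambda>_ _. 0"]) (use Suc in auto)
qed simp

lemma Ck_on_linear:
  assumes "open S" "bounded_linear f"
  shows "Ck_on k S f"
proof (cases k)
  case 0
  then show ?thesis using assms(2) by (simp add: linear_continuous_on)
next
  case (Suc n)
  show ?thesis unfolding Suc
    by (rule Ck_on_SucI'[OF assms(1) bounded_linear_imp_has_derivative[OF assms(2)]])
      (rule Ck_on_const[OF assms(1)])
qed

lemma Ck_on_add:
  assumes "open S" "Ck_on k S f" "Ck_on k S g"
  shows "Ck_on k S (\<lambda>x. f x + g x)"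
  using assms(2,3)
proof (induction k arbitrary: f g)
  case 0 then show ?case by (auto intro: continuous_on_add)
next
  case (Suc k)
  show ?case
    by (rule Ck_on_SucI'[OF assms(1) has_derivative_add[OF Ck_on_SucD[OF Suc.prems(1)] Ck_on_SucD[OF Suc.prems(2)]]])
      (use Suc in auto)
qed

lemma Ck_on_scaleR:
  fixes f :: "'a::euclidean_space \<Rightarrow> real" and g :: "'a \<Rightarrow> 'b::real_normed_vector"
  assumes "open S" "Ck_on k S f" "Ck_on k S g"
  shows "Ck_on k S (\<lambda>x. f x *\<^sub>R g x)"
  using assms(2,3)
proof (induction k arbitrary: f g)
  case 0 then show ?case by (auto intro: continuous_on_scaleR)
next
  case (Suc k)
  have "Ck_on k S f" "Ck_on k S g" using Suc.prems Ck_on_Suc_imp by blast+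
  then show ?case
    by (intro Ck_on_SucI'[OF assms(1) has_derivative_scaleR[OF Ck_on_SucD[OF Suc.prems(1)] Ck_on_SucD[OF Suc.prems(2)]]]
        Ck_on_add assms(1) Suc.IH) (use Suc.prems in auto)
qed

lemma Ck_on_mult:
  fixes f g :: "'a::euclidean_space \<Rightarrow> real"
  assumes "open S" "Ck_on k S f" "Ck_on k S g"
  shows "Ck_on k S (\<lambda>x. f x * g x)"
  using Ck_on_scaleR[OF assms] by simp

lemma Ck_on_sum:
  assumes "open S" "\<And>i. i \<in> I \<Longrightarrow> Ck_on k S (f i)"
  shows "Ck_on k S (\<lambda>x. \<Sum>i\<in>I. f i x)"
  using assms(2)
  by (induction I rule: infinite_finite_induct) (auto intro: Ck_on_const Ck_on_add assms(1))

lemma Ck_on_prod: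
  fixes f :: "'i \<Rightarrow> 'a::euclidean_space \<Rightarrow> real"
  assumes "open S" "\<And>i. i \<in> I \<Longrightarrow> Ck_on k S (f i)"
  shows "Ck_on k S (\<lambda>x. \<Prod>i\<in>I. f i x)"
  using assms(2)
  by (induction I rule: infinite_finite_induct) (auto intro: Ck_on_const Ck_on_mult assms(1))

lemma Ck_on_inverse:
  fixes f :: "'a::euclidean_space \<Rightarrow> real"
  assumes "open S" "\<And>x. x \<in> S \<Longrightarrow> f x \<noteq> 0" "Ck_on k S f"
  shows "Ck_on k S (\<lambda>x. inverse (f x))"
  using assms(3)
proof (induction k)
  case 0 then show ?case using assms(2) by (auto intro: continuous_on_inverse)
next
  case (Suc k)
  note IH = Suc.IH[OF Ck_on_Suc_imp[OF Suc.prems]]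
  show ?case
  proof (rule Ck_on_SucI'[OF assms(1),
        where f' = "\<lambda>x h. - (inverse (f x) * frechet_derivative f (at x) h * inverse (f x))"])
    show "((\<lambda>x. inverse (f x)) has_derivative
        (\<lambda>h. - (inverse (f x) * frechet_derivative f (at x) h * inverse (f x)))) (at x)" if "x \<in> S" for x
      by (rule Deriv.has_derivative_inverse[OF assms(2)[OF that] Ck_on_SucD[OF Suc.prems that]])
    fix b :: 'a assume b: "b \<in> Basis"
    have "Ck_on k S (\<lambda>x. frechet_derivative f (at x) b)" using Suc.prems b by simp
    then have "Ck_on k S (\<lambda>x. (-1) * (inverse (f x) * frechet_derivative f (at x) b * inverse (f x)))"
      by (intro Ck_on_mult assms(1) IH Ck_on_const)
    then show "Ck_on k S (\<lambda>x. - (inverse (f x) * frechet_derivative f (at x) b * inverse (f x)))" by simp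
  qed
qed

lemma Ck_on_det:
  fixes a :: "'n::finite \<Rightarrow> 'n \<Rightarrow> 'a::euclidean_space \<Rightarrow> real"
  assumes "open S" "\<And>i j. Ck_on k S (a i j)"
  shows "Ck_on k S (\<lambda>x. det (\<chi> i j. a i j x :: real ^ 'n ^ 'n))"
  unfolding det_def by (simp, intro Ck_on_sum Ck_on_mult Ck_on_prod Ck_on_const assms)

text \<open>The chain rule expresses the derivatives by partial derivatives of F composed with g and
  by derivatives of the coordinates of g. The partial derivatives are again smooth functions of the
  coordinates in C, so the induction closes.\<close>

lemma Ck_on_coords:
  fixes g :: "'a::euclidean_space \<Rightarrow> 'i \<Rightarrow> real"
  assumes cyl: "open_cylinder C \<Omega>" "finite C" and U: "open U" "\<And>x. x \<in> U \<Longrightarrow> g x \<in> \<Omega>"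
    and g: "\<And>c k. c \<in> C \<Longrightarrow> Ck_on k U (\<lambda>x. g x c)"
  shows "smooth_coords \<Omega> F \<Longrightarrow> depends_only_on C \<Omega> F \<Longrightarrow> Ck_on k U (\<lambda>x. F (g x))"
proof (induction k arbitrary: F)
  case 0
  \<comment> \<open>Continuity into the product space concerns all coordinates, while g is
    controlled on C only; the others are set to 0.\<close>
  define g' where "g' x c = (if c \<in> C then g x c else 0)" for x c
  have g'in: "g' x \<in> \<Omega>" if "x \<in> U" for x
    by (rule open_cylinder_agree[OF cyl(1) U(2)[OF that]]) (simp add: g'_def)
  have "continuous_on U g'"
  proof (rule continuous_on_coordinatewise_then_product)
    show "continuous_on U (\<lambda>x. g' x c)" for c
      using g[of c 0] by (cases "c \<in> C") (auto simp: g'_def)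
  qed
  then have "continuous_on U (\<lambda>x. F (g' x))"
    by (rule continuous_on_compose2[OF smooth_coords_cont[OF 0(1)]]) (use g'in in auto)
  moreover have "F (g' x) = F (g x)" if "x \<in> U" for x
    by (rule depends_only_onD[OF 0(2) g'in[OF that] U(2)[OF that]]) (simp add: g'_def)
  ultimately show ?case using continuous_on_cong[of U U "\<lambda>x. F (g' x)" "\<lambda>x. F (g x)"] by simp
next
  case (Suc k)
  show ?case
  proof (rule Ck_on_SucI'[OF U(1)])
    fix x assume x: "x \<in> U"
    show "((\<lambda>x. F (g x)) has_derivative
        (\<lambda>h. \<Sum>c\<in>C. pderiv_at c F (g x) * frechet_derivative (\<lambda>x. g x c) (at x) h)) (at x)"
      by (rule has_derivative_coords[OF cyl Suc.prems(2) _ U(2)[OF x] Ck_on_SucD[OF g x]])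
        (use Suc.prems(1) smooth_coords_iff_Ckc in blast)
  next
    fix b :: 'a assume b: "b \<in> Basis"
    show "Ck_on k U (\<lambda>x. \<Sum>c\<in>C. pderiv_at c F (g x) * frechet_derivative (\<lambda>x. g x c) (at x) b)"
    proof (intro Ck_on_sum Ck_on_mult U(1))
      fix c assume c: "c \<in> C"
      show "Ck_on k U (\<lambda>x. pderiv_at c F (g x))"
        by (rule Suc.IH[OF smooth_coords_pderiv[OF Suc.prems(1)] depends_only_on_pderiv[OF cyl(1) Suc.prems(2)]])
      show "Ck_on k U (\<lambda>x. frechet_derivative (\<lambda>x. g x c) (at x) b)"
        using g[OF c, of "Suc k"] b by simp
    qed
  qed
qed

lemma linear_axis_expansion:
  fixes D :: "real ^ 'n::finite \<Rightarrow> 'b::real_normed_vector"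
  assumes "bounded_linear D"
  shows "D v = (\<Sum>j\<in>UNIV. v $ j *\<^sub>R D (axis j 1))"
proof -
  interpret bounded_linear D by (rule assms)
  have "v = (\<Sum>j\<in>UNIV. v $ j *\<^sub>R axis j 1)"
    by (simp add: vec_eq_iff axis_def if_distrib[of "(*) _"] cong: if_cong)
  then have "D v = D (\<Sum>j\<in>UNIV. v $ j *\<^sub>R axis j 1)" by simp
  also have "\<dots> = (\<Sum>j\<in>UNIV. v $ j *\<^sub>R D (axis j 1))" by (simp add: sum scaleR)
  finally show ?thesis .
qed

text \<open>
  The inverse of a smooth map close to the identity. Its smoothness follows from Cramer's rule: each
  partial derivative of \<open>H \<circ> g\<close> is again of the form \<open>H' \<circ> g\<close> with \<open>H'\<close> smooth.
\<close>

lemma smooth_near_identity_inverse: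
  fixes b :: "real ^ 'n::finite \<Rightarrow> real ^ 'n"
  assumes V: "convex V" "open V" and b: "\<And>i k. Ck_on k V (\<lambda>x. b x $ i)"
    and near: "\<forall>x\<in>V. \<forall>i j.
      \<bar>frechet_derivative (\<lambda>x. b x $ i) (at x) (axis j 1) - (if i = j then 1 else 0)\<bar> \<le> 1 / (2 * (real CARD('n))\<^sup>2)"
  defines "g \<equiv> inv_into V b"
  shows "open (b ` V)" "\<And>x. x \<in> V \<Longrightarrow> g (b x) = x"
    "\<And>H :: real ^ 'n \<Rightarrow> real. smooth_on V H \<Longrightarrow> smooth_on (b ` V) (\<lambda>y. H (g y))"
    "\<And>x w. x \<in> V \<Longrightarrow> \<exists>v. (\<chi> i. frechet_derivative (\<lambda>x. b x $ i) (at x) v) = w \<and>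
      (\<forall>H :: real ^ 'n \<Rightarrow> real. \<forall>H'. (H has_derivative H') (at x) \<longrightarrow>
        (\<exists>D. ((\<lambda>y. H (g y)) has_derivative D) (at (b x)) \<and> D w = H' v))"
proof -
  define n where "n = real CARD('n)"
  have n: "n > 0" by (simp add: n_def)
  define B where "B x v = (\<chi> i. frechet_derivative (\<lambda>x. b x $ i) (at x) v)" for x v
  have bder: "((\<lambda>x. b x $ i) has_derivative frechet_derivative (\<lambda>x. b x $ i) (at x)) (at x)" if "x \<in> V" for x i
    by (rule Ck_on_SucD[OF b that])
  have Bder: "(b has_derivative B x) (at x)" if x: "x \<in> V" for x
  proof -
    have "((\<lambda>x. b x \<bullet> e) has_derivative (\<lambda>v. B x v \<bullet> e)) (at x)" if e: "e \<in> Basis" for e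
    proof -
      obtain i where "e = axis i 1" using e by (auto simp: Basis_vec_def)
      then show ?thesis using bder[OF x, of i] by (simp add: inner_axis B_def)
    qed
    then show ?thesis unfolding has_derivative_componentwise_within[of b] by blast
  qed
  have Blin: "bounded_linear (B x)" if "x \<in> V" for x
    using Bder[OF that] by (rule has_derivative_bounded_linear)
  \<comment> \<open>The bound 1 / (2 n^2) on the entries gives 1 / (2 n) for a component and 1 / 2
    for the norm, as each step sums n terms.\<close>
  have Bnear: "norm (B x v - v) \<le> 1 / 2 * norm v" if x: "x \<in> V" for x v
  proof -
    have "\<bar>(B x v - v) $ i\<bar> \<le> 1 / (2 * n) * norm v" for i
    proof -
      let ?D = "frechet_derivative (\<lambda>x. b x $ i) (at x)"
      have "?D v = (\<Sum>j\<in>UNIV. v $ j *\<^sub>R ?D (axis j 1))"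
        by (rule linear_axis_expansion[OF has_derivative_bounded_linear[OF bder[OF x]]])
      moreover have "v $ i = (\<Sum>j\<in>UNIV. v $ j * (if i = j then 1 else 0))"
        by (simp add: if_distrib[of "(*) _"] cong: if_cong)
      ultimately have "(B x v - v) $ i = (\<Sum>j\<in>UNIV. v $ j * (?D (axis j 1) - (if i = j then 1 else 0)))"
        by (simp add: B_def right_diff_distrib sum_subtractf)
      then have "\<bar>(B x v - v) $ i\<bar> \<le> (\<Sum>j\<in>UNIV. \<bar>v $ j * (?D (axis j 1) - (if i = j then 1 else 0))\<bar>)"
        by (simp only: sum_abs)
      also have "\<dots> \<le> (\<Sum>j\<in>(UNIV :: 'n set). norm v * (1 / (2 * n\<^sup>2)))"
        unfolding abs_mult n_def using near x
        by (intro sum_mono mult_mono component_le_norm_cart) auto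
      also have "\<dots> = 1 / (2 * n) * norm v"
        using n by (simp add: n_def[symmetric] power2_eq_square)
      finally show ?thesis .
    qed
    then have "(\<Sum>i\<in>UNIV. \<bar>(B x v - v) $ i\<bar>) \<le> (\<Sum>i\<in>(UNIV :: 'n set). 1 / (2 * n) * norm v)"
      by (intro sum_mono) blast
    also have "\<dots> = 1 / 2 * norm v" using n by (simp add: n_def[symmetric])
    finally show ?thesis using norm_le_l1_cart[of "B x v - v"] by linarith
  qed
  have Binj: "v = 0" if "x \<in> V" "B x v = 0" for x v
    using Bnear[OF that(1), of v] that(2) by simp
  \<comment> \<open>On the convex set V the map b - id has Lipschitz constant 1 / 2, so b is
    injective and its inverse has Lipschitz constant 2.\<close>
  have dist_b: "norm (x - y) \<le> 2 * norm (b x - b y)" if "x \<in> V" "y \<in> V" for x y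
  proof -
    have "norm ((b x - x) - (b y - y)) \<le> 1 / 2 * norm (x - y)"
    proof (rule differentiable_bound[OF V(1) _ _ that, where f' = "\<lambda>x v. B x v - v"])
      fix z assume z: "z \<in> V"
      show "((\<lambda>x. b x - x) has_derivative (\<lambda>v. B z v - v)) (at z within V)"
        by (intro has_derivative_diff has_derivative_ident has_derivative_at_withinI[OF Bder[OF z]])
      show "onorm (\<lambda>v. B z v - v) \<le> 1 / 2" by (rule onorm_le) (use Bnear[OF z] in auto)
    qed
    moreover have "norm (x - y) \<le> norm (b x - b y) + norm ((b x - x) - (b y - y))"
      using norm_triangle_ineq4[of "b x - b y" "(b x - x) - (b y - y)"] by simp
    ultimately show ?thesis by simp
  qed
  have inj: "inj_on b V" by (rule inj_onI) (use dist_b in fastforce)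
  have bcont: "continuous_on V b"
    using Bder has_derivative_continuous continuous_at_imp_continuous_on by blast
  show op: "open (b ` V)" by (rule invariance_of_domain[OF bcont V(2) inj])
  show gb: "g (b x) = x" if "x \<in> V" for x
    unfolding g_def by (rule inv_into_f_f[OF inj that])
  have bg: "b (g y) = y" "g y \<in> V" if "y \<in> b ` V" for y using that gb by auto
  have gcont: "continuous_on (b ` V) g"
    unfolding continuous_on_iff
  proof (intro ballI allI impI)
    fix y and e :: real assume y: "y \<in> b ` V" and e: "e > 0"
    have "dist (g y') (g y) < e" if "y' \<in> b ` V" "dist y' y < e / 2" for y'
      using dist_b[OF bg(2)[OF that(1)] bg(2)[OF y]] that bg(1)[OF y] bg(1)[OF that(1)] by (simp add: dist_norm)
    then show "\<exists>d>0. \<forall>x'\<in>b ` V. dist x' y < d \<longrightarrow> dist (g x') (g y) < e"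
      using e by (intro exI[of _ "e / 2"]) auto
  qed
  define J where "J x = matrix (B x)" for x
  have JB: "J x *v v = B x v" if "x \<in> V" for x v
    unfolding J_def using matrix_works[of "B x"] Blin[OF that]
    by (metis matrix_vector_mul(3))
  have detJ: "det (J x) \<noteq> 0" if "x \<in> V" for x
  proof -
    have "inj ((*v) (J x))"
    proof (rule injI)
      fix v w assume "J x *v v = J x *v w"
      then have "B x (v - w) = 0"
        using JB[OF that, of "v - w"] by (simp add: matrix_vector_mult_diff_distrib)
      then show "v = w" using Binj[OF that, of "v - w"] by simp
    qed
    then show ?thesis by (simp add: invertible_det_nz[symmetric] invertible_left_inverse matrix_left_invertible_injective)
  qed
  define solve where "solve x w = (\<chi> k. det (\<chi> i j. if j = k then w $ i else J x $ i $ j) / det (J x))" for x w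
  have solve: "B x v = w \<longleftrightarrow> v = solve x w" if "x \<in> V" for x v w
    using cramer[OF detJ[OF that], of v w] JB[OF that, of v] by (simp add: solve_def)
  have Bsolve: "B x (solve x w) = w" if "x \<in> V" for x w using solve[OF that] by blast
  have solve_lin: "bounded_linear (solve x)" if x: "x \<in> V" for x
  proof -
    interpret B: bounded_linear "B x" by (rule Blin[OF x])
    have "linear (solve x)"
      by (rule linearI) (use solve[OF x] Bsolve[OF x] B.add B.scaleR in metis)+
    then show ?thesis by (simp add: linear_conv_bounded_linear)
  qed
  have gder: "(g has_derivative solve x) (at (b x))" if x: "x \<in> V" for x
  proof (rule has_derivative_inverse_basic[of b "B x" g "b x" "solve x" "b ` V"])
    show "(b has_derivative B x) (at (g (b x)))" using Bder[OF x] gb[OF x] by simp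
    show "solve x \<circ> B x = id" using solve[OF x, THEN iffD1, OF refl] by (auto simp: fun_eq_iff)
    show "continuous (at (b x)) g" using gcont op x continuous_on_eq_continuous_at by blast
  qed (use solve_lin[OF x] op x bg in auto)
  have Hg: "((\<lambda>y. H (g y)) has_derivative (\<lambda>w. H' (solve x w))) (at (b x))"
    if "x \<in> V" "(H has_derivative H') (at x)" for x H' and H :: "real ^ 'n \<Rightarrow> real"
    using has_derivative_compose[OF gder[OF that(1)], of H H'] that gb by simp
  \<comment> \<open>The preimage of w under the derivative of b is \<open>solve x w\<close>, which
    stays hidden in this form of the chain rule.\<close>
  show "\<exists>v. (\<chi> i. frechet_derivative (\<lambda>x. b x $ i) (at x) v) = w \<and>
      (\<forall>H :: real ^ 'n \<Rightarrow> real. \<forall>H'. (H has_derivative H') (at x) \<longrightarrow>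
        (\<exists>D. ((\<lambda>y. H (g y)) has_derivative D) (at (b x)) \<and> D w = H' v))" if x: "x \<in> V" for x w
    using Bsolve[OF x, of w] Hg[OF x] unfolding B_def by blast
  have Jk: "Ck_on k V (\<lambda>x. J x $ i $ j)" for k i j
    using b[of "Suc k" i] axis_in_Basis_iff[of j "1::real"] by (simp add: J_def matrix_def B_def)
  have "Ck_on k (b ` V) (\<lambda>y. H (g y))" if "smooth_on V H" for k and H :: "real ^ 'n \<Rightarrow> real"
    using that
  proof (induction k arbitrary: H)
    case 0
    then have "continuous_on V H" unfolding smooth_on_def using Ck_on_continuous by blast
    then show ?case using continuous_on_compose2[OF _ gcont, of V H] bg(2) by auto
  next
    case (Suc k)
    have Hk: "Ck_on m V H" for m using Suc.prems by (simp add: smooth_on_def)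
    define H' where "H' x = frechet_derivative H (at x)" for x
    have Hd: "(H has_derivative H' x) (at x)" if "x \<in> V" for x
      unfolding H'_def by (rule Ck_on_SucD[OF Hk that])
    show ?case
    proof (rule Ck_on_SucI'[OF op, where f' = "\<lambda>y w. H' (g y) (solve (g y) w)"])
      fix y assume "y \<in> b ` V"
      then obtain x where x: "x \<in> V" "y = b x" by blast
      show "((\<lambda>y. H (g y)) has_derivative (\<lambda>w. H' (g y) (solve (g y) w))) (at y)"
        using Hg[OF x(1) Hd[OF x(1)]] x gb by simp
    next
      fix e :: "real ^ 'n" assume "e \<in> Basis"
      define Q where "Q x = (\<Sum>l\<in>UNIV. (det (\<chi> i j. if j = l then e $ i else J x $ i $ j) * inverse (det (\<chi> i j. J x $ i $ j)))
          * H' x (axis l 1))" for x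
      have QH: "Q x = H' x (solve x e)" if "x \<in> V" for x
      proof -
        have "(\<chi> i j. J x $ i $ j) = J x" by (simp add: vec_eq_iff)
        then show ?thesis
          unfolding linear_axis_expansion[OF has_derivative_bounded_linear[OF Hd[OF that]], of "solve x e"]
          by (simp only: Q_def solve_def divide_inverse vec_lambda_beta real_scaleR_def)
      qed
      have "Ck_on m V Q" for m
        unfolding Q_def
      proof (intro Ck_on_sum Ck_on_mult Ck_on_inverse Ck_on_det V(2) Jk)
        show "Ck_on m V (\<lambda>x. if j = l then e $ i else J x $ i $ j)" for i j l
          by (cases "j = l") (auto intro: Ck_on_const V(2) Jk)
        show "det (\<chi> i j. J x $ i $ j) \<noteq> 0" if "x \<in> V" for x using detJ[OF that] by simp
        show "Ck_on m V (\<lambda>x. H' x (axis l 1))" for l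
          using Hk[of "Suc m"] axis_in_Basis_iff[of l "1::real"] by (simp add: H'_def)
      qed
      then have "Ck_on k (b ` V) (\<lambda>y. Q (g y))" by (intro Suc.IH) (simp add: smooth_on_def)
      then show "Ck_on k (b ` V) (\<lambda>y. H' (g y) (solve (g y) e))"
        by (rule Ck_on_cong[OF op, rotated]) (use QH bg in auto)
    qed
  qed
  then show "smooth_on (b ` V) (\<lambda>y. H (g y))" if "smooth_on V H" for H :: "real ^ 'n \<Rightarrow> real"
    using that by (simp add: smooth_on_def)
qed


subsection \<open>Contact fields on the first jet space\<close>

abbreviation y1 :: "'n \<Rightarrow> 'n coord" where
  "y1 i \<equiv> Dep (bump (\<lambda>_. 0) i)"

abbreviation y0 :: "'n coord" where
  "y0 \<equiv> Dep (\<lambda>_. 0)"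

definition first_coords :: "'n::finite coord set" where
  "first_coords = {c. coord_rank c \<le> 1}"

lemma first_coords_eq: "first_coords = range Indep \<union> insert y0 (range y1)"
proof
  show "first_coords \<subseteq> range Indep \<union> insert y0 (range (y1 :: 'a \<Rightarrow> 'a coord))"
  proof
    fix c :: "'a coord" assume c: "c \<in> first_coords"
    show "c \<in> range Indep \<union> insert y0 (range y1)"
    proof (cases c)
      case (Dep \<alpha>)
      then have sz: "msize \<alpha> \<le> 1" using c by (simp add: first_coords_def)
      show ?thesis
      proof (cases "\<alpha> = (\<lambda>_. 0)")
        case False
        then obtain k where k: "\<alpha> k > 0" by (auto simp: fun_eq_iff)
        then have "msize (mlower \<alpha> k) = 0" using msize_mlower[of \<alpha> k] sz by simp
        then have "mlower \<alpha> k = (\<lambda>_. 0)" by (simp add: msize_eq_0)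
        then have "\<alpha> = bump (\<lambda>_. 0) k" using bump_mlower[of \<alpha> k, OF k] by simp
        then show ?thesis using Dep by blast
      qed (use Dep in auto)
    qed auto
  qed
qed (auto simp: first_coords_def)

lemma first_coords_simps [simp]: "Indep i \<in> first_coords" "y0 \<in> first_coords" "y1 i \<in> first_coords"
  by (auto simp: first_coords_def)

lemma finite_first_coords [simp]: "finite first_coords"
  by (simp add: first_coords_eq)

lemma sum_first_coords:
  fixes g :: "'n::finite coord \<Rightarrow> real"
  shows "(\<Sum>c\<in>first_coords. g c) = (\<Sum>i\<in>UNIV. g (Indep i)) + g y0 + (\<Sum>i\<in>UNIV. g (y1 i))"
proof -
  have "(\<Sum>c\<in>first_coords. g c) = (\<Sum>c\<in>range Indep. g c) + (\<Sum>c\<in>insert y0 (range y1). g c)"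
    unfolding first_coords_eq by (intro sum.union_disjoint) auto
  also have "(\<Sum>c\<in>insert y0 (range y1). g c) = g y0 + (\<Sum>c\<in>range y1. g c)"
    by (intro sum.insert) auto
  also have "(\<Sum>c\<in>range Indep. g c) = (\<Sum>i\<in>UNIV. g (Indep i))"
    by (subst sum.reindex) (auto simp: inj_on_def)
  also have "(\<Sum>c\<in>range y1. g c) = (\<Sum>i\<in>UNIV. g (y1 i))"
    by (subst sum.reindex) (auto simp: inj_on_def bump_left_inject)
  finally show ?thesis by simp
qed

text \<open>A section of \<open>proj1\<close> with higher coordinates 0. The sum over i selects the
  component with \<alpha> = bump 0 i and vanishes if there is none, which avoids choosing i.\<close>

definition emb :: "'n::finite jet1 \<Rightarrow> 'n jet" where
  "emb w c = (case c of Indep i \<Rightarrow> fst w $ i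
    | Dep \<alpha> \<Rightarrow> if \<alpha> = (\<lambda>_. 0) then fst (snd w)
        else \<Sum>i\<in>UNIV. (if \<alpha> = bump (\<lambda>_. 0) i then 1 else 0) * snd (snd w) $ i)"

lemma emb_simps [simp]: "emb w (Indep i) = fst w $ i" "emb w y0 = fst (snd w)" "emb w (y1 i) = snd (snd w) $ i"
  by (simp_all add: emb_def bump_left_inject if_distrib[of "\<lambda>x. x * _"] cong: if_cong)

lemma bounded_linear_emb: "bounded_linear (\<lambda>w. emb w c)"
proof (cases c)
  case (Indep i)
  then show ?thesis by (simp add: emb_def bounded_linear_compose[OF bounded_linear_vec_nth bounded_linear_fst])
next
  case (Dep \<alpha>)
  have "bounded_linear (\<lambda>w :: 'a jet1. \<Sum>i\<in>UNIV. (if \<alpha> = bump (\<lambda>_. 0) i then 1 else 0) * snd (snd w) $ i)"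
    by (intro bounded_linear_sum bounded_linear_const_mult bounded_linear_compose[OF bounded_linear_vec_nth]
        bounded_linear_compose[OF bounded_linear_snd] bounded_linear_snd)
  then show ?thesis using Dep
    by (cases "\<alpha> = (\<lambda>_. 0)") (simp_all add: emb_def bounded_linear_compose[OF bounded_linear_fst bounded_linear_snd])
qed

lemma proj1_emb [simp]: "proj1 (emb w) = w"
  by (simp add: proj1_def prod_eq_iff vec_eq_iff)

lemma emb_proj1: "c \<in> first_coords \<Longrightarrow> emb (proj1 p) c = p c"
  by (auto simp: first_coords_eq proj1_def)

lemma proj1_cong: "(\<And>c. c \<in> first_coords \<Longrightarrow> p c = q c) \<Longrightarrow> proj1 p = proj1 q"
  by (simp add: proj1_def)

text \<open>Reduces derivatives and smoothness of maps into J^1 to those of scalar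
  coordinates.\<close>

lemma proj1_eq_sum:
  "proj1 v = (\<Sum>c\<in>first_coords. v c *\<^sub>R proj1 (\<lambda>d. if d = c then 1 else 0))"
proof -
  have "(\<Sum>c\<in>first_coords. v c * (if d = c then 1 else 0)) = v d" if "d \<in> first_coords" for d
    using that by (simp add: if_distrib[of "\<lambda>x. _ * x"] cong: if_cong)
  then show ?thesis
    by (simp add: proj1_def prod_eq_iff fst_sum snd_sum vec_eq_iff sum_component)
qed

lemma continuous_on_at_time:
  fixes g :: "'a::topological_space \<Rightarrow> 'i \<Rightarrow> real"
  assumes "\<And>c. continuous_on T (\<lambda>z. g z c)" "continuous_on T t"
  shows "continuous_on T (\<lambda>z. at_time (g z) (t z))"
proof (rule continuous_on_coordinatewise_then_product)
  show "continuous_on T (\<lambda>z. at_time (g z) (t z) k)" for k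
    by (cases k) (auto intro: assms)
qed

text \<open>The components of \<theta> on J^1, in coordinates; those along dy^i are 0.\<close>

definition contact_form :: "'n::finite jet \<Rightarrow> 'n coord \<Rightarrow> real" where
  "contact_form p d = (case d of Indep j \<Rightarrow> - p (y1 j) | Dep \<alpha> \<Rightarrow> if \<alpha> = (\<lambda>_. 0) then 1 else 0)"

lemma sum_contact_form:
  "(\<Sum>d\<in>first_coords. contact_form p d * v d) = v y0 - (\<Sum>i\<in>UNIV. p (y1 i) * v (Indep i))"
  by (simp add: sum_first_coords contact_form_def sum_negf)

text \<open>The hypothesis \<open>contact\<close> is L_G \<theta> = \<lambda> \<theta>, written for
  each component d, with \<lambda> read off from the dy-component of the left-hand side.\<close>

locale contact_field =
  fixes W :: "'n::finite jet1 set" and G :: "'n jet_field"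
  assumes W: "open W"
    and field: "coord_field first_coords {p. proj1 p \<in> W} G"
    and contact: "\<And>p d. proj1 p \<in> W \<Longrightarrow> d \<in> first_coords \<Longrightarrow>
      pderiv_at d (G y0) p - (\<Sum>i\<in>UNIV. p (y1 i) * pderiv_at d (G (Indep i)) p)
        - (\<Sum>i\<in>UNIV. if d = Indep i then G (y1 i) p else 0) =
      (pderiv_at y0 (G y0) p - (\<Sum>i\<in>UNIV. p (y1 i) * pderiv_at y0 (G (Indep i)) p)) * contact_form p d"
begin

definition \<Omega>1 :: "'n jet set" where "\<Omega>1 = {p. proj1 p \<in> W}"

lemma F: "coord_field first_coords \<Omega>1 G"
  using field by (simp add: \<Omega>1_def)

abbreviation fl :: "'n coord \<Rightarrow> ('n coord option \<Rightarrow> real) \<Rightarrow> real" where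
  "fl \<equiv> flow first_coords \<Omega>1 G"

abbreviation dom :: "('n coord option \<Rightarrow> real) set" where
  "dom \<equiv> flow_dom first_coords \<Omega>1 G"

definition dfl :: "'n coord \<Rightarrow> 'n coord \<Rightarrow> ('n coord option \<Rightarrow> real) \<Rightarrow> real" where
  "dfl d c = pderiv_at (Some d) (fl c)"

lemma open_dom: "open dom"
  by (rule open_cylinder_open[OF open_cylinder_flow_dom[OF F]])

lemma smooth_fl: "c \<in> first_coords \<Longrightarrow> smooth_coords dom (fl c)"
  by (rule smooth_coords_flow[OF infinite_coord F])

lemma smooth_dfl: "c \<in> first_coords \<Longrightarrow> smooth_coords dom (dfl d c)"
  unfolding dfl_def by (intro smooth_coords_pderiv smooth_fl)

lemma pderiv_time_fl:
  assumes "P \<in> dom" "c \<in> first_coords"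
  shows "pderiv_at None (fl c) P = G c (\<lambda>k. fl k P)"
proof (rule pderiv_at_eqI)
  have P: "at_time (\<lambda>d. P (Some d)) s = P(None := s)" for s
    using at_time_upd[of "\<lambda>d. P (Some d)" "P None" s] by (simp add: at_time_surj)
  have "at_time (\<lambda>d. P (Some d)) (P None) \<in> dom" using assms(1) by (simp add: at_time_surj)
  from flow_DERIV[OF infinite_coord F this assms(2)]
  show "((\<lambda>s. fl c (P(None := s))) has_real_derivative G c (\<lambda>k. fl k P)) (at (P None))"
    by (simp add: P)
qed

lemma fl_in: "P \<in> dom \<Longrightarrow> (\<lambda>k. fl k P) \<in> \<Omega>1"
  using flow_in(2)[OF F, of "\<lambda>d. P (Some d)" "P None"] by (simp add: at_time_surj)

text \<open>The variational equation, obtained by exchanging the derivative in time with that in the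
  initial point.\<close>

lemma pderiv_time_dfl:
  assumes P: "P \<in> dom" and c: "c \<in> first_coords"
  shows "pderiv_at None (dfl d c) P =
    (\<Sum>e\<in>first_coords. pderiv_at e (G c) (\<lambda>k. fl k P) * dfl d e P)"
proof -
  note D = coord_fieldD[OF F]
  have "pderiv_at None (dfl d c) P = pderiv_at (Some d) (pderiv_at None (fl c)) P"
    unfolding dfl_def by (rule pderiv_commute[OF open_dom smooth_fl[OF c] P])
  also have "\<dots> = pderiv_at (Some d) (\<lambda>Q. G c (\<lambda>k. fl k Q)) P"
    by (rule pderiv_at_cong[OF open_dom P]) (rule pderiv_time_fl[OF _ c])
  also have "\<dots> = (\<Sum>e\<in>first_coords. pderiv_at e (G c) (\<lambda>k. fl k P) * dfl d e P)"
  proof (rule pderiv_at_eqI)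
    have "((\<lambda>s. G c (\<lambda>k. fl k (P(Some d := s)))) has_real_derivative
        (\<Sum>e\<in>first_coords. pderiv_at e (G c) (\<lambda>k. fl k (P(Some d := P (Some d)))) * dfl d e P)) (at (P (Some d)))"
    proof (rule has_real_derivative_coords[OF D(2,1) D(4)[OF c] D(5)[OF c]])
      show "(\<lambda>k. fl k (P(Some d := P (Some d)))) \<in> \<Omega>1" using fl_in[OF P] by simp
      fix e :: "'n coord" assume e: "e \<in> first_coords"
      show "((\<lambda>s. fl e (P(Some d := s))) has_real_derivative dfl d e P) (at (P (Some d)))"
        unfolding dfl_def by (rule smooth_coords_DERIV[OF smooth_fl[OF e] P])
    qed
    then show "((\<lambda>s. G c (\<lambda>k. fl k (P(Some d := s)))) has_real_derivative
        (\<Sum>e\<in>first_coords. pderiv_at e (G c) (\<lambda>k. fl k P) * dfl d e P)) (at (P (Some d)))" by simp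
  qed
  finally show ?thesis .
qed

lemma dfl_0:
  assumes p: "p \<in> \<Omega>1"
  shows "dfl d c (at_time p 0) = (if c = d then 1 else 0)"
  unfolding dfl_def
proof (rule pderiv_at_eqI)
  have "\<forall>\<^sub>F s in nhds (p d). p(d := s) \<in> \<Omega>1"
    using coord_fieldD(3)[OF F] p by (intro eventually_fun_upd_in) auto
  then have ev: "\<forall>\<^sub>F s in nhds (p d). fl c ((at_time p 0)(Some d := s)) = (p(d := s)) c"
  proof eventually_elim
    case (elim s)
    have "(at_time p 0)(Some d := s) = at_time (p(d := s)) 0"
      by (auto simp: at_time_def fun_eq_iff split: option.splits)
    then show ?case using flow_0(2)[OF F elim] by simp
  qed
  have "((\<lambda>s. (p(d := s)) c) has_real_derivative (if c = d then 1 else 0)) (at (p d))"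
    by (cases "c = d") auto
  then show "((\<lambda>s. fl c ((at_time p 0)(Some d := s))) has_real_derivative (if c = d then 1 else 0))
      (at (at_time p 0 (Some d)))"
    using DERIV_cong_ev[OF refl ev refl] by simp
qed

text \<open>Let \<kappa> be \<theta> applied to the vector v transported along the trajectory. As
  the Lie derivative of \<theta> is a multiple of \<theta>, \<kappa> satisfies a linear homogeneous
  equation and stays 0 when it starts at 0.\<close>

lemma contact_preserved:
  assumes pt: "at_time p t \<in> dom" and v: "(\<Sum>d\<in>first_coords. contact_form p d * v d) = 0"
  shows "(\<Sum>d\<in>first_coords. v d * dfl d y0 (at_time p t)) =
    (\<Sum>i\<in>UNIV. fl (y1 i) (at_time p t) * (\<Sum>d\<in>first_coords. v d * dfl d (Indep i) (at_time p t)))"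
proof -
  note D = coord_fieldD[OF F]
  obtain x where x: "sol first_coords \<Omega>1 (\<lambda>i x. t * G i x) p x" using flow_imp_sol[OF F pt] by blast
  have dom: "at_time p (l * t) \<in> dom" and fx: "fl c (at_time p (l * t)) = x l c" if "l \<in> {0..1}" for l c
    using flow_scale_time[OF F x that] by auto
  define L where "L q = pderiv_at y0 (G y0) q - (\<Sum>i\<in>UNIV. q (y1 i) * pderiv_at y0 (G (Indep i)) q)" for q
  define \<delta> where "\<delta> c l = (\<Sum>d\<in>first_coords. v d * dfl d c (at_time p (l * t)))" for c l
  define \<kappa> where "\<kappa> l = \<delta> y0 l - (\<Sum>i\<in>UNIV. x l (y1 i) * \<delta> (Indep i) l)" for l
  have \<delta>_der: "(\<delta> c has_real_derivative t * (\<Sum>e\<in>first_coords. pderiv_at e (G c) (x l) * \<delta> e l)) (at l within {0..1})"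
    if l: "l \<in> {0..1}" and c: "c \<in> first_coords" for c l
  proof -
    have "((\<lambda>l. dfl d c (at_time p (l * t))) has_real_derivative
        (\<Sum>e\<in>first_coords. pderiv_at e (G c) (x l) * dfl d e (at_time p (l * t))) * t) (at l within {0..1})" for d
    proof -
      have "((\<lambda>s. dfl d c (at_time p s)) has_real_derivative
          pderiv_at None (dfl d c) (at_time p (l * t))) (at (l * t))"
        using smooth_coords_DERIV[OF smooth_dfl[OF c] dom[OF l], of d None] by simp
      moreover have "((\<lambda>l. l * t) has_real_derivative t) (at l within {0..1})"
        by (auto intro!: derivative_eq_intros)
      ultimately show ?thesis
        unfolding pderiv_time_dfl[OF dom[OF l] c] fx[OF l] by (rule DERIV_chain2)
    qed
    then have "((\<lambda>l. \<Sum>d\<in>first_coords. v d * dfl d c (at_time p (l * t))) has_real_derivative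
        (\<Sum>d\<in>first_coords. v d * ((\<Sum>e\<in>first_coords. pderiv_at e (G c) (x l) * dfl d e (at_time p (l * t))) * t)))
        (at l within {0..1})"
      by (intro DERIV_sum DERIV_cmult)
    moreover have "(\<Sum>d\<in>first_coords. v d * ((\<Sum>e\<in>first_coords. pderiv_at e (G c) (x l) * dfl d e (at_time p (l * t))) * t)) =
        t * (\<Sum>e\<in>first_coords. pderiv_at e (G c) (x l) * \<delta> e l)"
      unfolding \<delta>_def sum_distrib_left sum_distrib_right by (subst sum.swap) (simp only: mult_ac)
    ultimately show ?thesis unfolding \<delta>_def by simp
  qed
  have \<kappa>_der: "(\<kappa> has_real_derivative t * L (x l) * \<kappa> l) (at l within {0..1})" if l: "l \<in> {0..1}" for l
  proof -
    let ?s = "\<lambda>c. \<Sum>e\<in>first_coords. pderiv_at e (G c) (x l) * \<delta> e l"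
    have xW: "proj1 (x l) \<in> W" using solD(2)[OF x l] by (simp add: \<Omega>1_def)
    have "(\<kappa> has_real_derivative t * ?s y0 - (\<Sum>i\<in>UNIV. t * G (y1 i) (x l) * \<delta> (Indep i) l +
        t * ?s (Indep i) * x l (y1 i))) (at l within {0..1})"
      unfolding \<kappa>_def by (intro DERIV_diff DERIV_sum DERIV_mult \<delta>_der[OF l] solD(4)[OF x l]) auto
    moreover have "t * ?s y0 - (\<Sum>i\<in>UNIV. t * G (y1 i) (x l) * \<delta> (Indep i) l + t * ?s (Indep i) * x l (y1 i)) =
        t * (\<Sum>e\<in>first_coords. (pderiv_at e (G y0) (x l) - (\<Sum>i\<in>UNIV. x l (y1 i) * pderiv_at e (G (Indep i)) (x l))
          - (\<Sum>i\<in>UNIV. if e = Indep i then G (y1 i) (x l) else 0)) * \<delta> e l)"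
    proof -
      have "(\<Sum>e\<in>first_coords. (\<Sum>i\<in>UNIV. if e = Indep i then G (y1 i) (x l) else 0) * \<delta> e l) =
          (\<Sum>i\<in>UNIV. G (y1 i) (x l) * \<delta> (Indep i) l)"
        by (simp add: sum_first_coords)
      moreover have "(\<Sum>e\<in>first_coords. (\<Sum>i\<in>UNIV. x l (y1 i) * pderiv_at e (G (Indep i)) (x l)) * \<delta> e l) =
          (\<Sum>i\<in>UNIV. ?s (Indep i) * x l (y1 i))"
        unfolding sum_distrib_right by (subst sum.swap) (simp only: mult_ac)
      ultimately show ?thesis
        by (simp add: left_diff_distrib right_diff_distrib sum_subtractf sum.distrib sum_distrib_left[symmetric]
            distrib_left mult.assoc)
    qed
    also have "\<dots> = t * (\<Sum>e\<in>first_coords. L (x l) * contact_form (x l) e * \<delta> e l)"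
      using contact[OF xW] by (simp add: L_def)
    also have "\<dots> = t * L (x l) * \<kappa> l"
      using sum_contact_form[of "x l" "\<lambda>e. \<delta> e l"] by (simp add: \<kappa>_def mult.assoc sum_distrib_left[symmetric])
    ultimately show ?thesis by simp
  qed
  have Lc: "continuous_on {0..1} (\<lambda>l. t * L (x l))"
  proof -
    have "smooth_coords \<Omega>1 L"
      unfolding L_def [abs_def]
      by (intro smooth_coords_diff smooth_coords_sum smooth_coords_mult smooth_coords_pderiv D(3,5) smooth_coords_coord) auto
    then have "continuous_on {0..1} (\<lambda>l. L (x l))"
      by (rule continuous_on_compose2[OF smooth_coords_cont sol_cont[OF x]]) (use solD(2)[OF x] in auto)
    then show ?thesis by (intro continuous_intros)
  qed
  then have "compact ((\<lambda>l. t * L (x l)) ` {0..1})" by (intro compact_continuous_image) auto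
  then obtain M where "\<forall>z\<in>(\<lambda>l. t * L (x l)) ` {0..1}. norm z \<le> M"
    using compact_imp_bounded bounded_iff by metis
  then have M: "\<bar>t * L (x l)\<bar> \<le> \<bar>M\<bar>" if "l \<in> {0..1}" for l using that by force
  \<comment> \<open>The scalar case of the Gronwall estimate, with a one-element index set.\<close>
  have "(\<Sum>i\<in>{()}. (\<kappa> 1)\<^sup>2) \<le> ((\<Sum>i\<in>{()}. (\<kappa> 0)\<^sup>2) + real (card {()}) * (0::real)\<^sup>2) * exp (1 + 2 * \<bar>M\<bar> * card {()})"
  proof (rule sum_squares_gronwall[where w' = "\<lambda>l _. t * L (x l) * \<kappa> l" and w = "\<lambda>l _. \<kappa> l"])
    fix l :: real assume l: "l \<in> {0..1}"
    show "\<bar>t * L (x l) * \<kappa> l\<bar> \<le> 0 + \<bar>M\<bar> * (\<Sum>j\<in>{()}. \<bar>\<kappa> l\<bar>)"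
      using M[OF l] by (simp add: abs_mult mult_right_mono)
  qed (use \<kappa>_der in auto)
  moreover have "\<kappa> 0 = 0"
  proof -
    have p: "p \<in> \<Omega>1" using flow_in(1)[OF F pt] .
    have "\<delta> c 0 = v c" if "c \<in> first_coords" for c
      using that by (simp add: \<delta>_def dfl_0[OF p] if_distrib[of "\<lambda>x. _ * x"] cong: if_cong)
    then show ?thesis using v solD(1)[OF x] by (simp add: \<kappa>_def sum_contact_form)
  qed
  ultimately have "\<kappa> 1 = 0" by simp
  then show ?thesis using fx[of 1] by (simp add: \<kappa>_def \<delta>_def)
qed

definition Z :: "'n jet1 \<Rightarrow> 'n jet1" where
  "Z w = proj1 (\<lambda>c. G c (emb w))"

definition E :: "('n jet1 \<times> real) set" where
  "E = {(w, t). at_time (emb w) t \<in> dom}"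

definition \<Phi> :: "real \<Rightarrow> 'n jet1 \<Rightarrow> 'n jet1" where
  "\<Phi> t w = proj1 (\<lambda>c. fl c (at_time (emb w) t))"

lemma continuous_on_emb: "continuous_on T g \<Longrightarrow> continuous_on T (\<lambda>z. emb (g z) c)"
  using continuous_on_compose2[OF linear_continuous_on[OF bounded_linear_emb[of c], of UNIV], of T g] by simp

lemma open_E: "open E"
proof -
  have "continuous_on UNIV (\<lambda>z :: 'n jet1 \<times> real. at_time (emb (fst z)) (snd z))"
    by (intro continuous_on_at_time continuous_on_emb continuous_intros)
  then have "open ((\<lambda>z :: 'n jet1 \<times> real. at_time (emb (fst z)) (snd z)) -` dom)"
    using open_dom open_vimage by blast
  moreover have "(\<lambda>z :: 'n jet1 \<times> real. at_time (emb (fst z)) (snd z)) -` dom = E" by (auto simp: E_def)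
  ultimately show ?thesis by simp
qed

lemma emb_in: "w \<in> W \<Longrightarrow> emb w \<in> \<Omega>1"
  by (simp add: \<Omega>1_def)

lemma local_flow1_Z: "local_flow1 W Z E \<Phi>"
  unfolding local_flow1_def
proof (intro conjI allI ballI impI)
  show "open E" by (rule open_E)
  show "E \<subseteq> W \<times> UNIV" using flow_in(1)[OF F] by (fastforce simp: E_def \<Omega>1_def)
  show "W \<times> {0} \<subseteq> E" using flow_0(1)[OF F emb_in] by (auto simp: E_def)
  show "is_interval {t. (w, t) \<in> E}" for w
  proof (rule star_is_interval)
    fix t l :: real assume t: "t \<in> {t. (w, t) \<in> E}" and l: "l \<in> {0..1}"
    then obtain x where "sol first_coords \<Omega>1 (\<lambda>i x. t * G i x) (emb w) x"
      using flow_imp_sol[OF F] by (auto simp: E_def)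
    from flow_scale_time(1)[OF F this l] show "l * t \<in> {t. (w, t) \<in> E}" by (simp add: E_def)
  qed
  show "\<Phi> 0 w = w" if "w \<in> W" for w
    using flow_0(2)[OF F emb_in[OF that]] by (simp add: \<Phi>_def)
  fix w t assume wt: "(w, t) \<in> E"
  then have P: "at_time (emb w) t \<in> dom" by (simp add: E_def)
  show "\<Phi> t w \<in> W" using fl_in[OF P] by (simp add: \<Phi>_def \<Omega>1_def)
  have "((\<lambda>s. \<Sum>c\<in>first_coords. fl c (at_time (emb w) s) *\<^sub>R proj1 (\<lambda>d. if d = c then 1 else 0))
      has_vector_derivative (\<Sum>c\<in>first_coords. G c (\<lambda>d. fl d (at_time (emb w) t)) *\<^sub>R proj1 (\<lambda>d. if d = c then 1 else 0))) (at t)"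
    by (intro has_vector_derivative_sum bounded_linear.has_vector_derivative[OF bounded_linear_scaleR_left])
      (use flow_DERIV[OF infinite_coord F P] in \<open>simp add: has_real_derivative_iff_has_vector_derivative\<close>)
  moreover have "G c (\<lambda>d. fl d (at_time (emb w) t)) = G c (emb (\<Phi> t w))" if "c \<in> first_coords" for c
  proof (rule depends_only_onD[OF coord_fieldD(4)[OF F that] fl_in[OF P] emb_in[OF \<open>\<Phi> t w \<in> W\<close>]])
    show "fl d (at_time (emb w) t) = emb (\<Phi> t w) d" if "d \<in> first_coords" for d
      unfolding \<Phi>_def using emb_proj1[OF that] by simp
  qed
  ultimately show "((\<lambda>s. \<Phi> s w) has_vector_derivative Z (\<Phi> t w)) (at t)"
    unfolding \<Phi>_def Z_def proj1_eq_sum[of "\<lambda>c. fl c _"] proj1_eq_sum[of "\<lambda>c. G c _"] by simp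
qed

lemma smooth_on_Z: "smooth_on W Z"
  unfolding smooth_on_def
proof
  fix k
  note D = coord_fieldD[OF F]
  have "Ck_on k W (\<lambda>w. G c (emb w))" if "c \<in> first_coords" for c
    by (rule Ck_on_coords[OF D(2,1) W emb_in Ck_on_linear[OF W bounded_linear_emb] D(5)[OF that] D(4)[OF that]])
  then have "Ck_on k W (\<lambda>w. \<Sum>c\<in>first_coords. G c (emb w) *\<^sub>R proj1 (\<lambda>d. if d = c then 1 else 0))"
    by (intro Ck_on_sum Ck_on_scaleR W Ck_on_const)
  moreover have "Z = (\<lambda>w. \<Sum>c\<in>first_coords. G c (emb w) *\<^sub>R proj1 (\<lambda>d. if d = c then 1 else 0))"
    unfolding Z_def [abs_def] proj1_eq_sum[of "\<lambda>c. G c _"] ..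
  ultimately show "Ck_on k W Z" by simp
qed

end

section \<open>Transport of 1-graphs by a contact flow\<close>

lemma Ck_on_emb_tau1:
  assumes U: "open U" and f: "smooth_on U f" and c: "c \<in> first_coords"
  shows "Ck_on k U (\<lambda>x. emb (tau1 f x) c)"
proof -
  have fk: "Ck_on m U f" for m using f by (simp add: smooth_on_def)
  consider i where "c = Indep i" | "c = y0" | i where "c = y1 i"
    using c by (auto simp: first_coords_eq)
  then show ?thesis
  proof cases
    case (1 i)
    then show ?thesis using Ck_on_linear[OF U bounded_linear_vec_nth] by (simp add: tau1_def)
  next
    case 2
    then show ?thesis using fk by (simp add: tau1_def)
  next
    case (3 i)
    then show ?thesis using fk[of "Suc k"] axis_in_Basis_iff[of i "1::real"] by (simp add: tau1_def)
  qed
qed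

lemma emb_outside: "c \<notin> first_coords \<Longrightarrow> emb w c = 0"
  by (cases c) (auto simp: emb_def first_coords_eq intro!: sum.neutral)

context contact_field
begin

text \<open>Let b be the x-part of the 1-graph over V after transport by the flow. Near x0 and for
  small t its derivative is close to the identity, so b is invertible. The y-part then becomes a
  function \<open>ft\<close> on the image of b, and preservation of the contact form says that the
  remaining part consists of the derivatives of \<open>ft\<close>.\<close>

lemma prolonged_germs:
  fixes U :: "(real ^ 'n) set" and f :: "real ^ 'n \<Rightarrow> real"
  assumes U: "open U" and f: "smooth_on U f" and fW: "graph1 U f \<subseteq> W" and x0: "x0 \<in> U"
  shows "\<exists>\<delta>>0. \<exists>V. open V \<and> x0 \<in> V \<and> V \<subseteq> U \<and> (\<forall>t. \<bar>t\<bar> < \<delta> \<longrightarrow>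
    (\<exists>Ut ft. open Ut \<and> smooth_on Ut ft \<and>
      (\<forall>x\<in>V. maps_germ {w. (w, t) \<in> E} (\<Phi> t) (graph1 U f) (tau1 f x) (graph1 Ut ft))))"
proof -
  define e where "e x c = emb (tau1 f x) c" for x c
  have e_simps: "e x (Indep i) = x $ i" "e x y0 = f x" "e x (y1 i) = frechet_derivative f (at x) (axis i 1)" for x i
    by (simp_all add: e_def tau1_def)
  have ek: "Ck_on k U (\<lambda>x. e x c)" if "c \<in> first_coords" for c k
    unfolding e_def by (rule Ck_on_emb_tau1[OF U f that])
  have ec: "continuous_on U (\<lambda>x. e x c)" for c
    using Ck_on_continuous[OF ek[of c 0]] emb_outside[of c] by (cases "c \<in> first_coords") (auto simp: e_def)
  define De where "De x c = frechet_derivative (\<lambda>x. e x c) (at x)" for x c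
  have eder: "((\<lambda>x. e x c) has_derivative De x c) (at x)" if "x \<in> U" "c \<in> first_coords" for x c
    unfolding De_def by (rule Ck_on_SucD[OF ek[OF that(2)] that(1)])
  define Oz where "Oz = {z \<in> U \<times> UNIV. at_time (e (fst z)) (snd z) \<in> dom}"
  have mc: "continuous_on (U \<times> UNIV) (\<lambda>z. at_time (e (fst z)) (snd z))"
  proof (intro continuous_on_at_time continuous_intros)
    show "continuous_on (U \<times> UNIV) (\<lambda>z :: (real ^ 'n) \<times> real. e (fst z) c)" for c
      by (rule continuous_on_compose2[OF ec continuous_on_fst[OF continuous_on_id]]) auto
  qed
  have Oz_open: "open Oz"
    using continuous_open_preimage[OF mc open_Times[OF U open_UNIV] open_dom]
    by (simp add: Oz_def vimage_def Int_def conj_commute)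
  have O0: "(x, 0) \<in> Oz" if "x \<in> U" for x
  proof -
    have "tau1 f x \<in> W" using fW that by (auto simp: graph1_def)
    then have "at_time (emb (tau1 f x)) 0 \<in> dom" by (intro flow_0(1)[OF F emb_in])
    then show ?thesis using that by (simp add: Oz_def e_def [abs_def])
  qed
  define h where "h t c x = fl c (at_time (e x) t)" for t c x
  define Dh where "Dh t c x v = (\<Sum>d\<in>first_coords. dfl d c (at_time (e x) t) * De x d v)" for t c x v
  have hder: "(h t c has_derivative Dh t c x) (at x)" if xt: "(x, t) \<in> Oz" and c: "c \<in> first_coords" for x t c
  proof -
    let ?g' = "\<lambda>k. case k of None \<Rightarrow> (\<lambda>_. 0) | Some d \<Rightarrow> De x d"
    have "((\<lambda>x. fl c (at_time (e x) t)) has_derivative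
        (\<lambda>v. \<Sum>k\<in>timed_coords first_coords. pderiv_at k (fl c) (at_time (e x) t) * ?g' k v)) (at x)"
    proof (rule has_derivative_coords[OF open_cylinder_flow_dom[OF F] _ depends_only_on_flow[OF F c]])
      show "Ckc 1 dom (fl c)" using smooth_fl[OF c] smooth_coords_iff_Ckc by blast
      show "at_time (e x) t \<in> dom" using xt by (simp add: Oz_def)
      show "((\<lambda>x. at_time (e x) t k) has_derivative ?g' k) (at x)" if "k \<in> timed_coords first_coords" for k
        using that eder xt by (auto simp: timed_coords_def Oz_def)
    qed (simp add: timed_coords_def)
    moreover have "(\<Sum>k\<in>timed_coords first_coords. pderiv_at k (fl c) (at_time (e x) t) * ?g' k v) = Dh t c x v" for v
      by (simp add: timed_coords_def sum.reindex Dh_def dfl_def)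
    ultimately show ?thesis by (simp add: h_def [abs_def])
  qed
  have hk: "Ck_on k V (h t c)" if V: "open V" "\<And>x. x \<in> V \<Longrightarrow> (x, t) \<in> Oz" and c: "c \<in> first_coords" for V t c k
    unfolding h_def [abs_def]
  proof (rule Ck_on_coords[OF open_cylinder_flow_dom[OF F] _ V(1) _ _ smooth_fl[OF c] depends_only_on_flow[OF F c]])
    have VU: "V \<subseteq> U" using V(2) by (auto simp: Oz_def)
    show "Ck_on m V (\<lambda>x. at_time (e x) t k)" if "k \<in> timed_coords first_coords" for k m
      using that Ck_on_subset[OF ek VU] Ck_on_const[OF V(1)] by (auto simp: timed_coords_def)
    show "at_time (e x) t \<in> dom" if "x \<in> V" for x using V(2)[OF that] by (simp add: Oz_def)
  qed (simp add: timed_coords_def)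
  have De_base: "De x (Indep i) v = v $ i" "De x y0 v = (\<Sum>j\<in>UNIV. v $ j * e x (y1 j))" if "x \<in> U" for x i v
  proof -
    have "((\<lambda>x. x $ i) has_derivative De x (Indep i)) (at x)" using eder[OF that, of "Indep i"] by (simp add: e_simps)
    moreover have "((\<lambda>x. x $ i) has_derivative (\<lambda>x. x $ i)) (at x)"
      by (rule bounded_linear_imp_has_derivative[OF bounded_linear_vec_nth])
    ultimately show "De x (Indep i) v = v $ i" using has_derivative_unique by metis
    have d: "(f has_derivative De x y0) (at x)" using eder[OF that, of y0] by (simp add: e_simps)
    have "De x y0 = frechet_derivative f (at x)" by (rule frechet_derivative_at[OF d])
    then show "De x y0 v = (\<Sum>j\<in>UNIV. v $ j * e x (y1 j))"
      using linear_axis_expansion[OF has_derivative_bounded_linear[OF d], of v] by (simp add: e_simps)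
  qed
  have contact_h: "Dh t y0 x v = (\<Sum>i\<in>UNIV. h t (y1 i) x * Dh t (Indep i) x v)" if xt: "(x, t) \<in> Oz" for x t v
  proof -
    have x: "x \<in> U" using xt by (simp add: Oz_def)
    \<comment> \<open>The contact form annihilates the tangent vectors of a 1-graph.\<close>
    have "(\<Sum>d\<in>first_coords. contact_form (e x) d * De x d v) = 0"
      unfolding sum_contact_form by (simp add: De_base[OF x] mult.commute)
    from contact_preserved[OF _ this, of t] show ?thesis
      using xt by (simp add: Oz_def Dh_def h_def mult.commute)
  qed
  define J where "J z i j = Dh (snd z) (Indep i) (fst z) (axis j 1)" for z i j
  \<comment> \<open>The bound demanded by \<open>smooth_near_identity_inverse\<close>.\<close>
  define \<epsilon> where "\<epsilon> = 1 / (2 * (real CARD('n))\<^sup>2)"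
  have \<epsilon>: "\<epsilon> > 0" by (simp add: \<epsilon>_def)
  have "\<forall>\<^sub>F z in nhds (x0, 0). z \<in> Oz \<and> (\<forall>i. \<forall>j. \<bar>J z i j - (if i = j then 1 else 0)\<bar> < \<epsilon>)"
  proof (intro eventually_conj)
    show "\<forall>\<^sub>F z in nhds (x0, 0). z \<in> Oz"
      by (rule eventually_nhds_in_open[OF Oz_open O0[OF x0]])
    have "\<forall>\<^sub>F z in nhds (x0, 0). \<bar>J z i j - (if i = j then 1 else 0)\<bar> < \<epsilon>" for i j
    proof -
      have Jc: "continuous_on Oz (\<lambda>z. J z i j)"
        unfolding J_def Dh_def
      proof (intro continuous_on_sum continuous_on_mult)
        fix d :: "'n coord" assume d: "d \<in> first_coords"
        show "continuous_on Oz (\<lambda>z. dfl d (Indep i) (at_time (e (fst z)) (snd z)))"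
          by (rule continuous_on_compose2[OF smooth_coords_cont[OF smooth_dfl] continuous_on_subset[OF mc]])
            (auto simp: Oz_def)
        have "continuous_on U (\<lambda>x. De x d (axis j 1))"
          using ek[OF d, of 1] axis_in_Basis_iff[of j "1::real"] by (simp add: De_def)
        then show "continuous_on Oz (\<lambda>z. De (fst z) d (axis j 1))"
          by (rule continuous_on_compose2[OF _ continuous_on_fst[OF continuous_on_id]]) (auto simp: Oz_def)
      qed
      have "J (x0, 0) i j = (if i = j then 1 else 0)"
      proof -
        have p: "e x0 \<in> \<Omega>1"
          using fW x0 emb_in[of "tau1 f x0"] by (auto simp: graph1_def e_def [abs_def])
        have "J (x0, 0) i j = (\<Sum>d\<in>first_coords. if Indep i = d then De x0 d (axis j 1) else 0)"
          by (simp add: J_def Dh_def dfl_0[OF p] if_distrib[of "\<lambda>x. x * _"] cong: if_cong)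
        also have "\<dots> = (if i = j then 1 else 0)"
          by (simp add: De_base[OF x0] axis_def)
        finally show ?thesis .
      qed
      moreover have "isCont (\<lambda>z. J z i j) (x0, 0)"
        using Jc Oz_open O0[OF x0] by (simp add: continuous_on_eq_continuous_at)
      then have "((\<lambda>z. J z i j) \<longlongrightarrow> J (x0, 0) i j) (nhds (x0, 0))"
        using tendsto_at_iff_tendsto_nhds[of "\<lambda>z. J z i j" "(x0, 0)"] by (simp add: continuous_at)
      ultimately have "((\<lambda>z. J z i j) \<longlongrightarrow> (if i = j then 1 else 0)) (nhds (x0, 0))"
        by (simp only:)
      from tendstoD[OF this \<epsilon>] show ?thesis by (simp add: dist_real_def)
    qed
    then show "\<forall>\<^sub>F z in nhds (x0, 0). \<forall>i. \<forall>j. \<bar>J z i j - (if i = j then 1 else 0)\<bar> < \<epsilon>"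
      by (intro eventually_all_finite)
  qed
  then obtain r where r: "r > 0" "\<And>z. dist z (x0, 0) < r \<Longrightarrow>
      z \<in> Oz \<and> (\<forall>i. \<forall>j. \<bar>J z i j - (if i = j then 1 else 0)\<bar> < \<epsilon>)"
    unfolding eventually_nhds_metric by blast
  \<comment> \<open>Together with |t| < r / 2 this keeps (x, t) within distance r of (x0, 0); a ball
    is moreover convex.\<close>
  define V where "V = ball x0 (r / 2)"
  have V: "open V" "convex V" "x0 \<in> V" using r(1) by (auto simp: V_def)
  have near: "(x, t) \<in> Oz" "\<bar>J (x, t) i j - (if i = j then 1 else 0)\<bar> < \<epsilon>"
    if "x \<in> V" "\<bar>t\<bar> < r / 2" for x t i j
  proof -
    have "dist (x, t) (x0, 0) \<le> dist x x0 + dist t 0"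
      unfolding dist_prod_def fst_conv snd_conv by (rule sqrt_sum_squares_le_sum) auto
    also have "\<dots> < r" using that by (simp add: V_def dist_commute)
    finally show "(x, t) \<in> Oz" "\<bar>J (x, t) i j - (if i = j then 1 else 0)\<bar> < \<epsilon>" using r(2) by blast+
  qed
  have VU: "V \<subseteq> U" using near(1)[of _ 0] r(1) by (auto simp: Oz_def)
  have "\<exists>Ut ft. open Ut \<and> smooth_on Ut ft \<and>
      (\<forall>x\<in>V. maps_germ {w. (w, t) \<in> E} (\<Phi> t) (graph1 U f) (tau1 f x) (graph1 Ut ft))"
    if t: "\<bar>t\<bar> < r / 2" for t
  proof -
    define b where "b x = (\<chi> i. h t (Indep i) x)" for x
    define g where "g = inv_into V b"
    have xt: "(x, t) \<in> Oz" if "x \<in> V" for x by (rule near(1)[OF that t])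
    have bk: "Ck_on k V (\<lambda>x. b x $ i)" for i k
      using hk[OF V(1) xt, of "Indep i" k] by (simp add: b_def)
    have Db: "frechet_derivative (\<lambda>x. b x $ i) (at x) = Dh t (Indep i) x" if "x \<in> V" for x i
      using frechet_derivative_at[OF hder[OF xt[OF that], of "Indep i"]] by (simp add: b_def)
    have bnear: "\<forall>x\<in>V. \<forall>i j. \<bar>frechet_derivative (\<lambda>x. b x $ i) (at x) (axis j 1) - (if i = j then 1 else 0)\<bar>
        \<le> 1 / (2 * (real CARD('n))\<^sup>2)"
    proof (intro ballI allI)
      fix x i j assume "x \<in> V"
      from near(2)[OF this t, of i j] Db[OF this]
      show "\<bar>frechet_derivative (\<lambda>x. b x $ i) (at x) (axis j 1) - (if i = j then 1 else 0)\<bar>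
          \<le> 1 / (2 * (real CARD('n))\<^sup>2)" by (simp add: J_def \<epsilon>_def less_imp_le)
    qed
    note inv = smooth_near_identity_inverse[of V b, OF V(2,1) bk bnear, folded g_def]
    define ft where "ft y = h t y0 (g y)" for y
    have smooth_ft: "smooth_on (b ` V) ft"
      unfolding ft_def using hk[OF V(1) xt, of y0] by (intro inv(3)) (auto simp: smooth_on_def)
    have tau_ft: "tau1 ft (b x) = \<Phi> t (tau1 f x)" if x: "x \<in> V" for x
    proof -
      \<comment> \<open>For the vector v that the derivative of b maps to w, this is the contact
        relation between the dy- and dx_i-components of the transported vector.\<close>
      have "frechet_derivative ft (at (b x)) w = (\<Sum>i\<in>UNIV. h t (y1 i) x * w $ i)" for w
      proof -
        obtain v where v: "(\<chi> i. frechet_derivative (\<lambda>x. b x $ i) (at x) v) = w"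
          "\<And>H H'. (H has_derivative H') (at x) \<Longrightarrow>
            \<exists>D. ((\<lambda>y. H (g y)) has_derivative D) (at (b x)) \<and> D w = (H' v :: real)"
          using inv(4)[OF x, of w] by blast
        obtain D where D: "((\<lambda>y. h t y0 (g y)) has_derivative D) (at (b x))" "D w = Dh t y0 x v"
          using v(2)[OF hder[OF xt[OF x] first_coords_simps(2)]] by blast
        have "frechet_derivative ft (at (b x)) = D"
          unfolding ft_def by (rule frechet_derivative_at[OF D(1), symmetric])
        moreover have "w $ i = Dh t (Indep i) x v" for i
          unfolding v(1)[symmetric] by (simp add: Db[OF x])
        ultimately show ?thesis using D(2) contact_h[OF xt[OF x], of v] by simp
      qed
      then have "frechet_derivative ft (at (b x)) (axis j 1) = h t (y1 j) x" for j
        by (simp add: axis_def if_distrib[of "\<lambda>x. _ * x"] cong: if_cong)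
      moreover have "ft (b x) = h t y0 x" by (simp add: ft_def inv(2)[OF x])
      ultimately show ?thesis
        by (simp add: tau1_def \<Phi>_def proj1_def b_def h_def e_def [abs_def])
    qed
    \<comment> \<open>Restricting the x-component to V cuts the 1-graph of f down to its part over
      V, which the flow maps onto the whole new 1-graph; so the target neighbourhood can be
      everything.\<close>
    define N where "N = {w. fst w \<in> V \<and> (w, t) \<in> E}"
    have N_open: "open N"
    proof -
      have "open ((\<lambda>w :: 'n jet1. (w, t)) -` E)" by (intro open_vimage open_E continuous_intros)
      moreover have "open (fst -` V :: 'n jet1 set)" by (intro open_vimage V continuous_intros)
      moreover have "N = fst -` V \<inter> (\<lambda>w. (w, t)) -` E" by (auto simp: N_def)
      ultimately show ?thesis by auto
    qed
    have E_tau: "(tau1 f x, t) \<in> E" if "x \<in> V" for x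
      using xt[OF that] by (simp add: E_def Oz_def e_def [abs_def])
    have "maps_germ {w. (w, t) \<in> E} (\<Phi> t) (graph1 U f) (tau1 f x) (graph1 (b ` V) ft)" if x: "x \<in> V" for x
      unfolding maps_germ_def
    proof (rule exI[of _ N], rule exI[of _ UNIV], intro conjI)
      show "tau1 f x \<in> N" using x E_tau by (simp add: N_def tau1_def)
      have "graph1 U f \<inter> N = tau1 f ` V"
        using VU E_tau by (auto simp: graph1_def N_def tau1_def)
      then show "\<Phi> t ` (graph1 U f \<inter> N) \<inter> UNIV = graph1 (b ` V) ft \<inter> UNIV"
        using tau_ft by (simp add: graph1_def image_image)
    qed (use N_open in \<open>auto simp: N_def\<close>)
    then show ?thesis using inv(1) smooth_ft by blast
  qed
  then show ?thesis using r(1) V VU by (intro exI[of _ "r / 2"] conjI exI[of _ V]) auto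
qed

lemma Lie_Baecklund1_Z: "Lie_Baecklund1 W Z"
  unfolding Lie_Baecklund1_def using W smooth_on_Z local_flow1_Z prolonged_germs by blast

end


subsection \<open>Descent to the first jet space\<close>

text \<open>Read on J^1, this is a local section of the projection from \<Omega> through p0; it
  carries smoothness of the coefficients over to J^1.\<close>

definition replace_first :: "'n::finite jet \<Rightarrow> 'n jet \<Rightarrow> 'n jet" where
  "replace_first p0 p c = (if c \<in> first_coords then p c else p0 c)"

lemma replace_first_subst:
  "replace_first p0 = subst_coords (\<lambda>c. if c \<in> first_coords then Some c else None) p0"
  by (auto simp: replace_first_def subst_coords_def fun_eq_iff)

lemma proj1_replace_first [simp]: "proj1 (replace_first p0 p) = proj1 p"
  by (rule proj1_cong) (simp add: replace_first_def)

lemma proj1_eq_iff: "proj1 p = proj1 q \<longleftrightarrow> (\<forall>c\<in>first_coords. p c = q c)"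
  using proj1_cong[of p q] emb_proj1[of _ p] emb_proj1[of _ q] by metis

lemma replace_first_eq: "proj1 p = proj1 p0 \<Longrightarrow> replace_first p0 p = p0"
  by (auto simp: proj1_eq_iff replace_first_def fun_eq_iff)

lemma continuous_on_replace_first: "continuous_on T (replace_first p0)"
  unfolding replace_first_subst by (rule continuous_on_subst_coords)

context lb_field_F
begin

text \<open>Any point of \<Omega> over the same point of J^1 may be chosen, once the coefficients
  are constant on fibres.\<close>

definition descended :: "'n jet_field" where
  "descended c p = X c (SOME q. q \<in> \<Omega> \<and> proj1 q = proj1 p)"

lemma X_first_eq_on_box:
  assumes "box_convex D" "D \<subseteq> \<Omega>" "p \<in> D" "q \<in> D" "proj1 p = proj1 q" "c \<in> first_coords"
  shows "X c p = X c q"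
  by (rule X_same_rank[OF assms(1-4)]) (use assms(5,6) in \<open>auto simp: proj1_eq_iff first_coords_def\<close>)

text \<open>By the hypothesis the chosen point can be exchanged locally for
  \<open>replace_first p0 p\<close>, which varies smoothly with p. Partial derivatives by
  coordinates of J^1 are the same on both sides, so the contact relations on \<Omega> become those
  on J^1.\<close>

lemma lifting_of_descended:
  assumes H: "\<And>p q c. p \<in> \<Omega> \<Longrightarrow> q \<in> \<Omega> \<Longrightarrow> proj1 p = proj1 q \<Longrightarrow> c \<in> first_coords \<Longrightarrow> X c p = X c q"
  shows "\<exists>W Z. lifting_of \<Omega> X W Z"
proof -
  define W where "W = proj1 ` \<Omega>"
  have G: "descended c p = X c q" if "q \<in> \<Omega>" "proj1 p = proj1 q" "c \<in> first_coords" for c p q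
  proof -
    have "(SOME q. q \<in> \<Omega> \<and> proj1 q = proj1 p) \<in> \<Omega> \<and> proj1 (SOME q. q \<in> \<Omega> \<and> proj1 q = proj1 p) = proj1 p"
      by (rule someI[of _ q]) (use that in auto)
    then show ?thesis unfolding descended_def by (intro H that(1,3)) (simp_all add: that(2))
  qed
  have cont_emb: "continuous_on UNIV (\<lambda>w :: 'n jet1. emb w)"
    by (intro continuous_on_coordinatewise_then_product linear_continuous_on bounded_linear_emb)
  have W_open: "open W"
    unfolding open_subopen[of W]
  proof
    fix w assume "w \<in> W"
    then obtain p0 where p0: "p0 \<in> \<Omega>" "w = proj1 p0" by (auto simp: W_def)
    let ?T = "(\<lambda>w. replace_first p0 (emb w)) -` \<Omega>"
    have "continuous_on UNIV (\<lambda>w. replace_first p0 (emb w))"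
      by (rule continuous_on_compose2[OF continuous_on_replace_first cont_emb]) auto
    then have "open ?T" by (rule open_vimage[OF open_dom])
    moreover have "w \<in> ?T" using p0 replace_first_eq[of "emb w" p0] by simp
    moreover have "?T \<subseteq> W"
    proof
      fix v assume "v \<in> ?T"
      then have "replace_first p0 (emb v) \<in> \<Omega>" by simp
      then show "v \<in> W" unfolding W_def by (rule rev_image_eqI) simp
    qed
    ultimately show "\<exists>T. open T \<and> w \<in> T \<and> T \<subseteq> W" by blast
  qed
  define \<Omega>1 where "\<Omega>1 = {p. proj1 p \<in> W}"
  have local: "\<exists>U. open U \<and> p \<in> U \<and> U \<subseteq> \<Omega>1 \<and> (\<forall>q\<in>U. replace_first p0 q \<in> \<Omega>)"
    if "p0 \<in> \<Omega>" "proj1 p = proj1 p0" for p p0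
  proof (intro exI[of _ "replace_first p0 -` \<Omega>"] conjI)
    show "open (replace_first p0 -` \<Omega>)" by (rule open_vimage[OF open_dom continuous_on_replace_first])
    show "p \<in> replace_first p0 -` \<Omega>" using replace_first_eq[OF that(2)] that(1) by simp
    show "replace_first p0 -` \<Omega> \<subseteq> \<Omega>1"
    proof
      fix q assume "q \<in> replace_first p0 -` \<Omega>"
      then have "proj1 (replace_first p0 q) \<in> W" unfolding W_def by (intro imageI) simp
      then show "q \<in> \<Omega>1" by (simp add: \<Omega>1_def)
    qed
  qed auto
  have G_replace: "descended c q = X c (replace_first p0 q)"
    if "replace_first p0 q \<in> \<Omega>" "c \<in> first_coords" for c q p0
    by (rule G[OF that(1) _ that(2)]) simp
  have field: "coord_field first_coords \<Omega>1 descended"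
    unfolding coord_field_def
  proof (intro conjI ballI)
    show "open_cylinder first_coords \<Omega>1"
      unfolding open_cylinder_def
    proof (intro conjI ballI allI impI)
      show "open \<Omega>1"
        unfolding open_subopen[of \<Omega>1]
      proof
        fix p assume "p \<in> \<Omega>1"
        then obtain p0 where "p0 \<in> \<Omega>" "proj1 p = proj1 p0" by (auto simp: \<Omega>1_def W_def)
        from local[OF this] show "\<exists>T. open T \<and> p \<in> T \<and> T \<subseteq> \<Omega>1" by blast
      qed
      fix p q assume "p \<in> \<Omega>1" "agree_on first_coords p q"
      moreover from this(2) have "proj1 p = proj1 q" by (simp add: proj1_eq_iff agree_on_def)
      ultimately show "q \<in> \<Omega>1" by (simp add: \<Omega>1_def)
    qed
    fix c :: "'n coord" assume c: "c \<in> first_coords"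
    show "depends_only_on first_coords \<Omega>1 (descended c)"
      unfolding depends_only_on_def agree_on_def proj1_eq_iff[symmetric] by (simp add: descended_def)
    show "smooth_coords \<Omega>1 (descended c)"
    proof (rule smooth_coords_local)
      fix p assume "p \<in> \<Omega>1"
      then obtain p0 where p0: "p0 \<in> \<Omega>" "proj1 p = proj1 p0" by (auto simp: \<Omega>1_def W_def)
      obtain U where U: "open U" "p \<in> U" "\<forall>q\<in>U. replace_first p0 q \<in> \<Omega>" using local[OF p0] by blast
      have "smooth_coords U (\<lambda>q. X c (replace_first p0 q))"
        unfolding replace_first_subst
        by (rule smooth_coords_subst[OF _ JF_smooth[OF JF_X] open_dom U(1)])
          (use U(3) in \<open>auto simp: replace_first_subst[symmetric] split: if_splits\<close>)
      then have "smooth_coords U (descended c)"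
        by (rule smooth_coords_cong[OF U(1), rotated]) (use G_replace[OF _ c] U(3) in auto)
      then show "\<exists>U. open U \<and> p \<in> U \<and> smooth_coords U (descended c)" using U by blast
    qed
  qed simp
  interpret contact_field W descended
  proof
    show "open W" by (rule W_open)
    show "coord_field first_coords {p. proj1 p \<in> W} descended" using field by (simp add: \<Omega>1_def)
    fix p and d :: "'n coord" assume p: "proj1 p \<in> W" and d: "d \<in> first_coords"
    then obtain p0 where p0: "p0 \<in> \<Omega>" "proj1 p = proj1 p0" by (auto simp: W_def)
    obtain U where U: "open U" "p \<in> U" "\<forall>q\<in>U. replace_first p0 q \<in> \<Omega>" using local[OF p0] by blast
    have r: "replace_first p0 p = p0" by (rule replace_first_eq[OF p0(2)])
    have pd: "pderiv_at d' (descended c) p = pderiv_at d' (X c) p0" if "c \<in> first_coords" "d' \<in> first_coords" for c d'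
    proof -
      have "pderiv_at d' (descended c) p = pderiv_at d' (\<lambda>q. X c (replace_first p0 q)) p"
        by (rule pderiv_at_cong[OF U(1,2)]) (use G_replace[OF _ that(1)] U(3) in auto)
      also have "\<dots> = pderiv_at d' (X c) (replace_first p0 p)"
        unfolding replace_first_subst by (rule pderiv_subst_coords) (use that(2) in \<open>auto split: if_splits\<close>)
      finally show ?thesis by (simp add: r)
    qed
    have Gy: "descended (y1 i) p = X (y1 i) p0" for i by (rule G[OF p0]) simp
    have py: "p (y1 i) = p0 (y1 i)" for i using p0(2) by (simp add: proj1_eq_iff)
    have cf: "contact_form p d = contact_form p0 d"
      using py by (simp add: contact_form_def split: coord.split)
    \<comment> \<open>The three kinds of components: dx_j by \<open>contact_x\<close>, dy by the
      definition of M, and dy^j by \<open>contact_y\<close>.\<close>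
    have "pderiv_at d (X y0) p0 - (\<Sum>i\<in>UNIV. p0 (y1 i) * pderiv_at d (X (Indep i)) p0)
        - (\<Sum>i\<in>UNIV. if d = Indep i then X (y1 i) p0 else 0) = M (\<lambda>_. 0) (\<lambda>_. 0) p0 * contact_form p0 d"
    proof -
      consider j where "d = Indep j" | "d = y0" | j where "d = y1 j" using d by (auto simp: first_coords_eq)
      then show ?thesis
      proof cases
        case (1 j)
        then show ?thesis using contact_x[OF p0(1), of j] by (simp add: contact_form_def mult.commute)
      next
        case 2
        then show ?thesis by (simp add: contact_form_def M_def)
      next
        case (3 j)
        then show ?thesis using contact_y[OF p0(1), of j] by (simp add: contact_form_def)
      qed
    qed
    then show "pderiv_at d (descended y0) p - (\<Sum>i\<in>UNIV. p (y1 i) * pderiv_at d (descended (Indep i)) p)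
        - (\<Sum>i\<in>UNIV. if d = Indep i then descended (y1 i) p else 0) =
      (pderiv_at y0 (descended y0) p - (\<Sum>i\<in>UNIV. p (y1 i) * pderiv_at y0 (descended (Indep i)) p)) * contact_form p d"
      using d by (simp add: pd py Gy cf M_def cong: if_cong)
  qed
  have "lifting_of \<Omega> X W Z"
    unfolding lifting_of_def
  proof (intro conjI ballI)
    show "Lie_Baecklund1 W Z" by (rule Lie_Baecklund1_Z)
    show "Lie_Baecklund \<Omega> X" by (rule LB)
    show "proj1 ` \<Omega> \<subseteq> W" by (simp add: W_def)
    fix p assume p: "p \<in> \<Omega>"
    show "proj1 (\<lambda>c. X c p) = Z (proj1 p)"
      unfolding Z_def by (rule proj1_cong) (use G[OF p] in simp)
  qed
  then show ?thesis by blast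
qed

section \<open>Restriction to boxes; local and global liftings\<close>

lemma lb_field_F_subset:
  assumes "\<Omega>' \<subseteq> \<Omega>" "open_cylinder A \<Omega>'"
  shows "lb_field_F A \<Omega>' X F"
proof unfold_locales
  have "jet_function \<Omega>' (X c)" for c
    using JF_X[of c] smooth_coords_subset[OF _ assms(1)] depends_only_on_mono[OF _ order_refl assms(1)]
    unfolding jet_function_def by metis
  then have "jet_vector_field \<Omega>' X"
    using assms(2) fin_A by (auto simp: jet_vector_field_def jet_domain_def)
  moreover have "\<forall>\<alpha> k. \<forall>p\<in>\<Omega>'. X (Dep (bump \<alpha> k)) p = total_deriv k (X (Dep \<alpha>)) p
        - (\<Sum>i\<in>UNIV. p (Dep (bump \<alpha> i)) * total_deriv k (X (Indep i)) p)"
    using recursion assms(1) by blast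
  ultimately show "Lie_Baecklund \<Omega>' X" unfolding Lie_Baecklund_def by blast
  show "depends_only_on F \<Omega>' ((field_apply X ^^ k) (\<lambda>p. p g))" if "g \<in> insert y0 (range Indep)" for g k
    by (rule depends_only_on_mono[OF dep_F[OF that] order_refl assms(1)])
qed (use fin_A assms(2) fin_F A_F in auto)

lemma box_domain:
  assumes "p \<in> \<Omega>"
  shows "\<exists>D. box_convex D \<and> open_cylinder A D \<and> p \<in> D \<and> D \<subseteq> \<Omega>"
proof -
  obtain e where e: "e > 0" "\<forall>x. (\<forall>i\<in>A. \<bar>x i - p i\<bar> < e) \<longrightarrow> x \<in> \<Omega>"
    using open_cylinder_imp_box[OF cyl assms fin_A] by blast
  let ?D = "{x. \<forall>i\<in>A. \<bar>x i - p i\<bar> < e}"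
  have "open_cylinder A ?D"
    using open_box[OF fin_A, of p e] by (auto simp: open_cylinder_def agree_on_def)
  then show ?thesis using e box_convex_box[of A p "\<lambda>_. e"] by (intro exI[of _ ?D]) auto
qed

text \<open>Any two points of a box over the same point of J^1 are joined by changes of higher
  coordinates inside the box, so the coefficients are constant on its fibres.\<close>

lemma local_lifting:
  assumes "p \<in> \<Omega>"
  shows "\<exists>\<Omega>'. jet_domain \<Omega>' \<and> p \<in> \<Omega>' \<and> \<Omega>' \<subseteq> \<Omega> \<and> (\<exists>W Z. lifting_of \<Omega>' X W Z)"
proof -
  obtain D where D: "box_convex D" "open_cylinder A D" "p \<in> D" "D \<subseteq> \<Omega>" using box_domain[OF assms] by blast
  interpret D: lb_field_F A D X F by (rule lb_field_F_subset[OF D(4,2)])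
  have "\<exists>W Z. lifting_of D X W Z"
    by (rule D.lifting_of_descended) (use X_first_eq_on_box[OF D(1,4)] in blast)
  then show ?thesis using D fin_A by (auto simp: jet_domain_def)
qed

text \<open>On a fibre the coefficients are locally constant, since each point has a box around it;
  connectedness makes them constant.\<close>

lemma global_lifting:
  assumes "connected_fibres1 \<Omega>"
  shows "\<exists>W Z. lifting_of \<Omega> X W Z"
proof (rule lifting_of_descended)
  fix p q and c :: "'n coord" assume pq: "p \<in> \<Omega>" "q \<in> \<Omega>" "proj1 p = proj1 q" and c: "c \<in> first_coords"
  let ?F = "{x \<in> \<Omega>. proj1 x = proj1 q}"
  show "X c p = X c q"
  proof (rule connected_local_const[where A = ?F and f = "X c"])
    show "connected ?F" using assms unfolding connected_fibres1_def by blast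
    show "\<forall>a\<in>?F. \<forall>\<^sub>F b in at a within ?F. X c a = X c b"
    proof
      fix a assume a: "a \<in> ?F"
      then obtain D where D: "box_convex D" "open_cylinder A D" "a \<in> D" "D \<subseteq> \<Omega>" using box_domain by blast
      have "X c a = X c b" if "b \<in> D" "b \<in> ?F" for b
        by (rule X_first_eq_on_box[OF D(1,4,3) that(1) _ c]) (use a that(2) in simp)
      then show "\<forall>\<^sub>F b in at a within ?F. X c a = X c b"
        unfolding eventually_at_topological using open_cylinder_open[OF D(2)] D(3) by blast
    qed
  qed (use pq in auto)
qed

end

theorem theorem3:
  fixes \<Omega> :: "'n::finite jet set" and X :: "'n jet_field"
  assumes "Lie_Baecklund \<Omega> X" and "condition_F \<Omega> X"
  shows "(\<forall>p\<in>\<Omega>. \<exists>\<Omega>'. jet_domain \<Omega>' \<and> p \<in> \<Omega>' \<and> \<Omega>' \<subseteq> \<Omega> \<and> (\<exists>W Z. lifting_of \<Omega>' X W Z)) \<and>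
         (connected_fibres1 \<Omega> \<longrightarrow> (\<exists>W Z. lifting_of \<Omega> X W Z)) \<and>
         exponentiable \<Omega> X"
proof -
  obtain A F where "lb_field_F A \<Omega> X F" using lb_field_F_exists[OF assms] by blast
  then interpret lb_field_F A \<Omega> X F .
  show ?thesis using local_lifting global_lifting exponentiable_X by blast
qed

end
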